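(* Let $0<\alpha<\tfrac14$ and $0<T\le1$. If $0<\epsilon<\min\{\tfrac1{12},\tfrac14-\alpha\}$ and $0<\delta<\tfrac23\epsilon$, then there exists $\eta=\eta(\epsilon)>0$ such that $$\|uvw\|_{\mathcal X_T^{-\frac34+\epsilon,-\frac12+\delta}}\lesssim T^\eta\,\|u\|_{L^\infty_TW^{-\alpha-\epsilon,\infty}_x}\,\|v\|_{\mathcal X_T^{\frac14+\epsilon,\frac12+\delta}}\,\|w\|_{\mathcal X_T^{\frac14+\epsilon,\frac12+\delta}}$$ for all functions $u,v,w$ on $[0,T]\times\mathbb T^2$, with a constant independent of $u,v,w$ and $T$.
   Context: $\mathbb T^2=(\mathbb R/2\pi\mathbb Z)^2$, $\langle x\rangle=\sqrt{1+|x|^2}$. $\mathcal X^{s,b}$ is the closure of the Schwartz functions on $\mathbb R\times\mathbb T^2$ under $\|u\|_{\mathcal X^{s,b}}=\|\langle n\rangle^s\langle|\lambda|-\langle n\rangle\rangle^b\,\widetilde u(\lambda,n)\|_{L^2_\lambda\ell^2_n(\mathbb R\times\mathbb Z^2)}$, $\widetilde u$ being the space-time Fourier transform. $\|u\|_{\mathcal X^{s,b}_T}=\inf\{\|w\|_{\mathcal X^{s,b}}:w|_{[0,T]}=u\}$. $\|u\|_{L^\infty_TW^{s,\infty}_x}=\operatorname{ess\,sup}_{t\in[0,T]}\|(1-\Delta)^{s/2}u(t)\|_{L^\infty(\mathbb T^2)}$. *)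

theory Defs
  imports "HOL-Probability.Essential_Supremum"
begin

section \<open>Conventions\<close>

text \<open>
  The torus \<open>(\<real> / 2\<pi>\<int>)\<^sup>2\<close> is represented by \<open>\<real> \<times> \<real>\<close> with the fundamental cell \<open>[-\<pi>, \<pi>]\<^sup>2\<close>.
  Smooth functions on it are \<open>2\<pi>\<close>-periodic functions on the plane; merely measurable functions
  are only ever integrated over the cell, so for them periodicity is not imposed.
  Space-time points are pairs \<open>(t, x)\<close> with \<open>t :: real\<close> and \<open>x :: real \<times> real\<close>.
\<close>

definition jbracket :: "'a::real_normed_vector \<Rightarrow> real" where
  "jbracket x = sqrt (1 + (norm x)\<^sup>2)"

definition freq :: "int \<times> int \<Rightarrow> real \<times> real" where
  "freq n = (real_of_int (fst n), real_of_int (snd n))"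

definition cell :: "(real \<times> real) set" where
  "cell = {-pi..pi} \<times> {-pi..pi}"

definition slab :: "real \<Rightarrow> (real \<times> real \<times> real) set" where
  "slab T = {0..T} \<times> cell"


section \<open>Smooth functions, Schwartz functions, test functions\<close>

primrec dderiv ::
  "'a::real_normed_vector list \<Rightarrow> ('a \<Rightarrow> 'b::real_normed_vector) \<Rightarrow> 'a \<Rightarrow> 'b" where
  "dderiv [] f = f"
| "dderiv (v # vs) f = (\<lambda>x. frechet_derivative (dderiv vs f) (at x) v)"

text \<open>\<open>C\<^sup>\<infinity>\<close>: all iterated directional derivatives exist and are again differentiable.\<close>

definition smooth :: "('a::real_normed_vector \<Rightarrow> 'b::real_normed_vector) \<Rightarrow> bool" where
  "smooth f \<longleftrightarrow> (\<forall>vs. dderiv vs f differentiable_on UNIV)"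

definition periodic :: "(real \<times> real \<Rightarrow> 'b) \<Rightarrow> bool" where
  "periodic f \<longleftrightarrow> (\<forall>x y. f (x + 2 * pi, y) = f (x, y) \<and> f (x, y + 2 * pi) = f (x, y))"

definition schwartz :: "(real \<times> real \<times> real \<Rightarrow> complex) set" where
  "schwartz = {f. smooth f \<and> (\<forall>t. periodic (\<lambda>x. f (t, x))) \<and>
     (\<forall>vs m. \<exists>C. \<forall>t x. \<bar>t\<bar> ^ m * cmod (dderiv vs f (t, x)) \<le> C)}"

text \<open>Test functions on \<open>(0, T) \<times> \<^bold>T\<^sup>2\<close>, with compact support in the open time interval.\<close>

definition st_test :: "real \<Rightarrow> (real \<times> real \<times> real \<Rightarrow> complex) set" where
  "st_test T = {f. smooth f \<and> (\<forall>t. periodic (\<lambda>x. f (t, x))) \<and>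
     (\<exists>a b. 0 < a \<and> b < T \<and> (\<forall>t x. f (t, x) \<noteq> 0 \<longrightarrow> a \<le> t \<and> t \<le> b))}"

definition torus_test :: "(real \<times> real \<Rightarrow> complex) set" where
  "torus_test = {f. smooth f \<and> periodic f}"


section \<open>The spaces \<open>X\<^sup>s\<^sup>,\<^sup>b\<close> and their restrictions to \<open>[0, T]\<close>\<close>

definition st_fourier :: "(real \<times> real \<times> real \<Rightarrow> complex) \<Rightarrow> real \<Rightarrow> int \<times> int \<Rightarrow> complex" where
  "st_fourier f \<tau> n =
     (LINT p:UNIV \<times> cell|lborel. f p * cis (- (\<tau> * fst p + freq n \<bullet> snd p)))"

definition Xsb_sqnorm :: "real \<Rightarrow> real \<Rightarrow> (real \<Rightarrow> int \<times> int \<Rightarrow> complex) \<Rightarrow> ennreal" where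
  "Xsb_sqnorm s b F =
     (\<integral>\<^sup>+ n. (\<integral>\<^sup>+ \<tau>. ennreal ((jbracket (freq n) powr s *
         jbracket (\<bar>\<tau>\<bar> - jbracket (freq n)) powr b * cmod (F \<tau> n))\<^sup>2) \<partial>lborel)
       \<partial>count_space UNIV)"

text \<open>
  An element of \<open>X\<^sup>s\<^sup>,\<^sup>b\<close> is a tempered distribution on \<open>\<real> \<times> \<^bold>T\<^sup>2\<close>; it is given here by its space-time
  Fourier transform \<open>F\<close>. Membership is being in the closure of the Fourier transforms of
  Schwartz functions.
\<close>

definition Xsb :: "real \<Rightarrow> real \<Rightarrow> (real \<Rightarrow> int \<times> int \<Rightarrow> complex) set" where
  "Xsb s b = {F. (\<forall>n. (\<lambda>\<tau>. F \<tau> n) \<in> borel_measurable lborel) \<and>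
     (\<forall>e>0. \<exists>f\<in>schwartz. Xsb_sqnorm s b (\<lambda>\<tau> n. F \<tau> n - st_fourier f \<tau> n) < ennreal e)}"

definition Xsb_norm :: "real \<Rightarrow> real \<Rightarrow> (real \<Rightarrow> int \<times> int \<Rightarrow> complex) \<Rightarrow> real" where
  "Xsb_norm s b F = sqrt (enn2real (Xsb_sqnorm s b F))"

text \<open>
  The tempered distribution with space-time Fourier transform \<open>F\<close>. By Parseval, with the
  unnormalised transform above, \<open>st_dist (st_fourier f) \<phi> = \<integral> f \<phi>\<close> for Schwartz \<open>f\<close> and \<open>\<phi>\<close>.
\<close>

definition st_dist ::
  "(real \<Rightarrow> int \<times> int \<Rightarrow> complex) \<Rightarrow> (real \<times> real \<times> real \<Rightarrow> complex) \<Rightarrow> complex" where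
  "st_dist F \<phi> =
     (LINT n|count_space UNIV. LINT \<tau>|lborel. F \<tau> n * st_fourier \<phi> (- \<tau>) (- n)) / (2 * pi) ^ 3"

text \<open>
  The norm of \<open>X\<^sup>s\<^sup>,\<^sup>b\<close> restricted to \<open>[0, T]\<close>, for a distribution \<open>z\<close> on \<open>(0, T) \<times> \<^bold>T\<^sup>2\<close> (a functional of
  which only the values on \<^term>\<open>st_test T\<close> matter). It is \<open>\<infinity>\<close> iff \<open>z\<close> has no extension in
  \<open>X\<^sup>s\<^sup>,\<^sup>b\<close>, so membership in the restricted space is finiteness of this norm.
\<close>

definition XT_norm ::
  "real \<Rightarrow> real \<Rightarrow> real \<Rightarrow> ((real \<times> real \<times> real \<Rightarrow> complex) \<Rightarrow> complex) \<Rightarrow> ennreal" where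
  "XT_norm s b T z =
     (INF F\<in>{F \<in> Xsb s b. \<forall>\<phi>\<in>st_test T. st_dist F \<phi> = z \<phi>}. ennreal (Xsb_norm s b F))"

definition dist_of ::
  "real \<Rightarrow> (real \<times> real \<times> real \<Rightarrow> complex) \<Rightarrow> (real \<times> real \<times> real \<Rightarrow> complex) \<Rightarrow> complex" where
  "dist_of T v \<phi> = (LINT p:slab T|lborel. v p * \<phi> p)"


section \<open>Distributions on the torus and \<open>L\<^sup>\<infinity>\<^sub>T W\<^sup>s\<^sup>,\<^sup>\<infinity>\<^sub>x\<close>\<close>

definition torus_distribution :: "((real \<times> real \<Rightarrow> complex) \<Rightarrow> complex) \<Rightarrow> bool" where
  "torus_distribution u \<longleftrightarrow>
     (\<forall>f\<in>torus_test. \<forall>g\<in>torus_test. \<forall>a b. u (\<lambda>x. a * f x + b * g x) = a * u f + b * u g) \<and>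
     (\<exists>C N. \<forall>f\<in>torus_test. \<forall>K.
        (\<forall>vs x. set vs \<subseteq> Basis \<and> length vs \<le> N \<longrightarrow> cmod (dderiv vs f x) \<le> K) \<longrightarrow>
        cmod (u f) \<le> C * K)"

definition torus_coeff :: "((real \<times> real \<Rightarrow> complex) \<Rightarrow> complex) \<Rightarrow> int \<times> int \<Rightarrow> complex" where
  "torus_coeff u n = u (\<lambda>x. cis (- (freq n \<bullet> x))) / (2 * pi)\<^sup>2"

definition torus_dist_of ::
  "(real \<times> real \<Rightarrow> complex) \<Rightarrow> (real \<times> real \<Rightarrow> complex) \<Rightarrow> complex" where
  "torus_dist_of g f = (LINT x:cell|lborel. g x * f x)"

text \<open>
  \<open>g = (1 - \<Delta>)\<^sup>s\<^sup>/\<^sup>2 u\<close>, the Fourier multiplier with symbol \<open>\<langle>n\<rangle>\<^sup>s\<close> applied to \<open>u\<close>, being a function: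
  a distribution on the torus is determined by its Fourier coefficients.
\<close>

definition is_bessel_pot ::
  "real \<Rightarrow> ((real \<times> real \<Rightarrow> complex) \<Rightarrow> complex) \<Rightarrow> (real \<times> real \<Rightarrow> complex) \<Rightarrow> bool" where
  "is_bessel_pot s u g \<longleftrightarrow> set_integrable lborel cell g \<and>
     (\<forall>n. torus_coeff (torus_dist_of g) n =
        complex_of_real (jbracket (freq n) powr s) * torus_coeff u n)"

text \<open>The function \<open>g\<close> is unique up to null sets; the infimum is \<open>\<infinity>\<close> if there is none.\<close>

definition Winf_norm :: "real \<Rightarrow> ((real \<times> real \<Rightarrow> complex) \<Rightarrow> complex) \<Rightarrow> ennreal" where
  "Winf_norm s u =
     (INF g\<in>{g. is_bessel_pot s u g}. esssup (restrict_space lborel cell) (\<lambda>x. ennreal (cmod (g x))))"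

definition LinfW_norm ::
  "real \<Rightarrow> real \<Rightarrow> (real \<Rightarrow> (real \<times> real \<Rightarrow> complex) \<Rightarrow> complex) \<Rightarrow> ennreal" where
  "LinfW_norm s T u = esssup (restrict_space lborel {0..T}) (\<lambda>t. Winf_norm s (u t))"

text \<open>Weakly measurable families of distributions on the torus, indexed by \<open>t \<in> [0, T]\<close>.\<close>

definition dist_family ::
  "real \<Rightarrow> (real \<Rightarrow> (real \<times> real \<Rightarrow> complex) \<Rightarrow> complex) \<Rightarrow> bool" where
  "dist_family T u \<longleftrightarrow> (\<forall>t\<in>{0..T}. torus_distribution (u t)) \<and>
     (\<forall>f\<in>torus_test. (\<lambda>t. u t f) \<in> borel_measurable (restrict_space lborel {0..T}))"


section \<open>The product of a distribution and two functions\<close>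

definition approx_identity :: "(nat \<Rightarrow> real \<times> real \<Rightarrow> complex) \<Rightarrow> bool" where
  "approx_identity \<rho> \<longleftrightarrow>
     (\<forall>k. \<rho> k \<in> torus_test) \<and>
     (\<forall>k. (LINT x:cell|lborel. \<rho> k x) = 1) \<and>
     (\<exists>C. \<forall>k. (LINT x:cell|lborel. cmod (\<rho> k x)) \<le> C) \<and>
     (\<forall>d>0. (\<lambda>k. LINT x:{x \<in> cell. norm x \<ge> d}|lborel. cmod (\<rho> k x)) \<longlonglongrightarrow> 0)"

definition mollify ::
  "(real \<times> real \<Rightarrow> complex) \<Rightarrow> (real \<Rightarrow> (real \<times> real \<Rightarrow> complex) \<Rightarrow> complex) \<Rightarrow>
   real \<times> real \<times> real \<Rightarrow> complex" where
  "mollify \<rho> u p = u (fst p) (\<lambda>y. \<rho> (snd p - y))"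

text \<open>
  \<open>z = u v w\<close> as distributions on \<open>(0, T) \<times> \<^bold>T\<^sup>2\<close>: \<open>z\<close> is the limit of \<open>(\<rho>\<^sub>k * u) v w\<close>, where \<open>\<rho>\<^sub>k * u\<close> is the
  spatial regularisation of the (in general singular) factor \<open>u\<close>, whatever the approximate
  identity \<open>\<rho>\<close>. This determines \<open>z\<close> on \<^term>\<open>st_test T\<close>, and is the pointwise product when \<open>u\<close> is
  a bounded function.
\<close>

definition is_triple_product ::
  "real \<Rightarrow> (real \<Rightarrow> (real \<times> real \<Rightarrow> complex) \<Rightarrow> complex) \<Rightarrow>
   (real \<times> real \<times> real \<Rightarrow> complex) \<Rightarrow> (real \<times> real \<times> real \<Rightarrow> complex) \<Rightarrow>
   ((real \<times> real \<times> real \<Rightarrow> complex) \<Rightarrow> complex) \<Rightarrow> bool" where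
  "is_triple_product T u v w z \<longleftrightarrow>
     (\<forall>\<rho>. approx_identity \<rho> \<longrightarrow>
        (\<forall>k. set_integrable lborel (slab T) (\<lambda>p. mollify (\<rho> k) u p * v p * w p)) \<and>
        (\<forall>\<phi>\<in>st_test T. (\<lambda>k. dist_of T (\<lambda>p. mollify (\<rho> k) u p * v p * w p) \<phi>) \<longlonglongrightarrow> z \<phi>))"

end

theory Submission
  imports Defs "HOL-Probability.Probability"
begin

text \<open>
  The estimate holds with \<open>\<eta> = 1/2\<close>, and it is an estimate at fixed time. With \<open>s = \<alpha> + \<epsilon>\<close>, so that
  \<open>0 < s < 1/4\<close>, the claim at fixed time is

    \<open>\<parallel>u v w\<parallel> \<le> C \<parallel>u\<parallel> \<parallel>v\<parallel> \<parallel>w\<parallel>\<close> with the norms of \<open>H\<^sup>-\<^sup>3\<^sup>/\<^sup>4\<^sup>+\<^sup>\<epsilon>\<close>, \<open>W\<^sup>-\<^sup>s\<^sup>,\<^sup>\<infinity>\<close>, \<open>H\<^sup>1\<^sup>/\<^sup>4\<^sup>+\<^sup>\<epsilon>\<close> and \<open>H\<^sup>1\<^sup>/\<^sup>4\<^sup>+\<^sup>\<epsilon>\<close>.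

  In time, \<open>X\<^sup>\<sigma>\<^sup>,\<^sup>b\<close> with \<open>b > 1/2\<close> embeds in \<open>L\<^sup>\<infinity>H\<^sup>\<sigma>\<close> (\<open>time_slice_bound\<close>), so the product is bounded in
  time with values in \<open>H\<^sup>-\<^sup>3\<^sup>/\<^sup>4\<^sup>+\<^sup>\<epsilon>\<close>. Extended by zero outside \<open>[0, T]\<close> it lies in \<open>L\<^sup>2\<close> in time, with a norm that
  contains the factor \<open>T\<^sup>1\<^sup>/\<^sup>2\<close>, and since \<open>-1/2 + \<delta> \<le> 0\<close> this space embeds in the target space (\<open>Xsb_of_curve\<close>).

  The estimate at fixed time is proved by duality and dyadic decomposition. Write \<open>u = (1 - \<Delta>)\<^sup>s\<^sup>/\<^sup>2 h\<close> with \<open>h\<close>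
  bounded, and let \<open>v\<close>, \<open>w\<close> and the dual function \<open>g\<close> be localised at frequencies \<open>2\<^sup>i\<close>, \<open>2\<^sup>j\<close>, \<open>2\<^sup>k\<close>. Then \<open>u\<close>
  matters only at frequencies at most of order \<open>2\<^sup>m\<^sup>a\<^sup>x\<close>, so that the derivative costs \<open>2\<^sup>s \<^sup>m\<^sup>a\<^sup>x\<close>, and the lowest of
  the three frequencies is put in \<open>L\<^sup>\<infinity>\<close> at the cost of \<open>2\<^sup>m\<^sup>i\<^sup>n\<close> (Bernstein). Because \<open>\<alpha> < 1/4\<close>, the regularities
  \<open>1/4 + \<epsilon>\<close>, \<open>1/4 + \<epsilon>\<close>, \<open>3/4 - \<epsilon>\<close> pay for both and leave a geometric factor in each of \<open>i\<close>, \<open>j\<close>, \<open>k\<close>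
  (\<open>dyadic_exponent_le\<close>). The boundedness of \<open>h\<close> enters only through the resulting bounds on dyadic
  blocks (\<open>blockbdd\<close>). They survive averages of translations, and this replaces multiplier theorems on
  \<open>L\<^sup>\<infinity>\<close>: \<open>\<langle>n\<rangle>\<^sup>s\<close> is an integral of \<open>1 - e\<^sup>-\<^sup>t\<^sup>\<langle>\<^sup>n\<^sup>\<rangle>\<^sup>2\<close> over \<open>t\<close>, and the heat multiplier is a Gaussian average of
  translations (\<open>blockbdd_bessel\<close>); mollification is an average of translations too (\<open>blockbdd_mollify\<close>).

  The geometric factors also make the partial sums of the trilinear form converge at a rate that is
  uniform in the entries (\<open>tri_rate\<close>). This defines the product through its Fourier coefficients and shows
  that it is the limit of the products with mollified \<open>u\<close> (\<open>is_triple_product_curve\<close>).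

  What remains is to relate the definitions through duality, which are phrased with distributions, to
  Fourier coefficients: test functions and distributions on the torus are determined by their Fourier
  series (\<open>torus_test_fseries\<close>, \<open>mollify_tendsto\<close>), integrable functions with square summable coefficients
  are in \<open>L\<^sup>2\<close> (\<open>cell_l2_of_fcoeff_l2\<close>), and an extension of \<open>v\<close> in \<open>X\<^sup>s\<^sup>,\<^sup>b\<close> has, at almost every time of \<open>[0, T]\<close>, the
  same spatial coefficients as \<open>v\<close> (\<open>fcoeff_eq_time_slice\<close>).
\<close>

section \<open>Trigonometric polynomials on the torus\<close>

definition ech :: "int \<times> int \<Rightarrow> real \<times> real \<Rightarrow> complex" where
 "ech n x = cis (freq n \<bullet> x)"

definition fcoeff :: "(real \<times> real \<Rightarrow> complex) \<Rightarrow> int \<times> int \<Rightarrow> complex" where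
 "fcoeff f n = (LINT x:cell|lborel. f x * ech (- n) x)"

definition trig_sum :: "(int \<times> int) set \<Rightarrow> (int \<times> int \<Rightarrow> complex) \<Rightarrow> real \<times> real \<Rightarrow> complex" where
 "trig_sum S a x = (\<Sum>n\<in>S. a n * ech n x)"

abbreviation l2 :: "(int \<times> int) set \<Rightarrow> (int \<times> int \<Rightarrow> complex) \<Rightarrow> real" where
 "l2 S a \<equiv> L2_set (\<lambda>n. cmod (a n)) S"

lemma freq_zero [simp]: "freq 0 = 0"
 by (simp add: freq_def zero_prod_def)

lemma freq_add: "freq (m + n) = freq m + freq n"
 by (simp add: freq_def)

lemma freq_uminus: "freq (- n) = - freq n"
 by (simp add: freq_def)

lemma norm_ech [simp]: "cmod (ech n x) = 1"
 by (simp add: ech_def)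

lemma ech_zero [simp]: "ech 0 x = 1"
 by (simp add: ech_def)

lemma ech_add: "ech (m + n) x = ech m x * ech n x"
 by (simp add: ech_def freq_add cis_mult inner_add_left)

lemma ech_uminus: "ech (- n) x = cnj (ech n x)"
 by (simp add: ech_def freq_uminus cis_cnj)

lemma ech_cis: "ech n (x, y) = cis (real_of_int (fst n) * x) * cis (real_of_int (snd n) * y)"
 by (simp add: ech_def freq_def cis_mult)

lemma continuous_ech [continuous_intros]: "continuous_on S (ech n)"
 unfolding ech_def cis_conv_exp by (intro continuous_intros)

lemma measurable_ech [measurable]: "ech n \<in> borel_measurable borel"
 by (intro borel_measurable_continuous_onI continuous_ech)

lemma cell_cbox: "cell = cbox (-pi, -pi) (pi, pi)"
 by (auto simp: cell_def cbox_Pair_eq)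

lemma compact_cell: "compact cell"
 by (simp add: cell_cbox)

lemma cell_borel [measurable]: "cell \<in> sets borel"
 by (simp add: cell_cbox)

lemma measure_cell: "measure lborel cell = (2 * pi)\<^sup>2"
proof -
 have "emeasure lborel cell = emeasure (lborel \<Otimes>\<^sub>M lborel) ({-pi..pi} \<times> {-pi..pi})"
  by (simp add: cell_def lborel_prod)
 also have "\<dots> = emeasure lborel {-pi..pi} * emeasure lborel {-pi..pi}"
  by (rule lborel.emeasure_pair_measure_Times) auto
 also have "\<dots> = ennreal ((2 * pi)\<^sup>2)"
  by (simp add: power2_eq_square flip: ennreal_mult)
 finally show ?thesis by (simp add: measure_def)
qed

lemma emeasure_cell: "emeasure lborel cell < \<infinity>"
 unfolding cell_cbox by (rule emeasure_lborel_cbox_finite)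

lemma set_integrable_cell_continuous:
 fixes f :: "real \<times> real \<Rightarrow> 'b::{banach,second_countable_topology}"
 assumes "continuous_on cell f"
 shows "set_integrable lborel cell f"
 unfolding set_integrable_def
 using borel_integrable_compact[OF compact_cell assms] .

lemma trig_sum_continuous [continuous_intros]: "continuous_on S (trig_sum F a)"
 unfolding trig_sum_def by (intro continuous_intros)

lemma trig_sum_measurable [measurable]: "trig_sum F a \<in> borel_measurable borel"
 by (intro borel_measurable_continuous_onI trig_sum_continuous)

lemma LINT_cell_iterated:
 fixes f :: "real \<times> real \<Rightarrow> complex"
 assumes "set_integrable lborel cell f"
 shows "(LINT x:cell|lborel. f x) = (LINT x:{-pi..pi}|lborel. LINT y:{-pi..pi}|lborel. f (x, y))"
  and "(LINT x:cell|lborel. f x) = (LINT y:{-pi..pi}|lborel. LINT x:{-pi..pi}|lborel. f (x, y))"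
proof -
 have int: "integrable (lborel \<Otimes>\<^sub>M lborel) (\<lambda>(x, y). indicator cell (x, y) *\<^sub>R f (x, y))"
  using assms unfolding set_integrable_def lborel_prod by (simp add: split_def)
 have ind: "indicator cell (x, y) = (indicator {-pi..pi} x * indicator {-pi..pi} y :: real)" for x y
  by (auto simp: cell_def indicator_def)
 have ind': "indicator cell (x, y) = (indicator {-pi..pi} y * indicator {-pi..pi} x :: real)" for x y
  by (auto simp: cell_def indicator_def)
 have eq: "(LINT x:cell|lborel. f x) = (LINT (x, y)|(lborel \<Otimes>\<^sub>M lborel). indicator cell (x, y) *\<^sub>R f (x, y))"
  unfolding set_lebesgue_integral_def lborel_prod by (simp add: split_def)
 show "(LINT x:cell|lborel. f x) = (LINT x:{-pi..pi}|lborel. LINT y:{-pi..pi}|lborel. f (x, y))"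
  unfolding eq lborel_pair.integral_fst[OF int, symmetric]
  by (simp add: set_lebesgue_integral_def ind flip: scaleR_scaleR)
 show "(LINT x:cell|lborel. f x) = (LINT y:{-pi..pi}|lborel. LINT x:{-pi..pi}|lborel. f (x, y))"
  unfolding eq lborel_pair.integral_snd[OF int, symmetric]
  by (simp add: set_lebesgue_integral_def ind' flip: scaleR_scaleR)
qed

lemma has_vector_derivative_cis_linear:
 "((\<lambda>x. cis (c * x)) has_vector_derivative \<i> * of_real c * cis (c * x)) (at x within S)"
proof -
 have "((\<lambda>z. exp (\<i> * (of_real c * z))) has_field_derivative \<i> * of_real c * exp (\<i> * (of_real c * of_real x)))
   (at (of_real x :: complex))"
  by (rule derivative_eq_intros refl | simp)+
 from has_vector_derivative_real_field[OF this] show ?thesis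
  unfolding cis_conv_exp by (simp only: of_real_mult)
qed

lemma cis_int_pi: "cis (real_of_int k * pi) = cis (real_of_int k * (- pi))"
proof -
 have "cis (real_of_int k * pi) / cis (real_of_int k * (- pi)) = cis (2 * pi * real_of_int k)"
  by (simp add: cis_divide algebra_simps)
 also have "\<dots> = 1" by (rule cis_multiple_2pi) simp
 finally show ?thesis by simp
qed

lemma LINT_cis_int:
 "(LINT x:{-pi..pi}|lborel. cis (real_of_int k * x)) = (if k = 0 then 2 * pi else 0)"
proof (cases "k = 0")
 case True
 then show ?thesis by (simp add: set_lebesgue_integral_def scaleR_conv_of_real)
next
 case False
 have "(LINT x|lborel. indicator {-pi..pi} x *\<^sub>R cis (real_of_int k * x)) =
   cis (real_of_int k * pi) / (\<i> * of_int k) - cis (real_of_int k * (- pi)) / (\<i> * of_int k)"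
 proof (rule integral_FTC_Icc)
  show "((\<lambda>x. cis (real_of_int k * x) / (\<i> * of_int k)) has_vector_derivative cis (real_of_int k * x))
    (at x within {- pi..pi})" for x
   using has_vector_derivative_mult_left[OF has_vector_derivative_cis_linear[of "real_of_int k" x "{-pi..pi}"],
     of "1 / (\<i> * of_int k)"] False
   by (simp add: mult.commute)
  show "continuous_on {- pi..pi} (\<lambda>x. cis (real_of_int k * x))"
   unfolding cis_conv_exp by (intro continuous_intros)
 qed simp
 with False show ?thesis by (simp add: set_lebesgue_integral_def cis_int_pi)
qed

lemma LINT_ech: "(LINT x:cell|lborel. ech n x) = (if n = 0 then (2 * pi)\<^sup>2 else 0)"
proof -
 have "(LINT x:cell|lborel. ech n x) =
   (LINT x:{-pi..pi}|lborel. cis (real_of_int (fst n) * x) *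
    (LINT y:{-pi..pi}|lborel. cis (real_of_int (snd n) * y)))"
  by (subst LINT_cell_iterated(1)) (auto intro: set_integrable_cell_continuous continuous_ech simp: ech_cis)
 also have "\<dots> = (if n = 0 then (2 * pi)\<^sup>2 else 0)"
  by (simp add: LINT_cis_int prod_eq_iff power2_eq_square)
 finally show ?thesis .
qed

lemma fcoeff_ech: "fcoeff (ech m) n = (if m = n then (2 * pi)\<^sup>2 else 0)"
 unfolding fcoeff_def by (simp add: LINT_ech flip: ech_add)

lemma set_lebesgue_integral_sum:
 fixes f :: "'i \<Rightarrow> 'a \<Rightarrow> 'b::{banach,second_countable_topology}"
 assumes "\<And>i. i \<in> I \<Longrightarrow> set_integrable M A (f i)"
 shows "(LINT x:A|M. (\<Sum>i\<in>I. f i x)) = (\<Sum>i\<in>I. LINT x:A|M. f i x)"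
 using assms unfolding set_lebesgue_integral_def set_integrable_def
 by (simp add: scaleR_sum_right Bochner_Integration.integral_sum)

lemma norm_trig_sum_le: "cmod (trig_sum S a x) \<le> (\<Sum>n\<in>S. cmod (a n))"
 unfolding trig_sum_def by (rule sum_norm_le) (simp add: norm_mult)

lemma LINT_trig_sum_square:
 assumes "finite S"
 shows "(LINT x:cell|lborel. (cmod (trig_sum S a x))\<^sup>2) = (2 * pi)\<^sup>2 * (l2 S a)\<^sup>2"
proof -
 have sq: "complex_of_real ((cmod (trig_sum S a x))\<^sup>2) =
   (\<Sum>n\<in>S. \<Sum>m\<in>S. a n * cnj (a m) * ech (n - m) x)" for x
  unfolding complex_norm_square trig_sum_def
  by (simp add: sum_product ech_add ech_uminus diff_conv_add_uminus mult_ac del: add_uminus_conv_diff)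
 have "complex_of_real (LINT x:cell|lborel. (cmod (trig_sum S a x))\<^sup>2) =
   (LINT x:cell|lborel. (\<Sum>n\<in>S. \<Sum>m\<in>S. a n * cnj (a m) * ech (n - m) x))"
  unfolding sq[symmetric] set_lebesgue_integral_def
  by (subst integral_complex_of_real[symmetric]) (simp only: scaleR_conv_of_real of_real_mult of_real_eq_id id_apply)
 also have "\<dots> = (\<Sum>n\<in>S. \<Sum>m\<in>S. LINT x:cell|lborel. a n * cnj (a m) * ech (n - m) x)"
  by (subst set_lebesgue_integral_sum, intro set_integrable_cell_continuous continuous_intros,
    intro sum.cong refl set_lebesgue_integral_sum set_integrable_cell_continuous continuous_intros)
 also have "\<dots> = (\<Sum>n\<in>S. \<Sum>m\<in>S. if m = n then (2 * pi)\<^sup>2 * (a n * cnj (a n)) else 0)"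
  by (intro sum.cong refl) (auto simp: LINT_ech)
 also have "\<dots> = of_real ((2 * pi)\<^sup>2 * (l2 S a)\<^sup>2)"
 proof -
  have "(l2 S a)\<^sup>2 = (\<Sum>n\<in>S. (cmod (a n))\<^sup>2)" by (simp add: L2_set_def sum_nonneg)
  then have "of_real ((l2 S a)\<^sup>2) = (\<Sum>n\<in>S. a n * cnj (a n))"
   by (simp only: of_real_sum complex_norm_square)
  moreover have "(\<Sum>m\<in>S. if m = n then (2 * pi)\<^sup>2 * (a n * cnj (a n)) else 0) = (2 * pi)\<^sup>2 * (a n * cnj (a n))"
   if "n \<in> S" for n using assms that by (simp add: sum.delta)
  ultimately show ?thesis by (simp add: sum_distrib_left)
 qed
 finally show ?thesis unfolding of_real_eq_iff .
qed

lemma set_integrable_cell_mult: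
 fixes f g :: "real \<times> real \<Rightarrow> real"
 assumes "set_borel_measurable lborel cell f" "set_borel_measurable lborel cell g"
  and "set_integrable lborel cell (\<lambda>x. (f x)\<^sup>2)" "set_integrable lborel cell (\<lambda>x. (g x)\<^sup>2)"
 shows "set_integrable lborel cell (\<lambda>x. \<bar>f x * g x\<bar>)"
proof (rule set_integrable_bound)
 show "set_integrable lborel cell (\<lambda>x. (f x)\<^sup>2 + (g x)\<^sup>2)" using assms(3,4) by (rule set_integral_add)
 have "(\<lambda>x. indicator cell x *\<^sub>R \<bar>f x * g x\<bar>) = (\<lambda>x. \<bar>(indicator cell x *\<^sub>R f x) * (indicator cell x *\<^sub>R g x)\<bar>)"
  by (auto simp: fun_eq_iff indicator_def)
 then show "set_borel_measurable lborel cell (\<lambda>x. \<bar>f x * g x\<bar>)"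
  using borel_measurable_abs[OF borel_measurable_times[OF assms(1,2)[unfolded set_borel_measurable_def]]]
  unfolding set_borel_measurable_def by (simp only:)
 have "\<bar>f x * g x\<bar> \<le> (f x)\<^sup>2 + (g x)\<^sup>2" for x
  using sum_squares_bound[of "\<bar>f x\<bar>" "\<bar>g x\<bar>"] mult_nonneg_nonneg[of "\<bar>f x\<bar>" "\<bar>g x\<bar>"]
  unfolding abs_mult power2_abs by linarith
 then show "AE x in lborel. x \<in> cell \<longrightarrow> norm \<bar>f x * g x\<bar> \<le> norm ((f x)\<^sup>2 + (g x)\<^sup>2)" by simp
qed

lemma LINT_cell_Cauchy_Schwarz:
 fixes f g :: "real \<times> real \<Rightarrow> real"
 assumes "set_borel_measurable lborel cell f" "set_borel_measurable lborel cell g"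
  and "set_integrable lborel cell (\<lambda>x. (f x)\<^sup>2)" "set_integrable lborel cell (\<lambda>x. (g x)\<^sup>2)"
  and "(LINT x:cell|lborel. (f x)\<^sup>2) \<le> A\<^sup>2" "(LINT x:cell|lborel. (g x)\<^sup>2) \<le> B\<^sup>2" "0 \<le> A" "0 \<le> B"
 shows "(LINT x:cell|lborel. \<bar>f x * g x\<bar>) \<le> A * B"
proof (rule field_le_epsilon)
 fix e :: real assume "0 < e"
 obtain d where d: "d > 0" "(A + d) * (B + d) \<le> A * B + e"
 proof
  let ?d = "min 1 (e / (A + B + 1))"
  show "?d > 0" using \<open>0 < e\<close> assms by auto
  have "(A + ?d) * (B + ?d) = A * B + ?d * (A + B + ?d)" by (simp add: algebra_simps)
  also have "?d * (A + B + ?d) \<le> e / (A + B + 1) * (A + B + 1)"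
   using \<open>0 < e\<close> assms by (intro mult_mono) auto
  also have "\<dots> = e" using assms by (simp add: field_simps)
  finally show "(A + ?d) * (B + ?d) \<le> A * B + e" by simp
 qed
 define l where "l = (B + d) / (A + d)"
 have l: "l > 0" using d assms by (simp add: l_def)
 have pt: "\<bar>f x * g x\<bar> \<le> (l / 2) * (f x)\<^sup>2 + (1 / (2 * l)) * (g x)\<^sup>2" for x
 proof -
  have "0 \<le> (l * \<bar>f x\<bar> - \<bar>g x\<bar>)\<^sup>2 / (2 * l)" using l by simp
  also have "\<dots> = (l / 2) * (f x)\<^sup>2 + (1 / (2 * l)) * (g x)\<^sup>2 - \<bar>f x * g x\<bar>"
   using l by (simp add: power2_eq_square field_simps abs_mult)
  finally show ?thesis by simp
 qed
 have i: "set_integrable lborel cell (\<lambda>x. (l / 2) * (f x)\<^sup>2)" "set_integrable lborel cell (\<lambda>x. (1 / (2 * l)) * (g x)\<^sup>2)"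
  "set_integrable lborel cell (\<lambda>x. \<bar>f x * g x\<bar>)"
  using assms(3,4) set_integrable_cell_mult[OF assms(1-4)] by simp_all
 have "(LINT x:cell|lborel. \<bar>f x * g x\<bar>) \<le>
   (LINT x:cell|lborel. (l / 2) * (f x)\<^sup>2 + (1 / (2 * l)) * (g x)\<^sup>2)"
  using i pt by (intro set_integral_mono set_integral_add) auto
 also have "\<dots> = (l / 2) * (LINT x:cell|lborel. (f x)\<^sup>2) + (1 / (2 * l)) * (LINT x:cell|lborel. (g x)\<^sup>2)"
  using i by (subst set_integral_add) auto
 also have "\<dots> \<le> (l / 2) * (A + d)\<^sup>2 + (1 / (2 * l)) * (B + d)\<^sup>2"
 proof (intro add_mono mult_left_mono)
  show "(LINT x:cell|lborel. (f x)\<^sup>2) \<le> (A + d)\<^sup>2" "(LINT x:cell|lborel. (g x)\<^sup>2) \<le> (B + d)\<^sup>2"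
   using assms d by (auto intro: order_trans power_mono)
 qed (use l in auto)
 also have "\<dots> = (A + d) * (B + d)"
 proof -
  have "A + d > 0" "B + d > 0" using d assms by auto
  then have "(l / 2) * (A + d)\<^sup>2 = (A + d) * (B + d) / 2" "(1 / (2 * l)) * (B + d)\<^sup>2 = (A + d) * (B + d) / 2"
   unfolding l_def power2_eq_square by (simp_all add: divide_simps)
  then show ?thesis by linarith
 qed
 finally show "(LINT x:cell|lborel. \<bar>f x * g x\<bar>) \<le> A * B + e" using d by linarith
qed

text \<open>
 Bernstein for the first factor, whose supremum is at most the \<open>l\<^sup>1\<close> norm of its coefficients, and
 Cauchy--Schwarz for the other two.
\<close>

lemma LINT_trig_sum_product3:
 assumes "finite S1" "finite S2" "finite S3"
 shows "(LINT x:cell|lborel. cmod (trig_sum S1 a x * trig_sum S2 b x * trig_sum S3 c x))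
   \<le> (2 * pi)\<^sup>2 * sqrt (card S1) * (l2 S1 a * l2 S2 b * l2 S3 c)"
proof -
 let ?f = "trig_sum S1 a" and ?g = "trig_sum S2 b" and ?h = "trig_sum S3 c"
 have sup: "cmod (?f x) \<le> sqrt (card S1) * l2 S1 a" for x
 proof -
  have "cmod (?f x) \<le> (\<Sum>n\<in>S1. \<bar>1\<bar> * \<bar>cmod (a n)\<bar>)" using norm_trig_sum_le[of S1 a x] by simp
  also have "\<dots> \<le> L2_set (\<lambda>_. 1) S1 * l2 S1 a" by (rule L2_set_mult_ineq)
  finally show ?thesis by (simp add: L2_set_def)
 qed
 have "(LINT x:cell|lborel. cmod (?f x * ?g x * ?h x))
   \<le> (LINT x:cell|lborel. (sqrt (card S1) * l2 S1 a) * \<bar>cmod (?g x) * cmod (?h x)\<bar>)"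
  using sup by (intro set_integral_mono set_integrable_cell_continuous continuous_intros)
   (auto simp: norm_mult mult.assoc[symmetric] abs_mult intro!: mult_right_mono)
 also have "\<dots> = (sqrt (card S1) * l2 S1 a) * (LINT x:cell|lborel. \<bar>cmod (?g x) * cmod (?h x)\<bar>)"
  by simp
 also have "\<dots> \<le> (sqrt (card S1) * l2 S1 a) * ((2 * pi * l2 S2 b) * (2 * pi * l2 S3 c))"
  using assms by (intro mult_left_mono LINT_cell_Cauchy_Schwarz set_integrable_cell_continuous continuous_intros)
   (auto simp: LINT_trig_sum_square power_mult_distrib set_borel_measurable_def intro!: mult_nonneg_nonneg)
 finally show ?thesis by (simp add: power2_eq_square mult_ac)
qed

section \<open>Dyadic frequency blocks and the block-bounded sequences\<close>

definition freq_box :: "nat \<Rightarrow> (int \<times> int) set" where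
 "freq_box j = {n. \<bar>fst n\<bar> < 2 ^ j \<and> \<bar>snd n\<bar> < 2 ^ j}"

primrec block :: "nat \<Rightarrow> (int \<times> int) set" where
 "block 0 = freq_box 0"
| "block (Suc j) = freq_box (Suc j) - freq_box j"

text \<open>
 Up to a power of \<open>2\<pi>\<close> this is the integral of a function with coefficients \<open>a\<close> against the three
 trigonometric polynomials with coefficients \<open>v\<close>, \<open>w\<close>, \<open>g\<close> on \<open>S1\<close>, \<open>S2\<close>, \<open>S3\<close>.
\<close>

definition tri :: "(int \<times> int \<Rightarrow> complex) \<Rightarrow> (int \<times> int) set \<Rightarrow> (int \<times> int) set \<Rightarrow> (int \<times> int) set \<Rightarrow>
  (int \<times> int \<Rightarrow> complex) \<Rightarrow> (int \<times> int \<Rightarrow> complex) \<Rightarrow> (int \<times> int \<Rightarrow> complex) \<Rightarrow> complex" where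
 "tri a S1 S2 S3 v w g = (\<Sum>n\<in>S1. \<Sum>m\<in>S2. \<Sum>l\<in>S3. v n * w m * g l * a (- (n + m + l)))"

text \<open>
 All that is used of the boundedness of a function with coefficients \<open>a\<close>. The factor \<open>2\<^sup>m\<^sup>i\<^sup>n\<close> is Bernstein's
 inequality in two dimensions for the factor of lowest frequency.
\<close>

definition blockbdd :: "real \<Rightarrow> (int \<times> int \<Rightarrow> complex) \<Rightarrow> bool" where
 "blockbdd A a \<longleftrightarrow> (\<forall>i j k v w g. cmod (tri a (block i) (block j) (block k) v w g)
   \<le> A * 2 ^ min i (min j k) * (l2 (block i) v * l2 (block j) w * l2 (block k) g))"

lemma freq_box_eq: "freq_box j = {- (2 ^ j) + 1..2 ^ j - 1} \<times> {- (2 ^ j) + 1..2 ^ j - 1}"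
 by (auto simp: freq_box_def)

lemma finite_freq_box [simp]: "finite (freq_box j)"
 by (simp add: freq_box_eq)

lemma block_subset_box: "block j \<subseteq> freq_box j"
 by (cases j) auto

lemma finite_block [simp]: "finite (block j)"
 by (rule finite_subset[OF block_subset_box finite_freq_box])

lemma freq_box_mono: "i \<le> j \<Longrightarrow> freq_box i \<subseteq> freq_box j"
proof -
 assume "i \<le> j"
 then have "(2::int) ^ i \<le> 2 ^ j" by simp
 then show ?thesis unfolding freq_box_def by (auto intro: less_le_trans)
qed

lemma sqrt_card_block_le: "sqrt (card (block j)) \<le> 2 * 2 ^ j"
proof -
 have "card (block j) \<le> card (freq_box j)" by (rule card_mono[OF finite_freq_box block_subset_box])
 also have "card (freq_box j) = nat (2 * 2 ^ j - 1) * nat (2 * 2 ^ j - 1)"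
  by (simp add: freq_box_eq card_cartesian_product)
 also have "\<dots> \<le> (2 * 2 ^ j) * (2 * 2 ^ j)"
  by (intro mult_mono) (auto simp: nat_le_iff)
 finally have "card (block j) \<le> (2 * 2 ^ j) * (2 * 2 ^ j :: nat)" .
 then have "real (card (block j)) \<le> (2 * 2 ^ j)\<^sup>2"
 proof -
  assume "card (block j) \<le> (2 * 2 ^ j) * (2 * 2 ^ j :: nat)"
  then have "real (card (block j)) \<le> real ((2 * 2 ^ j) * (2 * 2 ^ j))" by (simp only: of_nat_le_iff)
  then show ?thesis by (simp add: power2_eq_square)
 qed
 then show ?thesis by (simp add: real_le_lsqrt)
qed

lemma UN_block: "(\<Union>j\<le>N. block j) = freq_box N"
proof (induction N)
 case (Suc N)
 have "(\<Union>j\<le>Suc N. block j) = block (Suc N) \<union> freq_box N"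
  unfolding atMost_Suc using Suc.IH by (simp del: block.simps)
 also have "\<dots> = freq_box (Suc N)" using freq_box_mono[of N "Suc N"] by auto
 finally show ?case .
qed simp

lemma block_disjoint: "i \<noteq> j \<Longrightarrow> block i \<inter> block j = {}"
proof (induction i j rule: linorder_wlog)
 case (le i j)
 then obtain j' where j: "j = Suc j'" "i \<le> j'" by (cases j) auto
 then show ?case using block_subset_box[of i] freq_box_mono[of i j'] by auto
qed auto

lemma ex_block: "\<exists>j. n \<in> block j"
proof -
 define m where "m = nat (max \<bar>fst n\<bar> \<bar>snd n\<bar>)"
 have "int m < 2 ^ m" using of_nat_less_two_power by blast
 moreover have "\<bar>fst n\<bar> \<le> int m" "\<bar>snd n\<bar> \<le> int m" by (auto simp: m_def)
 ultimately have "n \<in> freq_box m" unfolding freq_box_def mem_Collect_eq by linarith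
 then show ?thesis using UN_block[of m] by blast
qed

lemma finite_subset_box: "finite S \<Longrightarrow> \<exists>N. S \<subseteq> freq_box N"
proof (induction rule: finite_induct)
 case (insert n S)
 then obtain N where N: "S \<subseteq> freq_box N" by auto
 obtain j where "n \<in> block j" using ex_block by blast
 then have "n \<in> freq_box (max N j)" "S \<subseteq> freq_box (max N j)"
  using N freq_box_mono[of N "max N j"] freq_box_mono[of j "max N j"] block_subset_box[of j] by auto
 then show ?case by auto
qed simp

lemma jbracket_ge_one: "1 \<le> jbracket x"
 by (simp add: jbracket_def)

lemma jbracket_pos [simp]: "0 < jbracket x"
 using jbracket_ge_one[of x] by linarith

lemma jbracket_nonneg [simp]: "0 \<le> jbracket x"
 by (rule less_imp_le) simp

lemma jbracket_freq_sq: "(jbracket (freq n))\<^sup>2 = 1 + (real_of_int (fst n))\<^sup>2 + (real_of_int (snd n))\<^sup>2"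
 by (simp add: jbracket_def freq_def norm_Pair)

lemma jbracket_block_ge: "n \<in> block j \<Longrightarrow> 2 ^ j / 2 \<le> jbracket (freq n)"
proof (cases j)
 case 0
 then show ?thesis using jbracket_ge_one[of "freq n"] by simp
next
 case (Suc i)
 assume "n \<in> block j"
 then have "2 ^ i \<le> \<bar>fst n\<bar> \<or> 2 ^ i \<le> \<bar>snd n\<bar>" by (auto simp: Suc freq_box_def)
 then have "(2 ^ i :: real)\<^sup>2 \<le> (real_of_int (fst n))\<^sup>2 \<or> (2 ^ i :: real)\<^sup>2 \<le> (real_of_int (snd n))\<^sup>2"
 proof -
  have *: "(2 ^ i :: real)\<^sup>2 \<le> (real_of_int x)\<^sup>2" if "2 ^ i \<le> \<bar>x\<bar>" for x :: int
  proof -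
   have "real_of_int (2 ^ i) \<le> real_of_int \<bar>x\<bar>" using that by (simp only: of_int_le_iff)
   then have "(2 ^ i)\<^sup>2 \<le> \<bar>real_of_int x\<bar>\<^sup>2" by (intro power_mono) auto
   then show ?thesis by simp
  qed
  assume "2 ^ i \<le> \<bar>fst n\<bar> \<or> 2 ^ i \<le> \<bar>snd n\<bar>"
  then show ?thesis using *[of "fst n"] *[of "snd n"] by blast
 qed
 then have "(2 ^ i)\<^sup>2 \<le> (jbracket (freq n))\<^sup>2"
  unfolding jbracket_freq_sq by (smt (verit) zero_le_power2)
 then have "2 ^ i \<le> jbracket (freq n)" by (rule power2_le_imp_le) simp
 then show ?thesis by (simp add: Suc)
qed

lemma LINT_trig_sum_blocks:
 "(LINT x:cell|lborel. cmod (trig_sum (block i) v x * trig_sum (block j) w x * trig_sum (block k) g x))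
   \<le> 8 * pi\<^sup>2 * 2 ^ min i (min j k) * (l2 (block i) v * l2 (block j) w * l2 (block k) g)" (is "?I \<le> ?R")
proof -
 let ?P = "l2 (block i) v * l2 (block j) w * l2 (block k) g"
 have P: "0 \<le> ?P" by (simp add: L2_set_nonneg)
 have step: "X \<le> (2 * pi)\<^sup>2 * sqrt (card (block r)) * ?P \<Longrightarrow> min i (min j k) = r \<Longrightarrow> X \<le> ?R" for X r
 proof -
  assume X: "X \<le> (2 * pi)\<^sup>2 * sqrt (card (block r)) * ?P" and r: "min i (min j k) = r"
  note X
  also have "(2 * pi)\<^sup>2 * sqrt (card (block r)) * ?P \<le> (2 * pi)\<^sup>2 * (2 * 2 ^ r) * ?P"
   by (intro mult_right_mono mult_left_mono sqrt_card_block_le P) auto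
  finally show "X \<le> ?R" by (simp add: r power_mult_distrib)
 qed
 consider "min i (min j k) = i" | "min i (min j k) = j" | "min i (min j k) = k" by linarith
 then show ?thesis
 proof cases
  case 1
  show ?thesis by (rule step[OF _ 1]) (rule LINT_trig_sum_product3; simp)
 next
  case 2
  show ?thesis
   by (rule step[OF _ 2]) (use LINT_trig_sum_product3[of "block j" "block i" "block k" w v g] in \<open>simp add: mult_ac\<close>)
 next
  case 3
  show ?thesis
   by (rule step[OF _ 3]) (use LINT_trig_sum_product3[of "block k" "block i" "block j" g v w] in \<open>simp add: mult_ac\<close>)
 qed
qed

lemma integral_norm_bound_AE:
 fixes f :: "'a \<Rightarrow> 'b::{banach,second_countable_topology}"
 assumes g: "integrable M g" and le: "AE x in M. norm (f x) \<le> g x"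
 shows "norm (integral\<^sup>L M f) \<le> integral\<^sup>L M g"
proof (cases "integrable M f")
 case True
 have "norm (integral\<^sup>L M f) \<le> (\<integral>x. norm (f x) \<partial>M)" by (rule integral_norm_bound)
 also have "\<dots> \<le> integral\<^sup>L M g" using True g le by (intro integral_mono_AE) auto
 finally show ?thesis .
next
 case False
 have "AE x in M. 0 \<le> g x" using le by eventually_elim (rule order_trans[OF norm_ge_zero])
 then show ?thesis using False by (simp add: not_integrable_integral_eq integral_nonneg_AE)
qed

lemma blockbddD:
 "blockbdd A a \<Longrightarrow> cmod (tri a (block i) (block j) (block k) v w g)
   \<le> A * 2 ^ min i (min j k) * (l2 (block i) v * l2 (block j) w * l2 (block k) g)"
 by (simp add: blockbdd_def)

lemma blockbdd_nonneg: "blockbdd A a \<Longrightarrow> 0 \<le> A"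
proof -
 assume "blockbdd A a"
 then have "0 \<le> A * 2 ^ min 0 (min 0 0) * (l2 (block 0) (\<lambda>_. 1) * l2 (block 0) (\<lambda>_. 1) * l2 (block 0) (\<lambda>_. 1))"
  by (intro order_trans[OF norm_ge_zero blockbddD])
 moreover have "block 0 = {0}" by (auto simp: freq_box_def prod_eq_iff)
 ultimately show ?thesis by (simp add: L2_set_def)
qed

lemma integrable_bounded_times:
 fixes f h :: "'a \<Rightarrow> complex"
 assumes "integrable M f" "h \<in> borel_measurable M" "\<And>x. cmod (h x) \<le> B"
 shows "integrable M (\<lambda>x. f x * h x)"
proof (rule Bochner_Integration.integrable_bound[OF integrable_mult_right[OF integrable_norm[OF assms(1)], of B]])
 show "AE x in M. norm (f x * h x) \<le> norm (B * norm (f x))"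
 proof (rule AE_I2)
  fix x
  have "cmod (f x) * cmod (h x) \<le> cmod (f x) * \<bar>B\<bar>"
   using assms(3)[of x] by (intro mult_left_mono) auto
  then show "norm (f x * h x) \<le> norm (B * norm (f x))" by (simp add: norm_mult abs_mult mult.commute)
 qed
qed (use assms in auto)

lemma tri_integral:
 assumes "\<And>n. integrable M (\<lambda>t. f t n)"
 shows "tri (\<lambda>n. integral\<^sup>L M (\<lambda>t. f t n) * a n) S1 S2 S3 v w g = (\<integral>t. tri (\<lambda>n. f t n * a n) S1 S2 S3 v w g \<partial>M)"
 unfolding tri_def using assms by (simp add: Bochner_Integration.integral_sum integrable_sum)

text \<open>
 A character splits over the frequencies because they add up to zero: translating one function amounts
 to translating the three others, which does not change their norms.
\<close>

lemma tri_modulate: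
 assumes "\<And>m n. e (m + n) = e m * e n"
 shows "tri (\<lambda>n. e (- n) * a n) S1 S2 S3 v w g = tri a S1 S2 S3 (\<lambda>n. v n * e n) (\<lambda>n. w n * e n) (\<lambda>n. g n * e n)"
 unfolding tri_def minus_minus assms by (simp add: mult_ac)

lemma tri_cmult: "tri (\<lambda>n. c * a n) S1 S2 S3 v w g = c * tri a S1 S2 S3 v w g"
 unfolding tri_def by (simp add: sum_distrib_left mult_ac)

lemma tri_add: "tri (\<lambda>n. a n + b n) S1 S2 S3 v w g = tri a S1 S2 S3 v w g + tri b S1 S2 S3 v w g"
 unfolding tri_def by (simp add: sum.distrib distrib_left)

lemma tri_one: "tri (\<lambda>n. 1) S1 S2 S3 v w g = sum v S1 * sum w S2 * sum g S3"
 by (simp only: tri_def mult.assoc sum_distrib_right mult_1_right) (simp only: sum_distrib_left)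

text \<open>
 An average of block-bounded sequences is block-bounded; everything below is written as such an average.
\<close>

lemma tri_average_le:
 assumes "\<And>n. integrable M (\<lambda>t. f t n)" "integrable M G"
  and "AE t in M. cmod (tri (\<lambda>n. f t n * a n) S1 S2 S3 v w g) \<le> G t"
 shows "cmod (tri (\<lambda>n. integral\<^sup>L M (\<lambda>t. f t n) * a n) S1 S2 S3 v w g) \<le> integral\<^sup>L M G"
 using assms by (simp add: tri_integral integral_norm_bound_AE)

lemma blockbdd_fcoeff:
 assumes h: "set_integrable lborel cell h" and B: "AE x in lborel. x \<in> cell \<longrightarrow> cmod (h x) \<le> B"
 shows "blockbdd (8 * pi\<^sup>2 * B) (fcoeff h)"
 unfolding blockbdd_def
proof (intro allI)
 fix i j k v w g
 let ?F = "\<lambda>x. trig_sum (block i) v x * trig_sum (block j) w x * trig_sum (block k) g x"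
 have B0: "0 \<le> B"
 proof (rule ccontr)
  assume "\<not> 0 \<le> B"
  have "AE x in lborel. x \<notin> cell"
   using B
  proof eventually_elim
   case (elim x)
   then show ?case using \<open>\<not> 0 \<le> B\<close> norm_ge_zero[of "h x"] by linarith
  qed
  then have "measure lborel cell = 0"
   by (subst (asm) AE_iff_measurable[OF _ refl]) (auto simp: measure_def)
  then show False by (simp add: measure_cell)
 qed
 have int: "integrable lborel (\<lambda>x. indicator cell x *\<^sub>R (h x * ech (- n) x))" for n
  using integrable_bounded_times[OF h[unfolded set_integrable_def], of "ech (- n)" 1]
  by (simp add: mult.assoc)
 have "tri (\<lambda>n. 1 * ech (- n) x * 1) (block i) (block j) (block k) v w g = ?F x" for x
  using tri_modulate[where e = "\<lambda>n. ech n x" and a = "\<lambda>_. 1", OF ech_add, of "block i" "block j" "block k" v w g]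
  by (simp add: tri_one trig_sum_def)
 then have F: "tri (\<lambda>n. indicator cell x *\<^sub>R (h x * ech (- n) x) * 1) (block i) (block j) (block k) v w g =
   indicator cell x *\<^sub>R (h x * ?F x)" for x
  using tri_cmult[of "indicator cell x *\<^sub>R h x" "\<lambda>n. ech (- n) x * 1"] by (simp add: mult.assoc)
 have "cmod (tri (\<lambda>n. fcoeff h n * 1) (block i) (block j) (block k) v w g)
   \<le> (\<integral>x. indicator cell x *\<^sub>R (B * cmod (?F x)) \<partial>lborel)"
  unfolding fcoeff_def set_lebesgue_integral_def
 proof (rule tri_average_le[OF int])
  have "continuous_on cell (\<lambda>x. B * cmod (?F x))" by (intro continuous_intros)
  from set_integrable_cell_continuous[OF this]
  show "integrable lborel (\<lambda>x. indicator cell x *\<^sub>R (B * cmod (?F x)))"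
   unfolding set_integrable_def .
  show "AE x in lborel. cmod (tri (\<lambda>n. indicator cell x *\<^sub>R (h x * ech (- n) x) * 1) (block i) (block j) (block k) v w g)
    \<le> indicator cell x *\<^sub>R (B * cmod (?F x))"
   using B unfolding F by eventually_elim (auto simp: indicator_def norm_mult intro!: mult_right_mono)
 qed
 also have "\<dots> = B * (LINT x:cell|lborel. cmod (?F x))"
  unfolding set_lebesgue_integral_def by (simp add: mult.left_commute[of _ B])
 also have "\<dots> \<le> B * (8 * pi\<^sup>2 * 2 ^ min i (min j k) * (l2 (block i) v * l2 (block j) w * l2 (block k) g))"
  by (intro mult_left_mono LINT_trig_sum_blocks B0)
 finally show "cmod (tri (fcoeff h) (block i) (block j) (block k) v w g) \<le>
   8 * pi\<^sup>2 * B * 2 ^ min i (min j k) * (l2 (block i) v * l2 (block j) w * l2 (block k) g)"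
  by (simp add: mult_ac)
qed

text \<open>
 A convolution is an average of translations, with total weight the \<open>L\<^sup>1\<close> norm of the mollifier.
\<close>

lemma blockbdd_mollify:
 assumes r: "set_integrable lborel cell r" and a: "blockbdd A a"
 shows "blockbdd (A * (LINT x:cell|lborel. cmod (r x))) (\<lambda>n. fcoeff r n * a n)"
 unfolding blockbdd_def
proof (intro allI)
 fix i j k v w g
 let ?t = "\<lambda>a. tri a (block i) (block j) (block k) v w g"
 let ?R = "A * 2 ^ min i (min j k) * (l2 (block i) v * l2 (block j) w * l2 (block k) g)"
 have int: "integrable lborel (\<lambda>x. indicator cell x *\<^sub>R (r x * ech (- n) x))" for n
  using integrable_bounded_times[OF r[unfolded set_integrable_def], of "ech (- n)" 1]
  by (simp add: mult.assoc)
 have mod: "cmod (?t (\<lambda>n. ech (- n) x * a n)) \<le> ?R" for x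
  using blockbddD[OF a, of i j k "\<lambda>n. v n * ech n x" "\<lambda>n. w n * ech n x" "\<lambda>n. g n * ech n x"]
   tri_modulate[where e = "\<lambda>n. ech n x" and a = a, OF ech_add]
  by (simp add: norm_mult)
 have "cmod (?t (\<lambda>n. fcoeff r n * a n)) \<le> (\<integral>x. cmod (indicator cell x *\<^sub>R r x) * ?R \<partial>lborel)"
  unfolding fcoeff_def set_lebesgue_integral_def
 proof (rule tri_average_le[OF int])
  show "integrable lborel (\<lambda>x. cmod (indicator cell x *\<^sub>R r x) * ?R)"
   using r by (intro integrable_mult_left integrable_norm) (simp add: set_integrable_def)
  have "?t (\<lambda>n. indicator cell x *\<^sub>R (r x * ech (- n) x) * a n) =
    (indicator cell x *\<^sub>R r x) * ?t (\<lambda>n. ech (- n) x * a n)" for x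
   unfolding tri_cmult[symmetric] by (simp add: mult.assoc)
  then show "AE x in lborel. cmod (?t (\<lambda>n. indicator cell x *\<^sub>R (r x * ech (- n) x) * a n))
    \<le> cmod (indicator cell x *\<^sub>R r x) * ?R"
   by (intro AE_I2) (simp only: norm_mult, intro mult_left_mono mod norm_ge_zero)
 qed
 also have "\<dots> = (LINT x:cell|lborel. cmod (r x)) * ?R"
  by (simp add: set_lebesgue_integral_def)
 finally show "cmod (?t (\<lambda>n. fcoeff r n * a n)) \<le> A * (LINT x:cell|lborel. cmod (r x)) * 2 ^ min i (min j k) *
   (l2 (block i) v * l2 (block j) w * l2 (block k) g)"
  by (simp add: mult_ac)
qed

section \<open>The Bessel multiplier on block-bounded sequences\<close>

lemma tri_diff_telescope:
 "tri a S1 S2 S3 v w g - tri a S1 S2 S3 v' w' g' =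
   tri a S1 S2 S3 (\<lambda>n. v n - v' n) w g + tri a S1 S2 S3 v' (\<lambda>n. w n - w' n) g
    + tri a S1 S2 S3 v' w' (\<lambda>n. g n - g' n)"
 unfolding tri_def by (simp add: algebra_simps flip: sum.distrib sum_subtractf)

lemma cmod_one_minus_cis_le: "cmod (1 - cis x) \<le> min 2 \<bar>x\<bar>"
proof -
 have "cmod (1 - cis x) \<le> cmod 1 + cmod (cis x)" by (rule norm_triangle_ineq4)
 moreover have "cmod (cis x - 1) \<le> \<bar>x\<bar>"
  using iexp_approx1[of x 0] by (simp add: cis_conv_exp)
 ultimately show ?thesis by (simp add: norm_minus_commute)
qed

lemma l2_block_modulation_diff:
 assumes "\<And>n. n \<in> block i \<Longrightarrow> \<bar>p n\<bar> \<le> 2 ^ i"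
 shows "l2 (block i) (\<lambda>n. v n - v n * cis (h * p n)) \<le> 2 * min 1 (\<bar>h\<bar> * 2 ^ i) * l2 (block i) v"
proof -
 have "l2 (block i) (\<lambda>n. v n - v n * cis (h * p n)) \<le> L2_set (\<lambda>n. 2 * min 1 (\<bar>h\<bar> * 2 ^ i) * cmod (v n)) (block i)"
 proof (rule L2_set_mono)
  fix n assume n: "n \<in> block i"
  have "v n - v n * cis (h * p n) = (1 - cis (h * p n)) * v n" by (simp add: algebra_simps)
  moreover have "cmod (1 - cis (h * p n)) \<le> 2 * min 1 (\<bar>h\<bar> * 2 ^ i)"
  proof -
   have "\<bar>h\<bar> * \<bar>p n\<bar> \<le> \<bar>h\<bar> * 2 ^ i" using assms[OF n] by (intro mult_left_mono) auto
   then have "cmod (1 - cis (h * p n)) \<le> min 2 (\<bar>h\<bar> * 2 ^ i)"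
    using cmod_one_minus_cis_le[of "h * p n"] by (simp add: abs_mult)
   moreover have "min 2 (\<bar>h\<bar> * 2 ^ i) \<le> 2 * min 1 (\<bar>h\<bar> * 2 ^ i)"
    proof -
    have "0 \<le> \<bar>h\<bar> * 2 ^ i" by (intro mult_nonneg_nonneg) auto
    then show ?thesis by linarith
   qed
   ultimately show ?thesis by linarith
  qed
  ultimately show "cmod (v n - v n * cis (h * p n)) \<le> 2 * min 1 (\<bar>h\<bar> * 2 ^ i) * cmod (v n)"
   by (simp add: norm_mult mult_right_mono)
 qed simp
 also have "\<dots> = 2 * min 1 (\<bar>h\<bar> * 2 ^ i) * l2 (block i) v"
  by (rule L2_set_right_distrib[symmetric]) simp
 finally show ?thesis .
qed

text \<open>
 The factor \<open>1 - e\<^sup>i\<^sup>h\<^sup>p\<close> is the difference of the identity and a translation by \<open>h\<close>. Both act on each of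
 the three factors, so the difference telescopes and gains \<open>\<bar>h\<bar> 2\<^sup>j\<close> on a factor of frequency \<open>2\<^sup>j\<close>.
\<close>

lemma blockbdd_translation_diff:
 assumes a: "blockbdd A a"
  and p: "\<And>m n. p (m + n) = p m + p n" "\<And>i n. n \<in> block i \<Longrightarrow> \<bar>p n\<bar> \<le> (2::real) ^ i"
 shows "cmod (tri (\<lambda>n. (1 - cis (h * p (- n))) * a n) (block i) (block j) (block k) v w g) \<le>
   6 * A * min 1 (\<bar>h\<bar> * 2 ^ max i (max j k)) * 2 ^ min i (min j k) * (l2 (block i) v * l2 (block j) w * l2 (block k) g)"
proof -
 let ?t = "\<lambda>v w g. tri a (block i) (block j) (block k) v w g"
 let ?m = "\<lambda>v n. v n * cis (h * p n)"
 let ?N = "min 1 (\<bar>h\<bar> * 2 ^ max i (max j k))"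
 define K where "K = A * 2 ^ min i (min j k)"
 have K: "K \<ge> 0" using blockbdd_nonneg[OF a] by (simp add: K_def)
 have l2m: "l2 S (?m v) = l2 S v" for S v by (simp add: norm_mult)
 have "tri (\<lambda>n. (1 - cis (h * p (- n))) * a n) (block i) (block j) (block k) v w g =
   ?t v w g - tri (\<lambda>n. cis (h * p (- n)) * a n) (block i) (block j) (block k) v w g"
  unfolding tri_def by (simp add: algebra_simps flip: sum_subtractf)
 also have "tri (\<lambda>n. cis (h * p (- n)) * a n) (block i) (block j) (block k) v w g = ?t (?m v) (?m w) (?m g)"
  by (rule tri_modulate[where e = "\<lambda>n. cis (h * p n)"]) (simp add: p cis_mult distrib_left)
 also have "?t v w g - ?t (?m v) (?m w) (?m g) = ?t (\<lambda>n. v n - ?m v n) w g + ?t (?m v) (\<lambda>n. w n - ?m w n) g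
   + ?t (?m v) (?m w) (\<lambda>n. g n - ?m g n)"
  by (rule tri_diff_telescope)
 finally have eq: "tri (\<lambda>n. (1 - cis (h * p (- n))) * a n) (block i) (block j) (block k) v w g = \<dots>" .
 have D: "l2 (block r) (\<lambda>n. u n - ?m u n) \<le> 2 * ?N * l2 (block r) u" if "r \<le> max i (max j k)" for r u
 proof -
  have "min 1 (\<bar>h\<bar> * 2 ^ r) \<le> ?N"
   using that by (intro min.mono mult_left_mono power_increasing) auto
  then have "2 * min 1 (\<bar>h\<bar> * 2 ^ r) * l2 (block r) u \<le> 2 * ?N * l2 (block r) u"
   by (intro mult_right_mono mult_left_mono L2_set_nonneg) auto
  then show ?thesis using l2_block_modulation_diff[of r p u h] p by force
 qed
 let ?P = "l2 (block i) v * l2 (block j) w * l2 (block k) g"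
 have 1: "cmod (?t (\<lambda>n. v n - ?m v n) w g) \<le> 2 * K * ?N * ?P"
 proof -
  have "cmod (?t (\<lambda>n. v n - ?m v n) w g) \<le> K * (l2 (block i) (\<lambda>n. v n - ?m v n) * l2 (block j) w * l2 (block k) g)"
   unfolding K_def by (rule blockbddD[OF a])
  also have "\<dots> \<le> K * ((2 * ?N * l2 (block i) v) * l2 (block j) w * l2 (block k) g)"
   using K by (intro mult_left_mono mult_right_mono D L2_set_nonneg) auto
  finally show ?thesis by (simp add: mult_ac)
 qed
 have 2: "cmod (?t (?m v) (\<lambda>n. w n - ?m w n) g) \<le> 2 * K * ?N * ?P"
 proof -
  have "cmod (?t (?m v) (\<lambda>n. w n - ?m w n) g) \<le> K * (l2 (block i) v * l2 (block j) (\<lambda>n. w n - ?m w n) * l2 (block k) g)"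
   unfolding K_def using blockbddD[OF a, of i j k "?m v" "\<lambda>n. w n - ?m w n" g] unfolding l2m .
  also have "\<dots> \<le> K * (l2 (block i) v * (2 * ?N * l2 (block j) w) * l2 (block k) g)"
   using K by (intro mult_left_mono mult_right_mono D L2_set_nonneg) auto
  finally show ?thesis by (simp add: mult_ac)
 qed
 have 3: "cmod (?t (?m v) (?m w) (\<lambda>n. g n - ?m g n)) \<le> 2 * K * ?N * ?P"
 proof -
  have "cmod (?t (?m v) (?m w) (\<lambda>n. g n - ?m g n)) \<le> K * (l2 (block i) v * l2 (block j) w * l2 (block k) (\<lambda>n. g n - ?m g n))"
   unfolding K_def using blockbddD[OF a, of i j k "?m v" "?m w" "\<lambda>n. g n - ?m g n"] unfolding l2m .
  also have "\<dots> \<le> K * (l2 (block i) v * l2 (block j) w * (2 * ?N * l2 (block k) g))"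
   using K by (intro mult_left_mono mult_right_mono D L2_set_nonneg mult_nonneg_nonneg) auto
  finally show ?thesis by (simp add: mult_ac)
 qed
 have "cmod (?t (\<lambda>n. v n - ?m v n) w g + ?t (?m v) (\<lambda>n. w n - ?m w n) g + ?t (?m v) (?m w) (\<lambda>n. g n - ?m g n))
   \<le> 2 * K * ?N * ?P + 2 * K * ?N * ?P + 2 * K * ?N * ?P"
  by (intro norm_triangle_mono 1 2 3)
 then show ?thesis unfolding eq by (simp add: K_def mult_ac)
qed

lemma gaussian_average_cis:
 "(\<integral>x. cis (c * x) \<partial>std_normal_distribution) = exp (- c\<^sup>2 / 2)"
 using fun_cong[OF char_std_normal_distribution, of c] by (simp add: char_def cis_conv_exp)

interpretation std_normal: prob_space std_normal_distribution
 by (rule prob_space_normal_density) simp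

lemma integrable_std_normal_cis: "integrable std_normal_distribution (\<lambda>x. cis (c * x))"
 by (rule std_normal.integrable_const_bound[of _ 1]) (auto simp: cis_conv_exp)

lemma std_normal_abs_moment: "integrable std_normal_distribution (\<lambda>x. \<bar>x\<bar>)"
  "(\<integral>x. \<bar>x\<bar> \<partial>std_normal_distribution) \<le> 1"
proof -
 show "integrable std_normal_distribution (\<lambda>x. \<bar>x\<bar>)"
  using integrable_std_normal_distribution_moment[of 1] by (intro integrable_abs) simp
 have "(\<integral>x. \<bar>x\<bar> \<partial>std_normal_distribution) = (\<integral>x. std_normal_density x * \<bar>x\<bar> \<partial>lborel)"
  by (subst integral_density) auto
 also have "\<dots> = sqrt (2 / pi)" using has_bochner_integral_integral_eq[OF std_normal_moment_abs_odd[of 0]] by simp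
 also have "\<dots> \<le> 1" using pi_ge_two by simp
 finally show "(\<integral>x. \<bar>x\<bar> \<partial>std_normal_distribution) \<le> 1" .
qed

text \<open>\<open>e\<^sup>-\<^sup>t\<^sup>p\<^sup>2\<close> is a Gaussian average of translations.\<close>

lemma heat_multiplier_eq:
 assumes "0 \<le> t"
 shows "complex_of_real (exp (- t * p\<^sup>2)) = (\<integral>x. cis ((sqrt (2 * t) * p) * x) \<partial>std_normal_distribution)"
 unfolding gaussian_average_cis using assms by (simp add: power_mult_distrib)

text \<open>
 A Gaussian average of translations; translations preserve block bounds.
\<close>

lemma blockbdd_heat:
 assumes a: "blockbdd A a" and p: "\<And>m n. p (m + n) = p m + p n" and t: "0 \<le> t"
 shows "blockbdd A (\<lambda>n. of_real (exp (- t * (p (- n))\<^sup>2)) * a n)"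
 unfolding blockbdd_def
proof (intro allI)
 fix i j k v w g
 let ?t = "\<lambda>a. tri a (block i) (block j) (block k) v w g"
 let ?R = "A * 2 ^ min i (min j k) * (l2 (block i) v * l2 (block j) w * l2 (block k) g)"
 have "cmod (?t (\<lambda>n. of_real (exp (- t * (p (- n))\<^sup>2)) * a n)) \<le> (\<integral>x. ?R \<partial>std_normal_distribution)"
  unfolding heat_multiplier_eq[OF t]
 proof (rule tri_average_le)
  show "integrable std_normal_distribution (\<lambda>x. cis (sqrt (2 * t) * p (- n) * x))" for n
   by (rule integrable_std_normal_cis)
  have "cmod (?t (\<lambda>n. cis (c * p (- n)) * a n)) \<le> ?R" for c
   using blockbddD[OF a, of i j k "\<lambda>n. v n * cis (c * p n)" "\<lambda>n. w n * cis (c * p n)" "\<lambda>n. g n * cis (c * p n)"]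
    tri_modulate[where e = "\<lambda>n. cis (c * p n)" and a = a]
   by (simp add: norm_mult p cis_mult distrib_left)
  from this[of "sqrt (2 * t) * x" for x]
  show "AE x in std_normal_distribution. cmod (?t (\<lambda>n. cis (sqrt (2 * t) * p (- n) * x) * a n)) \<le> ?R"
   by (intro AE_I2) (simp add: mult_ac)
 qed simp
 then show "cmod (?t (\<lambda>n. of_real (exp (- t * (p (- n))\<^sup>2)) * a n)) \<le> ?R"
  by (simp add: std_normal.prob_space[simplified])
qed

lemma blockbdd_heat_diff:
 assumes a: "blockbdd A a"
  and p: "\<And>m n. p (m + n) = p m + p n" "\<And>i n. n \<in> block i \<Longrightarrow> \<bar>p n\<bar> \<le> (2::real) ^ i" and t: "0 \<le> t"
 shows "cmod (tri (\<lambda>n. of_real (1 - exp (- t * (p (- n))\<^sup>2)) * a n) (block i) (block j) (block k) v w g) \<le>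
   12 * A * min 1 (sqrt t * 2 ^ max i (max j k)) * 2 ^ min i (min j k) * (l2 (block i) v * l2 (block j) w * l2 (block k) g)"
proof -
 let ?t = "\<lambda>a. tri a (block i) (block j) (block k) v w g"
 define L where "L = (2::real) ^ max i (max j k)"
 let ?R = "6 * A * 2 ^ min i (min j k) * (l2 (block i) v * l2 (block j) w * l2 (block k) g)"
 have R: "0 \<le> ?R" using blockbdd_nonneg[OF a] by (auto intro!: mult_nonneg_nonneg simp: L2_set_nonneg)
 have L: "0 \<le> L" by (simp add: L_def)
 let ?m = "\<lambda>x. min 1 (\<bar>sqrt (2 * t) * x\<bar> * L)"
 have int_m: "integrable std_normal_distribution ?m"
  using L by (intro std_normal.integrable_const_bound[of _ 1]) auto
 have m: "(\<integral>x. 1 - cis ((sqrt (2 * t) * y) * x) \<partial>std_normal_distribution) = of_real (1 - exp (- t * y\<^sup>2))" for y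
  unfolding Bochner_Integration.integral_diff[OF std_normal.integrable_const integrable_std_normal_cis]
  using std_normal.prob_space by (simp only: lebesgue_integral_const of_real_diff heat_multiplier_eq[OF t]) simp
 have "cmod (?t (\<lambda>n. (\<integral>x. 1 - cis ((sqrt (2 * t) * p (- n)) * x) \<partial>std_normal_distribution) * a n)) \<le>
   (\<integral>x. ?m x * ?R \<partial>std_normal_distribution)"
 proof (rule tri_average_le)
  show "integrable std_normal_distribution (\<lambda>x. 1 - cis (sqrt (2 * t) * p (- n) * x))" for n
   by (intro Bochner_Integration.integrable_diff integrable_std_normal_cis) simp
  show "AE x in std_normal_distribution. cmod (?t (\<lambda>n. (1 - cis (sqrt (2 * t) * p (- n) * x)) * a n)) \<le> ?m x * ?R"
  proof (rule AE_I2)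
   fix x
   show "cmod (?t (\<lambda>n. (1 - cis (sqrt (2 * t) * p (- n) * x)) * a n)) \<le> ?m x * ?R"
    using blockbdd_translation_diff[OF a p, of "sqrt (2 * t) * x" i j k v w g]
    by (simp add: L_def mult_ac)
  qed
 qed (use int_m in simp)
 also have "\<dots> = (\<integral>x. ?m x \<partial>std_normal_distribution) * ?R" by simp
 also have "\<dots> \<le> (2 * min 1 (sqrt t * L)) * ?R"
 proof (intro mult_right_mono R)
  have "(\<integral>x. ?m x \<partial>std_normal_distribution) \<le> (\<integral>x. 1 \<partial>std_normal_distribution)"
   by (rule integral_mono[OF int_m]) auto
  then have 1: "(\<integral>x. ?m x \<partial>std_normal_distribution) \<le> 1"
   by (simp add: std_normal.prob_space[simplified])
  have "(\<integral>x. ?m x \<partial>std_normal_distribution) \<le> (\<integral>x. (sqrt (2 * t) * L) * \<bar>x\<bar> \<partial>std_normal_distribution)"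
   using t by (intro integral_mono[OF int_m] integrable_mult_right std_normal_abs_moment) (simp add: abs_mult mult_ac)
  also have "\<dots> \<le> (sqrt (2 * t) * L) * 1"
   using std_normal_abs_moment(2) L t by (subst Bochner_Integration.integral_mult_right_zero) (intro mult_left_mono, auto)
  also have "\<dots> \<le> 2 * (sqrt t * L)"
   using L t sqrt2_less_2 unfolding real_sqrt_mult mult.assoc mult_1_right by (intro mult_right_mono) auto
  finally show "(\<integral>x. ?m x \<partial>std_normal_distribution) \<le> 2 * min 1 (sqrt t * L)" using 1 by linarith
 qed
 finally show ?thesis
  unfolding m by (simp add: L_def mult_ac)
qed

lemma jbracket_nonzero [simp]: "jbracket x \<noteq> 0"
 using jbracket_pos[of x] by (metis less_irrefl)

lemma one_minus_exp_le: "0 \<le> t \<Longrightarrow> \<bar>1 - exp (- t)\<bar> \<le> min 1 (sqrt t)"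
proof -
 assume t: "0 \<le> t"
 have 1: "1 - exp (- t) \<le> t" using exp_ge_add_one_self[of "- t"] by simp
 have "1 - exp (- t) \<le> sqrt t"
 proof (cases "t \<le> 1")
  case True
  then have "t \<le> sqrt t" using t by (simp add: real_le_rsqrt power2_eq_square mult_left_le)
  with 1 show ?thesis by linarith
 next
  case False
  then have "1 \<le> sqrt t" by simp
  then show ?thesis using exp_ge_zero[of "- t"] by linarith
 qed
 with t show ?thesis by simp
qed

text \<open>
 The heat multiplier is treated as three commuting factors, for the constant \<open>1\<close> in \<open>\<langle>n\<rangle>\<^sup>2\<close> and for the two
 coordinates of \<open>n\<close>. For small \<open>t\<close> each difference gains \<open>\<surd>t 2\<^sup>m\<^sup>a\<^sup>x\<close>, the first absolute moment of the
 Gaussian times the gain of a translation; for large \<open>t\<close> it is bounded.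
\<close>

lemma blockbdd_bessel_heat_diff:
 assumes a: "blockbdd A a" and t: "0 \<le> t"
 shows "cmod (tri (\<lambda>n. of_real (1 - exp (- t * (jbracket (freq n))\<^sup>2)) * a n) (block i) (block j) (block k) v w g) \<le>
   25 * A * min 1 (sqrt t * 2 ^ max i (max j k)) * 2 ^ min i (min j k) * (l2 (block i) v * l2 (block j) w * l2 (block k) g)"
proof -
 let ?t = "\<lambda>a. tri a (block i) (block j) (block k) v w g"
 define M where "M = min 1 (sqrt t * 2 ^ max i (max j k))"
 define R where "R = A * 2 ^ min i (min j k) * (l2 (block i) v * l2 (block j) w * l2 (block k) g)"
 have R: "0 \<le> R" using blockbdd_nonneg[OF a] by (auto intro!: mult_nonneg_nonneg simp: R_def L2_set_nonneg)
 define p q :: "int \<times> int \<Rightarrow> real" where "p n = real_of_int (fst n)" and "q n = real_of_int (snd n)" for n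
 have p: "p (m + n) = p m + p n" "n \<in> block r \<Longrightarrow> \<bar>p n\<bar> \<le> 2 ^ r"
  and q: "q (m + n) = q m + q n" "n \<in> block r \<Longrightarrow> \<bar>q n\<bar> \<le> 2 ^ r" for m n r
 proof -
  have *: "\<bar>real_of_int x\<bar> \<le> 2 ^ r" if "\<bar>x\<bar> < 2 ^ r" for x
  proof -
   have "real_of_int \<bar>x\<bar> \<le> real_of_int (2 ^ r)" using that by (simp only: of_int_le_iff)
   then show ?thesis by simp
  qed
  show "p (m + n) = p m + p n" "q (m + n) = q m + q n" by (simp_all add: p_def q_def)
  show "n \<in> block r \<Longrightarrow> \<bar>p n\<bar> \<le> 2 ^ r" "n \<in> block r \<Longrightarrow> \<bar>q n\<bar> \<le> 2 ^ r"
   using block_subset_box[of r] * by (auto simp: freq_box_def p_def q_def)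
 qed
 \<comment> \<open>\<open>1 - e\<^sub>0 e\<^sub>1 e\<^sub>2 = (1 - e\<^sub>0) + e\<^sub>0 (1 - e\<^sub>1) + e\<^sub>0 e\<^sub>1 (1 - e\<^sub>2)\<close>: the two coordinates are treated one after the other.\<close>
 have split: "?t (\<lambda>n. of_real (1 - exp (- t * (jbracket (freq n))\<^sup>2)) * a n) =
   of_real (1 - exp (- t)) * ?t a + of_real (exp (- t)) * ?t (\<lambda>n. of_real (1 - exp (- t * (p (- n))\<^sup>2)) * a n)
   + of_real (exp (- t)) * ?t (\<lambda>n. of_real (1 - exp (- t * (q (- n))\<^sup>2)) * (of_real (exp (- t * (p (- n))\<^sup>2)) * a n))"
 proof -
  have "complex_of_real (1 - exp (- t * (jbracket (freq n))\<^sup>2)) * a n = of_real (1 - exp (- t)) * a n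
    + of_real (exp (- t)) * (of_real (1 - exp (- t * (p (- n))\<^sup>2)) * a n)
    + of_real (exp (- t)) * (of_real (1 - exp (- t * (q (- n))\<^sup>2)) * (of_real (exp (- t * (p (- n))\<^sup>2)) * a n))" for n
  proof -
   have "exp (- t * (jbracket (freq n))\<^sup>2) = exp (- t) * exp (- t * (p (- n))\<^sup>2) * exp (- t * (q (- n))\<^sup>2)"
    by (simp add: jbracket_freq_sq p_def q_def algebra_simps flip: exp_add)
   then show ?thesis by (simp only: of_real_diff of_real_mult of_real_1) (simp add: algebra_simps)
  qed
  then show ?thesis by (simp only: tri_add tri_cmult)
 qed
 have e: "1 - exp (- t) \<le> M"
 proof -
  have "1 - exp (- t) \<le> min 1 (sqrt t)" using one_minus_exp_le[OF t] by linarith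
  also have "min 1 (sqrt t) \<le> min 1 (sqrt t * 2 ^ max i (max j k))"
   using t by (intro min.mono) (auto simp: mult_left_mono[of 1 _ "sqrt t", simplified])
  finally show ?thesis by (simp add: M_def)
 qed
 have e1: "exp (- t) \<le> 1" and M: "0 \<le> M" using t by (simp_all add: M_def)
 have "cmod (of_real (1 - exp (- t)) * ?t a) \<le> M * R"
  unfolding norm_mult norm_of_real R_def using e t e1 M
  by (intro mult_mono blockbddD[OF a]) auto
 moreover have "cmod (of_real (exp (- t)) * ?t (\<lambda>n. of_real (1 - exp (- t * (p (- n))\<^sup>2)) * a n)) \<le> 1 * (12 * M * R)"
  unfolding norm_mult norm_of_real using e1
   blockbdd_heat_diff[of A a p t i j k v w g, OF a p t]
  by (intro mult_mono) (auto simp: M_def R_def mult_ac)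
 moreover have "cmod (of_real (exp (- t)) * ?t (\<lambda>n. of_real (1 - exp (- t * (q (- n))\<^sup>2)) * (of_real (exp (- t * (p (- n))\<^sup>2)) * a n))) \<le> 1 * (12 * M * R)"
  unfolding norm_mult norm_of_real using e1
   blockbdd_heat_diff[of A _ q t i j k v w g, OF blockbdd_heat[of A a p t, OF a p(1) t] q t]
  by (intro mult_mono) (auto simp: M_def R_def mult_ac)
 ultimately have "cmod (?t (\<lambda>n. of_real (1 - exp (- t * (jbracket (freq n))\<^sup>2)) * a n)) \<le> M * R + 1 * (12 * M * R) + 1 * (12 * M * R)"
  unfolding split by (intro norm_triangle_mono)
 then show ?thesis by (simp add: M_def R_def mult_ac)
qed

text \<open>
 The integrand of the subordination formula \<open>c \<lambda>\<^sup>s\<^sup>/\<^sup>2 = \<integral>\<^sub>0\<^sup>\<infinity> t\<^sup>-\<^sup>1\<^sup>-\<^sup>s\<^sup>/\<^sup>2 (1 - e\<^sup>-\<^sup>t\<^sup>\<lambda>) dt\<close> for \<open>0 < s < 2\<close>.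
\<close>

definition subord_kernel :: "real \<Rightarrow> (real \<Rightarrow> real) \<Rightarrow> real \<Rightarrow> real" where
 "subord_kernel s f t = indicator {0<..} t * (t powr (- 1 - s / 2) * f t)"

lemma subord_kernel_measurable [measurable]:
 "f \<in> borel_measurable borel \<Longrightarrow> subord_kernel s f \<in> borel_measurable borel"
 unfolding subord_kernel_def by measurable

lemma subord_kernel_scale:
 assumes "0 < c"
 shows "(\<integral>t. subord_kernel s (\<lambda>t. f (c * t)) t \<partial>lborel) = c powr (s / 2) * (\<integral>t. subord_kernel s f t \<partial>lborel)"
proof -
 have "(\<integral>t. subord_kernel s f t \<partial>lborel) = c * (\<integral>t. subord_kernel s f (c * t) \<partial>lborel)"
  using lborel_integral_real_affine[of c "subord_kernel s f" 0] assms by simp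
 also have "(\<lambda>t. subord_kernel s f (c * t)) = (\<lambda>t. c powr (- 1 - s / 2) * subord_kernel s (\<lambda>t. f (c * t)) t)"
  using assms by (auto simp: subord_kernel_def fun_eq_iff indicator_def powr_mult zero_less_mult_iff)
 finally have "(\<integral>t. subord_kernel s f t \<partial>lborel) = (c * c powr (- 1 - s / 2)) * (\<integral>t. subord_kernel s (\<lambda>t. f (c * t)) t \<partial>lborel)"
  by simp
 also have "c * c powr (- 1 - s / 2) = c powr (- (s / 2))"
  using assms powr_add[of c 1 "- 1 - s / 2"] by simp
 finally show ?thesis using assms by (simp add: powr_minus field_simps)
qed

lemma subord_kernel_integrable_sqrt:
 assumes "0 < s" "s < 1"
 shows "integrable lborel (subord_kernel s (\<lambda>t. min 1 (sqrt t)))"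
proof -
 have "set_integrable lebesgue {0..1} (\<lambda>t::real. t powr (- 1/2 - s / 2))"
  using assms integrable_on_powr_from_0[of "- 1/2 - s / 2" 1]
  by (intro nonnegative_absolutely_integrable_1) auto
 then have 1: "set_integrable lborel {0..1} (\<lambda>t::real. t powr (- 1/2 - s / 2))"
  by (simp add: set_integrable_def integrable_completion)
 have "set_integrable lebesgue {1..} (\<lambda>t::real. t powr (- 1 - s / 2))"
  using assms has_integral_powr_to_inf[of "- 1 - s / 2" 1]
  by (intro nonnegative_absolutely_integrable_1) (auto simp: integrable_on_def)
 then have 2: "set_integrable lborel {1..} (\<lambda>t::real. t powr (- 1 - s / 2))"
  by (simp add: set_integrable_def integrable_completion)
 show ?thesis
 proof (rule Bochner_Integration.integrable_bound)
  show "integrable lborel (\<lambda>t. indicator {0..1} t *\<^sub>R (t powr (- 1/2 - s / 2)) + indicator {1..} t *\<^sub>R (t powr (- 1 - s / 2)))"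
   using 1 2 unfolding set_integrable_def by (rule Bochner_Integration.integrable_add)
  show "AE t in lborel. norm (subord_kernel s (\<lambda>t. min 1 (sqrt t)) t) \<le>
    norm (indicator {0..1} t *\<^sub>R (t powr (- 1/2 - s / 2)) + indicator {1..} t *\<^sub>R (t powr (- 1 - s / 2)) :: real)"
  proof (rule AE_I2)
   fix t :: real
   have "t powr (- 1 - s / 2) * sqrt t = t powr (- 1/2 - s / 2)" if "0 < t"
    using that powr_add[of t "- 1 - s / 2" "1/2"] by (simp add: powr_half_sqrt)
   then show "norm (subord_kernel s (\<lambda>t. min 1 (sqrt t)) t) \<le>
    norm (indicator {0..1} t *\<^sub>R (t powr (- 1/2 - s / 2)) + indicator {1..} t *\<^sub>R (t powr (- 1 - s / 2)) :: real)"
    by (cases "t \<le> 0"; cases "t \<le> 1") (auto simp: subord_kernel_def min_def indicator_def)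
  qed
 qed simp
qed

lemma subord_kernel_bound:
 assumes "integrable lborel (subord_kernel s g)" "f \<in> borel_measurable borel" "\<And>t. 0 < t \<Longrightarrow> \<bar>f t\<bar> \<le> g t"
 shows "integrable lborel (subord_kernel s f)"
proof (rule Bochner_Integration.integrable_bound[OF assms(1)])
 have "\<bar>f t\<bar> \<le> \<bar>g t\<bar>" if "0 < t" for t using assms(3)[OF that] by linarith
 then show "AE t in lborel. norm (subord_kernel s f t) \<le> norm (subord_kernel s g t)"
  by (intro AE_I2) (auto simp: subord_kernel_def indicator_def abs_mult intro!: mult_left_mono)
qed (use assms(2) in simp)

lemma subord_kernel_integrable_exp:
 assumes s: "0 < s" "s < 1" and c: "0 < c"
 shows "integrable lborel (subord_kernel s (\<lambda>t. 1 - exp (- (c * t))))"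
  and "integrable lborel (subord_kernel s (\<lambda>t. min 1 (sqrt (c * t))))"
proof -
 let ?g = "\<lambda>t. max 1 (sqrt c) * min 1 (sqrt t)"
 have i: "integrable lborel (subord_kernel s ?g)"
  using integrable_mult_right[OF subord_kernel_integrable_sqrt[OF s], of "max 1 (sqrt c)"]
  by (simp add: subord_kernel_def[abs_def] mult_ac)
 have le: "min 1 (sqrt (c * t)) \<le> ?g t" if "0 < t" for t
 proof (cases "t \<le> 1")
  case True
  have "min 1 (sqrt (c * t)) \<le> sqrt c * sqrt t" by (simp add: real_sqrt_mult)
  also have "\<dots> \<le> max 1 (sqrt c) * sqrt t" using that by (intro mult_right_mono) auto
  finally show ?thesis using True by simp
 qed auto
 show "integrable lborel (subord_kernel s (\<lambda>t. min 1 (sqrt (c * t))))"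
 proof (rule subord_kernel_bound[OF i])
  show "\<bar>min 1 (sqrt (c * t))\<bar> \<le> ?g t" if "0 < t" for t
  proof -
   have "0 \<le> min 1 (sqrt (c * t))" using c that by simp
   then show ?thesis using le[OF that] by linarith
  qed
 qed simp
 show "integrable lborel (subord_kernel s (\<lambda>t. 1 - exp (- (c * t))))"
 proof (rule subord_kernel_bound[OF i])
  show "\<bar>1 - exp (- (c * t))\<bar> \<le> ?g t" if "0 < t" for t
   by (rule order_trans[OF one_minus_exp_le le[OF that]]) (use c that in simp)
 qed simp
qed

lemma subord_kernel_integral_pos:
 assumes s: "0 < s" "s < 1"
 shows "0 < (\<integral>t. subord_kernel s (\<lambda>t. 1 - exp (- t)) t \<partial>lborel)"
proof -
 have i: "integrable lborel (subord_kernel s (\<lambda>t. 1 - exp (- t)))"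
  using subord_kernel_integrable_exp(1)[OF s, of 1] by simp
 have nn: "0 \<le> subord_kernel s (\<lambda>t. 1 - exp (- t)) t" for t
  by (auto simp: subord_kernel_def indicator_def)
 have "(\<integral>t. subord_kernel s (\<lambda>t. 1 - exp (- t)) t \<partial>lborel) \<noteq> 0"
 proof
  assume "(\<integral>t. subord_kernel s (\<lambda>t. 1 - exp (- t)) t \<partial>lborel) = 0"
  then have "AE t in lborel. subord_kernel s (\<lambda>t. 1 - exp (- t)) t = 0"
   using integral_nonneg_eq_0_iff_AE[OF i] nn by auto
  then have "AE t in lborel. t \<notin> {0<..<1::real}"
   by eventually_elim (auto simp: subord_kernel_def)
  then have "emeasure lborel {0<..<1::real} = 0"
   by (subst (asm) AE_iff_measurable[OF _ refl]) (auto simp: greaterThanLessThan_def greaterThan_def lessThan_def Int_def)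
  then show False by simp
 qed
 moreover have "0 \<le> (\<integral>t. subord_kernel s (\<lambda>t. 1 - exp (- t)) t \<partial>lborel)" using nn by simp
 ultimately show ?thesis by linarith
qed

text \<open>
 Subordination: integrating \<open>t\<^sup>-\<^sup>1\<^sup>-\<^sup>s\<^sup>/\<^sup>2\<close> against the gain \<open>min 1 (\<surd>t 2\<^sup>m\<^sup>a\<^sup>x)\<close> gives \<open>2\<^sup>s \<^sup>m\<^sup>a\<^sup>x\<close> by scaling. The integral
 converges at \<open>t = 0\<close> because \<open>s < 1\<close>.
\<close>

lemma blockbdd_bessel:
 assumes s: "0 < s" "s < 1"
 shows "\<exists>C>0. \<forall>A a i j k v w g. blockbdd A a \<longrightarrow>
   cmod (tri (\<lambda>n. of_real (jbracket (freq n) powr s) * a n) (block i) (block j) (block k) v w g) \<le>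
   C * A * (2 powr (s * real (max i (max j k))) * 2 ^ min i (min j k)) * (l2 (block i) v * l2 (block j) w * l2 (block k) g)"
proof -
 define I where "I = (\<integral>t. subord_kernel s (\<lambda>t. 1 - exp (- t)) t \<partial>lborel)"
 define J where "J = (\<integral>t. subord_kernel s (\<lambda>t. min 1 (sqrt t)) t \<partial>lborel)"
 have I: "0 < I" unfolding I_def by (rule subord_kernel_integral_pos[OF s])
 have "I \<le> J" unfolding I_def J_def
  using subord_kernel_integrable_exp[OF s, of 1] one_minus_exp_le
  by (intro integral_mono) (auto simp: subord_kernel_def indicator_def intro!: mult_left_mono)
 with I have J: "0 < J" by linarith
 show ?thesis
 proof (intro exI[of _ "25 * J / I"] conjI allI impI)
  show "0 < 25 * J / I" using I J by simp
  fix A :: real and a i j k v w g assume a: "blockbdd A a"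
  let ?t = "\<lambda>a. tri a (block i) (block j) (block k) v w g"
  let ?L = "2 ^ max i (max j k) :: real"
  define R where "R = 25 * A * 2 ^ min i (min j k) * (l2 (block i) v * l2 (block j) w * l2 (block k) g)"
  have K: "jbracket (freq n) powr s * I = (\<integral>t. subord_kernel s (\<lambda>t. 1 - exp (- ((jbracket (freq n))\<^sup>2 * t))) t \<partial>lborel)" for n
   unfolding I_def using subord_kernel_scale[of "(jbracket (freq n))\<^sup>2" s "\<lambda>t. 1 - exp (- t)"]
    jbracket_pos[of "freq n"]
   by (auto simp: powr_powr simp flip: powr_numeral)
  have "cmod (?t (\<lambda>n. of_real (\<integral>t. subord_kernel s (\<lambda>t. 1 - exp (- ((jbracket (freq n))\<^sup>2 * t))) t \<partial>lborel) * a n)) \<le>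
    (\<integral>t. subord_kernel s (\<lambda>t. min 1 (sqrt (?L\<^sup>2 * t))) t * R \<partial>lborel)"
   unfolding integral_complex_of_real[symmetric]
  proof (rule tri_average_le)
   show "integrable lborel (\<lambda>t. complex_of_real (subord_kernel s (\<lambda>t. 1 - exp (- ((jbracket (freq n))\<^sup>2 * t))) t))" for n
    by (intro integrable_of_real subord_kernel_integrable_exp s) simp
   show "integrable lborel (\<lambda>t. subord_kernel s (\<lambda>t. min 1 (sqrt (?L\<^sup>2 * t))) t * R)"
    by (intro integrable_mult_left subord_kernel_integrable_exp s) simp
   show "AE t in lborel. cmod (?t (\<lambda>n. complex_of_real (subord_kernel s (\<lambda>t. 1 - exp (- ((jbracket (freq n))\<^sup>2 * t))) t) * a n)) \<le>
     subord_kernel s (\<lambda>t. min 1 (sqrt (?L\<^sup>2 * t))) t * R"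
   proof (rule AE_I2)
    fix t :: real
    show "cmod (?t (\<lambda>n. complex_of_real (subord_kernel s (\<lambda>t. 1 - exp (- ((jbracket (freq n))\<^sup>2 * t))) t) * a n)) \<le>
     subord_kernel s (\<lambda>t. min 1 (sqrt (?L\<^sup>2 * t))) t * R"
    proof (cases "0 < t")
     case True
     have "?t (\<lambda>n. complex_of_real (subord_kernel s (\<lambda>t. 1 - exp (- ((jbracket (freq n))\<^sup>2 * t))) t) * a n) =
       of_real (t powr (- 1 - s / 2)) * ?t (\<lambda>n. of_real (1 - exp (- t * (jbracket (freq n))\<^sup>2)) * a n)"
      unfolding tri_cmult[symmetric] using True by (simp add: subord_kernel_def mult_ac)
     moreover have "cmod (?t (\<lambda>n. of_real (1 - exp (- t * (jbracket (freq n))\<^sup>2)) * a n)) \<le> min 1 (sqrt (?L\<^sup>2 * t)) * R"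
      using blockbdd_bessel_heat_diff[OF a, of t i j k v w g] True
      by (simp add: R_def real_sqrt_mult mult_ac)
     ultimately show ?thesis
      using True by (simp add: norm_mult subord_kernel_def mult.assoc mult_left_mono)
    qed (simp add: subord_kernel_def tri_def)
   qed
  qed
  also have "\<dots> = (?L\<^sup>2) powr (s / 2) * J * R"
   using subord_kernel_scale[of "?L\<^sup>2" s "\<lambda>t. min 1 (sqrt t)"] by (simp add: J_def)
  also have "(?L\<^sup>2) powr (s / 2) = 2 powr (s * real (max i (max j k)))"
   by (simp add: powr_powr mult_ac flip: powr_realpow powr_numeral)
  finally have "cmod (?t (\<lambda>n. of_real I * (of_real (jbracket (freq n) powr s) * a n))) \<le>
    2 powr (s * real (max i (max j k))) * J * R"
   unfolding K[symmetric] by (simp add: mult_ac)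
  then have "I * cmod (?t (\<lambda>n. of_real (jbracket (freq n) powr s) * a n)) \<le>
    2 powr (s * real (max i (max j k))) * J * R"
   unfolding tri_cmult using I by (simp add: norm_mult)
  then show "cmod (?t (\<lambda>n. of_real (jbracket (freq n) powr s) * a n)) \<le>
   25 * J / I * A * (2 powr (s * real (max i (max j k))) * 2 ^ min i (min j k)) * (l2 (block i) v * l2 (block j) w * l2 (block k) g)"
   using I by (simp add: R_def field_simps)
 qed
qed

section \<open>The trilinear estimate at fixed time\<close>

text \<open>
 The Sobolev norm of \<open>c\<close> of order \<open>s\<close> is at most \<open>K\<close>, stated with finite sums so that it includes
 summability.
\<close>

definition hbd :: "real \<Rightarrow> (int \<times> int \<Rightarrow> complex) \<Rightarrow> real \<Rightarrow> bool" where
 "hbd s c K \<longleftrightarrow> (\<forall>S. finite S \<longrightarrow> L2_set (\<lambda>n. jbracket (freq n) powr s * cmod (c n)) S \<le> K)"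

lemma hbd_nonneg: "hbd s c K \<Longrightarrow> 0 \<le> K"
 unfolding hbd_def by (metis L2_set_empty finite.emptyI)

lemma l2_block_le_hbd:
 assumes c: "hbd s c K" and s: "0 \<le> s"
 shows "l2 (block j) c \<le> 2 powr s * K * 2 powr (- s * real j)"
proof -
 have pos: "0 < (2 ^ j / 2 :: real) powr s" by simp
 have "(2 ^ j / 2) powr s * l2 (block j) c = L2_set (\<lambda>n. (2 ^ j / 2) powr s * cmod (c n)) (block j)"
  by (rule L2_set_right_distrib) simp
 also have "\<dots> \<le> L2_set (\<lambda>n. jbracket (freq n) powr s * cmod (c n)) (block j)"
  using s by (intro L2_set_mono mult_right_mono powr_mono2 jbracket_block_ge) auto
 also have "\<dots> \<le> K" using c by (simp add: hbd_def)
 finally have "l2 (block j) c \<le> K / (2 ^ j / 2) powr s" using pos by (simp add: field_simps)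
 also have "(2 ^ j / 2 :: real) powr s = 2 powr (s * real j) / 2 powr s"
  by (simp add: powr_divide powr_powr mult.commute flip: powr_realpow)
 finally show ?thesis by (simp add: powr_minus field_simps)
qed

text \<open>
 The numerology of the theorem. The worst case is that of three equal frequencies, with loss
 \<open>\<alpha> + \<epsilon> + 1\<close> against the total regularity \<open>5/4 + \<epsilon>\<close>: the condition \<open>\<alpha> < 1/4\<close> leaves exactly \<open>3 \<kappa>\<close>.
\<close>

lemma dyadic_exponent_le:
 fixes \<alpha> \<epsilon> i j k :: real
 assumes "0 < \<alpha>" "0 < \<epsilon>" "\<epsilon> < 1/4 - \<alpha>" "0 \<le> i" "0 \<le> j" "0 \<le> k"
 defines "\<kappa> \<equiv> (1/4 - \<alpha>) / 3"
 shows "(\<alpha> + \<epsilon>) * max i (max j k) + min i (min j k) \<le>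
   (1/4 + \<epsilon> - \<kappa>) * i + (1/4 + \<epsilon> - \<kappa>) * j + (3/4 - \<epsilon> - \<kappa>) * k"
proof -
 define m where "m = min i (min j k)"
 have m: "0 \<le> m" "m \<le> i" "m \<le> j" "m \<le> k" using assms by (auto simp: m_def)
 have comb: "m \<le> x * i + y * j + z * k" if "0 \<le> x" "0 \<le> y" "0 \<le> z" "1 \<le> x + y + z" for x y z
 proof -
  have "m \<le> (x + y + z) * m" using that m by (simp add: mult_right_mono[of 1 _ m, simplified])
  also have "\<dots> = x * m + y * m + z * m" by (simp add: algebra_simps)
  also have "\<dots> \<le> x * i + y * j + z * k" using that m by (intro add_mono mult_left_mono) auto
  finally show ?thesis .
 qed
 have k: "3 * \<kappa> = 1/4 - \<alpha>" by (simp add: \<kappa>_def)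
 consider "max i (max j k) = i" | "max i (max j k) = j" | "max i (max j k) = k" by linarith
 then show ?thesis
 proof cases
  case 1
  have "m \<le> (1/4 + \<epsilon> - \<kappa> - (\<alpha> + \<epsilon>)) * i + (1/4 + \<epsilon> - \<kappa>) * j + (3/4 - \<epsilon> - \<kappa>) * k"
   by (rule comb) (use k assms(1-3) in linarith)+
  then show ?thesis unfolding 1 m_def[symmetric] by (simp add: algebra_simps)
 next
  case 2
  have "m \<le> (1/4 + \<epsilon> - \<kappa>) * i + (1/4 + \<epsilon> - \<kappa> - (\<alpha> + \<epsilon>)) * j + (3/4 - \<epsilon> - \<kappa>) * k"
   by (rule comb) (use k assms(1-3) in linarith)+
  then show ?thesis unfolding 2 m_def[symmetric] by (simp add: algebra_simps)
 next
  case 3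
  have "m \<le> (1/4 + \<epsilon> - \<kappa>) * i + (1/4 + \<epsilon> - \<kappa>) * j + (3/4 - \<epsilon> - \<kappa> - (\<alpha> + \<epsilon>)) * k"
   by (rule comb) (use k assms(1-3) in linarith)+
  then show ?thesis unfolding 3 m_def[symmetric] by (simp add: algebra_simps)
 qed
qed

lemma tri_blocks_le:
 assumes "0 < \<alpha>" "0 < \<epsilon>" "\<epsilon> < 1/4 - \<alpha>"
 shows "\<exists>C>0. \<exists>q. 0 < q \<and> q < 1 \<and> (\<forall>A a v w g Kv Kw Kg i j k.
   blockbdd A a \<and> hbd (1/4 + \<epsilon>) v Kv \<and> hbd (1/4 + \<epsilon>) w Kw \<and> hbd (3/4 - \<epsilon>) g Kg \<longrightarrow>
   cmod (tri (\<lambda>n. of_real (jbracket (freq n) powr (\<alpha> + \<epsilon>)) * a n) (block i) (block j) (block k) v w g)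
    \<le> C * (A * Kv * Kw * Kg) * (q ^ i * q ^ j * q ^ k))"
proof -
 define \<kappa> where "\<kappa> = (1/4 - \<alpha>) / 3"
 define s where "s = \<alpha> + \<epsilon>"
 obtain C where C: "C > 0" and bd: "\<And>A a i j k v w g. blockbdd A a \<Longrightarrow>
   cmod (tri (\<lambda>n. of_real (jbracket (freq n) powr s) * a n) (block i) (block j) (block k) v w g) \<le>
   C * A * (2 powr (s * real (max i (max j k))) * 2 ^ min i (min j k)) * (l2 (block i) v * l2 (block j) w * l2 (block k) g)"
  using blockbdd_bessel[of s] assms by (auto simp: s_def)
 define D where "D = (2::real) powr (1/4 + \<epsilon>) * 2 powr (1/4 + \<epsilon>) * 2 powr (3/4 - \<epsilon>)"
 show ?thesis
 proof (rule exI[of _ "C * D"], intro exI[of _ "2 powr (- \<kappa>)"] conjI allI impI; (elim conjE)?)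
  show "C * D > 0" using C by (simp add: D_def)
  show "(2::real) powr - \<kappa> < 1" using assms by (simp add: \<kappa>_def powr_less_one)
  fix A a v w g Kv Kw Kg i j k
  assume a: "blockbdd A a" and v: "hbd (1/4 + \<epsilon>) v Kv" and w: "hbd (1/4 + \<epsilon>) w Kw" and g: "hbd (3/4 - \<epsilon>) g Kg"
  have nn: "0 \<le> A" "0 \<le> Kv" "0 \<le> Kw" "0 \<le> Kg"
   using blockbdd_nonneg[OF a] hbd_nonneg[OF v] hbd_nonneg[OF w] hbd_nonneg[OF g] by auto
  have e: "0 \<le> 1/4 + \<epsilon>" "0 \<le> 3/4 - \<epsilon>" using assms by auto
  have "l2 (block i) v * l2 (block j) w * l2 (block k) g \<le>
    (2 powr (1/4 + \<epsilon>) * Kv * 2 powr (- (1/4 + \<epsilon>) * real i)) *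
    (2 powr (1/4 + \<epsilon>) * Kw * 2 powr (- (1/4 + \<epsilon>) * real j)) *
    (2 powr (3/4 - \<epsilon>) * Kg * 2 powr (- (3/4 - \<epsilon>) * real k))"
   using nn by (intro mult_mono l2_block_le_hbd v w g e) (auto simp: L2_set_nonneg)
  also have "\<dots> = D * (Kv * Kw * Kg) * 2 powr (- (1/4 + \<epsilon>) * real i - (1/4 + \<epsilon>) * real j - (3/4 - \<epsilon>) * real k)"
   by (simp only: D_def diff_conv_add_uminus powr_add mult_minus_left mult_minus_right mult_ac)
  finally have L: "l2 (block i) v * l2 (block j) w * l2 (block k) g \<le> \<dots>" .
  have "cmod (tri (\<lambda>n. of_real (jbracket (freq n) powr s) * a n) (block i) (block j) (block k) v w g) \<le>
    C * A * (2 powr (s * real (max i (max j k))) * 2 ^ min i (min j k)) *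
    (D * (Kv * Kw * Kg) * 2 powr (- (1/4 + \<epsilon>) * real i - (1/4 + \<epsilon>) * real j - (3/4 - \<epsilon>) * real k))"
   using C nn by (intro order_trans[OF bd[OF a]] mult_left_mono[OF L]) auto
  also have "\<dots> = C * D * (A * Kv * Kw * Kg) *
    2 powr (s * real (max i (max j k)) + real (min i (min j k))
     - (1/4 + \<epsilon>) * real i - (1/4 + \<epsilon>) * real j - (3/4 - \<epsilon>) * real k)"
  proof -
   define E where "E = - (1/4 + \<epsilon>) * real i - (1/4 + \<epsilon>) * real j - (3/4 - \<epsilon>) * real k"
   have "s * real (max i (max j k)) + real (min i (min j k))
     - (1/4 + \<epsilon>) * real i - (1/4 + \<epsilon>) * real j - (3/4 - \<epsilon>) * real k =
     s * real (max i (max j k)) + real (min i (min j k)) + E" by (simp add: E_def algebra_simps)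
   then show ?thesis unfolding E_def[symmetric] by (simp only: powr_add powr_realpow zero_less_numeral mult_ac)
  qed
  also have "\<dots> \<le> C * D * (A * Kv * Kw * Kg) * 2 powr (- \<kappa> * real i - \<kappa> * real j - \<kappa> * real k)"
  proof (intro mult_left_mono powr_mono)
   show "s * real (max i (max j k)) + real (min i (min j k))
     - (1/4 + \<epsilon>) * real i - (1/4 + \<epsilon>) * real j - (3/4 - \<epsilon>) * real k \<le> - \<kappa> * real i - \<kappa> * real j - \<kappa> * real k"
    using dyadic_exponent_le[OF assms, of i j k] unfolding s_def \<kappa>_def of_nat_max of_nat_min
    by (simp add: algebra_simps)
  qed (use C nn in \<open>auto simp: D_def\<close>)
  also have "2 powr (- \<kappa> * real i - \<kappa> * real j - \<kappa> * real k) =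
    ((2 powr - \<kappa>) ^ i * (2 powr - \<kappa>) ^ j * (2 powr - \<kappa>) ^ k :: real)"
   by (simp add: powr_diff powr_add powr_minus field_simps powr_powr flip: powr_realpow)
  finally show "cmod (tri (\<lambda>n. of_real (jbracket (freq n) powr (\<alpha> + \<epsilon>)) * a n) (block i) (block j) (block k) v w g)
    \<le> C * D * (A * Kv * Kw * Kg) * ((2 powr - \<kappa>) ^ i * (2 powr - \<kappa>) ^ j * (2 powr - \<kappa>) ^ k)"
   by (simp add: s_def)
 qed simp
qed

lemma tri_box_eq_sum_blocks:
 "tri b (freq_box N1) (freq_box N2) (freq_box N3) v w g =
   (\<Sum>(i, j, k)\<in>{..N1} \<times> {..N2} \<times> {..N3}. tri b (block i) (block j) (block k) v w g)"
proof -
 have U: "sum f (freq_box N) = (\<Sum>i\<le>N. sum f (block i))" for f :: "int \<times> int \<Rightarrow> complex" and N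
  unfolding UN_block[symmetric] by (rule sum.UNION_disjoint) (use block_disjoint in auto)
 have sw: "(\<Sum>n\<in>block i. \<Sum>j\<le>N2. f n j) = (\<Sum>j\<le>N2. \<Sum>n\<in>block i. f n j)"
  and sw3: "(\<Sum>n\<in>block i. \<Sum>j\<le>N3. f n j) = (\<Sum>j\<le>N3. \<Sum>n\<in>block i. f n j)" for f :: "int \<times> int \<Rightarrow> nat \<Rightarrow> complex" and i
  by (rule sum.swap)+
 have "tri b (freq_box N1) (freq_box N2) (freq_box N3) v w g =
   (\<Sum>i\<le>N1. \<Sum>j\<le>N2. \<Sum>k\<le>N3. tri b (block i) (block j) (block k) v w g)"
  unfolding tri_def U sw sw3 ..
 then show ?thesis by (simp add: sum.cartesian_product)
qed

lemma geometric_sum_le: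
 fixes q :: real
 assumes "0 < q" "q < 1"
 shows "(\<Sum>i\<le>M. q ^ i) \<le> 1 / (1 - q)" "(\<Sum>i\<in>{N<..M}. q ^ i) \<le> q ^ N / (1 - q)"
proof -
 have le: "(\<Sum>i\<in>I. q ^ i) \<le> 1 / (1 - q)" if "finite I" for I
 proof -
  have "(\<Sum>i\<in>I. q ^ i) \<le> (\<Sum>i. q ^ i)" using assms that by (intro sum_le_suminf summable_geometric) auto
  then show ?thesis using assms by (simp add: suminf_geometric)
 qed
 show "(\<Sum>i\<le>M. q ^ i) \<le> 1 / (1 - q)" by (rule le) simp
 have "(\<Sum>i\<in>{N<..M}. q ^ i) = (\<Sum>i\<in>{N<..M}. q ^ N * q ^ (i - N))"
  by (rule sum.cong) (auto simp flip: power_add)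
 also have "\<dots> = q ^ N * (\<Sum>i\<in>(\<lambda>i. i - N) ` {N<..M}. q ^ i)"
  by (subst sum.reindex) (auto simp: inj_on_def sum_distrib_left)
 also have "\<dots> \<le> q ^ N * (1 / (1 - q))" using assms by (intro mult_left_mono le) auto
 finally show "(\<Sum>i\<in>{N<..M}. q ^ i) \<le> q ^ N / (1 - q)" by simp
qed

definition bessel_mult :: "real \<Rightarrow> (int \<times> int \<Rightarrow> complex) \<Rightarrow> int \<times> int \<Rightarrow> complex" where
 "bessel_mult s a n = of_real (jbracket (freq n) powr s) * a n"

text \<open>
 Partial sums of the trilinear form over large boxes form a Cauchy net, at a rate that depends only
 on the norms of the entries. Every limit below is taken with the help of this uniform rate.
\<close>
definition tri_rate :: "real \<Rightarrow> real \<Rightarrow> real \<Rightarrow> (nat \<Rightarrow> real) \<Rightarrow> bool" where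
 "tri_rate \<alpha> \<epsilon> C e \<longleftrightarrow> 0 < C \<and> e \<longlonglongrightarrow> 0 \<and> (\<forall>A a v w g Kv Kw Kg.
   blockbdd A a \<and> hbd (1/4 + \<epsilon>) v Kv \<and> hbd (1/4 + \<epsilon>) w Kw \<and> hbd (3/4 - \<epsilon>) g Kg \<longrightarrow>
   (\<forall>N1 N2 N3. cmod (tri (bessel_mult (\<alpha> + \<epsilon>) a) (freq_box N1) (freq_box N2) (freq_box N3) v w g)
    \<le> C * (A * Kv * Kw * Kg)) \<and>
   (\<forall>N M N1 N2 N3. N \<le> N1 \<and> N \<le> N2 \<and> N \<le> N3 \<and> N1 \<le> M \<and> N2 \<le> M \<and> N3 \<le> M \<longrightarrow>
    cmod (tri (bessel_mult (\<alpha> + \<epsilon>) a) (freq_box M) (freq_box M) (freq_box M) v w g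
      - tri (bessel_mult (\<alpha> + \<epsilon>) a) (freq_box N1) (freq_box N2) (freq_box N3) v w g)
    \<le> e N * (A * Kv * Kw * Kg)))"

lemma ex_tri_rate:
 assumes "0 < \<alpha>" "0 < \<epsilon>" "\<epsilon> < 1/4 - \<alpha>"
 shows "\<exists>C e. tri_rate \<alpha> \<epsilon> C e"
proof -
 obtain C q where C: "C > 0" and q: "0 < q" "q < 1" and bd: "\<And>A a v w g Kv Kw Kg i j k.
   blockbdd A a \<Longrightarrow> hbd (1/4 + \<epsilon>) v Kv \<Longrightarrow> hbd (1/4 + \<epsilon>) w Kw \<Longrightarrow> hbd (3/4 - \<epsilon>) g Kg \<Longrightarrow>
   cmod (tri (\<lambda>n. of_real (jbracket (freq n) powr (\<alpha> + \<epsilon>)) * a n) (block i) (block j) (block k) v w g)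
    \<le> C * (A * Kv * Kw * Kg) * (q ^ i * q ^ j * q ^ k)"
  using tri_blocks_le[OF assms] by meson
 define G where "G = 1 / (1 - q)"
 have G: "0 < G" using q by (simp add: G_def)
 define Q where "Q p = (case p of (i, j, k) \<Rightarrow> q ^ i * q ^ j * q ^ k)" for p :: "nat \<times> nat \<times> nat"
 have Q0: "0 \<le> Q p" for p using q by (auto simp: Q_def split: prod.split)
 have Qsum: "sum Q (I \<times> J \<times> K) = (\<Sum>i\<in>I. q ^ i) * ((\<Sum>j\<in>J. q ^ j) * (\<Sum>k\<in>K. q ^ k))" for I J K
  unfolding Q_def sum.cartesian_product[symmetric] prod.case
  by (simp only: sum_distrib_right mult.assoc) (simp only: sum_distrib_left)
 have nn: "0 \<le> (\<Sum>i\<in>I. q ^ i)" for I using q by (intro sum_nonneg) auto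
 have Un: "sum Q (A \<union> B) \<le> sum Q A + sum Q B" if "finite A" "finite B" for A B
  using sum_Un[OF that, of Q] sum_nonneg[of "A \<inter> B" Q] Q0 by simp
 note geo = geometric_sum_le[OF q, folded G_def]
 have geo': "(\<Sum>i\<in>{N<..M}. q ^ i) \<le> q ^ N * G" for N M using geo(2)[of N M] by (simp add: G_def)
 show ?thesis
  unfolding tri_rate_def bessel_mult_def[abs_def]
 proof (intro exI[of _ "C * (G * (G * G))"] exI[of _ "\<lambda>N. 3 * C * G ^ 3 * q ^ N"] conjI allI impI; (elim conjE)?)
  show "0 < C * (G * (G * G))" using C G by simp
  have "(\<lambda>N. 3 * C * G ^ 3 * q ^ N) \<longlonglongrightarrow> 3 * C * G ^ 3 * 0"
   using q by (intro tendsto_intros LIMSEQ_power_zero) auto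
  then show "(\<lambda>N. 3 * C * G ^ 3 * q ^ N) \<longlonglongrightarrow> 0" by simp
  fix A a v w g Kv Kw Kg
  assume a: "blockbdd A a" and v: "hbd (1/4 + \<epsilon>) v Kv" and w: "hbd (1/4 + \<epsilon>) w Kw" and g: "hbd (3/4 - \<epsilon>) g Kg"
  let ?b = "\<lambda>n. of_real (jbracket (freq n) powr (\<alpha> + \<epsilon>)) * a n"
  define P where "P = A * Kv * Kw * Kg"
  have P: "0 \<le> P"
   using blockbdd_nonneg[OF a] hbd_nonneg[OF v] hbd_nonneg[OF w] hbd_nonneg[OF g] by (simp add: P_def)
  define B where "B p = (case p of (i, j, k) \<Rightarrow> tri ?b (block i) (block j) (block k) v w g)" for p
  have B: "cmod (B p) \<le> C * P * Q p" for p
   using bd[OF a v w g] by (auto simp: B_def Q_def P_def split: prod.split)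
  have T: "tri ?b (freq_box N1) (freq_box N2) (freq_box N3) v w g = sum B ({..N1} \<times> {..N2} \<times> {..N3})" for N1 N2 N3
   unfolding tri_box_eq_sum_blocks B_def by (simp add: case_prod_unfold)
  have sumB: "cmod (sum B S) \<le> C * P * sum Q S" for S
   unfolding sum_distrib_left by (rule sum_norm_le) (rule B)
  show "cmod (tri ?b (freq_box N1) (freq_box N2) (freq_box N3) v w g) \<le> C * (G * (G * G)) * (A * Kv * Kw * Kg)" for N1 N2 N3
  proof -
   have "sum Q ({..N1} \<times> {..N2} \<times> {..N3}) \<le> G * (G * G)"
    unfolding Qsum using geo(1) nn G by (intro mult_mono mult_nonneg_nonneg) auto
   then have "C * P * sum Q ({..N1} \<times> {..N2} \<times> {..N3}) \<le> C * P * (G * (G * G))"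
    using C P by (intro mult_left_mono) auto
   with sumB[of "{..N1} \<times> {..N2} \<times> {..N3}"] show ?thesis unfolding T by (simp add: P_def mult_ac)
  qed
  fix N M N1 N2 N3 :: nat
  assume N: "N \<le> N1" "N \<le> N2" "N \<le> N3" "N1 \<le> M" "N2 \<le> M" "N3 \<le> M"
  let ?d = "{..M} \<times> {..M} \<times> {..M} - {..N1} \<times> {..N2} \<times> {..N3}"
  let ?u = "{N<..M} \<times> {..M} \<times> {..M} \<union> ({..M} \<times> {N<..M} \<times> {..M} \<union> {..M} \<times> {..M} \<times> {N<..M})"
  have "tri ?b (freq_box M) (freq_box M) (freq_box M) v w g - tri ?b (freq_box N1) (freq_box N2) (freq_box N3) v w g = sum B ?d"
   unfolding T using N by (intro sum_diff[symmetric]) auto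
  moreover have "sum Q ?d \<le> 3 * G ^ 3 * q ^ N"
  proof -
   have "sum Q ?d \<le> sum Q ?u" using N Q0 by (intro sum_mono2) auto
   also have "\<dots> \<le> sum Q ({N<..M} \<times> {..M} \<times> {..M}) + (sum Q ({..M} \<times> {N<..M} \<times> {..M}) + sum Q ({..M} \<times> {..M} \<times> {N<..M}))"
    by (intro order_trans[OF Un] add_left_mono Un) auto
   also have "\<dots> \<le> (q ^ N * G) * (G * G) + (G * ((q ^ N * G) * G) + G * (G * (q ^ N * G)))"
    unfolding Qsum using geo(1) geo' nn G q by (intro add_mono mult_mono mult_nonneg_nonneg) auto
   finally show ?thesis by (simp add: power3_eq_cube mult_ac)
  qed
  ultimately have "cmod (tri ?b (freq_box M) (freq_box M) (freq_box M) v w g - tri ?b (freq_box N1) (freq_box N2) (freq_box N3) v w g) \<le> C * P * (3 * G ^ 3 * q ^ N)"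
   using sumB[of ?d] C P by (smt (verit) mult_left_mono mult_nonneg_nonneg)
  then show "cmod (tri ?b (freq_box M) (freq_box M) (freq_box M) v w g - tri ?b (freq_box N1) (freq_box N2) (freq_box N3) v w g)
    \<le> 3 * C * G ^ 3 * q ^ N * (A * Kv * Kw * Kg)"
   by (simp add: P_def mult_ac)
 qed
qed

definition Lam :: "(int \<times> int \<Rightarrow> complex) \<Rightarrow> (int \<times> int \<Rightarrow> complex) \<Rightarrow> (int \<times> int \<Rightarrow> complex) \<Rightarrow>
  (int \<times> int \<Rightarrow> complex) \<Rightarrow> complex" where
 "Lam b v w g = lim (\<lambda>N. tri b (freq_box N) (freq_box N) (freq_box N) v w g)"

text \<open>The Fourier coefficients of the product, up to a reflection of the frequency and a factor.\<close>

definition prod_coeff :: "(int \<times> int \<Rightarrow> complex) \<Rightarrow> (int \<times> int \<Rightarrow> complex) \<Rightarrow> (int \<times> int \<Rightarrow> complex) \<Rightarrow>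
  int \<times> int \<Rightarrow> complex" where
 "prod_coeff b v w l = lim (\<lambda>N. tri b (freq_box N) (freq_box N) {l} v w (\<lambda>_. 1))"

lemma tri_last_sum:
 assumes "finite S3"
 shows "tri b S1 S2 S3 v w g = (\<Sum>l\<in>S3. g l * tri b S1 S2 {l} v w (\<lambda>_. 1))"
proof -
 define F where "F n m l = v n * w m * g l * b (- (n + m + l))" for n m l
 have "tri b S1 S2 S3 v w g = (\<Sum>n\<in>S1. \<Sum>l\<in>S3. \<Sum>m\<in>S2. F n m l)"
  unfolding tri_def F_def by (intro sum.cong refl sum.swap)
 also have "\<dots> = (\<Sum>l\<in>S3. \<Sum>n\<in>S1. \<Sum>m\<in>S2. F n m l)" by (rule sum.swap)
 finally show ?thesis by (simp add: tri_def F_def sum_distrib_left mult_ac)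
qed

lemma hbd_single: "hbd s (\<lambda>n. if n = l then c else 0) (jbracket (freq l) powr s * cmod c)"
 unfolding hbd_def
proof (intro allI impI)
 fix S :: "(int \<times> int) set" assume "finite S"
 have "L2_set (\<lambda>n. jbracket (freq n) powr s * cmod (if n = l then c else 0)) S
   \<le> (\<Sum>n\<in>S. jbracket (freq n) powr s * cmod (if n = l then c else 0))"
  by (rule L2_set_le_sum) simp
 also have "\<dots> = (\<Sum>n\<in>S. if n = l then jbracket (freq l) powr s * cmod c else 0)"
  by (rule sum.cong) auto
 also have "\<dots> \<le> jbracket (freq l) powr s * cmod c"
  using \<open>finite S\<close> by (simp add: sum.delta)
 finally show "L2_set (\<lambda>n. jbracket (freq n) powr s * cmod (if n = l then c else 0)) S
   \<le> jbracket (freq l) powr s * cmod c" .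
qed

context
 fixes \<alpha> \<epsilon> C e A a v w Kv Kw
 assumes rate: "tri_rate \<alpha> \<epsilon> C e" and a: "blockbdd A a"
  and v: "hbd (1/4 + \<epsilon>) v Kv" and w: "hbd (1/4 + \<epsilon>) w Kw"
begin

private abbreviation b where "b \<equiv> bessel_mult (\<alpha> + \<epsilon>) a"

lemma tri_rate_bound:
 "hbd (3/4 - \<epsilon>) g Kg \<Longrightarrow> cmod (tri b (freq_box N1) (freq_box N2) (freq_box N3) v w g) \<le> C * (A * Kv * Kw * Kg)"
 using rate a v w unfolding tri_rate_def by blast

lemma tri_rate_diff:
 "hbd (3/4 - \<epsilon>) g Kg \<Longrightarrow> N \<le> N1 \<Longrightarrow> N \<le> N2 \<Longrightarrow> N \<le> N3 \<Longrightarrow> N1 \<le> M \<Longrightarrow> N2 \<le> M \<Longrightarrow> N3 \<le> M \<Longrightarrow>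
  cmod (tri b (freq_box M) (freq_box M) (freq_box M) v w g - tri b (freq_box N1) (freq_box N2) (freq_box N3) v w g) \<le> e N * (A * Kv * Kw * Kg)"
 using rate a v w unfolding tri_rate_def by blast

lemma Lam_tendsto:
 assumes g: "hbd (3/4 - \<epsilon>) g Kg"
 shows "(\<lambda>N. tri b (freq_box N) (freq_box N) (freq_box N) v w g) \<longlonglongrightarrow> Lam b v w g"
proof -
 let ?P = "A * Kv * Kw * Kg"
 have "Cauchy (\<lambda>N. tri b (freq_box N) (freq_box N) (freq_box N) v w g)"
 proof (rule metric_CauchyI)
  fix r :: real assume "0 < r"
  have "(\<lambda>N. e N * ?P) \<longlonglongrightarrow> 0 * ?P"
   using rate by (intro tendsto_intros) (simp add: tri_rate_def)
  then have "eventually (\<lambda>N. e N * ?P < r / 2) sequentially"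
   using \<open>0 < r\<close> by (intro order_tendstoD(2)) auto
  then obtain N where N: "e N * ?P < r / 2" by (auto simp: eventually_sequentially)
  let ?T = "\<lambda>N. tri b (freq_box N) (freq_box N) (freq_box N) v w g"
  have d: "dist (?T M) (?T N) < r / 2" if "N \<le> M" for M
   using tri_rate_diff[OF g, of N N N N M] that N by (simp add: dist_norm)
  show "\<exists>M. \<forall>m\<ge>M. \<forall>n\<ge>M. dist (?T m) (?T n) < r"
   using d by (meson dist_triangle_half_l)
 qed
 then show ?thesis unfolding Lam_def by (simp add: Cauchy_convergent_iff convergent_LIMSEQ_iff)
qed

lemma Lam_bound:
 assumes g: "hbd (3/4 - \<epsilon>) g Kg"
 shows "cmod (Lam b v w g) \<le> C * (A * Kv * Kw * Kg)"
 by (rule LIMSEQ_le_const2[OF tendsto_norm[OF Lam_tendsto[OF g]]]) (use tri_rate_bound[OF g] in auto)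

lemma Lam_diff:
 assumes g: "hbd (3/4 - \<epsilon>) g Kg"
 shows "cmod (Lam b v w g - tri b (freq_box N) (freq_box N) (freq_box N) v w g) \<le> e N * (A * Kv * Kw * Kg)"
 by (rule LIMSEQ_le_const2[OF tendsto_norm[OF tendsto_diff[OF Lam_tendsto[OF g] tendsto_const]]])
  (use tri_rate_diff[OF g, of N N N N] in auto)

text \<open>
 Testing against a single frequency is testing against a function of finite norm.
\<close>

lemma prod_coeff_tendsto: "(\<lambda>N. tri b (freq_box N) (freq_box N) {l} v w (\<lambda>_. 1)) \<longlonglongrightarrow> prod_coeff b v w l"
proof -
 let ?d = "\<lambda>n. if n = l then 1 else 0 :: complex"
 obtain N0 where N0: "{l} \<subseteq> freq_box N0" using finite_subset_box[of "{l}"] by auto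
 have eq: "tri b (freq_box N) (freq_box N) (freq_box N) v w ?d = tri b (freq_box N) (freq_box N) {l} v w (\<lambda>_. 1)" if "N0 \<le> N" for N
 proof -
  have "l \<in> freq_box N" using N0 freq_box_mono[OF that] by auto
  then show ?thesis
   unfolding tri_last_sum[OF finite_freq_box] by (simp add: if_distrib[of "\<lambda>x. x * _"] sum.delta cong: if_cong)
 qed
 have "(\<lambda>N. tri b (freq_box N) (freq_box N) {l} v w (\<lambda>_. 1)) \<longlonglongrightarrow> Lam b v w ?d"
  using Lam_tendsto[OF hbd_single] by (rule Lim_transform_eventually) (rule eventually_sequentiallyI[of N0], rule eq)
 then have "convergent (\<lambda>N. tri b (freq_box N) (freq_box N) {l} v w (\<lambda>_. 1))" by (rule convergentI)
 then show ?thesis unfolding prod_coeff_def by (simp add: convergent_LIMSEQ_iff)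
qed

lemma sum_prod_coeff_tendsto:
 assumes "finite S"
 shows "(\<lambda>N. tri b (freq_box N) (freq_box N) S v w g) \<longlonglongrightarrow> (\<Sum>l\<in>S. g l * prod_coeff b v w l)"
 unfolding tri_last_sum[OF assms] by (intro tendsto_intros prod_coeff_tendsto)

lemma sum_prod_coeff_Lam:
 assumes g: "hbd (3/4 - \<epsilon>) g Kg"
 shows "(\<lambda>N. \<Sum>l\<in>freq_box N. g l * prod_coeff b v w l) \<longlonglongrightarrow> Lam b v w g"
proof -
 let ?P = "A * Kv * Kw * Kg"
 have d: "cmod (Lam b v w g - (\<Sum>l\<in>freq_box N. g l * prod_coeff b v w l)) \<le> e N * ?P" for N
  by (rule LIMSEQ_le_const2[OF tendsto_norm[OF tendsto_diff[OF Lam_tendsto[OF g] sum_prod_coeff_tendsto[OF finite_freq_box]]]])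
   (use tri_rate_diff[OF g, of N _ _ N] in \<open>auto intro!: exI[of _ N]\<close>)
 have "(\<lambda>N. e N * ?P) \<longlonglongrightarrow> 0"
  using rate unfolding tri_rate_def by (intro tendsto_mult_left_zero) auto
 then have "(\<lambda>N. Lam b v w g - (\<Sum>l\<in>freq_box N. g l * prod_coeff b v w l)) \<longlonglongrightarrow> 0"
  by (rule Lim_null_comparison[rotated]) (intro always_eventually allI d)
 from tendsto_diff[OF tendsto_const[of "Lam b v w g"] this] show ?thesis by simp
qed

text \<open>Duality: test the coefficients against themselves.\<close>

lemma hbd_prod_coeff: "hbd (- (3/4 - \<epsilon>)) (prod_coeff b v w) (C * (A * Kv * Kw))"
 unfolding hbd_def
proof (intro allI impI)
 fix S :: "(int \<times> int) set" assume S: "finite S"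
 define z where "z = prod_coeff b v w"
 define u where "u = 3/4 - \<epsilon>"
 define J where "J n = jbracket (freq n)" for n
 have J: "0 < J n" for n by (simp add: J_def)
 define X where "X = L2_set (\<lambda>n. J n powr (- u) * cmod (z n)) S"
 define g where "g n = (if n \<in> S then of_real (J n powr (- u) * J n powr (- u)) * cnj (z n) else 0)" for n
 have J1: "J n powr u * (J n powr (- u) * J n powr (- u) * cmod (z n)) = J n powr (- u) * cmod (z n)" for n
  using J[of n] by (simp add: powr_minus field_simps)
 have "hbd u g X"
  unfolding hbd_def
 proof (intro allI impI)
  fix S' :: "(int \<times> int) set" assume "finite S'"
  have "L2_set (\<lambda>n. jbracket (freq n) powr u * cmod (g n)) S' =
    L2_set (\<lambda>n. if n \<in> S then J n powr (- u) * cmod (z n) else 0) S'"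
   by (rule L2_set_cong) (auto simp: g_def norm_mult J1 simp flip: J_def)
  also have "\<dots> = L2_set (\<lambda>n. J n powr (- u) * cmod (z n)) (S' \<inter> S)"
   unfolding L2_set_def using \<open>finite S'\<close>
   by (simp add: sum.inter_restrict if_distrib[of "\<lambda>x. x\<^sup>2"] cong: if_cong)
  also have "\<dots> \<le> X" unfolding X_def L2_set_def using S
   by (intro real_sqrt_le_mono sum_mono2) auto
  finally show "L2_set (\<lambda>n. jbracket (freq n) powr u * cmod (g n)) S' \<le> X" .
 qed
 then have g: "hbd (3/4 - \<epsilon>) g X" by (simp add: u_def)
 obtain N0 where N0: "S \<subseteq> freq_box N0" using finite_subset_box[OF S] by auto
 have "(\<Sum>l\<in>freq_box N. g l * z l) = of_real (X\<^sup>2)" if "N0 \<le> N" for N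
 proof -
  have "S \<subseteq> freq_box N" using N0 freq_box_mono[OF that] by auto
  then have "(\<Sum>l\<in>freq_box N. g l * z l) = (\<Sum>l\<in>S. g l * z l)"
   by (intro sum.mono_neutral_right) (auto simp: g_def)
  also have "\<dots> = (\<Sum>l\<in>S. of_real ((J l powr (- u) * cmod (z l))\<^sup>2))"
   by (intro sum.cong refl) (simp add: g_def power_mult_distrib complex_norm_square[simplified] power2_eq_square[of "_ powr _"] mult_ac)
  also have "\<dots> = of_real (X\<^sup>2)" by (simp add: X_def L2_set_def sum_nonneg)
  finally show ?thesis .
 qed
 then have "(\<lambda>N. \<Sum>l\<in>freq_box N. g l * z l) \<longlonglongrightarrow> of_real (X\<^sup>2)"
  by (intro tendsto_eventually) (auto simp: eventually_sequentially)
 with sum_prod_coeff_Lam[OF g] have "Lam b v w g = of_real (X\<^sup>2)"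
  unfolding z_def by (rule LIMSEQ_unique)
 with Lam_bound[OF g] have le: "X * X \<le> C * (A * Kv * Kw) * X"
  by (simp add: power2_eq_square norm_mult mult_ac)
 have "0 \<le> C * (A * Kv * Kw)"
  using rate blockbdd_nonneg[OF a] hbd_nonneg[OF v] hbd_nonneg[OF w] by (simp add: tri_rate_def)
 moreover have "0 \<le> X" by (simp add: X_def L2_set_nonneg)
 ultimately have "X \<le> C * (A * Kv * Kw)"
  using le by (cases "X = 0") (auto simp: mult_le_cancel_right)
 then show "L2_set (\<lambda>n. jbracket (freq n) powr (- (3/4 - \<epsilon>)) * cmod (prod_coeff b v w n)) S \<le> C * (A * Kv * Kw)"
  by (simp add: X_def J_def u_def z_def)
qed

end

text \<open>
 Since the rate is uniform, the trilinear form passes to the limit in its first entry, if the entries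
 converge pointwise and stay block-bounded.
\<close>

lemma Lam_tendsto_first:
 assumes rate: "tri_rate \<alpha> \<epsilon> C e" and ak: "\<And>k. blockbdd A (a k)" and a: "blockbdd A a'"
  and v: "hbd (1/4 + \<epsilon>) v Kv" and w: "hbd (1/4 + \<epsilon>) w Kw" and g: "hbd (3/4 - \<epsilon>) g Kg"
  and lim: "\<And>n. (\<lambda>k. a k n) \<longlonglongrightarrow> a' n"
 shows "(\<lambda>k. Lam (bessel_mult (\<alpha> + \<epsilon>) (a k)) v w g) \<longlonglongrightarrow> Lam (bessel_mult (\<alpha> + \<epsilon>) a') v w g"
proof (rule metric_LIMSEQ_I)
 let ?b = "\<lambda>a. bessel_mult (\<alpha> + \<epsilon>) a" and ?P = "A * Kv * Kw * Kg"
 let ?T = "\<lambda>a N. tri (?b a) (freq_box N) (freq_box N) (freq_box N) v w g"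
 fix r :: real assume r: "0 < r"
 have "(\<lambda>N. e N * ?P) \<longlonglongrightarrow> 0"
  using rate unfolding tri_rate_def by (intro tendsto_mult_left_zero) auto
 then have "eventually (\<lambda>N. e N * ?P < r / 3) sequentially"
  using r by (intro order_tendstoD(2)) auto
 then obtain N where N: "e N * ?P < r / 3" by (auto simp: eventually_sequentially)
 have "(\<lambda>k. ?T (a k) N) \<longlonglongrightarrow> ?T a' N"
  unfolding tri_def bessel_mult_def by (intro tendsto_intros lim)
 then obtain k0 where k0: "\<And>k. k0 \<le> k \<Longrightarrow> dist (?T (a k) N) (?T a' N) < r / 3"
  using metric_LIMSEQ_D[of _ _ "r / 3"] r by (metis divide_pos_pos zero_less_numeral)
 have 1: "dist (Lam (?b (a k)) v w g) (?T (a k) N) < r / 3" for k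
  using Lam_diff[OF rate ak v w g, of k N] N by (simp add: dist_norm)
 have 2: "dist (?T a' N) (Lam (?b a') v w g) < r / 3"
  using Lam_diff[OF rate a v w g, of N] N by (simp add: dist_norm norm_minus_commute)
 have "dist (Lam (?b (a k)) v w g) (Lam (?b a') v w g) < r" if "k0 \<le> k" for k
  using 1[of k] k0[OF that] 2 dist_triangle[of "Lam (?b (a k)) v w g" "Lam (?b a') v w g" "?T (a k) N"]
   dist_triangle[of "?T (a k) N" "Lam (?b a') v w g" "?T a' N"] by linarith
 then show "\<exists>k0. \<forall>k\<ge>k0. dist (Lam (?b (a k)) v w g) (Lam (?b a') v w g) < r" by blast
qed

section \<open>Completeness of the trigonometric system\<close>

definition trig_polys :: "(real \<times> real \<Rightarrow> complex) set" where
 "trig_polys = {f. \<exists>S c. finite S \<and> f = trig_sum S c}"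

lemma trig_polys_cmult_ech: "(\<lambda>x. c * ech n x) \<in> trig_polys"
 unfolding trig_polys_def mem_Collect_eq
 by (intro exI[of _ "{n}"] exI[of _ "\<lambda>_. c"]) (simp add: trig_sum_def fun_eq_iff)

lemma trig_polys_add: "f \<in> trig_polys \<Longrightarrow> g \<in> trig_polys \<Longrightarrow> (\<lambda>x. f x + g x) \<in> trig_polys"
proof -
 assume "f \<in> trig_polys" "g \<in> trig_polys"
 then obtain S c T d where S: "finite S" "f = trig_sum S c" and T: "finite T" "g = trig_sum T d"
  by (auto simp: trig_polys_def)
 have "trig_sum S c x + trig_sum T d x =
   trig_sum (S \<union> T) (\<lambda>n. (if n \<in> S then c n else 0) + (if n \<in> T then d n else 0)) x" for x
 proof -
  have "trig_sum S c x = (\<Sum>n\<in>S \<union> T. (if n \<in> S then c n else 0) * ech n x)"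
   "trig_sum T d x = (\<Sum>n\<in>S \<union> T. (if n \<in> T then d n else 0) * ech n x)"
   unfolding trig_sum_def using S T by (auto intro!: sum.mono_neutral_cong_left)
  then show ?thesis unfolding trig_sum_def by (simp add: distrib_right sum.distrib)
 qed
 then show ?thesis
  unfolding trig_polys_def mem_Collect_eq using S T by (intro exI[of _ "S \<union> T"] exI) auto
qed

lemma trig_polys_zero: "(\<lambda>x. 0) \<in> trig_polys"
 using trig_polys_cmult_ech[of 0 0] by simp

lemma trig_polys_sum: "finite I \<Longrightarrow> (\<And>i. i \<in> I \<Longrightarrow> f i \<in> trig_polys) \<Longrightarrow> (\<lambda>x. \<Sum>i\<in>I. f i x) \<in> trig_polys"
 by (induction I rule: finite_induct) (auto intro: trig_polys_zero trig_polys_add)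

lemma trig_polys_mult: "f \<in> trig_polys \<Longrightarrow> g \<in> trig_polys \<Longrightarrow> (\<lambda>x. f x * g x) \<in> trig_polys"
proof -
 assume "f \<in> trig_polys" "g \<in> trig_polys"
 then obtain S c T d where S: "finite S" "f = trig_sum S c" and T: "finite T" "g = trig_sum T d"
  by (auto simp: trig_polys_def)
 have "(\<lambda>x. f x * g x) = (\<lambda>x. \<Sum>n\<in>S. \<Sum>m\<in>T. (c n * d m) * ech (n + m) x)"
  unfolding S T trig_sum_def by (simp add: sum_product ech_add mult_ac)
 also have "\<dots> \<in> trig_polys"
  by (intro trig_polys_sum S T trig_polys_cmult_ech)
 finally show ?thesis .
qed

lemma trig_polys_const: "(\<lambda>x. c) \<in> trig_polys"
 using trig_polys_cmult_ech[of c 0] by simp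

definition torus_map :: "real \<times> real \<Rightarrow> complex \<times> complex" where
 "torus_map x = (cis (fst x), cis (snd x))"

lemma continuous_torus_map: "continuous_on S torus_map"
 unfolding torus_map_def cis_conv_exp by (intro continuous_intros)

lemma trig_polys_cos_sin:
 "(\<lambda>x. of_real (cos (fst x))) \<in> trig_polys" "(\<lambda>x. of_real (sin (fst x))) \<in> trig_polys"
 "(\<lambda>x. of_real (cos (snd x))) \<in> trig_polys" "(\<lambda>x. of_real (sin (snd x))) \<in> trig_polys"
proof -
 have e: "complex_of_real (cos y) = (1/2) * cis y + (1/2) * cis (- y)"
   "complex_of_real (sin y) = (- \<i>/2) * cis y + (\<i>/2) * cis (- y)" for y
  by (simp_all add: complex_eq_iff)
 have f: "cis (fst x) = ech (1, 0) x" "cis (- fst x) = ech (-1, 0) x"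
  "cis (snd x) = ech (0, 1) x" "cis (- snd x) = ech (0, -1) x" for x
  by (cases x; simp add: ech_cis)+
 show "(\<lambda>x. of_real (cos (fst x))) \<in> trig_polys" "(\<lambda>x. of_real (sin (fst x))) \<in> trig_polys"
  "(\<lambda>x. of_real (cos (snd x))) \<in> trig_polys" "(\<lambda>x. of_real (sin (snd x))) \<in> trig_polys"
  unfolding e f by (intro trig_polys_add trig_polys_cmult_ech)+
qed

lemma trig_polys_real_polynomial:
 "real_polynomial_function p \<Longrightarrow> (\<lambda>x. of_real (p (torus_map x))) \<in> trig_polys"
proof (induction rule: real_polynomial_function.induct)
 case (linear f)
 interpret bounded_linear f by fact
 have "f (torus_map x) = f (1, 0) * cos (fst x) + f (\<i>, 0) * sin (fst x) + f (0, 1) * cos (snd x) + f (0, \<i>) * sin (snd x)" for x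
 proof -
  have "torus_map x = cos (fst x) *\<^sub>R (1, 0) + sin (fst x) *\<^sub>R (\<i>, 0) + cos (snd x) *\<^sub>R (0, 1) + sin (snd x) *\<^sub>R (0, \<i>)"
   by (simp add: torus_map_def complex_eq_iff)
  then have "f (torus_map x) = f (cos (fst x) *\<^sub>R (1, 0) + sin (fst x) *\<^sub>R (\<i>, 0) + cos (snd x) *\<^sub>R (0, 1) + sin (snd x) *\<^sub>R (0, \<i>))"
   by (rule arg_cong)
  then show ?thesis by (simp only: add scaleR) (simp add: mult.commute)
 qed
 then have "(\<lambda>x. complex_of_real (f (torus_map x))) = (\<lambda>x. of_real (f (1, 0)) * of_real (cos (fst x))
   + of_real (f (\<i>, 0)) * of_real (sin (fst x)) + of_real (f (0, 1)) * of_real (cos (snd x)) + of_real (f (0, \<i>)) * of_real (sin (snd x)))"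
  by simp
 also have "\<dots> \<in> trig_polys"
  by (intro trig_polys_add trig_polys_mult trig_polys_const trig_polys_cos_sin)
 finally show ?case .
qed (simp_all add: trig_polys_const trig_polys_add trig_polys_mult)

text \<open>
 Weierstrass on the torus: a continuous function that vanishes on the boundary of the cell factors
 through the torus, embedded in \<open>\<complex>\<^sup>2\<close>, where polynomials are trigonometric polynomials.
\<close>

lemma trig_polys_dense:
 assumes h: "continuous_on cell h" and bdry: "\<And>x y. (x, y) \<in> cell \<Longrightarrow> \<bar>x\<bar> = pi \<or> \<bar>y\<bar> = pi \<Longrightarrow> h (x, y) = 0"
  and e: "0 < e"
 shows "\<exists>p\<in>trig_polys. \<forall>x\<in>cell. cmod (h x - p x) < e"
proof -
 define S where "S = torus_map ` cell"
 define G where "G t = h (inv_into cell torus_map t)" for t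
 have cis_inj: "x = y \<or> \<bar>x\<bar> = pi \<and> \<bar>y\<bar> = pi" if "cis x = cis y" "x \<in> {-pi..pi}" "y \<in> {-pi..pi}" for x y
 proof -
  have "cos x = cos y" "sin x = sin y" using that(1) by (auto simp: complex_eq_iff)
  then obtain n :: int where n: "x = y + 2 * pi * n" using sin_cos_eq_iff by metis
  have "x - y = real_of_int n * (2 * pi)" using n by simp
  moreover have "x - y \<le> 1 * (2 * pi)" "(- 1) * (2 * pi) \<le> x - y" using that(2,3) by auto
  ultimately have "real_of_int n * (2 * pi) \<le> 1 * (2 * pi)" "(- 1) * (2 * pi) \<le> real_of_int n * (2 * pi)"
   by linarith+
  then have "real_of_int n \<le> 1" "- 1 \<le> real_of_int n" unfolding mult_le_cancel_right by auto
  then have "n = 0 \<or> n = 1 \<or> n = -1" by linarith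
  then show ?thesis using n that(2,3) by auto
 qed
 have Gh: "G (torus_map x) = h x" if "x \<in> cell" for x
 proof -
  let ?y = "inv_into cell torus_map (torus_map x)"
  have y: "?y \<in> cell" "torus_map ?y = torus_map x"
   using that by (auto intro: inv_into_into f_inv_into_f)
  obtain a b c d where x: "x = (a, b)" and yc: "?y = (c, d)" by (metis surj_pair)
  have "(c, d) \<in> cell" "torus_map (c, d) = torus_map (a, b)" "(a, b) \<in> cell"
   using y that by (simp_all only: x[symmetric] yc[symmetric])
  then have "c = a \<or> \<bar>c\<bar> = pi \<and> \<bar>a\<bar> = pi" "d = b \<or> \<bar>d\<bar> = pi \<and> \<bar>b\<bar> = pi"
   using cis_inj[of c a] cis_inj[of d b] by (simp_all add: torus_map_def cell_def)
  then have "?y = x \<or> (h ?y = 0 \<and> h x = 0)"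
   using bdry[of a b] bdry[of c d] \<open>(c, d) \<in> cell\<close> \<open>(a, b) \<in> cell\<close> unfolding x[symmetric] yc[symmetric]
   by (metis prod.inject x yc)
  then show ?thesis by (auto simp: G_def)
 qed
 have S: "compact S" unfolding S_def by (intro compact_continuous_image continuous_torus_map compact_cell)
 have "continuous_on S G"
  unfolding continuous_on_closed_vimage[OF compact_imp_closed[OF S]]
 proof (intro allI impI)
  fix B :: "complex set" assume B: "closed B"
  have "G -` B \<inter> S = torus_map ` (h -` B \<inter> cell)" using Gh by (auto simp: S_def)
  moreover have "compact (h -` B \<inter> cell)"
   using h B compact_cell continuous_on_closed_vimage[OF compact_imp_closed[OF compact_cell], of h]
   by (metis Int_absorb1 Int_lower2 compact_Int_closed inf_commute)
  ultimately show "closed (G -` B \<inter> S)"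
   by (simp add: compact_imp_closed compact_continuous_image continuous_torus_map)
 qed
 from Stone_Weierstrass_polynomial_function[OF S this e]
 obtain P where P: "polynomial_function P" "\<And>t. t \<in> S \<Longrightarrow> cmod (G t - P t) < e" by blast
 have re: "real_polynomial_function (Re \<circ> P)" "real_polynomial_function (Im \<circ> P)"
  using P(1) bounded_linear_Re bounded_linear_Im by (auto simp: polynomial_function_def)
 let ?p = "\<lambda>x. of_real ((Re \<circ> P) (torus_map x)) + \<i> * of_real ((Im \<circ> P) (torus_map x))"
 have "?p \<in> trig_polys"
  by (intro trig_polys_add trig_polys_mult trig_polys_const trig_polys_real_polynomial re)
 moreover have "?p x = P (torus_map x)" for x by (simp add: complex_eq_iff)
 moreover have "cmod (h x - P (torus_map x)) < e" if "x \<in> cell" for x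
  using P(2)[of "torus_map x"] Gh[OF that] that by (simp add: S_def)
 ultimately show ?thesis by (intro bexI[of _ ?p]) simp_all
qed

lemma AE_lborel_not_in_negligible: "negligible N \<Longrightarrow> AE x in lborel. x \<notin> N"
 using AE_not_in[of N lebesgue] by (simp add: negligible_iff_null_sets AE_completion_iff)

lemma bounded_measurable_approx_trig_polys:
 fixes f :: "real \<times> real \<Rightarrow> complex"
 assumes f: "f \<in> borel_measurable lborel" and R: "\<And>x. cmod (f x) \<le> R"
 shows "\<exists>p. (\<forall>k. p k \<in> trig_polys) \<and> (\<forall>k. \<forall>x\<in>cell. cmod (p k x) \<le> R + 1) \<and>
   (AE x in lborel. x \<in> cell \<longrightarrow> (\<lambda>k. p k x) \<longlonglongrightarrow> f x)"
proof -
 have R0: "0 \<le> R" using R[of 0] norm_ge_zero order_trans by blast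
 have "f measurable_on UNIV"
  using f by (simp add: measurable_on_iff_borel_measurable lebesgue_on_UNIV_eq measurable_completion)
 then obtain N g where N: "negligible N" and g: "\<And>k. continuous_on UNIV (g k)"
  and gf: "\<And>x. x \<notin> N \<Longrightarrow> (\<lambda>k. g k x) \<longlonglongrightarrow> f x"
  unfolding measurable_on_def by auto
 let ?c = "closest_point (cball 0 R :: complex set)"
 have ne: "cball 0 R \<noteq> ({} :: complex set)" using R0 by auto
 have cc: "continuous_on UNIV ?c" by (intro continuous_on_closest_point) (use ne in auto)
 have cR: "cmod (?c z) \<le> R" for z using closest_point_in_set[of "cball 0 R" z] ne by auto
 define th where "th k x = max 0 (min 1 (real k * (pi - \<bar>fst x\<bar>))) * max 0 (min 1 (real k * (pi - \<bar>snd x\<bar>)))"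
  for k and x :: "real \<times> real"
 have th: "0 \<le> th k x" "th k x \<le> 1" for k x unfolding th_def by (auto intro!: mult_le_one)
 define h where "h k x = th k x *\<^sub>R ?c (g k x)" for k x
 have "\<exists>p\<in>trig_polys. \<forall>x\<in>cell. cmod (h k x - p x) < 1 / real (Suc k)" for k
 proof (rule trig_polys_dense)
  show "continuous_on cell (h k)"
   unfolding h_def th_def
   by (intro continuous_intros continuous_on_compose2[OF cc] continuous_on_subset[OF g]) auto
  show "h k (x, y) = 0" if "(x, y) \<in> cell" "\<bar>x\<bar> = pi \<or> \<bar>y\<bar> = pi" for x y
   using that by (auto simp: h_def th_def)
 qed simp
 then obtain p where p: "\<And>k. p k \<in> trig_polys" "\<And>k x. x \<in> cell \<Longrightarrow> cmod (h k x - p k x) < 1 / real (Suc k)"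
  by metis
 have hR: "cmod (h k x) \<le> R" for k x
  using mult_mono[OF th(2) cR] th(1)[of k x] by (simp add: h_def)
 show ?thesis
 proof (intro exI[of _ p] conjI allI ballI p)
  show "cmod (p k x) \<le> R + 1" if "x \<in> cell" for k x
  proof -
   have "cmod (p k x) \<le> cmod (h k x) + cmod (h k x - p k x)" by (metis norm_triangle_sub norm_minus_commute)
   also have "cmod (h k x - p k x) \<le> 1" using p(2)[OF that, of k] by (rule order_trans[OF less_imp_le]) simp
   finally show ?thesis using hR[of k x] by linarith
  qed
  have "negligible (cell - box (-pi, -pi) (pi, pi))"
   unfolding cell_cbox by (rule negligible_frontier_interval)
  from AE_lborel_not_in_negligible[OF N] AE_lborel_not_in_negligible[OF this]
  show "AE x in lborel. x \<in> cell \<longrightarrow> (\<lambda>k. p k x) \<longlonglongrightarrow> f x"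
  proof eventually_elim
   case (elim x)
   show ?case
   proof
    assume x: "x \<in> cell"
    then have "x \<in> box (-pi, -pi) (pi, pi)" using elim by auto
    then have int: "\<bar>fst x\<bar> < pi" "\<bar>snd x\<bar> < pi" by (cases x; auto simp: box_def Basis_prod_def)+
    have "(\<lambda>k. ?c (g k x)) \<longlonglongrightarrow> ?c (f x)"
     using continuous_on_tendsto_compose[OF cc gf[of x]] elim by auto
    also have "?c (f x) = f x" using R[of x] by (intro closest_point_self) simp
    finally have 1: "(\<lambda>k. ?c (g k x)) \<longlonglongrightarrow> f x" .
    have ev: "\<forall>\<^sub>F k in sequentially. 1 \<le> real k * (pi - y)" if "y < pi" for y
    proof -
     obtain k0 :: nat where "1 / (pi - y) < k0" using reals_Archimedean2 by blast
     then have k0: "1 \<le> real k0 * (pi - y)" using \<open>y < pi\<close> by (simp add: field_simps)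
     have "1 \<le> real k * (pi - y)" if "k0 \<le> k" for k
      using that \<open>y < pi\<close> by (intro order_trans[OF k0] mult_right_mono) auto
     then show ?thesis by (auto simp: eventually_sequentially)
    qed
    have "\<forall>\<^sub>F k in sequentially. h k x = ?c (g k x)"
     using ev[OF int(1)] ev[OF int(2)] by eventually_elim (simp add: h_def th_def)
    with 1 have "(\<lambda>k. h k x) \<longlonglongrightarrow> f x" by (simp add: tendsto_cong)
    moreover have "(\<lambda>k. h k x - p k x) \<longlonglongrightarrow> 0"
    proof (rule Lim_null_comparison)
     show "\<forall>\<^sub>F k in sequentially. norm (h k x - p k x) \<le> 1 / real (Suc k)"
      using p(2)[OF x] by (intro always_eventually allI less_imp_le)
     show "(\<lambda>k. 1 / real (Suc k)) \<longlonglongrightarrow> 0" using LIMSEQ_inverse_real_of_nat by (simp add: inverse_eq_divide)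
    qed
    ultimately have "(\<lambda>k. h k x - (h k x - p k x)) \<longlonglongrightarrow> f x - 0" by (rule tendsto_diff)
    then show "(\<lambda>k. p k x) \<longlonglongrightarrow> f x" by simp
   qed
  qed
 qed
qed

lemma measurable_cnj [measurable]: "cnj \<in> borel_measurable borel"
 by (intro borel_measurable_continuous_onI continuous_intros)

lemma norm_integral_times_trig_sum_le:
 assumes v: "set_integrable lborel cell v" and M: "\<And>S. finite S \<Longrightarrow> l2 S (fcoeff v) \<le> M" and S: "finite S"
 shows "cmod (LINT x:cell|lborel. v x * trig_sum S c x) \<le> M / (2 * pi) * sqrt (LINT x:cell|lborel. (cmod (trig_sum S c x))\<^sup>2)"
proof -
 have int: "set_integrable lborel cell (\<lambda>x. c n * (v x * ech (- (- n)) x))" for n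
  using integrable_bounded_times[OF v[unfolded set_integrable_def], of "\<lambda>x. c n * ech n x" "cmod (c n)"]
  by (simp add: set_integrable_def norm_mult mult_ac)
 have "(LINT x:cell|lborel. v x * trig_sum S c x) = (LINT x:cell|lborel. (\<Sum>n\<in>S. c n * (v x * ech (- (- n)) x)))"
  by (simp add: trig_sum_def sum_distrib_left mult_ac)
 also have "\<dots> = (\<Sum>n\<in>S. c n * fcoeff v (- n))"
  using int by (simp add: set_lebesgue_integral_sum fcoeff_def)
 finally have "cmod (LINT x:cell|lborel. v x * trig_sum S c x) \<le> (\<Sum>n\<in>S. \<bar>cmod (c n)\<bar> * \<bar>cmod (fcoeff v (- n))\<bar>)"
  by (auto intro!: sum_norm_le simp: norm_mult)
 also have "\<dots> \<le> l2 S c * L2_set (\<lambda>n. cmod (fcoeff v (- n))) S" by (rule L2_set_mult_ineq)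
 also have "L2_set (\<lambda>n. cmod (fcoeff v (- n))) S = l2 (uminus ` S) (fcoeff v)"
  unfolding L2_set_def by (subst sum.reindex) (auto simp: inj_on_def)
 also have "l2 S c * l2 (uminus ` S) (fcoeff v) \<le> l2 S c * M"
  using S by (intro mult_left_mono M L2_set_nonneg) auto
 also have "l2 S c = sqrt (LINT x:cell|lborel. (cmod (trig_sum S c x))\<^sup>2) / (2 * pi)"
  by (simp add: LINT_trig_sum_square[OF S] real_sqrt_mult L2_set_nonneg)
 finally show ?thesis by (simp add: mult_ac)
qed

text \<open>
 Parseval's inequality in the hard direction, for a merely integrable function: its truncated
 conjugate is a bounded limit of trigonometric polynomials, which see only the coefficients.
\<close>

lemma cell_l2_of_fcoeff_l2:
 assumes v: "set_integrable lborel cell v" and M: "\<And>S. finite S \<Longrightarrow> l2 S (fcoeff v) \<le> M"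
 shows "set_integrable lborel cell (\<lambda>x. (cmod (v x))\<^sup>2)"
  and "(LINT x:cell|lborel. (cmod (v x))\<^sup>2) \<le> (M / (2 * pi))\<^sup>2"
proof -
 define u where "u x = indicator cell x *\<^sub>R v x" for x
 have u: "integrable lborel u" using v by (simp add: u_def[abs_def] set_integrable_def)
 then have [measurable]: "u \<in> borel_measurable borel" by (simp add: borel_measurable_integrable)
 have M0: "0 \<le> M" using M[of "{}"] by simp
 have trunc: "integrable lborel (\<lambda>x. indicator {x. cmod (u x) \<le> real R} x * (cmod (u x))\<^sup>2) \<and>
   (\<integral>x. indicator {x. cmod (u x) \<le> real R} x * (cmod (u x))\<^sup>2 \<partial>lborel) \<le> (M / (2 * pi))\<^sup>2" for R :: nat
 proof -
  define f where "f x = (if cmod (u x) \<le> real R then cnj (u x) else 0)" for x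
  have [measurable]: "f \<in> borel_measurable borel" unfolding f_def by measurable
  have fR: "cmod (f x) \<le> real R" for x by (simp add: f_def)
  obtain p where p: "\<And>k. p k \<in> trig_polys" "\<And>k x. x \<in> cell \<Longrightarrow> cmod (p k x) \<le> real R + 1"
    "AE x in lborel. x \<in> cell \<longrightarrow> (\<lambda>k. p k x) \<longlonglongrightarrow> f x"
  proof -
   have "f \<in> borel_measurable lborel" by simp
   from bounded_measurable_approx_trig_polys[OF this fR] that show ?thesis by blast
  qed
  have [measurable]: "p k \<in> borel_measurable borel" for k
   using p(1)[of k] by (auto simp: trig_polys_def)
  have bound: "integrable lborel (\<lambda>x. indicator cell x *\<^sub>R ((real R + 1)\<^sup>2))"
   using emeasure_cell by (intro integrable_scaleR_left integrable_real_indicator) auto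
  have lim1: "(\<lambda>k. \<integral>x. u x * p k x \<partial>lborel) \<longlonglongrightarrow> (\<integral>x. u x * f x \<partial>lborel)"
  proof (rule integral_dominated_convergence)
   show "integrable lborel (\<lambda>x. cmod (u x) * (real R + 1))" using u by (intro integrable_mult_left integrable_norm)
   show "AE x in lborel. (\<lambda>k. u x * p k x) \<longlonglongrightarrow> u x * f x"
    using p(3)
   proof eventually_elim
    case (elim x)
    then show ?case by (cases "x \<in> cell") (auto simp: u_def intro!: tendsto_intros)
   qed
   show "AE x in lborel. norm (u x * p k x) \<le> cmod (u x) * (real R + 1)" for k
    using p(2)[of _ k] by (intro AE_I2) (auto simp: u_def indicator_def norm_mult intro!: mult_left_mono)
  qed measurable
  have lim2: "(\<lambda>k. \<integral>x. indicator cell x *\<^sub>R (cmod (p k x))\<^sup>2 \<partial>lborel) \<longlonglongrightarrow> (\<integral>x. indicator cell x *\<^sub>R (cmod (f x))\<^sup>2 \<partial>lborel)"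
  proof (rule integral_dominated_convergence[OF _ _ bound])
   show "AE x in lborel. (\<lambda>k. indicator cell x *\<^sub>R (cmod (p k x))\<^sup>2) \<longlonglongrightarrow> indicator cell x *\<^sub>R (cmod (f x))\<^sup>2"
    using p(3) by eventually_elim (auto simp: indicator_def intro!: tendsto_intros)
   show "AE x in lborel. norm (indicator cell x *\<^sub>R (cmod (p k x))\<^sup>2) \<le> indicator cell x *\<^sub>R (real R + 1)\<^sup>2" for k
    using p(2)[of _ k] by (intro AE_I2) (auto simp: indicator_def intro!: power_mono)
  qed measurable
  have "cmod (\<integral>x. u x * p k x \<partial>lborel) \<le> M / (2 * pi) * sqrt (\<integral>x. indicator cell x *\<^sub>R (cmod (p k x))\<^sup>2 \<partial>lborel)" for k
   using p(1)[of k] norm_integral_times_trig_sum_le[OF v M]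
   by (auto simp: trig_polys_def set_lebesgue_integral_def u_def)
  then have le: "cmod (\<integral>x. u x * f x \<partial>lborel) \<le> M / (2 * pi) * sqrt (\<integral>x. indicator cell x *\<^sub>R (cmod (f x))\<^sup>2 \<partial>lborel)"
   by (intro LIMSEQ_le[OF tendsto_norm[OF lim1] tendsto_mult[OF tendsto_const tendsto_real_sqrt[OF lim2]]]) auto
  define g where "g x = indicator {x. cmod (u x) \<le> real R} x * (cmod (u x))\<^sup>2" for x
  define I where "I = (\<integral>x. g x \<partial>lborel)"
  have "u x * f x = of_real (g x)" "indicator cell x *\<^sub>R (cmod (f x))\<^sup>2 = g x" for x
   by (auto simp: f_def u_def g_def indicator_def complex_norm_square[simplified])
  then have le: "cmod (of_real I) \<le> M / (2 * pi) * sqrt I"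
   using le by (simp add: I_def del: norm_of_real)
  have "0 \<le> I" unfolding I_def g_def by (intro Bochner_Integration.integral_nonneg) auto
  then have "I \<le> M / (2 * pi) * sqrt I" using le by simp
  then have "sqrt I * sqrt I \<le> M / (2 * pi) * sqrt I" using \<open>0 \<le> I\<close> by simp
  then have "sqrt I \<le> M / (2 * pi)"
  proof (cases "I = 0")
   case False
   then have "0 < sqrt I" using \<open>0 \<le> I\<close> by simp
   with \<open>sqrt I * sqrt I \<le> M / (2 * pi) * sqrt I\<close> show ?thesis unfolding mult_le_cancel_right by linarith
  qed (use M0 in simp)
  then have "(sqrt I)\<^sup>2 \<le> (M / (2 * pi))\<^sup>2" using \<open>0 \<le> I\<close> by (intro power_mono) auto
  then have "I \<le> (M / (2 * pi))\<^sup>2" using \<open>0 \<le> I\<close> by simp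
  moreover have "integrable lborel g"
  proof (rule Bochner_Integration.integrable_bound[OF integrable_norm[OF u, THEN integrable_mult_right, of "real R"]])
   show "AE x in lborel. norm (g x) \<le> norm (real R * norm (u x))"
    by (intro AE_I2) (auto simp: g_def indicator_def power2_eq_square intro!: mult_right_mono)
   show "g \<in> borel_measurable lborel" unfolding g_def[abs_def] by measurable
  qed
  ultimately show ?thesis by (simp add: I_def g_def[abs_def])
 qed
 define g where "g R x = indicator {x. cmod (u x) \<le> real R} x * (cmod (u x))\<^sup>2" for R :: nat and x
 have mono: "mono (\<lambda>R. g R x)" for x
  by (intro monoI) (auto simp: g_def indicator_def)
 have lim: "(\<lambda>R. g R x) \<longlonglongrightarrow> (cmod (u x))\<^sup>2" for x
 proof (rule tendsto_eventually)
  obtain R0 :: nat where "cmod (u x) \<le> R0" using real_arch_simple by blast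
  then show "\<forall>\<^sub>F R in sequentially. g R x = (cmod (u x))\<^sup>2"
   by (intro eventually_sequentiallyI[of R0]) (auto simp: g_def indicator_def)
 qed
 define L where "L R = (\<integral>x. g R x \<partial>lborel)" for R
 have gi: "integrable lborel (g R)" and LM: "L R \<le> (M / (2 * pi))\<^sup>2" for R
  using trunc[of R] by (simp_all add: g_def[abs_def] L_def)
 have "mono L" unfolding L_def using gi mono by (intro monoI integral_mono) (auto simp: mono_def)
 then obtain l where l: "L \<longlonglongrightarrow> l"
  using LM by (metis incseq_convergent)
 have "has_bochner_integral lborel (\<lambda>x. (cmod (u x))\<^sup>2) l"
  using has_bochner_integral_monotone_convergence[of lborel g "\<lambda>x. (cmod (u x))\<^sup>2" l] gi mono lim l
  by (auto simp: L_def[abs_def])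
 moreover have "l \<le> (M / (2 * pi))\<^sup>2" using l LM by (intro LIMSEQ_le_const2[OF l]) auto
 moreover have "(cmod (u x))\<^sup>2 = indicator cell x *\<^sub>R (cmod (v x))\<^sup>2" for x
  by (auto simp: u_def indicator_def)
 ultimately show "set_integrable lborel cell (\<lambda>x. (cmod (v x))\<^sup>2)"
  and "(LINT x:cell|lborel. (cmod (v x))\<^sup>2) \<le> (M / (2 * pi))\<^sup>2"
  by (auto simp: set_integrable_def set_lebesgue_integral_def has_bochner_integral_iff)
qed

section \<open>Smooth periodic functions and their Fourier series\<close>

text \<open>
 Smoothness is shown by exhibiting a set of differentiable functions closed under derivatives.
\<close>

lemma smooth_coinduct:
 assumes "f \<in> K" "\<And>f. f \<in> K \<Longrightarrow> f differentiable_on UNIV"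
  and "\<And>f v. f \<in> K \<Longrightarrow> (\<lambda>x. frechet_derivative f (at x) v) \<in> K"
 shows "smooth f"
proof -
 have "dderiv vs f \<in> K" for vs by (induction vs) (use assms in auto)
 then show ?thesis using assms(2) by (simp add: smooth_def)
qed

lemma dderiv_append: "dderiv (vs @ us) f = dderiv vs (dderiv us f)"
 by (induction vs) auto

lemma smooth_dderiv: "smooth f \<Longrightarrow> smooth (dderiv us f)"
 unfolding smooth_def by (simp flip: dderiv_append)

lemma smooth_has_derivative: "smooth f \<Longrightarrow> (f has_derivative frechet_derivative f (at x)) (at x)"
 using frechet_derivative_works[of f "at x"] by (auto simp: smooth_def differentiable_on_def dest: spec[of _ "[]"])

lemma smooth_continuous: "smooth f \<Longrightarrow> continuous_on S f"
 by (metis continuous_at_imp_continuous_on has_derivative_continuous smooth_has_derivative)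

lemma dderiv_Cons_eq:
 assumes "dderiv vs f = g" "\<And>x. (g has_derivative g' x) (at x)"
 shows "dderiv (v # vs) f = (\<lambda>x. g' x v)"
 using frechet_derivative_at[OF assms(2)] by (simp add: assms(1))

lemma dderiv_linear:
 fixes f g :: "'a::real_normed_vector \<Rightarrow> complex"
 assumes "smooth f" "smooth g"
 shows "dderiv vs (\<lambda>x. a * f x + b * g x) = (\<lambda>x. a * dderiv vs f x + b * dderiv vs g x)"
proof (induction vs)
 case (Cons v vs)
 have "((\<lambda>x. a * dderiv vs f x + b * dderiv vs g x) has_derivative
   (\<lambda>h. a * frechet_derivative (dderiv vs f) (at x) h + b * frechet_derivative (dderiv vs g) (at x) h)) (at x)" for x
  using smooth_has_derivative[OF smooth_dderiv[OF assms(1)]] smooth_has_derivative[OF smooth_dderiv[OF assms(2)]]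
  by (auto intro!: derivative_eq_intros)
 from dderiv_Cons_eq[OF Cons this] show ?case by simp
qed simp

lemma smooth_linear:
 fixes f g :: "'a::real_normed_vector \<Rightarrow> complex"
 assumes "smooth f" "smooth g"
 shows "smooth (\<lambda>x. a * f x + b * g x)"
 unfolding smooth_def dderiv_linear[OF assms]
proof
 fix vs
 have "dderiv vs f differentiable_on UNIV" "dderiv vs g differentiable_on UNIV"
  using assms by (auto simp: smooth_def)
 then show "(\<lambda>x. a * dderiv vs f x + b * dderiv vs g x) differentiable_on UNIV"
  by (intro differentiable_on_add differentiable_on_mult differentiable_on_const)
qed

lemma ech_has_derivative: "(ech n has_derivative (\<lambda>h. \<i> * of_real (freq n \<bullet> h) * ech n x)) (at x within S)"
proof -
 have "((\<lambda>x. \<i> * complex_of_real (freq n \<bullet> x)) has_derivative (\<lambda>h. \<i> * of_real (freq n \<bullet> h))) (at x within S)"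
  by (intro has_derivative_mult_right has_derivative_of_real has_derivative_inner_right has_derivative_ident)
 from has_derivative_compose[OF this DERIV_exp[THEN has_field_derivative_imp_has_derivative]]
 show ?thesis by (simp add: ech_def[abs_def] cis_conv_exp mult_ac)
qed

definition ech_dfactor :: "int \<times> int \<Rightarrow> (real \<times> real) list \<Rightarrow> complex" where
 "ech_dfactor n vs = prod_list (map (\<lambda>v. \<i> * of_real (freq n \<bullet> v)) vs)"

lemma dderiv_ech: "dderiv vs (\<lambda>x. c * ech n x) = (\<lambda>x. c * ech_dfactor n vs * ech n x)"
proof (induction vs)
 case (Cons v vs)
 have "((\<lambda>x. c * ech_dfactor n vs * ech n x) has_derivative
   (\<lambda>h. c * ech_dfactor n vs * (\<i> * of_real (freq n \<bullet> h) * ech n x))) (at x)" for x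
  by (intro has_derivative_mult_right ech_has_derivative)
 from dderiv_Cons_eq[OF Cons this] show ?case by (simp add: ech_dfactor_def mult_ac)
qed (simp add: ech_dfactor_def)

lemma smooth_ech: "smooth (\<lambda>x. c * ech n x)"
 unfolding smooth_def dderiv_ech
proof
 fix vs
 have "((\<lambda>x. c * ech_dfactor n vs * ech n x) has_derivative
   (\<lambda>h. c * ech_dfactor n vs * (\<i> * of_real (freq n \<bullet> h) * ech n x))) (at x)" for x
  by (intro has_derivative_mult_right ech_has_derivative)
 then show "(\<lambda>x. c * ech_dfactor n vs * ech n x) differentiable_on UNIV"
  unfolding differentiable_on_def differentiable_def by auto
qed

lemma norm_ech_dfactor_le:
 assumes "set vs \<subseteq> Basis"
 shows "cmod (ech_dfactor n vs) \<le> jbracket (freq n) ^ length vs"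
 using assms
proof (induction vs)
 case (Cons v vs)
 have "\<bar>freq n \<bullet> v\<bar> \<le> norm (freq n) * norm v" by (rule Cauchy_Schwarz_ineq2)
 also have "\<dots> \<le> jbracket (freq n)"
  using Cons.prems by (simp add: jbracket_def real_le_rsqrt)
 finally have "cmod (\<i> * of_real (freq n \<bullet> v)) \<le> jbracket (freq n)" by (simp add: norm_mult)
 then show ?case using Cons by (auto simp: ech_dfactor_def norm_mult intro!: mult_mono)
qed (simp add: ech_dfactor_def)

lemma periodic_ech: "periodic (\<lambda>x. c * ech n x)"
proof -
 have *: "cis (real_of_int k * (2 * pi)) = 1" for k
  using cis_multiple_2pi[of "real_of_int k"] by (simp add: mult_ac)
 show ?thesis by (auto simp: periodic_def ech_cis distrib_left * simp flip: cis_mult)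
qed

lemma ech_torus_test: "(\<lambda>x. c * ech n x) \<in> torus_test"
 by (simp add: torus_test_def smooth_ech periodic_ech)

lemma torus_test_linear: "f \<in> torus_test \<Longrightarrow> g \<in> torus_test \<Longrightarrow> (\<lambda>x. a * f x + b * g x) \<in> torus_test"
 unfolding torus_test_def by (auto intro: smooth_linear simp: periodic_def)

lemma torus_test_trig_sum: "finite S \<Longrightarrow> trig_sum S c \<in> torus_test"
proof (induction S rule: finite_induct)
 case empty
 show ?case using ech_torus_test[of 0 0] by (simp add: trig_sum_def[abs_def])
next
 case (insert n S)
 then have "trig_sum (insert n S) c = (\<lambda>x. c n * (1 * ech n x) + 1 * trig_sum S c x)"
  by (simp add: trig_sum_def fun_eq_iff)
 then show ?case using torus_test_linear[OF ech_torus_test insert.IH] by metis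
qed

lemma dderiv_trig_sum: "finite S \<Longrightarrow> dderiv vs (trig_sum S c) = trig_sum S (\<lambda>n. c n * ech_dfactor n vs)"
proof (induction S rule: finite_induct)
 case empty
 have "trig_sum {} c = (\<lambda>x. 0 * ech 0 x)" by (simp add: trig_sum_def[abs_def])
 then have "dderiv vs (trig_sum {} c) = (\<lambda>x. 0 * ech_dfactor 0 vs * ech 0 x)" using dderiv_ech by metis
 then show ?case by (simp add: trig_sum_def[abs_def])
next
 case (insert n S)
 then have eq: "trig_sum (insert n S) c = (\<lambda>x. c n * (1 * ech n x) + 1 * trig_sum S c x)" for c
  by (simp add: trig_sum_def fun_eq_iff)
 have "smooth (trig_sum S c)" using torus_test_trig_sum[OF insert.hyps(1)] by (simp add: torus_test_def)
 from dderiv_linear[OF smooth_ech[of 1 n] this, of vs "c n" 1]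
 show ?case unfolding eq[symmetric] dderiv_ech insert.IH
  using insert.hyps by (simp add: trig_sum_def[abs_def] mult_ac)
qed

lemma dderiv_translation_invariant:
 fixes f :: "'a::real_normed_vector \<Rightarrow> complex"
 assumes f: "smooth f" and p: "\<And>x. f (x + p) = f x"
 shows "dderiv vs f (x + p) = dderiv vs f x"
proof (induction vs arbitrary: x)
 case (Cons v vs)
 have "(dderiv vs f has_derivative frechet_derivative (dderiv vs f) (at (x + p))) (at (x + p))"
  by (rule smooth_has_derivative[OF smooth_dderiv[OF f]])
 then have "((\<lambda>y. dderiv vs f (y + p)) has_derivative frechet_derivative (dderiv vs f) (at (x + p))) (at x)"
  by (intro has_derivative_compose[of "\<lambda>y. y + p" "\<lambda>h. h" x UNIV "dderiv vs f", simplified])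
    (auto intro!: derivative_eq_intros)
 then have "frechet_derivative (dderiv vs f) (at x) = frechet_derivative (dderiv vs f) (at (x + p))"
  unfolding Cons.IH by (rule frechet_derivative_at[symmetric])
 then show ?case by simp
qed (simp add: p)

lemma periodic_shift: "periodic f \<longleftrightarrow> (\<forall>x. f (x + (2 * pi, 0)) = f x) \<and> (\<forall>x. f (x + (0, 2 * pi)) = f x)"
 by (auto simp: periodic_def)

lemma torus_test_dderiv: "f \<in> torus_test \<Longrightarrow> dderiv vs f \<in> torus_test"
 unfolding torus_test_def mem_Collect_eq periodic_shift
 using smooth_dderiv dderiv_translation_invariant by blast

lemma dderiv_reflect:
 fixes f :: "'a::real_normed_vector \<Rightarrow> complex"
 assumes f: "smooth f"
 shows "dderiv vs (\<lambda>y. f (x - y)) = (\<lambda>y. (- 1) ^ length vs * dderiv vs f (x - y))"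
proof (induction vs)
 case (Cons v vs)
 have "((\<lambda>y. (- 1) ^ length vs * dderiv vs f (x - y)) has_derivative
   (\<lambda>h. (- 1) ^ length vs * frechet_derivative (dderiv vs f) (at (x - y)) (- h))) (at y)" for y
  by (intro has_derivative_mult_right has_derivative_compose[of "\<lambda>y. x - y" "\<lambda>h. - h" y UNIV "dderiv vs f", simplified]
    smooth_has_derivative[OF smooth_dderiv[OF f]])
    (auto intro!: derivative_eq_intros)
 moreover have "frechet_derivative (dderiv vs f) (at z) (- h) = - frechet_derivative (dderiv vs f) (at z) h" for z h
  using smooth_has_derivative[OF smooth_dderiv[OF f]]
  by (intro linear_neg) (metis has_derivative_linear)
 ultimately have "((\<lambda>y. (- 1) ^ length vs * dderiv vs f (x - y)) has_derivative
   (\<lambda>h. (- 1) ^ length (v # vs) * frechet_derivative (dderiv vs f) (at (x - y)) h)) (at y)" for y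
  by simp
 from dderiv_Cons_eq[OF Cons this] show ?case by simp
qed simp

lemma torus_test_reflect:
 assumes "f \<in> torus_test"
 shows "(\<lambda>y. f (x - y)) \<in> torus_test"
proof -
 have f: "smooth f" and p: "\<And>x. f (x + (2 * pi, 0)) = f x" "\<And>x. f (x + (0, 2 * pi)) = f x"
  using assms by (auto simp: torus_test_def periodic_shift)
 have "smooth (\<lambda>y. f (x - y))"
  unfolding smooth_def dderiv_reflect[OF f]
 proof
  fix vs
  have "((\<lambda>y. (- 1) ^ length vs * dderiv vs f (x - y)) has_derivative
   (\<lambda>h. (- 1) ^ length vs * frechet_derivative (dderiv vs f) (at (x - y)) (- h))) (at y)" for y
   by (intro has_derivative_mult_right has_derivative_compose[of "\<lambda>y. x - y" "\<lambda>h. - h" y UNIV "dderiv vs f", simplified]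
    smooth_has_derivative[OF smooth_dderiv[OF f]])
    (auto intro!: derivative_eq_intros)
  then show "(\<lambda>y. (- 1) ^ length vs * dderiv vs f (x - y)) differentiable_on UNIV"
   unfolding differentiable_on_def differentiable_def by auto
 qed
 moreover have "f (x - (y + (2 * pi, 0))) = f (x - y)" "f (x - (y + (0, 2 * pi))) = f (x - y)" for y
  using p(1)[of "x - (y + (2 * pi, 0))"] p(2)[of "x - (y + (0, 2 * pi))"] by (simp_all add: algebra_simps)
 ultimately show ?thesis unfolding torus_test_def mem_Collect_eq periodic_shift by blast
qed

lemma periodic_edges:
 assumes "periodic f"
 shows "f (pi, y) = f (- pi, y)" "f (x, pi) = f (x, - pi)"
proof -
 have "f (- pi + 2 * pi, y) = f (- pi, y)" "f (x, - pi + 2 * pi) = f (x, - pi)"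
  using assms unfolding periodic_def by blast+
 then show "f (pi, y) = f (- pi, y)" "f (x, pi) = f (x, - pi)" by simp_all
qed

lemma fcoeff_dderiv:
 assumes f: "f \<in> torus_test" and v: "v \<in> Basis"
 shows "fcoeff (dderiv [v] f) n = \<i> * of_real (freq n \<bullet> v) * fcoeff f n"
proof -
 define F where "F x = f x * ech (- n) x" for x
 define F' where "F' x = dderiv [v] f x * ech (- n) x - \<i> * of_real (freq n \<bullet> v) * (f x * ech (- n) x)" for x
 have sm: "smooth f" "smooth (dderiv [v] f)" and per: "periodic f" "periodic (ech (- n))"
  using f smooth_dderiv[of f "[v]"] periodic_ech[of 1 "- n"] by (auto simp: torus_test_def)
 have F: "(F has_derivative (\<lambda>h. frechet_derivative f (at x) h * ech (- n) x + f x * (\<i> * of_real (freq (- n) \<bullet> h) * ech (- n) x))) (at x)" for x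
  unfolding F_def using smooth_has_derivative[OF sm(1), of x] ech_has_derivative[of "- n" x UNIV]
  by (auto intro!: derivative_eq_intros)
 have cF': "continuous_on S F'" for S
  unfolding F'_def by (intro continuous_intros smooth_continuous sm)
 have FTC: "(LINT s:{-pi..pi}|lborel. F' (c + s *\<^sub>R v)) = F (c + pi *\<^sub>R v) - F (c + (- pi) *\<^sub>R v)" for c
  unfolding set_lebesgue_integral_def
 proof (rule integral_FTC_Icc)
  show "continuous_on {- pi..pi} (\<lambda>s. F' (c + s *\<^sub>R v))"
   by (intro continuous_on_compose2[OF cF'[of UNIV]] continuous_intros) auto
  show "((\<lambda>s. F (c + s *\<^sub>R v)) has_vector_derivative F' (c + s *\<^sub>R v)) (at s within {- pi..pi})" for s
  proof -
   have "((\<lambda>s. c + s *\<^sub>R v) has_derivative (\<lambda>h. h *\<^sub>R v)) (at s within {- pi..pi})"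
    by (auto intro!: derivative_eq_intros)
   from has_derivative_compose[OF this F]
   have "((\<lambda>s. F (c + s *\<^sub>R v)) has_derivative (\<lambda>h. h *\<^sub>R F' (c + s *\<^sub>R v))) (at s within {- pi..pi})"
    using linear_cmul[OF has_derivative_linear[OF smooth_has_derivative[OF sm(1)]]]
    by (simp add: F'_def freq_uminus scaleR_conv_of_real algebra_simps)
   then show ?thesis by (simp add: has_vector_derivative_def)
  qed
 qed simp
 have "(LINT x:cell|lborel. F' x) = 0"
 proof -
  have i: "set_integrable lborel cell F'" by (intro set_integrable_cell_continuous cF')
  consider "v = (1, 0)" | "v = (0, 1)" using v by (auto simp: Basis_prod_def)
  then show ?thesis
  proof cases
   case 1
   have "F (pi, y) = F (- pi, y)" for y
    using periodic_edges(1)[OF per(1)] periodic_edges(1)[OF per(2)] by (simp add: F_def)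
   then have "(LINT x:{-pi..pi}|lborel. F' (x, y)) = 0" for y
    using FTC[of "(0, y)"] 1 by simp
   then show ?thesis unfolding LINT_cell_iterated(2)[OF i] by simp
  next
   case 2
   have "F (x, pi) = F (x, - pi)" for x
    using periodic_edges(2)[OF per(1)] periodic_edges(2)[OF per(2)] by (simp add: F_def)
   then have "(LINT y:{-pi..pi}|lborel. F' (x, y)) = 0" for x
    using FTC[of "(x, 0)"] 2 by simp
   then show ?thesis unfolding LINT_cell_iterated(1)[OF i] by simp
  qed
 qed
 moreover have "(LINT x:cell|lborel. F' x) = fcoeff (dderiv [v] f) n - \<i> * of_real (freq n \<bullet> v) * fcoeff f n"
 proof -
  have "continuous_on cell (\<lambda>x. dderiv [v] f x * ech (- n) x)" "continuous_on cell (\<lambda>x. f x * ech (- n) x)"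
   using smooth_continuous[OF sm(1), of cell] smooth_continuous[OF sm(2), of cell]
   by (auto intro!: continuous_on_mult continuous_ech)
  then show ?thesis
   unfolding F'_def fcoeff_def
   by (subst set_integral_diff) (auto intro!: set_integrable_cell_continuous continuous_on_mult_left)
 qed
 ultimately show ?thesis by simp
qed

lemma fcoeff_dderiv_list:
 assumes "f \<in> torus_test" "set vs \<subseteq> Basis"
 shows "fcoeff (dderiv vs f) n = ech_dfactor n vs * fcoeff f n"
 using assms(2)
proof (induction vs)
 case (Cons v vs)
 have "fcoeff (dderiv [v] (dderiv vs f)) n = \<i> * of_real (freq n \<bullet> v) * fcoeff (dderiv vs f) n"
  using Cons.prems by (intro fcoeff_dderiv torus_test_dderiv assms) auto
 then show ?case using Cons by (simp add: ech_dfactor_def mult_ac)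
qed (simp add: ech_dfactor_def)

lemma norm_fcoeff_le:
 assumes "\<And>x. x \<in> cell \<Longrightarrow> cmod (f x) \<le> K"
 shows "cmod (fcoeff f n) \<le> (2 * pi)\<^sup>2 * K"
proof -
 have "cmod (fcoeff f n) \<le> (\<integral>x. indicator cell x * K \<partial>lborel)"
  unfolding fcoeff_def set_lebesgue_integral_def
 proof (rule integral_norm_bound_AE)
  show "integrable lborel (\<lambda>x. indicator cell x * K)"
   by (intro integrable_mult_left integrable_real_indicator emeasure_cell) simp
  show "AE x in lborel. cmod (indicator cell x *\<^sub>R (f x * ech (- n) x)) \<le> indicator cell x * K"
  proof (rule AE_I2)
   show "cmod (indicator cell x *\<^sub>R (f x * ech (- n) x)) \<le> indicator cell x * K" for x
    using assms[of x] by (cases "x \<in> cell") (auto simp: norm_mult)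
  qed
 qed
 then show ?thesis by (simp add: measure_cell)
qed

text \<open>
 Integration by parts \<open>k\<close> times in the coordinate direction in which the frequency is largest.
\<close>

lemma fcoeff_decay:
 assumes f: "f \<in> torus_test"
  and K: "\<And>x. x \<in> cell \<Longrightarrow> cmod (f x) \<le> K" "\<And>x v. x \<in> cell \<Longrightarrow> v \<in> Basis \<Longrightarrow> cmod (dderiv (replicate k v) f x) \<le> K"
 shows "cmod (fcoeff f n) \<le> (2 * pi)\<^sup>2 * 3 ^ k * K / jbracket (freq n) ^ k"
proof -
 have K0: "0 \<le> K"
  using K(1)[of 0] norm_ge_zero[of "f 0"] by (simp add: cell_def zero_prod_def) (meson norm_ge_zero order_trans)
 have 1: "\<bar>freq n \<bullet> v\<bar> ^ k * cmod (fcoeff f n) \<le> (2 * pi)\<^sup>2 * K" if "v \<in> Basis" for v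
 proof -
  have "fcoeff (dderiv (replicate k v) f) n = ech_dfactor n (replicate k v) * fcoeff f n"
   by (rule fcoeff_dderiv_list[OF f]) (use that in auto)
  moreover have "cmod (ech_dfactor n (replicate k v)) = \<bar>freq n \<bullet> v\<bar> ^ k"
   by (simp add: ech_dfactor_def prod_list_replicate norm_power norm_mult)
  ultimately show ?thesis
   using norm_fcoeff_le[of "dderiv (replicate k v) f" K n] K(2) that by (simp add: norm_mult)
 qed
 have B: "(1, 0) \<in> (Basis :: (real \<times> real) set)" "(0, 1) \<in> (Basis :: (real \<times> real) set)"
  by (auto simp: Basis_prod_def)
 let ?x = "\<bar>real_of_int (fst n)\<bar>" and ?y = "\<bar>real_of_int (snd n)\<bar>"
 define m where "m = max 1 (max ?x ?y)"
 have "m ^ k * cmod (fcoeff f n) \<le> (2 * pi)\<^sup>2 * K"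
  using 1[OF B(1)] 1[OF B(2)] norm_fcoeff_le[of f K n, OF K(1)]
  by (auto simp: m_def max_def freq_def)
 moreover have "jbracket (freq n) \<le> 3 * m"
 proof (rule power2_le_imp_le)
  have "1 \<le> m" "?x \<le> m" "?y \<le> m" by (auto simp: m_def)
  then have "1\<^sup>2 \<le> m\<^sup>2" "?x\<^sup>2 \<le> m\<^sup>2" "?y\<^sup>2 \<le> m\<^sup>2" by (intro power_mono; simp)+
  then show "(jbracket (freq n))\<^sup>2 \<le> (3 * m)\<^sup>2" by (simp add: jbracket_freq_sq)
 qed (simp add: m_def)
 then have "jbracket (freq n) ^ k \<le> 3 ^ k * m ^ k"
  by (metis jbracket_nonneg power_mono power_mult_distrib)
 ultimately have "jbracket (freq n) ^ k * cmod (fcoeff f n) \<le> 3 ^ k * ((2 * pi)\<^sup>2 * K)"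
  by (smt (verit, best) mult.assoc mult_left_mono mult_right_mono norm_ge_zero zero_le_numeral zero_le_power)
 then show ?thesis by (simp add: field_simps)
qed

section \<open>Absolutely convergent Fourier series\<close>

lemma sum_jbracket_tail_le:
 assumes "finite S" "\<And>n j. n \<in> S \<Longrightarrow> n \<in> block j \<Longrightarrow> N \<le> j"
 shows "(\<Sum>n\<in>S. 1 / jbracket (freq n) ^ 4) \<le> 128 * (1/4) ^ N"
proof -
 have blk: "(\<Sum>n\<in>block j. 1 / jbracket (freq n) ^ 4) \<le> 64 * (1/4) ^ j" for j
 proof -
  have "(\<Sum>n\<in>block j. 1 / jbracket (freq n) ^ 4) \<le> (\<Sum>n\<in>block j. 1 / (2 ^ j / 2) ^ 4)"
   by (intro sum_mono divide_left_mono power_mono jbracket_block_ge mult_pos_pos zero_less_power) auto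
  also have "\<dots> = (sqrt (card (block j)))\<^sup>2 * (16 / (2 ^ j) ^ 4)"
   by (simp add: power_divide)
  also have "\<dots> \<le> (2 * 2 ^ j)\<^sup>2 * (16 / (2 ^ j) ^ 4)"
   by (intro mult_right_mono power_mono sqrt_card_block_le) auto
  also have "\<dots> = 64 * (1 / (2 ^ j)\<^sup>2)"
   by (simp add: power2_eq_square power4_eq_xxxx field_simps)
  also have "1 / (2 ^ j)\<^sup>2 = ((1/4) ^ j :: real)"
   by (simp add: power_divide flip: power_mult) (simp add: power_mult mult.commute[of j])
  finally show ?thesis .
 qed
 obtain M where M: "S \<subseteq> freq_box M" using finite_subset_box[OF assms(1)] by auto
 have sub: "S \<subseteq> (\<Union>j\<in>{N..M}. block j)"
 proof
  fix n assume n: "n \<in> S"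
  then obtain j where j: "j \<le> M" "n \<in> block j" using M UN_block[of M] by blast
  with assms(2)[OF n j(2)] show "n \<in> (\<Union>j\<in>{N..M}. block j)" by auto
 qed
 have "(\<Sum>n\<in>S. 1 / jbracket (freq n) ^ 4) \<le> (\<Sum>n\<in>(\<Union>j\<in>{N..M}. block j). 1 / jbracket (freq n) ^ 4)"
  using sub by (intro sum_mono2) auto
 also have "\<dots> = (\<Sum>j\<in>{N..M}. \<Sum>n\<in>block j. 1 / jbracket (freq n) ^ 4)"
  by (rule sum.UNION_disjoint) (use block_disjoint in auto)
 also have "\<dots> \<le> (\<Sum>j\<in>{N..M}. 64 * (1/4) ^ j)" by (intro sum_mono blk)
 also have "\<dots> = 64 * (\<Sum>j\<in>{N..M}. (1/4) ^ N * (1/4) ^ (j - N))"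
  unfolding sum_distrib_left by (intro sum.cong) (auto simp: mult.assoc simp flip: power_add)
 also have "\<dots> = 64 * (1/4) ^ N * (\<Sum>i\<in>(\<lambda>j. j - N) ` {N..M}. (1/4) ^ i)"
  by (subst sum.reindex) (auto simp: inj_on_def sum_distrib_left mult.assoc)
 also have "(\<Sum>i\<in>(\<lambda>j. j - N) ` {N..M}. (1/4 :: real) ^ i) \<le> (\<Sum>i. (1/4) ^ i)"
  by (intro sum_le_suminf summable_geometric) auto
 also have "(\<Sum>i. (1/4 :: real) ^ i) \<le> 2" by (subst suminf_geometric) auto
 finally show ?thesis by simp
qed

lemma block_not_in_box: "n \<notin> freq_box N \<Longrightarrow> n \<in> block j \<Longrightarrow> Suc N \<le> j"
 using block_subset_box[of j] freq_box_mono[of j N] by (meson not_less_eq_eq subsetD)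

definition fseries :: "(int \<times> int \<Rightarrow> complex) \<Rightarrow> real \<times> real \<Rightarrow> complex" where
 "fseries a x = lim (\<lambda>N. trig_sum (freq_box N) a x)"

lemma trig_sum_box_diff_le:
 assumes "\<And>n. cmod (a n) \<le> K / jbracket (freq n) ^ 4" "N \<le> M"
 shows "cmod (trig_sum (freq_box M) a x - trig_sum (freq_box N) a x) \<le> K * 128 * (1/4) ^ N"
proof -
 have K: "0 \<le> K" using order_trans[OF norm_ge_zero assms(1)[of 0]] by (simp add: jbracket_def)
 have "trig_sum (freq_box M) a x - trig_sum (freq_box N) a x = trig_sum (freq_box M - freq_box N) a x"
  unfolding trig_sum_def by (rule sum_diff[symmetric]) (use freq_box_mono[OF assms(2)] in auto)
 also have "cmod \<dots> \<le> (\<Sum>n\<in>freq_box M - freq_box N. K * (1 / jbracket (freq n) ^ 4))"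
  by (rule order_trans[OF norm_trig_sum_le]) (use assms(1) in \<open>auto intro!: sum_mono\<close>)
 also have "\<dots> = K * (\<Sum>n\<in>freq_box M - freq_box N. 1 / jbracket (freq n) ^ 4)"
  by (simp add: sum_distrib_left)
 also have "\<dots> \<le> K * (128 * (1/4) ^ Suc N)"
  by (intro mult_left_mono sum_jbracket_tail_le K block_not_in_box) auto
 also have "\<dots> \<le> K * 128 * (1/4) ^ N" using K by (simp add: mult_left_mono)
 finally show ?thesis .
qed

lemma geometric_tail_tendsto: "(\<lambda>N. K * 128 * (1/4 :: real) ^ N) \<longlonglongrightarrow> 0"
 using tendsto_mult_right_zero[OF LIMSEQ_power_zero[of "1/4 :: real"], of "K * 128"] by simp

lemma fseries_tendsto:
 assumes a: "\<And>n. cmod (a n) \<le> K / jbracket (freq n) ^ 4"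
 shows "(\<lambda>N. trig_sum (freq_box N) a x) \<longlonglongrightarrow> fseries a x"
proof -
 have "Cauchy (\<lambda>N. trig_sum (freq_box N) a x)"
 proof (rule metric_CauchyI)
  fix r :: real assume "0 < r"
  then obtain N where N: "K * 128 * (1/4) ^ N < r / 2"
   using order_tendstoD(2)[OF geometric_tail_tendsto[of K], of "r / 2"] by (auto simp: eventually_sequentially)
  have "dist (trig_sum (freq_box M) a x) (trig_sum (freq_box N) a x) < r / 2" if "N \<le> M" for M
   using trig_sum_box_diff_le[OF a that, of x] N by (simp add: dist_norm)
  then show "\<exists>M. \<forall>m\<ge>M. \<forall>n\<ge>M. dist (trig_sum (freq_box m) a x) (trig_sum (freq_box n) a x) < r"
   by (meson dist_triangle_half_l)
 qed
 then show ?thesis unfolding fseries_def by (simp add: Cauchy_convergent_iff convergent_LIMSEQ_iff)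
qed

lemma fseries_diff_le:
 assumes a: "\<And>n. cmod (a n) \<le> K / jbracket (freq n) ^ 4"
 shows "cmod (fseries a x - trig_sum (freq_box N) a x) \<le> K * 128 * (1/4) ^ N"
 by (rule LIMSEQ_le_const2[OF tendsto_norm[OF tendsto_diff[OF fseries_tendsto[OF a] tendsto_const]]])
  (intro exI[of _ N] allI impI trig_sum_box_diff_le[OF a])

lemma fseries_bounded:
 assumes a: "\<And>n. cmod (a n) \<le> K / jbracket (freq n) ^ 4"
 shows "cmod (fseries a x) \<le> K * 129" "cmod (trig_sum (freq_box N) a x) \<le> K * 129"
proof -
 have z: "freq_box 0 = {0}" by (auto simp: freq_box_def prod_eq_iff)
 have "cmod (trig_sum (freq_box 0) a x) \<le> K"
  using norm_trig_sum_le[of "freq_box 0" a x] a[of 0] by (simp add: z jbracket_def)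
 then show "cmod (fseries a x) \<le> K * 129" "cmod (trig_sum (freq_box N) a x) \<le> K * 129"
  using fseries_diff_le[OF a, of x 0] trig_sum_box_diff_le[OF a, of 0 N x]
   norm_triangle_sub[of "fseries a x" "trig_sum (freq_box 0) a x"]
   norm_triangle_sub[of "trig_sum (freq_box N) a x" "trig_sum (freq_box 0) a x"]
  by auto
qed

lemma continuous_fseries:
 assumes a: "\<And>n. cmod (a n) \<le> K / jbracket (freq n) ^ 4"
 shows "continuous_on S (fseries a)"
proof (rule uniform_limit_theorem[OF _ _ trivial_limit_sequentially])
 show "\<forall>\<^sub>F N in sequentially. continuous_on S (trig_sum (freq_box N) a)"
  by (intro always_eventually allI trig_sum_continuous)
 show "uniform_limit S (\<lambda>N. trig_sum (freq_box N) a) (fseries a) sequentially"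
 proof (rule uniform_limitI)
  fix r :: real assume "0 < r"
  then have "\<forall>\<^sub>F N in sequentially. K * 128 * (1/4) ^ N < r"
   by (intro order_tendstoD(2)[OF geometric_tail_tendsto])
  then show "\<forall>\<^sub>F N in sequentially. \<forall>x\<in>S. dist (trig_sum (freq_box N) a x) (fseries a x) < r"
  proof eventually_elim
   case (elim N)
   then show ?case using fseries_diff_le[OF a, of _ N] by (auto simp: dist_norm norm_minus_commute intro: le_less_trans)
  qed
 qed
qed

lemma fcoeff_trig_sum:
 fixes a :: "int \<times> int \<Rightarrow> complex"
 assumes "finite S"
 shows "fcoeff (trig_sum S a) n = (if n \<in> S then (2 * pi)\<^sup>2 * a n else 0)"
proof -
 have "fcoeff (trig_sum S a) n = (LINT x:cell|lborel. (\<Sum>m\<in>S. a m * (ech m x * ech (- n) x)))"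
  unfolding fcoeff_def trig_sum_def by (simp add: sum_distrib_right mult.assoc)
 also have "\<dots> = (\<Sum>m\<in>S. LINT x:cell|lborel. a m * (ech m x * ech (- n) x))"
  by (intro set_lebesgue_integral_sum set_integrable_cell_continuous continuous_intros)
 also have "\<dots> = (\<Sum>m\<in>S. a m * fcoeff (ech m) n)" by (simp add: fcoeff_def)
 also have "\<dots> = (\<Sum>m\<in>S. if m = n then (2 * pi)\<^sup>2 * a n else 0)"
  by (intro sum.cong refl) (simp add: fcoeff_ech)
 also have "\<dots> = (if n \<in> S then (2 * pi)\<^sup>2 * a n else 0)" using assms by (simp add: sum.delta)
 finally show ?thesis .
qed

lemma fcoeff_fseries:
 fixes a :: "int \<times> int \<Rightarrow> complex"
 assumes a: "\<And>n. cmod (a n) \<le> K / jbracket (freq n) ^ 4"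
 shows "fcoeff (fseries a) n = (2 * pi)\<^sup>2 * a n"
proof (rule LIMSEQ_unique)
 have K: "0 \<le> K" using order_trans[OF norm_ge_zero a[of 0]] by (simp add: jbracket_def)
 show "(\<lambda>N. fcoeff (trig_sum (freq_box N) a) n) \<longlonglongrightarrow> fcoeff (fseries a) n"
  unfolding fcoeff_def set_lebesgue_integral_def
 proof (rule integral_dominated_convergence)
  show "integrable lborel (\<lambda>x. indicator cell x * (K * 129) :: real)"
   by (intro integrable_mult_left integrable_real_indicator emeasure_cell) simp
  show "(\<lambda>x. indicator cell x *\<^sub>R (fseries a x * ech (- n) x)) \<in> borel_measurable lborel"
   using borel_measurable_continuous_onI[OF continuous_fseries[OF a, of UNIV]] by simp
  show "AE x in lborel. (\<lambda>N. indicator cell x *\<^sub>R (trig_sum (freq_box N) a x * ech (- n) x))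
    \<longlonglongrightarrow> indicator cell x *\<^sub>R (fseries a x * ech (- n) x)"
   by (intro AE_I2 tendsto_intros fseries_tendsto[OF a])
  show "AE x in lborel. norm (indicator cell x *\<^sub>R (trig_sum (freq_box N) a x * ech (- n) x)) \<le> indicator cell x * (K * 129)" for N
   using fseries_bounded(2)[OF a] by (intro AE_I2) (auto simp: norm_mult indicator_def)
 qed simp
 obtain N0 where "{n} \<subseteq> freq_box N0" using finite_subset_box[of "{n}"] by auto
 then have "fcoeff (trig_sum (freq_box N) a) n = (2 * pi)\<^sup>2 * a n" if "N0 \<le> N" for N
 proof -
  assume "{n} \<subseteq> freq_box N0"
  then have "n \<in> freq_box N" using freq_box_mono[OF that] by blast
  then show ?thesis by (simp add: fcoeff_trig_sum)
 qed
 then show "(\<lambda>N. fcoeff (trig_sum (freq_box N) a) n) \<longlonglongrightarrow> (2 * pi)\<^sup>2 * a n"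
  by (intro tendsto_eventually eventually_sequentiallyI[of N0])
qed

lemma continuous_eq_of_fcoeff_eq:
 assumes c: "continuous_on cell f" "continuous_on cell g" and eq: "\<And>n. fcoeff f n = fcoeff g n" and x: "x \<in> cell"
 shows "f x = g x"
proof -
 let ?d = "\<lambda>x. f x - g x"
 have cd: "continuous_on cell ?d" using c by (intro continuous_intros)
 have "fcoeff ?d n = 0" for n
 proof -
  have "fcoeff ?d n = fcoeff f n - fcoeff g n"
   unfolding fcoeff_def using c
   by (subst set_integral_diff(2)[symmetric])
    (auto intro!: set_integrable_cell_continuous continuous_intros simp: left_diff_distrib)
  then show ?thesis by (simp add: eq)
 qed
 then have "(LINT x:cell|lborel. (cmod (?d x))\<^sup>2) \<le> (0 / (2 * pi))\<^sup>2"
  by (intro cell_l2_of_fcoeff_l2(2) set_integrable_cell_continuous cd) (simp add: L2_set_def)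
 then have le: "(\<integral>x. indicator cell x *\<^sub>R (cmod (?d x))\<^sup>2 \<partial>lborel) \<le> 0" by (simp add: set_lebesgue_integral_def)
 have int: "integrable lborel (\<lambda>x. indicator cell x *\<^sub>R (cmod (?d x))\<^sup>2)"
  using set_integrable_cell_continuous[of "\<lambda>x. (cmod (?d x))\<^sup>2"] cd
  by (simp add: set_integrable_def continuous_on_norm continuous_on_power)
 have "(\<integral>x. indicator cell x *\<^sub>R (cmod (?d x))\<^sup>2 \<partial>lborel) = 0"
  using le by (intro antisym Bochner_Integration.integral_nonneg) auto
 then have ae: "AE x in lborel. indicator cell x *\<^sub>R (cmod (?d x))\<^sup>2 = 0"
  by (subst (asm) integral_nonneg_eq_0_iff_AE[OF int]) auto
 define U where "U = box (- pi, - pi) (pi, pi :: real) \<inter> {x. ?d x \<noteq> 0}"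
 have Uc: "box (- pi, - pi) (pi, pi :: real) \<subseteq> cell" unfolding cell_cbox by (rule box_subset_cbox)
 have "open U"
 proof -
  have "open (box (- pi, - pi) (pi, pi :: real) \<inter> ?d -` (- {0}))"
   by (rule continuous_open_preimage) (use cd Uc continuous_on_subset in auto)
  then show ?thesis by (simp add: U_def vimage_def)
 qed
 moreover have "negligible U"
 proof -
  have "AE x in lborel. x \<notin> U" using ae
  proof eventually_elim
   case (elim x)
   then show ?case using Uc by (auto simp: U_def indicator_def)
  qed
  then have "U \<in> null_sets lborel"
   using \<open>open U\<close> by (subst (asm) AE_iff_null_sets[symmetric]) auto
  then show ?thesis by (simp add: negligible_iff_null_sets null_sets_completionI)
 qed
 ultimately have "U = {}" using open_not_negligible by blast
 then have z: "?d y = 0" if "y \<in> box (- pi, - pi) (pi, pi)" for y using that by (auto simp: U_def)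
 have "(0, 0) \<in> box (- pi, - pi) (pi, pi :: real)" by (simp add: box_def Basis_prod_def)
 then have cl: "closure (box (- pi, - pi) (pi, pi :: real)) = cell"
  unfolding cell_cbox by (intro closure_box) auto
 have "?d x = 0"
  by (rule continuous_constant_on_closure[of "box (- pi, - pi) (pi, pi)" ?d]) (use cl cd z x in auto)
 then show ?thesis by simp
qed

lemma periodic_shift_int:
 assumes "periodic f"
 shows "f (x + 2 * pi * of_int k, y + 2 * pi * of_int l) = f (x, y)"
proof -
 have 1: "f (x + 2 * pi * real k, y) = f (x, y)" "f (x, y + 2 * pi * real k) = f (x, y)" for x y and k :: nat
 proof (induction k)
  case (Suc k)
  { case 1
   have "x + 2 * pi * real (Suc k) = (x + 2 * pi * real k) + 2 * pi" by (simp add: algebra_simps)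
   then show ?case using assms Suc(1) unfolding periodic_def by metis
  next
   case 2
   have "y + 2 * pi * real (Suc k) = (y + 2 * pi * real k) + 2 * pi" by (simp add: algebra_simps)
   then show ?case using assms Suc(2) unfolding periodic_def by metis }
 qed simp_all
 have 2: "f (x + 2 * pi * of_int k, y) = f (x, y)" "f (x, y + 2 * pi * of_int k) = f (x, y)" for x y and k :: int
  using 1(1)[of x "nat k" y] 1(1)[of "x + 2 * pi * of_int k" "nat (- k)" y]
   1(2)[of x y "nat k"] 1(2)[of x "y + 2 * pi * of_int k" "nat (- k)"]
  by (cases "0 \<le> k"; simp)+
 show ?thesis by (simp add: 2)
qed

lemma ex_shift_into_cell: "\<exists>k l. (x + 2 * pi * of_int k, y + 2 * pi * of_int l) \<in> cell"
proof -
 have "\<exists>k. x + 2 * pi * of_int k \<in> {- pi..pi}" for x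
 proof -
  let ?k = "- \<lfloor>(x + pi) / (2 * pi)\<rfloor>"
  have "\<lfloor>(x + pi) / (2 * pi)\<rfloor> \<le> (x + pi) / (2 * pi)" "(x + pi) / (2 * pi) \<le> \<lfloor>(x + pi) / (2 * pi)\<rfloor> + 1"
   by linarith+
  then have "\<lfloor>(x + pi) / (2 * pi)\<rfloor> * (2 * pi) \<le> x + pi" "x + pi \<le> (\<lfloor>(x + pi) / (2 * pi)\<rfloor> + 1) * (2 * pi)"
   by (simp_all only: pos_le_divide_eq pos_divide_le_eq mult_pos_pos zero_less_numeral pi_gt_zero)
  then show ?thesis by (intro exI[of _ ?k]) (simp add: algebra_simps)
 qed
 then show ?thesis unfolding cell_def by auto
qed

lemma periodic_eqI:
 assumes "periodic f" "periodic g" "\<And>x. x \<in> cell \<Longrightarrow> f x = g x"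
 shows "f x = g x"
proof (cases x)
 case (Pair a b)
 obtain k l where "(a + 2 * pi * of_int k, b + 2 * pi * of_int l) \<in> cell" using ex_shift_into_cell by blast
 with assms(3) show ?thesis
  using periodic_shift_int[OF assms(1), of a k b l] periodic_shift_int[OF assms(2), of a k b l] Pair by metis
qed

lemma periodic_fseries:
 assumes a: "\<And>n. cmod (a n) \<le> K / jbracket (freq n) ^ 4"
 shows "periodic (fseries a)"
proof -
 have "periodic (trig_sum (freq_box N) a)" for N
  using torus_test_trig_sum[of "freq_box N" a] by (simp add: torus_test_def)
 then show ?thesis unfolding fseries_def[abs_def] periodic_def by simp
qed

text \<open>With this normalisation a function is \<open>\<Sum> ncoeff f n * ech n\<close>, without a further factor.\<close>

definition ncoeff :: "(real \<times> real \<Rightarrow> complex) \<Rightarrow> int \<times> int \<Rightarrow> complex" where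
 "ncoeff f n = fcoeff f n / (2 * pi)\<^sup>2"

lemma fcoeff_rapid_decay:
 assumes f: "f \<in> torus_test"
 shows "\<exists>K\<ge>0. \<forall>n. cmod (fcoeff f n) \<le> K / jbracket (freq n) ^ k"
proof -
 have bdd: "\<exists>K\<ge>0. \<forall>x\<in>cell. cmod (dderiv vs f x) \<le> K" for vs
 proof -
  have "continuous_on cell (dderiv vs f)"
   using f by (intro smooth_continuous smooth_dderiv) (simp add: torus_test_def)
  then have "bounded (dderiv vs f ` cell)" by (intro compact_imp_bounded compact_continuous_image compact_cell)
  then show ?thesis unfolding bounded_pos by (metis imageI less_imp_le)
 qed
 obtain K0 where K0: "K0 \<ge> 0" "\<And>x. x \<in> cell \<Longrightarrow> cmod (f x) \<le> K0" using bdd[of "[]"] by auto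
 obtain K1 where K1: "K1 \<ge> 0" "\<And>x. x \<in> cell \<Longrightarrow> cmod (dderiv (replicate k (1, 0)) f x) \<le> K1" using bdd by metis
 obtain K2 where K2: "K2 \<ge> 0" "\<And>x. x \<in> cell \<Longrightarrow> cmod (dderiv (replicate k (0, 1)) f x) \<le> K2" using bdd by metis
 define K where "K = K0 + K1 + K2"
 have "cmod (fcoeff f n) \<le> (2 * pi)\<^sup>2 * 3 ^ k * K / jbracket (freq n) ^ k" for n
 proof (rule fcoeff_decay[OF f])
  show "cmod (f x) \<le> K" if "x \<in> cell" for x using K0(2)[OF that] K1(1) K2(1) by (simp add: K_def)
  show "cmod (dderiv (replicate k v) f x) \<le> K" if "x \<in> cell" and v: "v \<in> Basis" for x v
  proof -
   consider "v = (1, 0)" | "v = (0, 1)" using v by (auto simp: Basis_prod_def)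
   then show ?thesis
    by cases (use K1(2)[OF that(1)] K2(2)[OF that(1)] K0(1) K1(1) K2(1) in \<open>auto simp: K_def\<close>)
  qed
 qed
 moreover have "0 \<le> (2 * pi)\<^sup>2 * 3 ^ k * K" using K0(1) K1(1) K2(1) by (simp add: K_def)
 ultimately show ?thesis by blast
qed

lemma ncoeff_rapid_decay:
 assumes f: "f \<in> torus_test"
 shows "\<exists>K\<ge>0. \<forall>n. cmod (ncoeff f n) \<le> K / jbracket (freq n) ^ k"
proof -
 obtain K where "K \<ge> 0" "\<And>n. cmod (fcoeff f n) \<le> K / jbracket (freq n) ^ k"
  using fcoeff_rapid_decay[OF f] by blast
 then show ?thesis
  by (intro exI[of _ "K / (2 * pi)\<^sup>2"]) (auto simp: ncoeff_def norm_divide norm_power field_simps)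
qed

lemma torus_test_fseries:
 assumes f: "f \<in> torus_test"
 shows "f x = fseries (ncoeff f) x"
proof (rule periodic_eqI)
 obtain K where K: "cmod (ncoeff f n) \<le> K / jbracket (freq n) ^ 4" for n
  using ncoeff_rapid_decay[OF f] by blast
 show "periodic f" using f by (simp add: torus_test_def)
 show "periodic (fseries (ncoeff f))" by (rule periodic_fseries[OF K])
 show "f x = fseries (ncoeff f) x" if "x \<in> cell" for x
 proof (rule continuous_eq_of_fcoeff_eq[OF _ _ _ that])
  show "continuous_on cell f" using f by (intro smooth_continuous) (simp add: torus_test_def)
  show "continuous_on cell (fseries (ncoeff f))" by (rule continuous_fseries[OF K])
  show "fcoeff f n = fcoeff (fseries (ncoeff f)) n" for n by (simp add: fcoeff_fseries[OF K] ncoeff_def)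
 qed
qed

text \<open>The Fourier series of a test function converges together with all derivatives.\<close>

lemma torus_test_remainder:
 assumes f: "f \<in> torus_test"
 shows "\<exists>K. \<forall>N vs x. set vs \<subseteq> Basis \<and> length vs \<le> L \<longrightarrow>
   cmod (dderiv vs (\<lambda>x. 1 * f x + (- 1) * trig_sum (freq_box N) (ncoeff f) x) x) \<le> K * (1/4) ^ N"
proof -
 obtain K where K: "K \<ge> 0" "cmod (ncoeff f n) \<le> K / jbracket (freq n) ^ (L + 4)" for n
  using ncoeff_rapid_decay[OF f] by blast
 show ?thesis
 proof (intro exI[of _ "K * 128"] allI impI; elim conjE)
  fix N and vs :: "(real \<times> real) list" and x assume vs: "set vs \<subseteq> Basis" "length vs \<le> L"
  let ?a = "\<lambda>n. ncoeff f n * ech_dfactor n vs"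
  have a: "cmod (?a n) \<le> K / jbracket (freq n) ^ 4" for n
  proof -
   have "cmod (ech_dfactor n vs) \<le> jbracket (freq n) ^ L"
    using norm_ech_dfactor_le[OF vs(1), of n] power_increasing[OF vs(2) jbracket_ge_one, of "freq n"] by linarith
   then have "cmod (?a n) \<le> (K / jbracket (freq n) ^ (L + 4)) * jbracket (freq n) ^ L"
    unfolding norm_mult using K by (intro mult_mono) auto
   then show ?thesis by (simp add: power_add)
  qed
  have "dderiv vs f x = fseries ?a x"
  proof -
   have "dderiv vs f x = fseries (ncoeff (dderiv vs f)) x" by (rule torus_test_fseries[OF torus_test_dderiv[OF f]])
   also have "ncoeff (dderiv vs f) = ?a" by (simp add: fun_eq_iff ncoeff_def fcoeff_dderiv_list[OF f vs(1)])
   finally show ?thesis .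
  qed
  moreover have "dderiv vs (\<lambda>x. 1 * f x + (- 1) * trig_sum (freq_box N) (ncoeff f) x) x =
    dderiv vs f x - trig_sum (freq_box N) ?a x"
   using f torus_test_trig_sum[of "freq_box N" "ncoeff f"]
   by (subst dderiv_linear) (auto simp: torus_test_def dderiv_trig_sum)
  ultimately show "cmod (dderiv vs (\<lambda>x. 1 * f x + (- 1) * trig_sum (freq_box N) (ncoeff f) x) x) \<le> K * 128 * (1/4) ^ N"
   using fseries_diff_le[OF a, of x N] by simp
 qed
qed

section \<open>Distributions on the torus\<close>

lemma torus_distribution_linear:
 assumes "torus_distribution u" "f \<in> torus_test" "g \<in> torus_test"
 shows "u (\<lambda>x. a * f x + b * g x) = a * u f + b * u g"
 using assms unfolding torus_distribution_def by blast

lemma torus_distribution_sum: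
 assumes u: "torus_distribution u" and S: "finite S"
 shows "u (\<lambda>y. \<Sum>n\<in>S. c n * ech (h n) y) = (\<Sum>n\<in>S. c n * u (ech (h n))) \<and> (\<lambda>y. \<Sum>n\<in>S. c n * ech (h n) y) \<in> torus_test"
 using S
proof (induction S rule: finite_induct)
 case empty
 have "u (\<lambda>x. 0 * ech 0 x + 0 * ech 0 x) = 0 * u (ech 0) + 0 * u (ech 0)"
  using ech_torus_test[of 1 0] by (intro torus_distribution_linear[OF u]) simp_all
 moreover have "(\<lambda>y. 0) \<in> torus_test" using ech_torus_test[of 0 0] by simp
 ultimately show ?case by simp
next
 case (insert n S)
 have e: "ech (h n) \<in> torus_test" using ech_torus_test[of 1 "h n"] by simp
 have eq: "(\<lambda>y. \<Sum>n\<in>insert n S. c n * ech (h n) y) = (\<lambda>y. c n * ech (h n) y + 1 * (\<Sum>n\<in>S. c n * ech (h n) y))"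
  using insert.hyps by (simp add: fun_eq_iff)
 show ?case unfolding eq
  using torus_distribution_linear[OF u e, of "\<lambda>y. \<Sum>n\<in>S. c n * ech (h n) y" "c n" 1]
   torus_test_linear[OF e, of "\<lambda>y. \<Sum>n\<in>S. c n * ech (h n) y" "c n" 1] insert
  by simp
qed

lemma torus_coeff_eq: "torus_coeff u n = u (ech (- n)) / (2 * pi)\<^sup>2"
proof -
 have "(\<lambda>x. cis (- (freq n \<bullet> x))) = ech (- n)" by (simp add: fun_eq_iff ech_def freq_uminus)
 then show ?thesis by (simp add: torus_coeff_def)
qed

text \<open>
 The Fourier series of the translated mollifier converges in the test space, so the distribution can be
 applied term by term.
\<close>

lemma mollify_tendsto:
 assumes u: "torus_distribution (u t)" and r: "r \<in> torus_test"
 shows "(\<lambda>N. trig_sum (freq_box N) (\<lambda>n. fcoeff r n * torus_coeff (u t) n) x) \<longlonglongrightarrow> mollify r u (t, x)"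
proof -
 obtain C L where H: "\<forall>f\<in>torus_test. \<forall>K. (\<forall>vs x. set vs \<subseteq> Basis \<and> length vs \<le> L \<longrightarrow> cmod (dderiv vs f x) \<le> K) \<longrightarrow> cmod (u t f) \<le> C * K"
  using u unfolding torus_distribution_def by blast
 have CN: "cmod (u t f) \<le> C * K" if "f \<in> torus_test" "\<And>vs x. set vs \<subseteq> Basis \<Longrightarrow> length vs \<le> L \<Longrightarrow> cmod (dderiv vs f x) \<le> K" for f K
  using H that by blast
 obtain K where K: "\<And>N vs x. set vs \<subseteq> Basis \<Longrightarrow> length vs \<le> L \<Longrightarrow>
   cmod (dderiv vs (\<lambda>x. 1 * r x + (- 1) * trig_sum (freq_box N) (ncoeff r) x) x) \<le> K * (1/4) ^ N"
  using torus_test_remainder[OF r] by blast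
 have d: "cmod (mollify r u (t, x) - trig_sum (freq_box N) (\<lambda>n. fcoeff r n * torus_coeff (u t) n) x) \<le> C * (K * (1/4) ^ N)" for N
 proof -
  define R where "R = (\<lambda>x. 1 * r x + (- 1) * trig_sum (freq_box N) (ncoeff r) x)"
  have R: "R \<in> torus_test" unfolding R_def by (intro torus_test_linear r torus_test_trig_sum) simp
  define S where "S y = (\<Sum>n\<in>freq_box N. (ncoeff r n * ech n x) * ech (- n) y)" for y
  have S: "u t S = (\<Sum>n\<in>freq_box N. (ncoeff r n * ech n x) * u t (ech (- n)))" "S \<in> torus_test"
   using torus_distribution_sum[OF u finite_freq_box[of N], of "\<lambda>n. ncoeff r n * ech n x" uminus] unfolding S_def[abs_def] by auto
  have "ech n (x - y) = ech n x * ech (- n) y" for n y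
   by (simp add: ech_def cis_mult inner_diff_right freq_uminus)
  then have "trig_sum (freq_box N) (ncoeff r) (x - y) = S y" for y
   unfolding trig_sum_def S_def by (simp only: mult.assoc)
  then have "R (x - y) = 1 * r (x - y) + (- 1) * S y" for y
   unfolding R_def by metis
  then have eqR: "(\<lambda>y. R (x - y)) = (\<lambda>y. 1 * r (x - y) + (- 1) * S y)" by (rule ext)
  have "u t (\<lambda>y. R (x - y)) = 1 * u t (\<lambda>y. r (x - y)) + (- 1) * u t S"
   unfolding eqR by (rule torus_distribution_linear[OF u torus_test_reflect[OF r] S(2)])
  also have "\<dots> = mollify r u (t, x) - u t S" by (simp add: mollify_def)
  also have "u t S = trig_sum (freq_box N) (\<lambda>n. fcoeff r n * torus_coeff (u t) n) x"
   unfolding S trig_sum_def by (intro sum.cong refl) (simp add: ncoeff_def torus_coeff_eq)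
  finally have eq: "u t (\<lambda>y. R (x - y)) = mollify r u (t, x) - trig_sum (freq_box N) (\<lambda>n. fcoeff r n * torus_coeff (u t) n) x" .
  have "cmod (u t (\<lambda>y. R (x - y))) \<le> C * (K * (1/4) ^ N)"
  proof (rule CN[OF torus_test_reflect[OF R]])
   have "smooth R" using R by (simp add: torus_test_def)
   then show "cmod (dderiv vs (\<lambda>y. R (x - y)) y) \<le> K * (1/4) ^ N" if "set vs \<subseteq> Basis" "length vs \<le> L" for vs y
    using K[OF that, of N "x - y"] unfolding R_def[symmetric] by (simp add: dderiv_reflect norm_mult norm_power)
  qed
  then show ?thesis by (simp add: eq)
 qed
 have "(\<lambda>N. C * (K * (1/4 :: real) ^ N)) \<longlonglongrightarrow> 0"
  by (intro tendsto_mult_right_zero LIMSEQ_power_zero) simp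
 from Lim_null_comparison[OF always_eventually[OF allI[OF d]] this]
 have "(\<lambda>N. mollify r u (t, x) - trig_sum (freq_box N) (\<lambda>n. fcoeff r n * torus_coeff (u t) n) x) \<longlonglongrightarrow> 0" .
 from tendsto_diff[OF tendsto_const[of "mollify r u (t, x)"] this] show ?thesis by simp
qed

lemma mollify_eq_fseries:
 assumes "torus_distribution (u t)" "r \<in> torus_test"
 shows "mollify r u (t, x) = fseries (\<lambda>n. fcoeff r n * torus_coeff (u t) n) x"
 unfolding fseries_def using mollify_tendsto[of u t, OF assms] by (rule limI[symmetric])

lemma blockbdd_scale: "blockbdd A a \<Longrightarrow> blockbdd (cmod c * A) (\<lambda>n. c * a n)"
 unfolding blockbdd_def by (simp add: tri_cmult norm_mult mult.assoc mult_left_mono)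

lemma blockbdd_norm_le:
 assumes a: "blockbdd A a"
 shows "cmod (a n) \<le> A"
proof -
 obtain j where j: "- n \<in> block j" using ex_block by blast
 let ?d = "\<lambda>m. if m = - n then 1 else 0 :: complex" and ?e = "\<lambda>m. if m = 0 then 1 else 0 :: complex"
 have z: "block 0 = {0}" by (auto simp: freq_box_def prod_eq_iff)
 have "tri a (block j) (block 0) (block 0) ?d ?e ?e = a n"
  using j unfolding tri_def z by (simp add: if_distrib[of "\<lambda>x. x * _"] sum.delta cong: if_cong)
 moreover have "l2 (block j) ?d = 1" "l2 (block 0) ?e = 1"
  using j unfolding L2_set_def z by (simp_all add: if_distrib[of "\<lambda>x. x\<^sup>2"] if_distrib[of cmod] sum.delta cong: if_cong)
 ultimately show ?thesis using blockbddD[OF a, of j 0 0 ?d ?e ?e] by simp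
qed

text \<open>The coefficients of \<open>(1 - \<Delta>)\<^sup>-\<^sup>s\<^sup>/\<^sup>2 u\<close>.\<close>

definition bessel_coeff :: "real \<Rightarrow> ((real \<times> real \<Rightarrow> complex) \<Rightarrow> complex) \<Rightarrow> int \<times> int \<Rightarrow> complex" where
 "bessel_coeff s u n = of_real (jbracket (freq n) powr (- s)) * torus_coeff u n"

lemma torus_coeff_eq_bessel_mult: "torus_coeff u = bessel_mult s (bessel_coeff s u)"
proof
 fix n
 have "jbracket (freq n) powr s * jbracket (freq n) powr - s = 1" by (simp flip: powr_add)
 then show "torus_coeff u n = bessel_mult s (bessel_coeff s u) n"
  by (simp add: bessel_mult_def bessel_coeff_def mult.assoc[symmetric] flip: of_real_mult)
qed

lemma blockbdd_bessel_coeff: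
 assumes W: "Winf_norm (- s) u \<le> ennreal U" and U: "0 \<le> U"
 shows "blockbdd (2 * U) (bessel_coeff s u)"
proof -
 have step: "blockbdd (2 * (U + e)) (bessel_coeff s u)" if e: "0 < e" for e
 proof -
  have "Winf_norm (- s) u < ennreal (U + e)"
   using W e U by (intro le_less_trans[OF W]) (simp add: ennreal_lessI)
  then obtain g where g: "is_bessel_pot (- s) u g"
   and sup: "esssup (restrict_space lborel cell) (\<lambda>x. ennreal (cmod (g x))) < ennreal (U + e)"
   unfolding Winf_norm_def by (auto simp: INF_less_iff)
  have "AE x in restrict_space lborel cell. ennreal (cmod (g x)) \<le> esssup (restrict_space lborel cell) (\<lambda>x. ennreal (cmod (g x)))"
   by (rule esssup_AE)
  then have "AE x in restrict_space lborel cell. cmod (g x) \<le> U + e"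
  proof eventually_elim
   case (elim x)
   then have "ennreal (cmod (g x)) \<le> ennreal (U + e)" using sup by (auto intro: order_trans less_imp_le)
   then show ?case using U e by (subst (asm) ennreal_le_iff) auto
  qed
  then have ae: "AE x in lborel. x \<in> cell \<longrightarrow> cmod (g x) \<le> U + e"
   by (subst (asm) AE_restrict_space_iff) auto
  have gi: "set_integrable lborel cell g" using g by (simp add: is_bessel_pot_def)
  have e1: "cmod (complex_of_real (1 / (2 * pi)\<^sup>2)) * (8 * pi\<^sup>2 * (U + e)) = 2 * (U + e)"
   unfolding norm_of_real by (simp add: power2_eq_square)
  from blockbdd_scale[OF blockbdd_fcoeff[OF gi ae], of "complex_of_real (1 / (2 * pi)\<^sup>2)"]
  have "blockbdd (2 * (U + e)) (\<lambda>n. complex_of_real (1 / (2 * pi)\<^sup>2) * fcoeff g n)"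
   unfolding e1 .
  moreover have "complex_of_real (1 / (2 * pi)\<^sup>2) * fcoeff g n = bessel_coeff s u n" for n
  proof -
   have "torus_coeff (torus_dist_of g) n = fcoeff g n / (2 * pi)\<^sup>2"
    by (simp add: torus_coeff_eq torus_dist_of_def fcoeff_def)
   moreover have "torus_coeff (torus_dist_of g) n = of_real (jbracket (freq n) powr (- s)) * torus_coeff u n"
    using g unfolding is_bessel_pot_def by blast
   ultimately show ?thesis by (simp add: bessel_coeff_def)
  qed
  ultimately show ?thesis by simp
 qed
 show ?thesis
  unfolding blockbdd_def
 proof (intro allI, rule field_le_epsilon)
  fix i j k v w g and e :: real assume "0 < e"
  define P where "P = 2 ^ min i (min j k) * (l2 (block i) v * l2 (block j) w * l2 (block k) g)"
  have P: "0 \<le> P" by (simp add: P_def L2_set_nonneg)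
  define d where "d = e / (2 * (P + 1))"
  have "0 < 2 * (P + 1)" using P by simp
  then have d: "0 < d" unfolding d_def by (rule divide_pos_pos[OF \<open>0 < e\<close>])
  have "2 * d * P \<le> 2 * d * (P + 1)" using d by (intro mult_left_mono) auto
  also have "\<dots> = e"
  proof -
   have "2 * (e / (2 * p)) * p = e" if "0 < p" for p :: real using that by simp
   from this[of "P + 1"] show ?thesis using P by (simp add: d_def)
  qed
  finally have "2 * d * P \<le> e" .
  with blockbddD[OF step[OF d], of i j k v w g]
  show "cmod (tri (bessel_coeff s u) (block i) (block j) (block k) v w g) \<le>
    2 * U * 2 ^ min i (min j k) * (l2 (block i) v * l2 (block j) w * l2 (block k) g) + e"
   unfolding mult.assoc[of _ "2 ^ _"] P_def[symmetric] by (simp add: algebra_simps)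
 qed
qed

text \<open>
 Near the origin the character is close to one; away from it the mollifier has small mass.
\<close>

lemma approx_identity_fcoeff:
 assumes "approx_identity r"
 shows "(\<lambda>k. fcoeff (r k) n) \<longlonglongrightarrow> 1"
proof (rule metric_LIMSEQ_I)
 fix e :: real assume e: "0 < e"
 have rt: "r k \<in> torus_test" and one: "(LINT x:cell|lborel. r k x) = 1" for k
  using assms by (auto simp: approx_identity_def)
 obtain C where C: "\<And>k. (LINT x:cell|lborel. cmod (r k x)) \<le> C" using assms by (auto simp: approx_identity_def)
 have rc: "continuous_on S (r k)" for k S using rt[of k] by (intro smooth_continuous) (simp add: torus_test_def)
 have C0: "0 \<le> C" by (rule order_trans[OF _ C[of 0]]) (auto simp: set_lebesgue_integral_def intro!: Bochner_Integration.integral_nonneg)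
 define F where "F = norm (freq n)"
 define d where "d = e / (2 * (F + 1) * (C + 1))"
 have F: "0 \<le> F" by (simp add: F_def)
 have d: "0 < d" using e C0 F by (simp add: d_def)
 let ?A = "{x \<in> cell. d \<le> norm x}"
 have A: "?A \<in> sets borel" by measurable
 have ech1: "cmod (ech (- n) x - 1) \<le> min 2 (F * norm x)" for x
 proof -
  have "cmod (ech (- n) x - 1) \<le> min 2 \<bar>freq (- n) \<bullet> x\<bar>"
   using cmod_one_minus_cis_le[of "freq (- n) \<bullet> x"] by (simp add: ech_def norm_minus_commute)
  also have "\<bar>freq (- n) \<bullet> x\<bar> \<le> F * norm x" unfolding F_def freq_uminus using Cauchy_Schwarz_ineq2[of "- freq n" x] by simp
  finally show ?thesis by (simp add: min.mono)
 qed
 have bd: "dist (fcoeff (r k) n) 1 \<le> 2 * (LINT x:?A|lborel. cmod (r k x)) + F * d * C" for k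
 proof -
  have ri: "set_integrable lborel cell (\<lambda>x. cmod (r k x))" by (intro set_integrable_cell_continuous continuous_intros rc)
  have rA: "set_integrable lborel ?A (\<lambda>x. cmod (r k x))" by (rule set_integrable_subset[OF ri]) (use A in auto)
  have "fcoeff (r k) n - 1 = (LINT x:cell|lborel. r k x * ech (- n) x - r k x)"
   unfolding fcoeff_def one[of k, symmetric]
   by (subst set_integral_diff) (auto intro!: set_integrable_cell_continuous continuous_on_mult continuous_ech rc)
  also have "cmod \<dots> \<le> (\<integral>x. 2 * (indicator ?A x *\<^sub>R cmod (r k x)) + F * d * (indicator cell x *\<^sub>R cmod (r k x)) \<partial>lborel)"
   unfolding set_lebesgue_integral_def
  proof (rule integral_norm_bound_AE)
   show "integrable lborel (\<lambda>x. 2 * (indicator ?A x *\<^sub>R cmod (r k x)) + F * d * (indicator cell x *\<^sub>R cmod (r k x)))"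
    using ri rA unfolding set_integrable_def by (intro Bochner_Integration.integrable_add integrable_mult_right)
   show "AE x in lborel. norm (indicator cell x *\<^sub>R (r k x * ech (- n) x - r k x)) \<le>
     2 * (indicator ?A x *\<^sub>R cmod (r k x)) + F * d * (indicator cell x *\<^sub>R cmod (r k x))"
   proof (rule AE_I2)
    fix x :: "real \<times> real"
    have eq: "r k x * ech (- n) x - r k x = (ech (- n) x - 1) * r k x" by (simp add: algebra_simps)
    show "norm (indicator cell x *\<^sub>R (r k x * ech (- n) x - r k x)) \<le>
     2 * (indicator ?A x *\<^sub>R cmod (r k x)) + F * d * (indicator cell x *\<^sub>R cmod (r k x))"
    proof (cases "x \<in> cell")
     case True
     show ?thesis
     proof (cases "d \<le> norm x")
      case far: True
      have "cmod (ech (- n) x - 1) * cmod (r k x) \<le> 2 * cmod (r k x)"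
       using ech1[of x] by (intro mult_right_mono) auto
      moreover have "0 \<le> F * d * cmod (r k x)" using F d by simp
      ultimately show ?thesis using True far unfolding eq by (simp add: norm_mult)
     next
      case near: False
      have "cmod (ech (- n) x - 1) \<le> F * d" using ech1[of x] near mult_left_mono[OF _ F, of "norm x" d] by linarith
      then have "cmod (ech (- n) x - 1) * cmod (r k x) \<le> F * d * cmod (r k x)" by (intro mult_right_mono) auto
      then show ?thesis using True near unfolding eq by (simp add: norm_mult)
     qed
    qed simp
   qed
  qed
  also have "\<dots> = 2 * (LINT x:?A|lborel. cmod (r k x)) + F * d * (LINT x:cell|lborel. cmod (r k x))"
   using ri rA unfolding set_integrable_def set_lebesgue_integral_def
   by (subst Bochner_Integration.integral_add) (auto intro!: integrable_mult_right)
  also have "\<dots> \<le> 2 * (LINT x:?A|lborel. cmod (r k x)) + F * d * C"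
   using F d C[of k] by (intro add_left_mono mult_left_mono) auto
  finally show ?thesis by (simp add: dist_norm)
 qed
 have "F * d * C \<le> e / 2"
 proof -
  have "F * d * C \<le> (F + 1) * d * (C + 1)" using F C0 d by (intro mult_mono) auto
  also have "\<dots> = e / 2"
  proof -
   have "p * (e / (2 * p * q)) * q = e / 2" if "p \<noteq> 0" "q \<noteq> 0" for p q :: real using that by simp
   from this[of "F + 1" "C + 1"] show ?thesis using F C0 by (simp add: d_def)
  qed
  finally show ?thesis .
 qed
 moreover have "(\<lambda>k. LINT x:?A|lborel. cmod (r k x)) \<longlonglongrightarrow> 0"
  using assms d by (auto simp: approx_identity_def)
 then have "\<forall>\<^sub>F k in sequentially. (LINT x:?A|lborel. cmod (r k x)) < e / 4"
  using e by (intro order_tendstoD(2)) auto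
 ultimately have "\<forall>\<^sub>F k in sequentially. dist (fcoeff (r k) n) 1 < e"
 proof (elim eventually_mono)
  fix k assume "F * d * C \<le> e / 2" "(LINT x:?A|lborel. cmod (r k x)) < e / 4"
  then show "dist (fcoeff (r k) n) 1 < e" using bd[of k] by linarith
 qed
 then show "\<exists>k0. \<forall>k\<ge>k0. dist (fcoeff (r k) n) 1 < e" by (simp add: eventually_sequentially)
qed

section \<open>The product of three Fourier series\<close>

lemma hbd_tail_le:
 assumes c: "hbd s c K" and s: "0 \<le> s" and S: "finite S" "S \<inter> freq_box N = {}"
 shows "l2 S c \<le> K * (2 powr (- s)) ^ N"
proof -
 have J: "2 ^ N \<le> jbracket (freq n)" if "n \<in> S" for n
 proof -
  obtain j where j: "n \<in> block j" using ex_block by blast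
  then have "Suc N \<le> j" using S that by (intro block_not_in_box) auto
  then have "(2 ^ Suc N :: real) \<le> 2 ^ j" by (intro power_increasing) auto
  then show ?thesis using jbracket_block_ge[OF j] by simp
 qed
 have "(2 powr s) ^ N * l2 S c = L2_set (\<lambda>n. (2 powr s) ^ N * cmod (c n)) S"
  by (rule L2_set_right_distrib) simp
 also have "\<dots> \<le> L2_set (\<lambda>n. jbracket (freq n) powr s * cmod (c n)) S"
 proof (intro L2_set_mono mult_right_mono)
  fix n assume "n \<in> S"
  have "(2 powr s) ^ N = (2 ^ N :: real) powr s" by (simp add: powr_powr mult.commute flip: powr_realpow)
  also have "\<dots> \<le> jbracket (freq n) powr s" using s J[OF \<open>n \<in> S\<close>] by (intro powr_mono2) auto
  finally show "(2 powr s) ^ N \<le> jbracket (freq n) powr s" .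
 qed auto
 also have "\<dots> \<le> K" using c S by (simp add: hbd_def)
 finally show ?thesis by (simp add: powr_minus field_simps power_inverse)
qed

lemma hbd_l2_le:
 assumes c: "hbd s c K" and s: "0 \<le> s" and S: "finite S"
 shows "l2 S c \<le> K"
proof -
 have "l2 S c \<le> L2_set (\<lambda>n. jbracket (freq n) powr s * cmod (c n)) S"
 proof (intro L2_set_mono)
  fix n
  have "1 \<le> jbracket (freq n) powr s" using powr_mono[of 0 s "jbracket (freq n)"] s jbracket_ge_one[of "freq n"] by simp
  then show "cmod (c n) \<le> jbracket (freq n) powr s * cmod (c n)" by (simp add: mult_right_mono[of 1 _ "cmod (c n)", simplified])
 qed auto
 then show ?thesis using c S by (auto simp: hbd_def intro: order_trans)
qed

text \<open>
 Positive regularity gives square summable coefficients, with a geometrically small tail.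
\<close>

lemma cell_hbd_approx:
 assumes v: "set_integrable lborel cell v" and h: "hbd s (ncoeff v) K" and s: "0 < s"
 defines "Sv \<equiv> \<lambda>N. trig_sum (freq_box N) (ncoeff v)"
 shows "set_integrable lborel cell (\<lambda>x. (cmod (v x))\<^sup>2)" "(LINT x:cell|lborel. (cmod (v x))\<^sup>2) \<le> (2 * pi * K)\<^sup>2"
  and "(LINT x:cell|lborel. (cmod (Sv N x))\<^sup>2) \<le> (2 * pi * K)\<^sup>2"
  and "set_integrable lborel cell (\<lambda>x. (cmod (v x - Sv N x))\<^sup>2)"
  and "(LINT x:cell|lborel. (cmod (v x - Sv N x))\<^sup>2) \<le> (2 * pi * (K * (2 powr (- s)) ^ N))\<^sup>2"
proof -
 have fc: "fcoeff v = (\<lambda>n. of_real ((2 * pi)\<^sup>2) * ncoeff v n)" by (simp add: fun_eq_iff ncoeff_def)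
 have l2fc: "l2 S (fcoeff v) = (2 * pi)\<^sup>2 * l2 S (ncoeff v)" for S
  unfolding fc by (simp only: norm_mult norm_of_real abs_power2 L2_set_right_distrib zero_le_power2)
 have e: "(2 * pi)\<^sup>2 * x / (2 * pi) = 2 * pi * x" for x :: real by (simp add: power2_eq_square)
 have "l2 S (fcoeff v) \<le> (2 * pi)\<^sup>2 * K" if "finite S" for S
  unfolding l2fc using s that by (intro mult_left_mono hbd_l2_le[OF h]) auto
 from cell_l2_of_fcoeff_l2[OF v this]
 show "set_integrable lborel cell (\<lambda>x. (cmod (v x))\<^sup>2)" "(LINT x:cell|lborel. (cmod (v x))\<^sup>2) \<le> (2 * pi * K)\<^sup>2"
  by (simp_all only: e)
 have K: "0 \<le> K" by (rule hbd_nonneg[OF h])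
 show "(LINT x:cell|lborel. (cmod (Sv N x))\<^sup>2) \<le> (2 * pi * K)\<^sup>2"
  unfolding Sv_def LINT_trig_sum_square[OF finite_freq_box] power_mult_distrib
  using s by (intro mult_left_mono power_mono hbd_l2_le[OF h]) (auto simp: L2_set_nonneg)
 have Si: "set_integrable lborel cell (Sv N)" unfolding Sv_def
  by (intro set_integrable_cell_continuous trig_sum_continuous)
 have di: "set_integrable lborel cell (\<lambda>x. v x - Sv N x)" by (rule set_integral_diff(1)[OF v Si])
 have dc: "fcoeff (\<lambda>x. v x - Sv N x) n = (if n \<in> freq_box N then 0 else fcoeff v n)" for n
 proof -
  have i: "set_integrable lborel cell (\<lambda>x. f x * ech (- n) x)" if "set_integrable lborel cell f" for f
   using integrable_bounded_times[OF that[unfolded set_integrable_def], of "ech (- n)" 1]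
   by (simp add: set_integrable_def mult.assoc)
  have "fcoeff (\<lambda>x. v x - Sv N x) n = fcoeff v n - fcoeff (Sv N) n"
   unfolding fcoeff_def left_diff_distrib by (rule set_integral_diff(2)[OF i[OF v] i[OF Si]])
  then show ?thesis by (simp add: Sv_def fcoeff_trig_sum ncoeff_def)
 qed
 have "l2 S (fcoeff (\<lambda>x. v x - Sv N x)) \<le> (2 * pi)\<^sup>2 * (K * (2 powr (- s)) ^ N)" if S: "finite S" for S
 proof -
  have "l2 S (fcoeff (\<lambda>x. v x - Sv N x)) = l2 (S - freq_box N) (fcoeff v)"
   unfolding L2_set_def using S
   by (intro arg_cong[of _ _ sqrt] sum.mono_neutral_cong_right) (auto simp: dc)
  also have "\<dots> \<le> (2 * pi)\<^sup>2 * (K * (2 powr (- s)) ^ N)"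
   unfolding l2fc using S s by (intro mult_left_mono hbd_tail_le[OF h]) auto
  finally show ?thesis .
 qed
 from cell_l2_of_fcoeff_l2[OF di this]
 show "set_integrable lborel cell (\<lambda>x. (cmod (v x - Sv N x))\<^sup>2)"
  "(LINT x:cell|lborel. (cmod (v x - Sv N x))\<^sup>2) \<le> (2 * pi * (K * (2 powr (- s)) ^ N))\<^sup>2"
  by (simp_all only: e)
qed

lemma set_borel_measurable_cmod:
 fixes f :: "'a \<Rightarrow> complex"
 assumes "set_borel_measurable M A f"
 shows "set_borel_measurable M A (\<lambda>x. cmod (f x))"
proof -
 have eq: "(\<lambda>x. indicator A x *\<^sub>R cmod (f x)) = (\<lambda>x. cmod (indicator A x *\<^sub>R f x))" by (auto simp: fun_eq_iff)
 show ?thesis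
  using assms unfolding set_borel_measurable_def eq by (rule measurable_compose[OF _ borel_measurable_norm])
qed

lemma LINT_cell_product4_le:
 fixes \<beta> f g h :: "real \<times> real \<Rightarrow> complex"
 assumes f: "set_borel_measurable lborel cell f" "set_integrable lborel cell (\<lambda>x. (cmod (f x))\<^sup>2)" "(LINT x:cell|lborel. (cmod (f x))\<^sup>2) \<le> A\<^sup>2" "0 \<le> A"
  and g: "set_borel_measurable lborel cell g" "set_integrable lborel cell (\<lambda>x. (cmod (g x))\<^sup>2)" "(LINT x:cell|lborel. (cmod (g x))\<^sup>2) \<le> B\<^sup>2" "0 \<le> B"
  and \<beta>: "\<beta> \<in> borel_measurable borel" "\<And>x. cmod (\<beta> x) \<le> D" and h: "h \<in> borel_measurable borel" "\<And>x. cmod (h x) \<le> E" 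
 shows "set_integrable lborel cell (\<lambda>x. \<beta> x * f x * g x * h x)"
  and "cmod (LINT x:cell|lborel. \<beta> x * f x * g x * h x) \<le> D * E * (A * B)"
proof -
 have m: "set_borel_measurable lborel cell (\<lambda>x. cmod (f x))" "set_borel_measurable lborel cell (\<lambda>x. cmod (g x))"
  by (intro set_borel_measurable_cmod f(1) g(1))+
 note i = set_integrable_cell_mult[OF m f(2) g(2)]
 have DE: "0 \<le> D" "0 \<le> E" using \<beta>(2)[of 0] h(2)[of 0] norm_ge_zero order_trans by blast+
 have pt: "cmod (\<beta> x * f x * g x * h x) \<le> D * E * \<bar>cmod (f x) * cmod (g x)\<bar>" for x
 proof -
  have "cmod (\<beta> x) * cmod (h x) \<le> D * E" using DE \<beta>(2) h(2) by (intro mult_mono) auto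
  then have "(cmod (\<beta> x) * cmod (h x)) * (cmod (f x) * cmod (g x)) \<le> (D * E) * (cmod (f x) * cmod (g x))"
   by (intro mult_right_mono) auto
  then show ?thesis by (simp add: norm_mult mult_ac)
 qed
 have eq: "(\<lambda>x. indicator cell x *\<^sub>R (\<beta> x * f x * g x * h x)) =
   (\<lambda>x. \<beta> x * (indicator cell x *\<^sub>R f x) * (indicator cell x *\<^sub>R g x) * h x)"
  by (auto simp: fun_eq_iff indicator_def)
 show "set_integrable lborel cell (\<lambda>x. \<beta> x * f x * g x * h x)"
 proof (rule set_integrable_bound)
  show "set_integrable lborel cell (\<lambda>x. D * E * \<bar>cmod (f x) * cmod (g x)\<bar>)" using i by simp
  show "set_borel_measurable lborel cell (\<lambda>x. \<beta> x * f x * g x * h x)"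
   unfolding set_borel_measurable_def eq
   using f(1) g(1) \<beta>(1) h(1) unfolding set_borel_measurable_def by (intro borel_measurable_times) simp_all
  show "AE x in lborel. x \<in> cell \<longrightarrow> norm (\<beta> x * f x * g x * h x) \<le> norm (D * E * \<bar>cmod (f x) * cmod (g x)\<bar>)"
   using pt DE by (intro AE_I2 impI) (simp add: abs_mult)
 qed
 have "cmod (LINT x:cell|lborel. \<beta> x * f x * g x * h x) \<le> (LINT x:cell|lborel. D * E * \<bar>cmod (f x) * cmod (g x)\<bar>)"
  unfolding set_lebesgue_integral_def
 proof (rule integral_norm_bound_AE)
  show "integrable lborel (\<lambda>x. indicator cell x *\<^sub>R (D * E * \<bar>cmod (f x) * cmod (g x)\<bar>))"
   using set_integrable_mult_right[OF i, of "D * E"] by (simp add: set_integrable_def)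
  show "AE x in lborel. norm (indicator cell x *\<^sub>R (\<beta> x * f x * g x * h x)) \<le> indicator cell x *\<^sub>R (D * E * \<bar>cmod (f x) * cmod (g x)\<bar>)"
   using pt by (intro AE_I2) (simp add: indicator_def)
 qed
 also have "\<dots> = D * E * (LINT x:cell|lborel. \<bar>cmod (f x) * cmod (g x)\<bar>)" by simp
 also have "\<dots> \<le> D * E * (A * B)"
  using DE f g by (intro mult_left_mono LINT_cell_Cauchy_Schwarz m) auto
 finally show "cmod (LINT x:cell|lborel. \<beta> x * f x * g x * h x) \<le> D * E * (A * B)" .
qed

text \<open>
 For regular entries the limit that defines the trilinear form is an honest integral: the truncated
 series converge in \<open>L\<^sup>2\<close>, \<open>L\<^sup>2\<close> and uniformly.
\<close>

lemma Lam_eq_integral: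
 assumes \<beta>: "\<And>n. cmod (\<beta> n) \<le> K\<beta> / jbracket (freq n) ^ 4" and c: "\<And>n. cmod (c n) \<le> Kc / jbracket (freq n) ^ 4"
  and v: "set_integrable lborel cell v" "hbd s (ncoeff v) Kv" and w: "set_integrable lborel cell w" "hbd s (ncoeff w) Kw"
  and s: "0 < s"
 shows "(LINT x:cell|lborel. fseries \<beta> x * v x * w x * fseries c x) = (2 * pi)\<^sup>2 * Lam \<beta> (ncoeff v) (ncoeff w) c"
  and "cmod (LINT x:cell|lborel. fseries \<beta> x * v x * w x * fseries c x) \<le> (K\<beta> * 129) * (Kc * 129) * ((2 * pi * Kv) * (2 * pi * Kw))"
  and "set_integrable lborel cell (\<lambda>x. fseries \<beta> x * v x * w x * fseries c x)"
proof -
 let ?I = "LINT x:cell|lborel. fseries \<beta> x * v x * w x * fseries c x"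
 define Sv where "Sv N = trig_sum (freq_box N) (ncoeff v)" for N
 define Sw where "Sw N = trig_sum (freq_box N) (ncoeff w)" for N
 define Sc where "Sc N = trig_sum (freq_box N) c" for N
 define q where "q = 2 powr (- s)"
 have q: "0 < q" "q < 1" using s by (simp_all add: q_def powr_less_one)
 have Kn: "0 \<le> Kv" "0 \<le> Kw" "0 \<le> K\<beta>" "0 \<le> Kc"
  using hbd_nonneg[OF v(2)] hbd_nonneg[OF w(2)] order_trans[OF norm_ge_zero \<beta>[of 0]] order_trans[OF norm_ge_zero c[of 0]]
  by (simp_all add: jbracket_def)
 note av = cell_hbd_approx[OF v s, folded Sv_def q_def] and aw = cell_hbd_approx[OF w s, folded Sw_def q_def]
 have fm: "fseries \<beta> \<in> borel_measurable borel" "fseries c \<in> borel_measurable borel"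
  using continuous_fseries[OF \<beta>, of UNIV] continuous_fseries[OF c, of UNIV] by (intro borel_measurable_continuous_onI; simp)+
 note fb = fseries_bounded(1)[OF \<beta>] and cb = fseries_bounded(1)[OF c]
 have Sm: "Sv N \<in> borel_measurable borel" "Sw N \<in> borel_measurable borel" "Sc N \<in> borel_measurable borel" for N
  by (simp_all add: Sv_def Sw_def Sc_def)
 have mv: "set_borel_measurable lborel cell v" "set_borel_measurable lborel cell w"
  using v w by (auto simp: set_borel_measurable_def set_integrable_def)
 have mS: "set_borel_measurable lborel cell (Sv N)" "set_borel_measurable lborel cell (Sw N)" for N
  using Sm by (simp_all add: set_borel_measurable_def)
 have md: "set_borel_measurable lborel cell (\<lambda>x. v x - Sv N x)" "set_borel_measurable lborel cell (\<lambda>x. w x - Sw N x)" for N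
 proof -
  show "set_borel_measurable lborel cell (\<lambda>x. v x - Sv N x)"
   unfolding set_borel_measurable_def scaleR_diff_right
   by (rule borel_measurable_diff[OF mv(1)[unfolded set_borel_measurable_def] mS(1)[unfolded set_borel_measurable_def]])
  show "set_borel_measurable lborel cell (\<lambda>x. w x - Sw N x)"
   unfolding set_borel_measurable_def scaleR_diff_right
   by (rule borel_measurable_diff[OF mv(2)[unfolded set_borel_measurable_def] mS(2)[unfolded set_borel_measurable_def]])
 qed
 have iS: "set_integrable lborel cell (\<lambda>x. (cmod (Sv N x))\<^sup>2)" "set_integrable lborel cell (\<lambda>x. (cmod (Sw N x))\<^sup>2)" for N
  unfolding Sv_def Sw_def by (intro set_integrable_cell_continuous continuous_intros)+
 have nn: "0 \<le> 2 * pi * Kv" "0 \<le> 2 * pi * Kw" "0 \<le> 2 * pi * (Kv * q ^ N)" "0 \<le> 2 * pi * (Kw * q ^ N)" for N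
  using Kn q by simp_all
 note main = LINT_cell_product4_le[OF mv(1) av(1,2) nn(1) mv(2) aw(1,2) nn(2) fm(1) fb fm(2) cb]
 show "cmod ?I \<le> (K\<beta> * 129) * (Kc * 129) * ((2 * pi * Kv) * (2 * pi * Kw))" by (rule main(2))
 show "set_integrable lborel cell (\<lambda>x. fseries \<beta> x * v x * w x * fseries c x)" by (rule main(1))
 let ?IN = "\<lambda>N. LINT x:cell|lborel. fseries \<beta> x * Sv N x * Sw N x * Sc N x"
 have IN: "?IN N = (2 * pi)\<^sup>2 * tri \<beta> (freq_box N) (freq_box N) (freq_box N) (ncoeff v) (ncoeff w) c" for N
 proof -
  have cont: "continuous_on cell (\<lambda>x. z * (fseries \<beta> x * ech n x))" for z n
   by (intro continuous_intros continuous_fseries[OF \<beta>])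
  have "?IN N = (LINT x:cell|lborel. (\<Sum>n\<in>freq_box N. \<Sum>m\<in>freq_box N. \<Sum>l\<in>freq_box N.
    (ncoeff v n * ncoeff w m * c l) * (fseries \<beta> x * ech (- (- (n + m + l))) x)))"
  proof -
   have "fseries \<beta> x * Sv N x * Sw N x * Sc N x = (\<Sum>n\<in>freq_box N. \<Sum>m\<in>freq_box N. \<Sum>l\<in>freq_box N.
    (ncoeff v n * ncoeff w m * c l) * (fseries \<beta> x * ech (- (- (n + m + l))) x))" for x
   proof -
    have "fseries \<beta> x * Sv N x * Sw N x * Sc N x = (Sv N x * (Sw N x * Sc N x)) * fseries \<beta> x" by (simp add: mult_ac)
    also have "Sv N x * (Sw N x * Sc N x) = (\<Sum>n\<in>freq_box N. \<Sum>m\<in>freq_box N. \<Sum>l\<in>freq_box N.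
      (ncoeff v n * ech n x) * ((ncoeff w m * ech m x) * (c l * ech l x)))"
     unfolding Sv_def Sw_def Sc_def trig_sum_def by (simp only: sum_distrib_right) (simp only: sum_distrib_left)
    finally show ?thesis unfolding sum_distrib_right minus_minus ech_add by (simp only: mult_ac)
   qed
   then show ?thesis by simp
  qed
  also have "\<dots> = (\<Sum>n\<in>freq_box N. \<Sum>m\<in>freq_box N. \<Sum>l\<in>freq_box N.
    (ncoeff v n * ncoeff w m * c l) * fcoeff (fseries \<beta>) (- (n + m + l)))"
  proof -
   have i1: "set_integrable lborel cell (\<lambda>x. (ncoeff v n * ncoeff w m * c l) * (fseries \<beta> x * ech (- (- (n + m + l))) x))" for n m l
    by (intro set_integrable_cell_continuous cont)
   have i2: "set_integrable lborel cell (\<lambda>x. \<Sum>l\<in>S. (ncoeff v n * ncoeff w m * c l) * (fseries \<beta> x * ech (- (- (n + m + l))) x))" for n m S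
    by (intro set_integrable_cell_continuous continuous_on_sum cont)
   have i3: "set_integrable lborel cell (\<lambda>x. \<Sum>m\<in>S'. \<Sum>l\<in>S. (ncoeff v n * ncoeff w m * c l) * (fseries \<beta> x * ech (- (- (n + m + l))) x))" for n S S'
    by (intro set_integrable_cell_continuous continuous_on_sum cont)
   show ?thesis
    by (simp only: set_lebesgue_integral_sum[OF i1] set_lebesgue_integral_sum[OF i2] set_lebesgue_integral_sum[OF i3]
      set_integral_mult_right fcoeff_def)
  qed
  also have "\<dots> = (2 * pi)\<^sup>2 * tri \<beta> (freq_box N) (freq_box N) (freq_box N) (ncoeff v) (ncoeff w) c"
   unfolding fcoeff_fseries[OF \<beta>] tri_def by (simp add: sum_distrib_left mult_ac)
  finally show ?thesis .
 qed
 have diff: "cmod (?I - ?IN N) \<le> (K\<beta> * 129) * (Kc * 129) * ((2 * pi * (Kv * q ^ N)) * (2 * pi * Kw))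
   + (K\<beta> * 129) * (Kc * 129) * ((2 * pi * Kv) * (2 * pi * (Kw * q ^ N)))
   + (K\<beta> * 129) * (Kc * 128 * (1/4) ^ N) * ((2 * pi * Kv) * (2 * pi * Kw))" for N
 proof -
  have dm: "(\<lambda>x. fseries c x - Sc N x) \<in> borel_measurable borel" using fm(2) Sm(3) by simp
  have db: "cmod (fseries c x - Sc N x) \<le> Kc * 128 * (1/4) ^ N" for x
   unfolding Sc_def by (rule fseries_diff_le[OF c])
  note t1 = LINT_cell_product4_le[OF md(1) av(4,5) nn(3) mv(2) aw(1,2) nn(2) fm(1) fb fm(2) cb, of N]
   and t2 = LINT_cell_product4_le[OF mS(1) iS(1) av(3) nn(1) md(2) aw(4,5) nn(4) fm(1) fb fm(2) cb, of N N]
   and t3 = LINT_cell_product4_le[OF mS(1) iS(1) av(3) nn(1) mS(2) iS(2) aw(3) nn(2) fm(1) fb dm db, of N]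
  have iN: "set_integrable lborel cell (\<lambda>x. fseries \<beta> x * Sv N x * Sw N x * Sc N x)"
   unfolding Sv_def Sw_def Sc_def by (intro set_integrable_cell_continuous continuous_intros continuous_fseries[OF \<beta>])
  have "?I - ?IN N = (LINT x:cell|lborel. fseries \<beta> x * v x * w x * fseries c x - fseries \<beta> x * Sv N x * Sw N x * Sc N x)"
   by (rule set_integral_diff(2)[OF main(1) iN, symmetric])
  also have "\<dots> = (LINT x:cell|lborel. (fseries \<beta> x * (v x - Sv N x) * w x * fseries c x
    + fseries \<beta> x * Sv N x * (w x - Sw N x) * fseries c x) + fseries \<beta> x * Sv N x * Sw N x * (fseries c x - Sc N x))"
   by (intro arg_cong[of _ _ "\<lambda>f. set_lebesgue_integral lborel cell f"]) (auto simp: algebra_simps)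
  also have "\<dots> = (LINT x:cell|lborel. fseries \<beta> x * (v x - Sv N x) * w x * fseries c x)
    + (LINT x:cell|lborel. fseries \<beta> x * Sv N x * (w x - Sw N x) * fseries c x)
    + (LINT x:cell|lborel. fseries \<beta> x * Sv N x * Sw N x * (fseries c x - Sc N x))"
   using t1(1) t2(1) t3(1) by (simp add: set_integral_add)
  finally show ?thesis using t1(2) t2(2) t3(2) by (simp only:) (intro norm_triangle_mono; assumption)
 qed
 have "(\<lambda>N. (K\<beta> * 129) * (Kc * 129) * ((2 * pi * (Kv * q ^ N)) * (2 * pi * Kw))
   + (K\<beta> * 129) * (Kc * 129) * ((2 * pi * Kv) * (2 * pi * (Kw * q ^ N)))
   + (K\<beta> * 129) * (Kc * 128 * (1/4) ^ N) * ((2 * pi * Kv) * (2 * pi * Kw))) \<longlonglongrightarrow>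
   (K\<beta> * 129) * (Kc * 129) * ((2 * pi * (Kv * 0)) * (2 * pi * Kw))
   + (K\<beta> * 129) * (Kc * 129) * ((2 * pi * Kv) * (2 * pi * (Kw * 0)))
   + (K\<beta> * 129) * (Kc * 128 * 0) * ((2 * pi * Kv) * (2 * pi * Kw))"
  using q by (intro tendsto_intros LIMSEQ_power_zero) auto
 then have "(\<lambda>N. ?I - ?IN N) \<longlonglongrightarrow> 0"
  by (intro Lim_null_comparison[OF always_eventually[OF allI[OF diff]]]) simp
 from tendsto_diff[OF tendsto_const[of ?I] this] have "?IN \<longlonglongrightarrow> ?I" by simp
 then have "(\<lambda>N. ?IN N / (2 * pi)\<^sup>2) \<longlonglongrightarrow> ?I / (2 * pi)\<^sup>2" by (intro tendsto_divide tendsto_const) auto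
 then have "(\<lambda>N. tri \<beta> (freq_box N) (freq_box N) (freq_box N) (ncoeff v) (ncoeff w) c) \<longlonglongrightarrow> ?I / (2 * pi)\<^sup>2"
  by (simp add: IN)
 then have "Lam \<beta> (ncoeff v) (ncoeff w) c = ?I / (2 * pi)\<^sup>2" unfolding Lam_def by (rule limI)
 then show "?I = (2 * pi)\<^sup>2 * Lam \<beta> (ncoeff v) (ncoeff w) c" by simp
qed

section \<open>The Fourier transform in time\<close>

definition tft :: "(real \<Rightarrow> complex) \<Rightarrow> real \<Rightarrow> complex" where
 "tft y \<tau> = (\<integral>t. y t * cis (- (\<tau> * t)) \<partial>lborel)"

definition gauss :: "real \<Rightarrow> real \<Rightarrow> real" where
 "gauss e \<tau> = exp (- (e * \<tau>)\<^sup>2 / 2)"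

lemma measurable_cis [measurable]: "cis \<in> borel_measurable borel"
 unfolding cis_conv_exp[abs_def] by (intro borel_measurable_continuous_onI continuous_intros)

lemma gauss_measurable [measurable]: "gauss e \<in> borel_measurable borel"
 unfolding gauss_def[abs_def] by measurable

lemma gauss_bounds: "0 < gauss e \<tau>" "gauss e \<tau> \<le> 1"
 by (auto simp: gauss_def)

lemma gauss_transform:
 assumes "0 < e"
 shows "integrable lborel (gauss e)"
  and "(\<integral>\<tau>. of_real (gauss e \<tau>) * cis (c * \<tau>) \<partial>lborel) = of_real (sqrt (2 * pi) / e * gauss (1 / e) c)"
proof -
 have d: "gauss e \<tau> = sqrt (2 * pi) * std_normal_density (0 + e * \<tau>)" for \<tau>
  by (simp add: gauss_def std_normal_density_def)
 show "integrable lborel (gauss e)"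
  unfolding d using assms by (intro integrable_mult_right lborel_integrable_real_affine) auto
 define f where "f x = std_normal_density x *\<^sub>R cis (c / e * x)" for x
 have "(\<integral>\<tau>. of_real (gauss e \<tau>) * cis (c * \<tau>) \<partial>lborel) = (\<integral>\<tau>. sqrt (2 * pi) * f (0 + e * \<tau>) \<partial>lborel)"
  using assms by (simp add: d f_def scaleR_conv_of_real mult.assoc)
 also have "\<dots> = sqrt (2 * pi) / e * (\<integral>x. f x \<partial>lborel)"
  using lborel_integral_real_affine[of e f 0] assms by (simp add: scaleR_conv_of_real field_simps)
 also have "(\<integral>x. f x \<partial>lborel) = (\<integral>x. cis (c / e * x) \<partial>std_normal_distribution)"
  unfolding f_def by (subst integral_density) auto
 also have "\<dots> = exp (- (c / e)\<^sup>2 / 2)" by (rule gaussian_average_cis)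
 finally show "(\<integral>\<tau>. of_real (gauss e \<tau>) * cis (c * \<tau>) \<partial>lborel) = of_real (sqrt (2 * pi) / e * gauss (1 / e) c)"
  by (simp add: gauss_def)
qed

lemma gauss_integral:
 assumes "0 < e"
 shows "(\<integral>\<tau>. gauss e \<tau> \<partial>lborel) = sqrt (2 * pi) / e"
proof -
 have "complex_of_real (\<integral>\<tau>. gauss e \<tau> \<partial>lborel) = of_real (sqrt (2 * pi) / e)"
  using gauss_transform(2)[OF assms, of 0] by (simp add: gauss_def)
 then show ?thesis unfolding of_real_eq_iff .
qed

lemma integrable_lborel_mult_pair:
 fixes f :: "'a::euclidean_space \<Rightarrow> complex" and g :: "'b::euclidean_space \<Rightarrow> complex"
 assumes f: "integrable lborel f" and g: "integrable lborel g"
 shows "integrable (lborel \<Otimes>\<^sub>M lborel) (\<lambda>(x, y). f x * g y)"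
proof (rule lborel_pair.Fubini_integrable)
 have [measurable]: "f \<in> borel_measurable borel" "g \<in> borel_measurable borel"
  using f g by (auto dest: borel_measurable_integrable)
 show "(\<lambda>(x, y). f x * g y) \<in> borel_measurable (lborel \<Otimes>\<^sub>M lborel)" by measurable
 show "integrable lborel (\<lambda>x. LBINT y. norm (case (x, y) of (x, y) \<Rightarrow> f x * g y))"
  using f by (simp add: norm_mult)
 show "AE x in lborel. integrable lborel (\<lambda>y. case (x, y) of (x, y) \<Rightarrow> f x * g y)"
  using g by simp
qed

text \<open>Fubini for a product against a bounded oscillating factor.\<close>

lemma Fubini_phase:
 fixes f :: "'a::euclidean_space \<Rightarrow> complex" and g :: "'b::euclidean_space \<Rightarrow> complex"
 assumes f: "integrable lborel f" and g: "integrable lborel g"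
  and h: "(\<lambda>p. h (fst p) (snd p)) \<in> borel_measurable (lborel \<Otimes>\<^sub>M lborel)" "\<And>x y. cmod (h x y) \<le> 1"
 shows "(\<integral>x. f x * (\<integral>y. g y * h x y \<partial>lborel) \<partial>lborel) = (\<integral>y. g y * (\<integral>x. f x * h x y \<partial>lborel) \<partial>lborel)"
  and "integrable lborel (\<lambda>x. f x * (\<integral>y. g y * h x y \<partial>lborel))"
proof -
 have "integrable (lborel \<Otimes>\<^sub>M lborel) (\<lambda>p. (case p of (x, y) \<Rightarrow> f x * g y) * h (fst p) (snd p))"
  by (rule integrable_bounded_times[OF integrable_lborel_mult_pair[OF f g] h(1)]) (use h(2) in auto)
 then have int: "integrable (lborel \<Otimes>\<^sub>M lborel) (\<lambda>(x, y). f x * g y * h x y)" by (simp add: split_def)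
 have 1: "(\<integral>y. f x * g y * h x y \<partial>lborel) = f x * (\<integral>y. g y * h x y \<partial>lborel)" for x by (simp add: mult.assoc)
 have 2: "(\<integral>x. f x * g y * h x y \<partial>lborel) = g y * (\<integral>x. f x * h x y \<partial>lborel)" for y
  by (subst integral_mult_right_zero[symmetric]) (simp add: mult_ac)
 from lborel_pair.Fubini_integral[OF int]
 show "(\<integral>x. f x * (\<integral>y. g y * h x y \<partial>lborel) \<partial>lborel) = (\<integral>y. g y * (\<integral>x. f x * h x y \<partial>lborel) \<partial>lborel)"
  unfolding 1 2 by simp
 from lborel_pair.integrable_fst'[OF int] show "integrable lborel (\<lambda>x. f x * (\<integral>y. g y * h x y \<partial>lborel))"
  by (simp add: mult.assoc)
qed

lemma measurable_phase [measurable]: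
 "(\<lambda>p. cis (c * (fst p * snd p))) \<in> borel_measurable (lborel \<Otimes>\<^sub>M lborel)"
 by measurable

lemma tft_measurable [measurable]:
 assumes "y \<in> borel_measurable borel"
 shows "tft y \<in> borel_measurable borel"
 unfolding tft_def[abs_def] using assms by measurable

lemma norm_tft_le: "integrable lborel y \<Longrightarrow> cmod (tft y \<tau>) \<le> (\<integral>t. cmod (y t) \<partial>lborel)"
 unfolding tft_def by (rule integral_norm_bound_AE) (auto simp: norm_mult)

text \<open>
 Plancherel's inequality. With a Gaussian weight in \<open>\<tau>\<close> the left side is \<open>\<integral>\<integral> y(t) y(s)* k(t - s)\<close>
 with a kernel \<open>k \<ge> 0\<close> of mass \<open>2\<pi>\<close>; then the weight is removed.
\<close>

lemma tft_Plancherel_le: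
 assumes y: "integrable lborel y" and y2: "integrable lborel (\<lambda>t. (cmod (y t))\<^sup>2)"
 shows "(\<integral>\<^sup>+\<tau>. ennreal ((cmod (tft y \<tau>))\<^sup>2) \<partial>lborel) \<le> ennreal (2 * pi * (\<integral>t. (cmod (y t))\<^sup>2 \<partial>lborel))"
proof -
 have [measurable]: "y \<in> borel_measurable borel" using y by (auto dest: borel_measurable_integrable)
 let ?N = "\<integral>t. (cmod (y t))\<^sup>2 \<partial>lborel"
 have weighted: "(\<integral>\<^sup>+\<tau>. ennreal (gauss e \<tau> * (cmod (tft y \<tau>))\<^sup>2) \<partial>lborel) \<le> ennreal (2 * pi * ?N)" if e: "0 < e" for e
 proof -
  define k where "k x = sqrt (2 * pi) / e * gauss (1 / e) x" for x
  have k0: "0 \<le> k x" for x using e gauss_bounds(1)[of "1 / e" x] by (simp add: k_def)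
  have [measurable]: "k \<in> borel_measurable borel" unfolding k_def[abs_def] by measurable
  have ki: "integrable lborel k" using gauss_transform(1)[of "1 / e"] e by (simp add: k_def[abs_def])
  have kI: "(\<integral>x. k x \<partial>lborel) = 2 * pi"
   using gauss_integral[of "1 / e"] e by (simp add: k_def mult.assoc[symmetric])
  have ksh: "integrable lborel (\<lambda>s. k (t - s))" "(\<integral>s. k (t - s) \<partial>lborel) = 2 * pi"
   "integrable lborel (\<lambda>s. k (s - t))" "(\<integral>s. k (s - t) \<partial>lborel) = 2 * pi" for t
   using lborel_integrable_real_affine[OF ki, of "- 1" t] lborel_integral_real_affine[of "- 1" k t]
    lborel_integrable_real_affine[OF ki, of 1 "- t"] lborel_integral_real_affine[of 1 k "- t"] kI
   by (simp_all add: algebra_simps)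
  define h where "h p = (case p of (t, s) \<Rightarrow> y t * cnj (y s))" for p
  have hi: "integrable lborel h"
   using integrable_lborel_mult_pair[OF y, of "\<lambda>s. cnj (y s)"] y
   by (simp add: h_def[abs_def] lborel_prod)
  have sq: "of_real ((cmod (tft y \<tau>))\<^sup>2) = (\<integral>p. h p * cis (- (\<tau> * (fst p - snd p))) \<partial>lborel)" for \<tau>
  proof -
   have "integrable lborel (\<lambda>t. y t * cis (- (\<tau> * t)))" "integrable lborel (\<lambda>s. cnj (y s * cis (- (\<tau> * s))))"
   proof -
    show i: "integrable lborel (\<lambda>t. y t * cis (- (\<tau> * t)))"
     by (rule integrable_bounded_times[OF y, of _ 1]) auto
    show "integrable lborel (\<lambda>s. cnj (y s * cis (- (\<tau> * s))))"
     by (rule integrable_bounded_linear[OF bounded_linear_cnj i])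
   qed
   from lborel_pair.integral_fst[OF integrable_lborel_mult_pair[OF this]]
   have "tft y \<tau> * cnj (tft y \<tau>) = (LINT (t, s)|(lborel \<Otimes>\<^sub>M lborel). y t * cis (- (\<tau> * t)) * cnj (y s * cis (- (\<tau> * s))))"
    by (simp add: tft_def integral_cnj[symmetric] del: complex_cnj_mult)
   also have "\<dots> = (\<integral>p. h p * cis (- (\<tau> * (fst p - snd p))) \<partial>lborel)"
    unfolding lborel_prod
    by (intro Bochner_Integration.integral_cong refl)
      (auto simp: h_def cis_cnj cis_mult algebra_simps split: prod.split)
   finally show ?thesis by (simp only: complex_norm_square)
  qed
  have gi: "integrable lborel (\<lambda>\<tau>. complex_of_real (gauss e \<tau>))" using gauss_transform(1)[OF e] by (intro integrable_of_real)
  have ph: "(\<lambda>p. cis (- (fst p * (fst (snd p) - snd (snd p))))) \<in> borel_measurable (lborel \<Otimes>\<^sub>M (lborel :: (real \<times> real) measure))"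
  proof -
   have "(\<lambda>p :: real \<times> real \<times> real. cis (- (fst p * (fst (snd p) - snd (snd p))))) \<in> borel_measurable borel"
    unfolding cis_conv_exp by (intro borel_measurable_continuous_onI continuous_intros)
   then show ?thesis by (simp add: lborel_prod)
  qed
  have F: "(\<integral>\<tau>. of_real (gauss e \<tau>) * (\<integral>p. h p * cis (- (\<tau> * (fst p - snd p))) \<partial>lborel) \<partial>lborel) =
    (\<integral>p. h p * (\<integral>\<tau>. of_real (gauss e \<tau>) * cis (- (\<tau> * (fst p - snd p))) \<partial>lborel) \<partial>lborel)"
   "integrable lborel (\<lambda>\<tau>. of_real (gauss e \<tau>) * (\<integral>p. h p * cis (- (\<tau> * (fst p - snd p))) \<partial>lborel))"
   by (rule Fubini_phase[OF gi hi ph], simp)+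
  have inner: "(\<integral>\<tau>. of_real (gauss e \<tau>) * cis (- (\<tau> * x)) \<partial>lborel) = of_real (k x)" for x
   using gauss_transform(2)[OF e, of "- x"] by (simp add: k_def gauss_def mult.commute)
  have gsq: "integrable lborel (\<lambda>\<tau>. gauss e \<tau> * (cmod (tft y \<tau>))\<^sup>2)"
   using integrable_Re[OF F(2)] unfolding sq[symmetric] by simp
  define I where "I = (\<integral>\<tau>. gauss e \<tau> * (cmod (tft y \<tau>))\<^sup>2 \<partial>lborel)"
  have I: "complex_of_real I = (\<integral>p. h p * of_real (k (fst p - snd p)) \<partial>lborel)"
   using F(1) unfolding sq[symmetric] inner I_def by (simp flip: integral_complex_of_real)
  define G where "G p = ennreal ((cmod (y (fst p)))\<^sup>2 / 2 * k (fst p - snd p))" for p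
  define H where "H p = ennreal ((cmod (y (snd p)))\<^sup>2 / 2 * k (fst p - snd p))" for p
  have GH[measurable]: "G \<in> borel_measurable (lborel \<Otimes>\<^sub>M lborel)" "H \<in> borel_measurable (lborel \<Otimes>\<^sub>M lborel)"
   unfolding G_def[abs_def] H_def[abs_def] by measurable
  have c: "(\<integral>\<^sup>+s. ennreal (a / 2 * k (t - s)) \<partial>lborel) = ennreal (a / 2 * (2 * pi))"
   "(\<integral>\<^sup>+s. ennreal (a / 2 * k (s - t)) \<partial>lborel) = ennreal (a / 2 * (2 * pi))" if "0 \<le> a" for a t
   using that k0 ksh[of t] by (simp_all add: nn_integral_eq_integral)
  have "ennreal (cmod (\<integral>p. h p * of_real (k (fst p - snd p)) \<partial>lborel)) \<le> (\<integral>\<^sup>+p. ennreal (cmod (h p * of_real (k (fst p - snd p)))) \<partial>lborel)"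
  proof (rule integral_norm_bound_ennreal, rule integrable_bounded_times[OF hi])
   show "cmod (complex_of_real (k (fst p - snd p))) \<le> sqrt (2 * pi) / e" for p
   proof -
    have "k (fst p - snd p) \<le> sqrt (2 * pi) / e * 1"
     unfolding k_def using e by (intro mult_left_mono gauss_bounds) simp
    then show ?thesis using k0[of "fst p - snd p"] by (simp only: norm_of_real)
   qed
  qed (simp add: borel_prod[symmetric])
  also have "\<dots> = (\<integral>\<^sup>+p. ennreal (cmod (h p * of_real (k (fst p - snd p)))) \<partial>(lborel \<Otimes>\<^sub>M lborel))"
   by (simp add: lborel_prod)
  also have "\<dots> \<le> (\<integral>\<^sup>+p. G p + H p \<partial>(lborel \<Otimes>\<^sub>M lborel))"
  proof (rule nn_integral_mono)
   fix p :: "real \<times> real"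
   have "cmod (y (fst p)) * cmod (y (snd p)) \<le> (cmod (y (fst p)))\<^sup>2 / 2 + (cmod (y (snd p)))\<^sup>2 / 2"
    using sum_squares_bound[of "cmod (y (fst p))" "cmod (y (snd p))"] by simp
   then have "(cmod (y (fst p)) * cmod (y (snd p))) * k (fst p - snd p) \<le>
     ((cmod (y (fst p)))\<^sup>2 / 2 + (cmod (y (snd p)))\<^sup>2 / 2) * k (fst p - snd p)"
    using k0 by (intro mult_right_mono) auto
   then show "ennreal (cmod (h p * of_real (k (fst p - snd p)))) \<le> G p + H p"
    using k0 by (simp add: G_def H_def h_def norm_mult distrib_right split_def flip: ennreal_plus)
  qed
  also have "\<dots> = (\<integral>\<^sup>+p. G p \<partial>(lborel \<Otimes>\<^sub>M lborel)) + (\<integral>\<^sup>+p. H p \<partial>(lborel \<Otimes>\<^sub>M lborel))"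
   by (rule nn_integral_add) simp_all
  also have "(\<integral>\<^sup>+p. G p \<partial>(lborel \<Otimes>\<^sub>M lborel)) = (\<integral>\<^sup>+t. \<integral>\<^sup>+s. G (t, s) \<partial>lborel \<partial>lborel)"
   by (rule lborel.nn_integral_fst[symmetric]) simp
  also have "\<dots> = (\<integral>\<^sup>+t. ennreal ((cmod (y t))\<^sup>2 / 2 * (2 * pi)) \<partial>lborel)"
   unfolding G_def fst_conv snd_conv by (subst c) simp_all
  also have "(\<integral>\<^sup>+p. H p \<partial>(lborel \<Otimes>\<^sub>M lborel)) = (\<integral>\<^sup>+t. \<integral>\<^sup>+s. H (s, t) \<partial>lborel \<partial>lborel)"
   by (rule lborel_pair.nn_integral_snd[symmetric]) simp
  also have "\<dots> = (\<integral>\<^sup>+t. ennreal ((cmod (y t))\<^sup>2 / 2 * (2 * pi)) \<partial>lborel)"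
   unfolding H_def fst_conv snd_conv by (subst c) simp_all
  also have "(\<integral>\<^sup>+t. ennreal ((cmod (y t))\<^sup>2 / 2 * (2 * pi)) \<partial>lborel) = ennreal (?N / 2 * (2 * pi))"
   using y2 by (subst nn_integral_eq_integral) auto
  also have "ennreal (?N / 2 * (2 * pi)) + ennreal (?N / 2 * (2 * pi)) = ennreal (2 * pi * ?N)"
   by (simp flip: ennreal_plus)
  finally have "ennreal \<bar>I\<bar> \<le> ennreal (2 * pi * ?N)" unfolding I[symmetric] by (simp only: norm_of_real)
  moreover have "(\<integral>\<^sup>+\<tau>. ennreal (gauss e \<tau> * (cmod (tft y \<tau>))\<^sup>2) \<partial>lborel) = ennreal I"
   unfolding I_def using gauss_bounds(1)[of e] by (intro nn_integral_eq_integral gsq AE_I2) (simp add: less_imp_le)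
  moreover have "0 \<le> I" unfolding I_def using gauss_bounds(1)[of e]
   by (intro Bochner_Integration.integral_nonneg) (simp add: less_imp_le)
  ultimately show ?thesis by simp
 qed
 define e where "e n = inverse (real (Suc n))" for n
 have e: "e \<longlonglongrightarrow> 0" "0 < e n" for n unfolding e_def by (rule LIMSEQ_inverse_real_of_nat) simp
 have lim: "(\<lambda>n. gauss (e n) \<tau> * (cmod (tft y \<tau>))\<^sup>2) \<longlonglongrightarrow> (cmod (tft y \<tau>))\<^sup>2" for \<tau>
 proof -
  have "(\<lambda>n. exp (- (e n * \<tau>)\<^sup>2 / 2) * (cmod (tft y \<tau>))\<^sup>2) \<longlonglongrightarrow> exp (- (0 * \<tau>)\<^sup>2 / 2) * (cmod (tft y \<tau>))\<^sup>2"
   by (intro tendsto_intros e(1)) simp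
  then show ?thesis by (simp add: gauss_def)
 qed
 have "(\<integral>\<^sup>+\<tau>. ennreal ((cmod (tft y \<tau>))\<^sup>2) \<partial>lborel) = (\<integral>\<^sup>+\<tau>. liminf (\<lambda>n. ennreal (gauss (e n) \<tau> * (cmod (tft y \<tau>))\<^sup>2)) \<partial>lborel)"
  by (intro nn_integral_cong lim_imp_Liminf[symmetric] tendsto_ennrealI lim) simp
 also have "\<dots> \<le> liminf (\<lambda>n. \<integral>\<^sup>+\<tau>. ennreal (gauss (e n) \<tau> * (cmod (tft y \<tau>))\<^sup>2) \<partial>lborel)"
  by (intro nn_integral_liminf) simp
 also have "\<dots> \<le> liminf (\<lambda>n. ennreal (2 * pi * ?N))"
  by (intro Liminf_mono always_eventually allI weighted e(2))
 also have "\<dots> = ennreal (2 * pi * ?N)" by (simp add: Liminf_const)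
 finally show ?thesis .
qed

text \<open>
 A Gaussian weight in \<open>\<tau>\<close> turns the left side into the convolution of \<open>f\<close> with a narrow Gaussian, which
 tends to \<open>f t\<close> by continuity.
\<close>

lemma tft_inversion:
 fixes f :: "real \<Rightarrow> complex"
 assumes f: "integrable lborel f" and c: "continuous_on UNIV f" and B: "\<And>t. cmod (f t) \<le> B" and F: "integrable lborel (tft f)"
 shows "(\<integral>\<tau>. tft f \<tau> * cis (\<tau> * t) \<partial>lborel) = 2 * pi * f t"
proof -
 define e where "e n = inverse (real (Suc n))" for n
 have e: "e \<longlonglongrightarrow> 0" "0 < e n" for n unfolding e_def by (rule LIMSEQ_inverse_real_of_nat) simp
 have [measurable]: "f \<in> borel_measurable borel" using f by (auto dest: borel_measurable_integrable)
 have g1: "(\<lambda>n. gauss (e n) x) \<longlonglongrightarrow> 1" for x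
 proof -
  have "(\<lambda>n. exp (- (e n * x)\<^sup>2 / 2)) \<longlonglongrightarrow> exp (- (0 * x)\<^sup>2 / 2)"
   by (intro tendsto_intros e(1)) simp
  then show ?thesis by (simp add: gauss_def)
 qed
 have L: "(\<lambda>n. \<integral>\<tau>. of_real (gauss (e n) \<tau>) * (tft f \<tau> * cis (\<tau> * t)) \<partial>lborel) \<longlonglongrightarrow> (\<integral>\<tau>. tft f \<tau> * cis (\<tau> * t) \<partial>lborel)"
 proof (rule integral_dominated_convergence[OF _ _ integrable_norm[OF F]])
  show "AE \<tau> in lborel. (\<lambda>n. of_real (gauss (e n) \<tau>) * (tft f \<tau> * cis (\<tau> * t))) \<longlonglongrightarrow> tft f \<tau> * cis (\<tau> * t)"
  proof (rule AE_I2)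
   fix \<tau>
   have "(\<lambda>n. of_real (gauss (e n) \<tau>) * (tft f \<tau> * cis (\<tau> * t))) \<longlonglongrightarrow> of_real 1 * (tft f \<tau> * cis (\<tau> * t))"
    by (intro tendsto_intros g1)
   then show "(\<lambda>n. of_real (gauss (e n) \<tau>) * (tft f \<tau> * cis (\<tau> * t))) \<longlonglongrightarrow> tft f \<tau> * cis (\<tau> * t)" by simp
  qed
  show "AE \<tau> in lborel. norm (of_real (gauss (e n) \<tau>) * (tft f \<tau> * cis (\<tau> * t))) \<le> norm (tft f \<tau>)" for n
   using gauss_bounds[of "e n"] by (intro AE_I2) (simp add: norm_mult mult_left_le_one_le less_imp_le)
 qed simp_all
 have R: "(\<integral>\<tau>. of_real (gauss (e n) \<tau>) * (tft f \<tau> * cis (\<tau> * t)) \<partial>lborel) =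
   (\<integral>x. of_real (sqrt (2 * pi) * gauss 1 x) * f (t + e n * x) \<partial>lborel)" for n
 proof -
  have gi: "integrable lborel (\<lambda>\<tau>. complex_of_real (gauss (e n) \<tau>) * cis (\<tau> * t))"
   by (rule integrable_bounded_times[of _ _ _ 1]) (use gauss_transform(1)[OF e(2)] in auto)
  have ph: "(\<lambda>p. cis (- (fst p * snd p))) \<in> borel_measurable (lborel \<Otimes>\<^sub>M (lborel :: real measure))" by measurable
  have "(\<integral>\<tau>. of_real (gauss (e n) \<tau>) * (tft f \<tau> * cis (\<tau> * t)) \<partial>lborel) =
    (\<integral>\<tau>. of_real (gauss (e n) \<tau>) * cis (\<tau> * t) * (\<integral>s. f s * cis (- (\<tau> * s)) \<partial>lborel) \<partial>lborel)"
   by (simp add: tft_def mult_ac)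
  also have "\<dots> = (\<integral>s. f s * (\<integral>\<tau>. of_real (gauss (e n) \<tau>) * cis (\<tau> * t) * cis (- (\<tau> * s)) \<partial>lborel) \<partial>lborel)"
   by (rule Fubini_phase(1)[OF gi f ph]) simp
  also have "\<dots> = (\<integral>s. f s * of_real (sqrt (2 * pi) / e n * gauss (1 / e n) (t - s)) \<partial>lborel)"
  proof -
   have "(\<integral>\<tau>. of_real (gauss (e n) \<tau>) * cis (\<tau> * t) * cis (- (\<tau> * s)) \<partial>lborel) =
     (\<integral>\<tau>. of_real (gauss (e n) \<tau>) * cis ((t - s) * \<tau>) \<partial>lborel)" for s
   proof -
    have "cis (\<tau> * t) * cis (- (\<tau> * s)) = cis ((t - s) * \<tau>)" for \<tau> by (simp add: cis_mult algebra_simps)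
    then show ?thesis by (simp only: mult.assoc)
   qed
   then show ?thesis by (simp only: gauss_transform(2)[OF e(2)])
  qed
  also have "\<dots> = \<bar>e n\<bar> *\<^sub>R (\<integral>x. f (t + e n * x) * of_real (sqrt (2 * pi) / e n * gauss (1 / e n) (t - (t + e n * x))) \<partial>lborel)"
   using e(2)[of n] by (intro lborel_integral_real_affine) simp
  also have "\<dots> = (\<integral>x. of_real (sqrt (2 * pi) * gauss 1 x) * f (t + e n * x) \<partial>lborel)"
   using e(2)[of n] by (subst integral_scaleR_right[symmetric]) (simp add: gauss_def scaleR_conv_of_real mult_ac)
  finally show ?thesis .
 qed
 have "(\<lambda>n. \<integral>x. of_real (sqrt (2 * pi) * gauss 1 x) * f (t + e n * x) \<partial>lborel) \<longlonglongrightarrow>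
   (\<integral>x. of_real (sqrt (2 * pi) * gauss 1 x) * f t \<partial>lborel)"
 proof (rule integral_dominated_convergence)
  show "integrable lborel (\<lambda>x. sqrt (2 * pi) * gauss 1 x * B)"
   using gauss_transform(1)[of 1] by simp
  show "AE x in lborel. (\<lambda>n. of_real (sqrt (2 * pi) * gauss 1 x) * f (t + e n * x)) \<longlonglongrightarrow> of_real (sqrt (2 * pi) * gauss 1 x) * f t"
  proof (rule AE_I2)
   fix x
   have "(\<lambda>n. t + e n * x) \<longlonglongrightarrow> t + 0 * x" by (intro tendsto_intros e(1))
   then have "(\<lambda>n. t + e n * x) \<longlonglongrightarrow> t" by simp
   from continuous_on_tendsto_compose[OF c this]
   show "(\<lambda>n. of_real (sqrt (2 * pi) * gauss 1 x) * f (t + e n * x)) \<longlonglongrightarrow> of_real (sqrt (2 * pi) * gauss 1 x) * f t"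
    by (intro tendsto_intros) auto
  qed
  show "AE x in lborel. norm (of_real (sqrt (2 * pi) * gauss 1 x) * f (t + e n * x)) \<le> sqrt (2 * pi) * gauss 1 x * B" for n
   using B gauss_bounds(1)[of 1] by (intro AE_I2) (simp add: norm_mult abs_mult mult_left_mono less_imp_le)
 qed simp_all
 then have "(\<integral>\<tau>. tft f \<tau> * cis (\<tau> * t) \<partial>lborel) = (\<integral>x. of_real (sqrt (2 * pi) * gauss 1 x) * f t \<partial>lborel)"
  using L unfolding R by (rule LIMSEQ_unique[rotated])
 also have "\<dots> = of_real (\<integral>x. sqrt (2 * pi) * gauss 1 x \<partial>lborel) * f t"
  by (simp only: integral_mult_left_zero integral_complex_of_real)
 also have "(\<integral>x. sqrt (2 * pi) * gauss 1 x \<partial>lborel) = 2 * pi" using gauss_integral[of 1] by simp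
 finally show ?thesis by simp
qed

lemma tft_swap:
 assumes f: "integrable lborel f" and g: "integrable lborel g"
 shows "(\<integral>\<tau>. f \<tau> * tft g (- \<tau>) \<partial>lborel) = (\<integral>t. g t * (\<integral>\<tau>. f \<tau> * cis (\<tau> * t) \<partial>lborel) \<partial>lborel)"
proof -
 have ph: "(\<lambda>p. cis (fst p * snd p)) \<in> borel_measurable (lborel \<Otimes>\<^sub>M (lborel :: real measure))" by measurable
 have "(\<integral>\<tau>. f \<tau> * (\<integral>t. g t * cis (\<tau> * t) \<partial>lborel) \<partial>lborel) = (\<integral>t. g t * (\<integral>\<tau>. f \<tau> * cis (\<tau> * t) \<partial>lborel) \<partial>lborel)"
  by (rule Fubini_phase(1)[OF f g ph]) simp
 then show ?thesis by (simp add: tft_def)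
qed

lemma tft_Parseval:
 fixes f g :: "real \<Rightarrow> complex"
 assumes f: "integrable lborel f" and g: "integrable lborel g" "continuous_on UNIV g" "\<And>t. cmod (g t) \<le> B" "integrable lborel (tft g)"
 shows "(\<integral>\<tau>. tft f \<tau> * tft g (- \<tau>) \<partial>lborel) = 2 * pi * (\<integral>t. f t * g t \<partial>lborel)"
proof -
 have "(\<integral>\<tau>. tft f \<tau> * tft g (- \<tau>) \<partial>lborel) = (\<integral>\<tau>. tft f (0 + (- 1) * \<tau>) * tft g (- (0 + (- 1) * \<tau>)) \<partial>lborel)"
  using lborel_integral_real_affine[of "- 1" "\<lambda>\<tau>. tft f \<tau> * tft g (- \<tau>)" 0] by simp
 also have "\<dots> = (\<integral>\<tau>. tft g \<tau> * tft f (- \<tau>) \<partial>lborel)" by (simp add: mult.commute)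
 also have "\<dots> = (\<integral>t. f t * (\<integral>\<tau>. tft g \<tau> * cis (\<tau> * t) \<partial>lborel) \<partial>lborel)" by (rule tft_swap[OF g(4) f])
 also have "\<dots> = (\<integral>t. 2 * pi * (f t * g t) \<partial>lborel)" unfolding tft_inversion[OF g] by (simp add: mult_ac)
 also have "\<dots> = 2 * pi * (\<integral>t. f t * g t \<partial>lborel)" by simp
 finally show ?thesis .
qed

section \<open>Test functions\<close>

text \<open>
 The derivatives of \<open>exp (- c / t)\<close>, extended by zero, are combinations of such functions.
\<close>

definition flatf :: "real \<Rightarrow> nat \<Rightarrow> real \<Rightarrow> real" where
 "flatf c i t = (if 0 < t then (1 / t) ^ i * exp (- c / t) else 0)"

lemma power_le_fact_exp:
 fixes x :: real
 assumes "0 \<le> x"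
 shows "x ^ n \<le> fact n * exp x"
proof -
 have "x ^ n /\<^sub>R fact n = (\<Sum>k\<in>{n}. x ^ k /\<^sub>R fact k)" by simp
 also have "\<dots> \<le> (\<Sum>k. x ^ k /\<^sub>R fact k)"
  using assms by (intro sum_le_suminf summable_exp_generic) auto
 also have "\<dots> = exp x" by (simp add: exp_def)
 finally show ?thesis by (simp add: field_simps)
qed

lemma flatf_le: "0 < c \<Longrightarrow> \<bar>flatf c i t\<bar> \<le> fact (Suc i) / c ^ Suc i * \<bar>t\<bar>"
proof (cases "0 < t")
 case True
 assume c: "0 < c"
 have "(c / t) ^ Suc i \<le> fact (Suc i) * exp (c / t)"
  using True c by (intro power_le_fact_exp) auto
 then have "exp (- c / t) * (c / t) ^ Suc i \<le> exp (- c / t) * (fact (Suc i) * exp (c / t))"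
  by (intro mult_left_mono) auto
 also have "\<dots> = fact (Suc i) * (exp (- c / t) * exp (c / t))" by (simp only: mult_ac)
 also have "exp (- c / t) * exp (c / t) = 1" by (simp flip: exp_add)
 finally have "exp (- c / t) * (c / t) ^ Suc i / c ^ Suc i \<le> fact (Suc i) / c ^ Suc i"
  using c by (intro divide_right_mono) auto
 moreover have "exp (- c / t) * (c / t) ^ Suc i / c ^ Suc i = (1 / t) ^ Suc i * exp (- c / t)"
  using c by (simp only: power_divide) simp
 ultimately have "(1 / t) ^ Suc i * exp (- c / t) \<le> fact (Suc i) / c ^ Suc i" by simp
 then have "t * ((1 / t) ^ Suc i * exp (- c / t)) \<le> t * (fact (Suc i) / c ^ Suc i)"
  using True by (intro mult_left_mono) auto
 then show ?thesis using True by (simp add: flatf_def mult_ac)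
next
 case False
 assume c: "0 < c"
 have "0 \<le> fact (Suc i) / c ^ Suc i * \<bar>t\<bar>"
  using c by (intro mult_nonneg_nonneg divide_nonneg_pos zero_less_power abs_ge_zero) auto
 then show ?thesis using False by (simp only: flatf_def if_False abs_zero)
qed

lemma flatf_has_derivative:
 assumes c: "0 < c"
 shows "(flatf c i has_real_derivative (- real i * flatf c (Suc i) t + c * flatf c (i + 2) t)) (at t)"
proof -
 consider "0 < t" | "t < 0" | "t = 0" by linarith
 then show ?thesis
 proof cases
  case 1
  have "((\<lambda>t. (1 / t) ^ i * exp (- c / t)) has_real_derivative
    (- real i * ((1 / t) ^ Suc i * exp (- c / t)) + c * ((1 / t) ^ (i + 2) * exp (- c / t)))) (at t)"
  proof -
   have "((\<lambda>t. 1 / t) has_real_derivative - ((1 / t)\<^sup>2)) (at t)"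
    using 1 by (auto intro!: derivative_eq_intros simp: power2_eq_square)
   from DERIV_power[OF this, of i]
   have P: "((\<lambda>t. (1 / t) ^ i) has_real_derivative - (real i * (1 / t) ^ Suc i)) (at t)"
    by (rule DERIV_cong) (cases i; simp add: power2_eq_square)
   have E: "((\<lambda>t. exp (- c / t)) has_real_derivative exp (- c / t) * (c * (1 / t)\<^sup>2)) (at t)"
    using 1 by (auto intro!: derivative_eq_intros simp: power2_eq_square)
   show ?thesis
    by (rule DERIV_cong[OF DERIV_mult[OF P E]]) (simp add: power_add power2_eq_square algebra_simps)
  qed
  then show ?thesis
   by (rule has_field_derivative_transform_within_open[of _ _ _ "{0<..}", THEN DERIV_cong]) (use 1 in \<open>auto simp: flatf_def\<close>)
 next
  case 2
  have "((\<lambda>t. 0) has_real_derivative 0) (at t)" by simp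
  then show ?thesis
   by (rule has_field_derivative_transform_within_open[of _ _ _ "{..<0}", THEN DERIV_cong]) (use 2 in \<open>auto simp: flatf_def\<close>)
 next
  case 3
  let ?K = "fact (Suc (Suc i)) / c ^ Suc (Suc i)"
  have q: "(flatf c i h - flatf c i 0) / (h - 0) = flatf c (Suc i) h" for h
   by (simp add: flatf_def)
  have "((\<lambda>h. flatf c (Suc i) h) \<longlongrightarrow> 0) (at 0)"
  proof (rule Lim_null_comparison)
   show "\<forall>\<^sub>F h in at 0. norm (flatf c (Suc i) h) \<le> ?K * \<bar>h\<bar>"
    unfolding real_norm_def by (intro always_eventually allI flatf_le c)
   have "((\<lambda>h. ?K * \<bar>h\<bar>) \<longlongrightarrow> ?K * \<bar>0\<bar>) (at 0)" by (intro tendsto_intros)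
   then show "((\<lambda>h. ?K * \<bar>h\<bar>) \<longlongrightarrow> 0) (at 0)" by simp
  qed
  then show ?thesis unfolding 3 has_field_derivative_iff q by (simp add: flatf_def)
 qed
qed

text \<open>
 Linear combinations of \<open>t\<^sup>k (t-a)\<^sup>-\<^sup>i (b-t)\<^sup>-\<^sup>j exp(-c/(t-a) - c/(b-t))\<close> on \<open>(a, b)\<close>, extended by zero: they are
 closed under differentiation, hence smooth, and still approximate all functions on \<open>(a, b)\<close> as \<open>c \<rightarrow> 0\<close>.
\<close>

inductive_set bumps :: "real \<Rightarrow> real \<Rightarrow> real \<Rightarrow> (real \<Rightarrow> complex) set" for a b c where
 mono: "(\<lambda>t. of_real (t ^ k * flatf c i (t - a) * flatf c j (b - t))) \<in> bumps a b c"
| lin: "f \<in> bumps a b c \<Longrightarrow> g \<in> bumps a b c \<Longrightarrow> (\<lambda>t. z * f t + w * g t) \<in> bumps a b c"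

lemma bumps_support: "f \<in> bumps a b c \<Longrightarrow> f t \<noteq> 0 \<Longrightarrow> a \<le> t \<and> t \<le> b"
proof (induction arbitrary: t rule: bumps.induct)
 case (lin f g z w)
 then have "f t \<noteq> 0 \<or> g t \<noteq> 0" by auto
 with lin.IH show ?case by blast
qed (auto simp: flatf_def split: if_splits)

lemma bumps_derivative:
 assumes c: "0 < c"
 shows "f \<in> bumps a b c \<Longrightarrow> \<exists>f'\<in>bumps a b c. \<forall>t. (f has_vector_derivative f' t) (at t)"
proof (induction rule: bumps.induct)
 case (mono k i j)
 let ?m = "\<lambda>k i j t. t ^ k * flatf c i (t - a) * flatf c j (b - t)"
 define f' where "f' t = real k * ?m (k - 1) i j t + (- real i * ?m k (Suc i) j t + c * ?m k (i + 2) j t)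
   - (- real j * ?m k i (Suc j) t + c * ?m k i (j + 2) t)" for t
 have "((\<lambda>t. ?m k i j t) has_real_derivative f' t) (at t)" for t
 proof -
  have 1: "((\<lambda>t. flatf c i (t - a)) has_real_derivative (- real i * flatf c (Suc i) (t - a) + c * flatf c (i + 2) (t - a)) * 1) (at t)"
   by (rule DERIV_chain2[OF flatf_has_derivative[OF c]]) (auto intro!: derivative_eq_intros)
  have 2: "((\<lambda>t. flatf c j (b - t)) has_real_derivative (- real j * flatf c (Suc j) (b - t) + c * flatf c (j + 2) (b - t)) * (- 1)) (at t)"
   by (rule DERIV_chain2[OF flatf_has_derivative[OF c]]) (auto intro!: derivative_eq_intros)
  have 3: "((\<lambda>t. t ^ k) has_real_derivative real k * t ^ (k - 1)) (at t)"
   using DERIV_pow[of k t] by simp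
  show ?thesis
   by (rule DERIV_cong[OF DERIV_mult[OF DERIV_mult[OF 3 1] 2]]) (simp add: f'_def algebra_simps)
 qed
 then have d: "((\<lambda>t. complex_of_real (?m k i j t)) has_vector_derivative of_real (f' t)) (at t)" for t
  by (intro has_vector_derivative_of_real) (simp add: has_real_derivative_iff_has_vector_derivative)
 have m: "(\<lambda>t. complex_of_real (f' t)) \<in> bumps a b c"
 proof -
  have "(\<lambda>t. complex_of_real (f' t)) = (\<lambda>t. 1 * (of_nat k * of_real (?m (k - 1) i j t)
    + 1 * (- of_nat i * of_real (?m k (Suc i) j t) + of_real c * of_real (?m k (i + 2) j t)))
    + (- 1) * (- of_nat j * of_real (?m k i (Suc j) t) + of_real c * of_real (?m k i (j + 2) t)))"
   by (simp add: f'_def fun_eq_iff)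
  also have "\<dots> \<in> bumps a b c" by (intro bumps.intros)
  finally show ?thesis .
 qed
 show ?case by (rule bexI[OF _ m]) (intro allI d)
next
 case (lin f g z w)
 then obtain f' g' where "f' \<in> bumps a b c" "\<And>t. (f has_vector_derivative f' t) (at t)"
  "g' \<in> bumps a b c" "\<And>t. (g has_vector_derivative g' t) (at t)" by auto
 then show ?case
  by (intro bexI[of _ "\<lambda>t. z * f' t + w * g' t"])
    (auto intro!: bumps.lin has_vector_derivative_add has_vector_derivative_mult_right)
qed

lemma bumps_continuous: "0 < c \<Longrightarrow> f \<in> bumps a b c \<Longrightarrow> continuous_on S f"
 using bumps_derivative has_vector_derivative_continuous continuous_at_imp_continuous_on by metis

definition tensor :: "(real \<Rightarrow> complex) \<Rightarrow> int \<times> int \<Rightarrow> real \<times> real \<times> real \<Rightarrow> complex" where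
 "tensor f n p = f (fst p) * ech n (snd p)"

lemma smooth_tensor_bump:
 assumes c: "0 < c" and f: "f \<in> bumps a b c"
 shows "smooth (tensor f n)"
proof (rule smooth_coinduct[of _ "{tensor f n |f. f \<in> bumps a b c}"])
 have D: "\<exists>f'\<in>bumps a b c. \<forall>p. (tensor f n has_derivative (\<lambda>h. tensor (\<lambda>t. of_real (fst h) * f' t + \<i> * of_real (freq n \<bullet> snd h) * f t) n p)) (at p)"
  if f: "f \<in> bumps a b c" for f
 proof -
  obtain f' where f': "f' \<in> bumps a b c" "\<And>t. (f has_vector_derivative f' t) (at t)"
   using bumps_derivative[OF c f] by auto
  have "(tensor f n has_derivative (\<lambda>h. tensor (\<lambda>t. of_real (fst h) * f' t + \<i> * of_real (freq n \<bullet> snd h) * f t) n p)) (at p)" for p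
  proof -
   have 1: "((\<lambda>p. f (fst p)) has_derivative (\<lambda>h. fst h *\<^sub>R f' (fst p))) (at p)"
    by (rule has_derivative_compose[OF has_derivative_fst[OF has_derivative_ident]])
     (use f'(2)[of "fst p"] in \<open>simp add: has_vector_derivative_def\<close>)
   have 2: "((\<lambda>p. ech n (snd p)) has_derivative (\<lambda>h. \<i> * of_real (freq n \<bullet> snd h) * ech n (snd p))) (at p)"
    by (rule has_derivative_compose[OF has_derivative_snd[OF has_derivative_ident] ech_has_derivative])
   show ?thesis
    unfolding tensor_def[abs_def]
    by (rule has_derivative_eq_rhs[OF has_derivative_mult[OF 1 2]]) (simp add: fun_eq_iff scaleR_conv_of_real algebra_simps)
  qed
  with f' show ?thesis by blast
 qed
 show "tensor f n \<in> {tensor f n |f. f \<in> bumps a b c}" using f by blast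
 fix F assume "F \<in> {tensor f n |f. f \<in> bumps a b c}"
 then obtain f where F: "F = tensor f n" "f \<in> bumps a b c" by blast
 from D[OF F(2)] obtain f' where f': "f' \<in> bumps a b c"
  "\<And>p. (F has_derivative (\<lambda>h. tensor (\<lambda>t. of_real (fst h) * f' t + \<i> * of_real (freq n \<bullet> snd h) * f t) n p)) (at p)"
  unfolding F(1) by blast
 show "F differentiable_on UNIV" using f'(2) by (auto simp: differentiable_on_def differentiable_def)
 fix v
 have "(\<lambda>p. frechet_derivative F (at p) v) = tensor (\<lambda>t. of_real (fst v) * f' t + \<i> * of_real (freq n \<bullet> snd v) * f t) n"
  by (rule ext) (simp only: frechet_derivative_at[OF f'(2), symmetric])
 moreover have "(\<lambda>t. of_real (fst v) * f' t + \<i> * of_real (freq n \<bullet> snd v) * f t) \<in> bumps a b c"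
  by (intro bumps.lin f' F)
 ultimately show "(\<lambda>p. frechet_derivative F (at p) v) \<in> {tensor f n |f. f \<in> bumps a b c}" by blast
qed

lemma dderiv_time_support:
 fixes f :: "real \<times> real \<times> real \<Rightarrow> complex"
 assumes f: "smooth f" and s: "\<And>p. f p \<noteq> 0 \<Longrightarrow> a \<le> fst p \<and> fst p \<le> b"
 shows "dderiv vs f p \<noteq> 0 \<Longrightarrow> a \<le> fst p \<and> fst p \<le> b"
proof (induction vs arbitrary: p)
 case (Cons v vs)
 show ?case
 proof (rule ccontr)
  assume p: "\<not> (a \<le> fst p \<and> fst p \<le> b)"
  have op: "open {p :: real \<times> real \<times> real. \<not> (a \<le> fst p \<and> fst p \<le> b)}"
   unfolding not_le de_Morgan_conj by (intro open_Collect_disj open_Collect_less continuous_intros)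
  have "((\<lambda>p. 0 :: complex) has_derivative (\<lambda>h. 0)) (at p)" by simp
  then have "(dderiv vs f has_derivative (\<lambda>h. 0)) (at p)"
   by (rule has_derivative_transform_within_open[OF _ op]) (use p Cons.IH in auto)
  then have "frechet_derivative (dderiv vs f) (at p) = (\<lambda>h. 0)" by (rule frechet_derivative_at[symmetric])
  with Cons.prems show False by simp
 qed
qed (use s in auto)

lemma periodic_slice:
 assumes "\<And>p. g (p + (0, 2 * pi, 0)) = g p" "\<And>p. g (p + (0, 0, 2 * pi)) = g p"
 shows "periodic (\<lambda>x. g (t :: real, x))"
 unfolding periodic_def
proof (intro allI conjI)
 show "g (t, x + 2 * pi, y) = g (t, x, y)" "g (t, x, y + 2 * pi) = g (t, x, y)" for x y
  using assms[of "(t, x, y)"] by simp_all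
qed

text \<open>
 Compact support in time and periodicity in space leave a compact set, on which derivatives are bounded.
\<close>

lemma schwartz_of_compact_support:
 assumes f: "smooth f" and per: "\<And>t. periodic (\<lambda>x. f (t, x))" and s: "\<And>p. f p \<noteq> 0 \<Longrightarrow> a \<le> fst p \<and> fst p \<le> b"
 shows "f \<in> schwartz"
proof -
 have "\<exists>C. \<forall>t x. \<bar>t\<bar> ^ m * cmod (dderiv vs f (t, x)) \<le> C" for vs m
 proof -
  have "compact ({a..b} \<times> cell)" by (intro compact_Times compact_cell) auto
  then have "bounded ((\<lambda>p. complex_of_real (\<bar>fst p\<bar> ^ m) * dderiv vs f p) ` ({a..b} \<times> cell))"
   by (intro compact_imp_bounded compact_continuous_image continuous_intros smooth_continuous smooth_dderiv f)
  then obtain C where C: "0 < C" "\<And>p. p \<in> {a..b} \<times> cell \<Longrightarrow> cmod (complex_of_real (\<bar>fst p\<bar> ^ m) * dderiv vs f p) \<le> C"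
   unfolding bounded_pos by blast
  have "\<bar>t\<bar> ^ m * cmod (dderiv vs f (t, x)) \<le> C" for t x
  proof (cases "dderiv vs f (t, x) = 0")
   case False
   then have t: "t \<in> {a..b}" using dderiv_time_support[OF f s, where vs = vs and p = "(t, x)"] by auto
   have "f (p + (0, 2 * pi, 0)) = f p" "f (p + (0, 0, 2 * pi)) = f p" for p
    using per[of "fst p"] by (cases p; auto simp: periodic_def)+
   then have "dderiv vs f (p + (0, 2 * pi, 0)) = dderiv vs f p" "dderiv vs f (p + (0, 0, 2 * pi)) = dderiv vs f p" for p
    by (intro dderiv_translation_invariant[OF f]; blast)+
   then have "periodic (\<lambda>x. dderiv vs f (t, x))" by (rule periodic_slice)
   moreover obtain k l where "(fst x + 2 * pi * of_int k, snd x + 2 * pi * of_int l) \<in> cell" using ex_shift_into_cell by blast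
   ultimately obtain y where y: "y \<in> cell" "dderiv vs f (t, x) = dderiv vs f (t, y)"
    using periodic_shift_int[of "\<lambda>x. dderiv vs f (t, x)" "fst x" k "snd x" l] by auto
   have "cmod (complex_of_real (\<bar>t\<bar> ^ m) * dderiv vs f (t, y)) \<le> C" using C(2)[of "(t, y)"] t y by auto
   then show ?thesis by (simp add: norm_mult norm_power y)
  qed (use C in simp)
  then show ?thesis by blast
 qed
 with f per show ?thesis by (simp add: schwartz_def)
qed

lemma tensor_bump_schwartz:
 assumes "0 < c" "f \<in> bumps a b c"
 shows "tensor f n \<in> schwartz"
proof (rule schwartz_of_compact_support[where a = a and b = b])
 show "smooth (tensor f n)" by (rule smooth_tensor_bump[OF assms])
 show "periodic (\<lambda>x. tensor f n (t, x))" for t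
  using periodic_ech[of "f t" n] by (simp add: tensor_def)
 show "tensor f n p \<noteq> 0 \<Longrightarrow> a \<le> fst p \<and> fst p \<le> b" for p
  using bumps_support[OF assms(2)] by (auto simp: tensor_def)
qed

lemma tensor_bump_st_test:
 assumes "0 < c" "f \<in> bumps a b c" "0 < a" "b < T"
 shows "tensor f n \<in> st_test T"
proof -
 have "smooth (tensor f n)" by (rule smooth_tensor_bump[OF assms(1,2)])
 moreover have "periodic (\<lambda>x. tensor f n (t, x))" for t
  using periodic_ech[of "f t" n] by (simp add: tensor_def)
 moreover have "\<forall>t x. tensor f n (t, x) \<noteq> 0 \<longrightarrow> a \<le> t \<and> t \<le> b"
  using bumps_support[OF assms(2)] by (auto simp: tensor_def)
 ultimately show ?thesis using assms(3,4) unfolding st_test_def by blast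
qed

lemma st_test_schwartz: "\<phi> \<in> st_test T \<Longrightarrow> \<phi> \<in> schwartz"
proof -
 assume "\<phi> \<in> st_test T"
 then obtain a b where *: "smooth \<phi>" "\<And>t. periodic (\<lambda>x. \<phi> (t, x))" "\<forall>t x. \<phi> (t, x) \<noteq> 0 \<longrightarrow> a \<le> t \<and> t \<le> b"
  unfolding st_test_def by blast
 have "a \<le> fst p \<and> fst p \<le> b" if "\<phi> p \<noteq> 0" for p using *(3)[rule_format, of "fst p" "snd p"] that by simp
 then show ?thesis using *(1,2) by (intro schwartz_of_compact_support[where a = a and b = b])
qed

lemma schwartz_dderiv: "f \<in> schwartz \<Longrightarrow> dderiv us f \<in> schwartz"
proof -
 assume f: "f \<in> schwartz"
 have sm: "smooth f" using f by (simp add: schwartz_def)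
 have "f (p + (0, 2 * pi, 0)) = f p" "f (p + (0, 0, 2 * pi)) = f p" for p
  using f by (cases p; auto simp: schwartz_def periodic_def)+
 then have "dderiv us f (p + (0, 2 * pi, 0)) = dderiv us f p" "dderiv us f (p + (0, 0, 2 * pi)) = dderiv us f p" for p
  by (intro dderiv_translation_invariant[OF sm]; blast)+
 then have "periodic (\<lambda>x. dderiv us f (t, x))" for t by (rule periodic_slice)
 moreover have "\<forall>vs m. \<exists>C. \<forall>t x. \<bar>t\<bar> ^ m * cmod (dderiv vs (dderiv us f) (t, x)) \<le> C"
  using f unfolding schwartz_def dderiv_append[symmetric] by blast
 ultimately show ?thesis using smooth_dderiv[OF sm] by (simp add: schwartz_def)
qed

lemma dderiv_slice:
 assumes f: "smooth (f :: real \<times> real \<times> real \<Rightarrow> complex)"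
 shows "dderiv vs (\<lambda>x. f (t, x)) = (\<lambda>x. dderiv (map (\<lambda>v. (0, v)) vs) f (t, x))"
proof (induction vs)
 case (Cons v vs)
 have "((\<lambda>x. dderiv (map (\<lambda>v. (0, v)) vs) f (t, x)) has_derivative
   (\<lambda>h. frechet_derivative (dderiv (map (\<lambda>v. (0, v)) vs) f) (at (t, x)) (0, h))) (at x)" for x
  by (rule has_derivative_compose[of "\<lambda>x. (t, x)" "\<lambda>h. (0, h)", OF _ smooth_has_derivative[OF smooth_dderiv[OF f]]])
   (auto intro!: derivative_eq_intros)
 from dderiv_Cons_eq[OF Cons this] show ?case by simp
qed simp

lemma schwartz_slice: "f \<in> schwartz \<Longrightarrow> (\<lambda>x. f (t, x)) \<in> torus_test"
proof -
 assume f: "f \<in> schwartz"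
 then have sm: "smooth f" by (simp add: schwartz_def)
 have "smooth (\<lambda>x. f (t, x))"
  unfolding smooth_def dderiv_slice[OF sm]
 proof
  fix vs :: "(real \<times> real) list"
  have "((\<lambda>x. dderiv (map (\<lambda>v. (0, v)) vs) f (t, x)) has_derivative
   (\<lambda>h. frechet_derivative (dderiv (map (\<lambda>v. (0, v)) vs) f) (at (t, x)) (0, h))) (at x)" for x
   by (rule has_derivative_compose[of "\<lambda>x. (t, x)" "\<lambda>h. (0, h)", OF _ smooth_has_derivative[OF smooth_dderiv[OF sm]]])
    (auto intro!: derivative_eq_intros)
  then show "(\<lambda>x. dderiv (map (\<lambda>v. (0, v)) vs) f (t, x)) differentiable_on UNIV"
   unfolding differentiable_on_def differentiable_def by auto
 qed
 then show ?thesis using f by (simp add: torus_test_def schwartz_def)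
qed

section \<open>Decay of the space-time Fourier transform\<close>

lemma jbracket_real_sq: "(jbracket (t :: real))\<^sup>2 = 1 + t\<^sup>2"
 by (simp add: jbracket_def)

lemma jbracket_powr_minus2: "jbracket (t :: real) powr (- 2) = 1 / (1 + t\<^sup>2)"
 by (simp add: powr_minus_divide jbracket_real_sq)

lemma jbracket_measurable [measurable]: "jbracket \<in> borel_measurable (borel :: real measure)"
 unfolding jbracket_def[abs_def] by measurable

lemma jbracket_powr_integrable:
 assumes p: "1 < p"
 shows "integrable lborel (\<lambda>t :: real. jbracket t powr (- p))"
proof -
 define g where "g t = indicator {1..} t *\<^sub>R (t powr (- p))" for t :: real
 have "set_integrable lebesgue {1..} (\<lambda>t::real. t powr (- p))"
  using p has_integral_powr_to_inf[of "- p" 1]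
  by (intro nonnegative_absolutely_integrable_1) (auto simp: integrable_on_def)
 then have g: "integrable lborel g" by (simp add: set_integrable_def integrable_completion g_def[abs_def])
 from lborel_integrable_real_affine[OF this, of "- 1" 0] have g': "integrable lborel (\<lambda>t. g (- t))" by simp
 show ?thesis
 proof (rule Bochner_Integration.integrable_bound)
  show "integrable lborel (\<lambda>t. indicator {- 1..1} t + (g t + g (- t)))"
   by (intro Bochner_Integration.integrable_add g g' integrable_real_indicator) auto
  show "AE t in lborel. norm (jbracket t powr (- p)) \<le> norm (indicator {- 1..1} t + (g t + g (- t)))"
  proof (rule AE_I2)
   fix t :: real
   have 0: "0 \<le> g t" "0 \<le> g (- t)" by (auto simp: g_def)
   have a: "jbracket t powr (- p) \<le> \<bar>t\<bar> powr (- p)" if "t \<noteq> 0"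
    using that p by (intro powr_mono2') (auto simp: jbracket_def real_le_rsqrt)
   have 1: "jbracket t powr (- p) \<le> 1"
    using powr_mono2'[of "- p" 1 "jbracket t"] jbracket_ge_one[of t] p by simp
   consider "\<bar>t\<bar> \<le> 1" | "1 < t" | "t < - 1" by linarith
   then have "jbracket t powr (- p) \<le> indicator {- 1..1} t + (g t + g (- t))"
   proof cases
    case c: 1
    then have "- 1 \<le> t \<and> t \<le> 1" by linarith
    then have "indicator {- 1..1} t = (1 :: real)" by (simp add: indicator_def)
    then show ?thesis using 0 1 by linarith
   next
    case c: 2
    then have "g t = \<bar>t\<bar> powr (- p)" "0 \<le> (indicator {- 1..1} t :: real)" by (auto simp: g_def)
    then show ?thesis using 0 a c by linarith
   next
    case c: 3
    then have "g (- t) = \<bar>t\<bar> powr (- p)" "0 \<le> (indicator {- 1..1} t :: real)" by (auto simp: g_def)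
    then show ?thesis using 0 a c by linarith
   qed
   then show "norm (jbracket t powr (- p)) \<le> norm (indicator {- 1..1} t + (g t + g (- t)))" by simp
  qed
 qed measurable
qed

lemma schwartz_bound:
 assumes f: "f \<in> schwartz"
 shows "\<exists>C\<ge>0. \<forall>t x. cmod (f (t, x)) \<le> C * jbracket t powr (- 2)"
proof -
 obtain C0 where C0: "\<And>t x. \<bar>t\<bar> ^ 0 * cmod (dderiv [] f (t, x)) \<le> C0" using f unfolding schwartz_def by blast
 obtain C2 where C2: "\<And>t x. \<bar>t\<bar> ^ 2 * cmod (dderiv [] f (t, x)) \<le> C2" using f unfolding schwartz_def by blast
 have "cmod (f (t, x)) \<le> (C0 + C2) * jbracket t powr (- 2)" for t x
 proof -
  have "(1 + t\<^sup>2) * cmod (f (t, x)) \<le> C0 + C2" using C0[of t x] C2[of t x] by (simp add: distrib_right)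
  then show ?thesis unfolding jbracket_powr_minus2 by (simp add: field_simps sum_power2_gt_zero_iff add_pos_nonneg)
 qed
 moreover have "0 \<le> C0 + C2" using C0[of 0 0] C2[of 0 0] by (simp add: norm_ge_zero[THEN order_trans])
 ultimately show ?thesis by blast
qed

lemma schwartz_continuous: "f \<in> schwartz \<Longrightarrow> continuous_on S f"
 by (intro smooth_continuous) (simp add: schwartz_def)

definition xcoeff :: "(real \<times> real \<times> real \<Rightarrow> complex) \<Rightarrow> real \<Rightarrow> int \<times> int \<Rightarrow> complex" where
 "xcoeff f t n = fcoeff (\<lambda>x. f (t, x)) n"

lemma xcoeff_decay:
 assumes f: "f \<in> schwartz"
 shows "\<exists>C\<ge>0. \<forall>t n. cmod (xcoeff f t n) \<le> C * jbracket t powr (- 2) / jbracket (freq n) ^ k"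
proof -
 obtain C0 where C0: "C0 \<ge> 0" "\<And>t x. cmod (f (t, x)) \<le> C0 * jbracket t powr (- 2)" using schwartz_bound[OF f] by blast
 obtain C1 where C1: "C1 \<ge> 0" "\<And>t x. cmod (dderiv (replicate k (0, (1, 0))) f (t, x)) \<le> C1 * jbracket t powr (- 2)"
  using schwartz_bound[OF schwartz_dderiv[OF f]] by blast
 obtain C2 where C2: "C2 \<ge> 0" "\<And>t x. cmod (dderiv (replicate k (0, (0, 1))) f (t, x)) \<le> C2 * jbracket t powr (- 2)"
  using schwartz_bound[OF schwartz_dderiv[OF f]] by blast
 have sm: "smooth f" using f by (simp add: schwartz_def)
 define C where "C = C0 + C1 + C2"
 have le: "C0 * z \<le> C * z" "C1 * z \<le> C * z" "C2 * z \<le> C * z" if "0 \<le> z" for z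
  using that C0(1) C1(1) C2(1) by (auto intro!: mult_right_mono simp: C_def)
 have "cmod (xcoeff f t n) \<le> ((2 * pi)\<^sup>2 * 3 ^ k * C) * jbracket t powr (- 2) / jbracket (freq n) ^ k" for t n
 proof -
  let ?K = "C * jbracket t powr (- 2)"
  have "cmod (fcoeff (\<lambda>x. f (t, x)) n) \<le> (2 * pi)\<^sup>2 * 3 ^ k * ?K / jbracket (freq n) ^ k"
  proof (rule fcoeff_decay[OF schwartz_slice[OF f]])
   show "cmod (f (t, x)) \<le> ?K" for x by (rule order_trans[OF C0(2) le(1)]) simp
   fix x v :: "real \<times> real" assume v: "v \<in> Basis"
   consider "v = (1, 0)" | "v = (0, 1)" using v by (auto simp: Basis_prod_def)
   then show "cmod (dderiv (replicate k v) (\<lambda>x. f (t, x)) x) \<le> ?K"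
    unfolding dderiv_slice[OF sm] map_replicate
    by cases (simp_all only:, (rule order_trans[OF C1(2) le(2)] order_trans[OF C2(2) le(3)]; simp)+)
  qed
  then show ?thesis by (simp add: xcoeff_def mult_ac)
 qed
 moreover have "0 \<le> (2 * pi)\<^sup>2 * 3 ^ k * C" using C0(1) C1(1) C2(1) by (simp add: C_def)
 ultimately show ?thesis by blast
qed

lemma LINT_derivative_zero:
 fixes g g' :: "real \<Rightarrow> complex"
 assumes d: "\<And>t. (g has_vector_derivative g' t) (at t)" and c: "continuous_on UNIV g'"
  and g: "\<And>t. cmod (g t) \<le> C * jbracket t powr (- 2)" and i: "integrable lborel g'"
 shows "(\<integral>t. g' t \<partial>lborel) = 0"
proof (rule LIMSEQ_unique)
 show "(\<lambda>N. \<integral>t. indicator {- real N..real N} t *\<^sub>R g' t \<partial>lborel) \<longlonglongrightarrow> (\<integral>t. g' t \<partial>lborel)"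
 proof (rule integral_dominated_convergence[OF _ _ integrable_norm[OF i]])
  show "AE t in lborel. (\<lambda>N. indicator {- real N..real N} t *\<^sub>R g' t) \<longlonglongrightarrow> g' t"
  proof (intro AE_I2 tendsto_eventually)
   fix t :: real
   obtain N0 :: nat where "\<bar>t\<bar> \<le> N0" using real_arch_simple by blast
   then show "\<forall>\<^sub>F N in sequentially. indicator {- real N..real N} t *\<^sub>R g' t = g' t"
    by (intro eventually_sequentiallyI[of N0]) (auto simp: indicator_def abs_le_iff)
  qed
 qed (use i in \<open>auto simp: indicator_def\<close>)
 have eq: "(\<integral>t. indicator {- real N..real N} t *\<^sub>R g' t \<partial>lborel) = g (real N) - g (- real N)" for N
  by (rule integral_FTC_Icc) (auto intro: has_vector_derivative_at_within d continuous_on_subset[OF c])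
 have tail: "(\<lambda>N. C * (1 / (1 + (real N)\<^sup>2))) \<longlonglongrightarrow> 0"
 proof (rule tendsto_mult_right_zero, rule Lim_null_comparison)
  show "\<forall>\<^sub>F N in sequentially. norm (1 / (1 + (real N)\<^sup>2)) \<le> inverse (real (Suc N)) * 2"
  proof (intro always_eventually allI)
   fix N :: nat
   have "0 \<le> (real N - 1)\<^sup>2 + (real N)\<^sup>2" by simp
   then have "1 + real N \<le> 2 * (1 + (real N)\<^sup>2)" by (simp add: power2_eq_square algebra_simps)
   then show "norm (1 / (1 + (real N)\<^sup>2)) \<le> inverse (real (Suc N)) * 2"
    by (simp add: field_simps add_pos_nonneg)
  qed
  show "(\<lambda>N. inverse (real (Suc N)) * 2) \<longlonglongrightarrow> 0"
   by (rule tendsto_mult_left_zero[OF LIMSEQ_inverse_real_of_nat])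
 qed
 have "(\<lambda>N. g (real N)) \<longlonglongrightarrow> 0" "(\<lambda>N. g (- real N)) \<longlonglongrightarrow> 0"
  using g[of "real _"] g[of "- real _"] unfolding jbracket_powr_minus2
  by (intro Lim_null_comparison[OF always_eventually tail]; simp)+
 from tendsto_diff[OF this] show "(\<lambda>N. \<integral>t. indicator {- real N..real N} t *\<^sub>R g' t \<partial>lborel) \<longlonglongrightarrow> 0"
  unfolding eq by simp
qed

lemma st_fourier_Fubini:
 assumes f: "f \<in> schwartz"
 shows "st_fourier f \<tau> n = tft (\<lambda>t. xcoeff f t n) \<tau>"
  and "st_fourier f \<tau> n = (\<integral>x. indicator cell x *\<^sub>R (ech (- n) x * (\<integral>t. f (t, x) * cis (- (\<tau> * t)) \<partial>lborel)) \<partial>lborel)"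
  and "integrable lborel (\<lambda>t. xcoeff f t n)"
proof -
 obtain C where C: "C \<ge> 0" "\<And>t x. cmod (f (t, x)) \<le> C * jbracket t powr (- 2)" using schwartz_bound[OF f] by blast
 have fm: "f \<in> borel_measurable borel" by (intro borel_measurable_continuous_onI schwartz_continuous f)
 have j: "integrable lborel (\<lambda>t :: real. complex_of_real (C * jbracket t powr (- 2)))"
  by (intro integrable_of_real integrable_mult_right jbracket_powr_integrable) simp
 have ci: "integrable lborel (\<lambda>x. complex_of_real (indicator cell x))"
  by (intro integrable_of_real integrable_real_indicator emeasure_cell) simp
 define G where "G p = indicator cell (snd p) *\<^sub>R (f p * (cis (- (\<tau> * fst p)) * ech (- n) (snd p)))" for p
 have Gm: "G \<in> borel_measurable borel"
  unfolding G_def[abs_def]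
 proof (intro borel_measurable_scaleR borel_measurable_times fm)
  have "UNIV \<times> cell \<in> sets (borel :: (real \<times> real \<times> real) measure)" by (intro borel_closed closed_Times closed_UNIV compact_imp_closed compact_cell)
  then show "(\<lambda>p. indicator cell (snd p) :: real) \<in> borel_measurable (borel :: (real \<times> real \<times> real) measure)"
  proof -
   assume U: "UNIV \<times> cell \<in> sets (borel :: (real \<times> real \<times> real) measure)"
   have "(\<lambda>p. indicator cell (snd p) :: real) = indicator ((UNIV :: real set) \<times> cell)"
    by (auto simp: fun_eq_iff indicator_def)
   then show ?thesis using borel_measurable_indicator[OF U] by (simp only:)
  qed
  show "(\<lambda>p :: real \<times> real \<times> real. cis (- (\<tau> * fst p))) \<in> borel_measurable borel"
   unfolding cis_conv_exp by (intro borel_measurable_continuous_onI continuous_intros)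
  show "(\<lambda>p :: real \<times> real \<times> real. ech (- n) (snd p)) \<in> borel_measurable borel"
   by (intro borel_measurable_continuous_onI continuous_on_compose2[OF continuous_ech[of UNIV]] continuous_intros) auto
 qed
 have Gi: "integrable (lborel \<Otimes>\<^sub>M lborel) G"
 proof (rule Bochner_Integration.integrable_bound[OF integrable_lborel_mult_pair[OF j ci]])
  show "G \<in> borel_measurable (lborel \<Otimes>\<^sub>M lborel)" using Gm by (simp add: lborel_prod)
  have "cmod (f p) \<le> C * jbracket (fst p) powr (- 2)" for p using C(2)[of "fst p" "snd p"] by simp
  then show "AE p in lborel \<Otimes>\<^sub>M lborel. norm (G p) \<le> norm (case p of (t, x) \<Rightarrow> complex_of_real (C * jbracket t powr (- 2)) * complex_of_real (indicator cell x))"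
   using C(1) by (intro AE_I2) (simp add: G_def norm_mult split_def indicator_def)
 qed
 then have Gi': "integrable (lborel \<Otimes>\<^sub>M lborel) (\<lambda>(t, x). G (t, x))" by (simp add: split_def)
 have sf: "st_fourier f \<tau> n = (LINT (t, x)|(lborel \<Otimes>\<^sub>M lborel). G (t, x))"
  unfolding st_fourier_def set_lebesgue_integral_def lborel_prod
  by (intro Bochner_Integration.integral_cong refl)
    (simp add: G_def ech_def cis_mult indicator_times freq_uminus split_def)
 have x: "(\<integral>x. G (t, x) \<partial>lborel) = xcoeff f t n * cis (- (\<tau> * t))" for t
 proof -
  have "(\<integral>x. G (t, x) \<partial>lborel) = (LINT x:cell|lborel. cis (- (\<tau> * t)) * (f (t, x) * ech (- n) x))"
   unfolding set_lebesgue_integral_def by (simp add: G_def mult_ac)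
  then show ?thesis by (simp add: xcoeff_def fcoeff_def mult.commute)
 qed
 show "st_fourier f \<tau> n = tft (\<lambda>t. xcoeff f t n) \<tau>"
  unfolding sf lborel_pair.integral_fst[OF Gi', symmetric] x by (simp add: tft_def)
 have t: "(\<integral>t. G (t, x) \<partial>lborel) = indicator cell x *\<^sub>R (ech (- n) x * (\<integral>t. f (t, x) * cis (- (\<tau> * t)) \<partial>lborel))" for x
  by (simp add: G_def integral_mult_right_zero[symmetric] mult_ac del: integral_mult_right_zero integral_mult_left_zero)
 show "st_fourier f \<tau> n = (\<integral>x. indicator cell x *\<^sub>R (ech (- n) x * (\<integral>t. f (t, x) * cis (- (\<tau> * t)) \<partial>lborel)) \<partial>lborel)"
  unfolding sf lborel_pair.integral_snd[OF Gi', symmetric] t by simp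
 have "integrable lborel (\<lambda>t. (xcoeff f t n * cis (- (\<tau> * t))) * cis (\<tau> * t))"
  by (rule integrable_bounded_times[of _ _ _ 1]) (use lborel_pair.integrable_fst'[OF Gi] in \<open>simp_all add: x\<close>)
 then show "integrable lborel (\<lambda>t. xcoeff f t n)" by (simp add: mult.assoc cis_mult)
qed

lemma st_fourier_time_derivative:
 assumes f: "f \<in> schwartz"
 shows "st_fourier (dderiv [(1, 0)] f) \<tau> n = \<i> * of_real \<tau> * st_fourier f \<tau> n"
proof -
 let ?f' = "dderiv [(1, 0)] f"
 have f': "?f' \<in> schwartz" by (rule schwartz_dderiv[OF f])
 have sm: "smooth f" using f by (simp add: schwartz_def)
 have X: "(\<integral>t. ?f' (t, x) * cis (- (\<tau> * t)) \<partial>lborel) = \<i> * of_real \<tau> * (\<integral>t. f (t, x) * cis (- (\<tau> * t)) \<partial>lborel)" for x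
 proof -
  obtain C where C: "\<And>t x. cmod (f (t, x)) \<le> C * jbracket t powr (- 2)" using schwartz_bound[OF f] by blast
  have int: "integrable lborel (\<lambda>t. F (t, x) * cis (- (\<tau> * t)))" if F: "F \<in> schwartz" for F
  proof -
   obtain C where C: "\<And>t x. cmod (F (t, x)) \<le> C * jbracket t powr (- 2)" using schwartz_bound[OF F] by blast
   have "continuous_on UNIV (\<lambda>t. F (t, x))"
    by (intro continuous_on_compose2[OF schwartz_continuous[OF F, of UNIV]] continuous_intros) auto
   then have m: "(\<lambda>t. F (t, x)) \<in> borel_measurable borel" by (rule borel_measurable_continuous_onI)
   have "integrable lborel (\<lambda>t. F (t, x))"
   proof (rule Bochner_Integration.integrable_bound)
    show "integrable lborel (\<lambda>t :: real. C * jbracket t powr (- 2))" by (intro integrable_mult_right jbracket_powr_integrable) simp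
    show "AE t in lborel. norm (F (t, x)) \<le> norm (C * jbracket t powr (- 2))"
     by (intro AE_I2) (simp only: real_norm_def, rule order_trans[OF C abs_ge_self])
   qed (use m in simp)
   then show ?thesis by (rule integrable_bounded_times[of _ _ _ 1]) auto
  qed
  let ?g' = "\<lambda>t. ?f' (t, x) * cis (- (\<tau> * t)) - \<i> * of_real \<tau> * (f (t, x) * cis (- (\<tau> * t)))"
  have "(\<integral>t. ?g' t \<partial>lborel) = 0"
  proof (rule LINT_derivative_zero[where C = C])
   show "((\<lambda>t. f (t, x) * cis (- (\<tau> * t))) has_vector_derivative ?g' t) (at t)" for t
   proof -
    have lin: "linear (frechet_derivative f (at (t, x)))"
     using smooth_has_derivative[OF sm] has_derivative_linear by blast
    have A: "((\<lambda>t. f (t, x)) has_derivative (\<lambda>h. frechet_derivative f (at (t, x)) (h, 0))) (at t)"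
     by (rule has_derivative_compose[of "\<lambda>t. (t, x)" "\<lambda>h. (h, 0)", OF _ smooth_has_derivative[OF sm]])
      (auto intro!: derivative_eq_intros)
    have "(\<lambda>h. frechet_derivative f (at (t, x)) (h, 0)) = (\<lambda>h. h *\<^sub>R ?f' (t, x))"
    proof
     fix h :: real
     have "(h, 0) = h *\<^sub>R ((1, 0) :: real \<times> real \<times> real)" by simp
     then have "frechet_derivative f (at (t, x)) (h, 0) = frechet_derivative f (at (t, x)) (h *\<^sub>R (1, 0))"
      by (rule arg_cong)
     also have "\<dots> = h *\<^sub>R frechet_derivative f (at (t, x)) (1, 0)" by (rule linear_cmul[OF lin])
     finally show "frechet_derivative f (at (t, x)) (h, 0) = h *\<^sub>R ?f' (t, x)" by (simp only: dderiv.simps)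
    qed
    from A[unfolded this] have "((\<lambda>t. f (t, x)) has_vector_derivative ?f' (t, x)) (at t)"
     unfolding has_vector_derivative_def .
    from has_vector_derivative_mult[OF this has_vector_derivative_cis_linear[of "- \<tau>"]] show ?thesis
     by (simp add: mult_ac)
   qed
   show "continuous_on UNIV ?g'"
    unfolding cis_conv_exp
    by (intro continuous_intros continuous_on_compose2[OF schwartz_continuous[OF f, of UNIV]] continuous_on_compose2[OF schwartz_continuous[OF f', of UNIV]]) auto
   show "cmod (f (t, x) * cis (- (\<tau> * t))) \<le> C * jbracket t powr (- 2)" for t using C by (simp add: norm_mult)
   show "integrable lborel ?g'"
    by (intro Bochner_Integration.integrable_diff integrable_mult_right int f f')
  qed
  moreover have "(\<integral>t. ?g' t \<partial>lborel) = (\<integral>t. ?f' (t, x) * cis (- (\<tau> * t)) \<partial>lborel)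
    - (\<integral>t. \<i> * of_real \<tau> * (f (t, x) * cis (- (\<tau> * t))) \<partial>lborel)"
   by (rule Bochner_Integration.integral_diff[OF int[OF f'] integrable_mult_right[OF int[OF f]]])
  ultimately show ?thesis by (simp only: integral_mult_right_zero) simp
 qed
 have "indicator cell x *\<^sub>R (ech (- n) x * (\<integral>t. ?f' (t, x) * cis (- (\<tau> * t)) \<partial>lborel)) =
   (\<i> * of_real \<tau>) * (indicator cell x *\<^sub>R (ech (- n) x * (\<integral>t. f (t, x) * cis (- (\<tau> * t)) \<partial>lborel)))" for x
  unfolding X by (simp only: scaleR_conv_of_real mult_ac)
 then show ?thesis
  unfolding st_fourier_Fubini(2)[OF f] st_fourier_Fubini(2)[OF f'] by (simp only: integral_mult_right_zero)
qed

text \<open>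
 Spatial derivatives give the decay in \<open>n\<close>, two time derivatives the decay in \<open>\<tau>\<close>.
\<close>

lemma st_fourier_decay:
 assumes f: "f \<in> schwartz"
 shows "\<exists>C\<ge>0. \<forall>\<tau> n. cmod (st_fourier f \<tau> n) \<le> C * jbracket \<tau> powr (- 2) / jbracket (freq n) ^ k"
proof -
 have bd: "\<exists>C\<ge>0. \<forall>\<tau> n. cmod (st_fourier g \<tau> n) \<le> C / jbracket (freq n) ^ k" if g: "g \<in> schwartz" for g
 proof -
  obtain C where C: "C \<ge> 0" "\<And>t n. cmod (xcoeff g t n) \<le> C * jbracket t powr (- 2) / jbracket (freq n) ^ k"
   using xcoeff_decay[OF g] by blast
  let ?I = "\<integral>t. jbracket (t :: real) powr (- 2) \<partial>lborel"
  have "cmod (st_fourier g \<tau> n) \<le> C * ?I / jbracket (freq n) ^ k" for \<tau> n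
  proof -
   have "cmod (st_fourier g \<tau> n) \<le> (\<integral>t. cmod (xcoeff g t n) \<partial>lborel)"
    unfolding st_fourier_Fubini(1)[OF g] by (rule norm_tft_le[OF st_fourier_Fubini(3)[OF g]])
   also have "\<dots> \<le> (\<integral>t. C / jbracket (freq n) ^ k * jbracket (t :: real) powr (- 2) \<partial>lborel)"
   proof (rule Bochner_Integration.integral_mono)
    show "integrable lborel (\<lambda>t. cmod (xcoeff g t n))" by (intro integrable_norm st_fourier_Fubini(3) g)
    show "integrable lborel (\<lambda>t. C / jbracket (freq n) ^ k * jbracket (t :: real) powr (- 2))"
     by (intro integrable_mult_right jbracket_powr_integrable) simp
    show "cmod (xcoeff g t n) \<le> C / jbracket (freq n) ^ k * jbracket t powr (- 2)" for t using C(2)[of t n] by simp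
   qed
   finally show ?thesis by simp
  qed
  moreover have "0 \<le> C * ?I" using C(1) by simp
  ultimately show ?thesis by blast
 qed
 let ?f' = "dderiv [(1, 0)] f" and ?f'' = "dderiv [(1, 0)] (dderiv [(1, 0)] f)"
 have s: "?f' \<in> schwartz" "?f'' \<in> schwartz" by (intro schwartz_dderiv f)+
 obtain C0 where C0: "C0 \<ge> 0" "\<And>\<tau> n. cmod (st_fourier f \<tau> n) \<le> C0 / jbracket (freq n) ^ k" using bd[OF f] by blast
 obtain C2 where C2: "C2 \<ge> 0" "\<And>\<tau> n. cmod (st_fourier ?f'' \<tau> n) \<le> C2 / jbracket (freq n) ^ k" using bd[OF s(2)] by blast
 have "cmod (st_fourier f \<tau> n) \<le> (C0 + C2) * jbracket \<tau> powr (- 2) / jbracket (freq n) ^ k" for \<tau> n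
 proof -
  have "cmod (st_fourier ?f'' \<tau> n) = \<tau>\<^sup>2 * cmod (st_fourier f \<tau> n)"
   unfolding st_fourier_time_derivative[OF s(1)] st_fourier_time_derivative[OF f]
   by (simp add: norm_mult power2_eq_square abs_mult[symmetric] mult.assoc[symmetric])
  then have "(1 + \<tau>\<^sup>2) * cmod (st_fourier f \<tau> n) \<le> (C0 + C2) / jbracket (freq n) ^ k"
   using C0(2)[of \<tau> n] C2(2)[of \<tau> n] by (simp add: distrib_right add_divide_distrib)
  then have "cmod (st_fourier f \<tau> n) \<le> ((C0 + C2) / jbracket (freq n) ^ k) / (1 + \<tau>\<^sup>2)"
   by (subst pos_le_divide_eq) (simp_all only: mult.commute, simp add: add_pos_nonneg)
  then show ?thesis unfolding jbracket_powr_minus2 by (simp add: mult.commute)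
 qed
 moreover have "0 \<le> C0 + C2" using C0 C2 by simp
 ultimately show ?thesis by blast
qed

lemma xcoeff_continuous:
 assumes f: "f \<in> schwartz"
 shows "continuous_on UNIV (\<lambda>t. xcoeff f t n)"
 unfolding continuous_on_sequentially
proof (intro allI ballI impI; elim conjE)
 fix r :: "nat \<Rightarrow> real" and t assume r: "r \<longlonglongrightarrow> t"
 obtain C where C: "C \<ge> 0" "\<And>t x. cmod (f (t, x)) \<le> C * jbracket t powr (- 2)" using schwartz_bound[OF f] by blast
 have C1: "cmod (f (t, x)) \<le> C" for t x
 proof -
  have "1 / (1 + t\<^sup>2) \<le> 1" by (subst divide_le_eq_1_pos) (auto simp: add_pos_nonneg)
  then have "C * jbracket t powr (- 2) \<le> C * 1" unfolding jbracket_powr_minus2 using C(1) by (intro mult_left_mono) auto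
  then show ?thesis using C(2)[of t x] by simp
 qed
 have cx: "continuous_on UNIV (\<lambda>x. f (t, x))" for t
  by (intro continuous_on_compose2[OF schwartz_continuous[OF f, of UNIV]] continuous_intros) auto
 have m: "(\<lambda>x. f (t, x)) \<in> borel_measurable borel" for t by (rule borel_measurable_continuous_onI[OF cx])
 have "(\<lambda>k. \<integral>x. indicator cell x *\<^sub>R (f (r k, x) * ech (- n) x) \<partial>lborel) \<longlonglongrightarrow> (\<integral>x. indicator cell x *\<^sub>R (f (t, x) * ech (- n) x) \<partial>lborel)"
 proof (rule integral_dominated_convergence)
  show "integrable lborel (\<lambda>x. indicator cell x * C)"
   by (intro integrable_mult_left integrable_real_indicator emeasure_cell) simp
  show "AE x in lborel. norm (indicator cell x *\<^sub>R (f (r k, x) * ech (- n) x)) \<le> indicator cell x * C" for k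
   using C1 by (intro AE_I2) (auto simp: indicator_def norm_mult)
  show "AE x in lborel. (\<lambda>k. indicator cell x *\<^sub>R (f (r k, x) * ech (- n) x)) \<longlonglongrightarrow> indicator cell x *\<^sub>R (f (t, x) * ech (- n) x)"
  proof (rule AE_I2)
   fix x :: "real \<times> real"
   have "(\<lambda>k. (r k, x)) \<longlonglongrightarrow> (t, x)" by (intro tendsto_intros r)
   from continuous_on_tendsto_compose[OF schwartz_continuous[OF f, of UNIV] this]
   show "(\<lambda>k. indicator cell x *\<^sub>R (f (r k, x) * ech (- n) x)) \<longlonglongrightarrow> indicator cell x *\<^sub>R (f (t, x) * ech (- n) x)"
    by (intro tendsto_intros) auto
  qed
 qed (use m in simp_all)
 then show "((\<lambda>t. xcoeff f t n) \<circ> r) \<longlonglongrightarrow> xcoeff f t n"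
  by (simp add: o_def xcoeff_def fcoeff_def set_lebesgue_integral_def)
qed

section \<open>The spaces \<open>X\<^sup>s\<^sup>,\<^sup>b\<close>\<close>

lemma nn_integral_count_space_le:
 assumes "\<And>S. finite S \<Longrightarrow> (\<Sum>n\<in>S. f n) \<le> K"
 shows "(\<integral>\<^sup>+n. f n \<partial>count_space (UNIV :: (int \<times> int) set)) \<le> K"
proof -
 have lim: "(\<lambda>N. f n * indicator (freq_box N) n) \<longlonglongrightarrow> f n" for n
 proof (rule tendsto_eventually)
  obtain N0 where N0: "{n} \<subseteq> freq_box N0" using finite_subset_box[of "{n}"] by auto
  show "\<forall>\<^sub>F N in sequentially. f n * indicator (freq_box N) n = f n"
  proof (rule eventually_sequentiallyI[of N0])
   fix N assume "N0 \<le> N"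
   then have "n \<in> freq_box N" using N0 freq_box_mono by blast
   then show "f n * indicator (freq_box N) n = f n" by simp
  qed
 qed
 have "(\<integral>\<^sup>+n. f n \<partial>count_space UNIV) = (\<integral>\<^sup>+n. liminf (\<lambda>N. f n * indicator (freq_box N) n) \<partial>count_space UNIV)"
  by (intro nn_integral_cong lim_imp_Liminf[symmetric] lim) simp
 also have "\<dots> \<le> liminf (\<lambda>N. \<integral>\<^sup>+n. f n * indicator (freq_box N) n \<partial>count_space UNIV)"
  by (intro nn_integral_liminf) simp
 also have "\<dots> \<le> liminf (\<lambda>N. K)"
 proof (intro Liminf_mono always_eventually allI)
  fix N
  have "(\<integral>\<^sup>+n. f n * indicator (freq_box N) n \<partial>count_space UNIV) = (\<integral>\<^sup>+n. f n \<partial>count_space (freq_box N))"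
   by (simp add: nn_integral_count_space_indicator)
  also have "\<dots> = (\<Sum>n\<in>freq_box N. f n)" by (rule nn_integral_count_space_finite) simp
  also have "\<dots> \<le> K" by (rule assms) simp
  finally show "(\<integral>\<^sup>+n. f n * indicator (freq_box N) n \<partial>count_space UNIV) \<le> K" .
 qed
 finally show ?thesis by (simp add: Liminf_const)
qed

lemma sum_le_nn_integral_count_space:
 assumes "finite S"
 shows "(\<Sum>n\<in>S. f n) \<le> (\<integral>\<^sup>+n. f n \<partial>count_space UNIV)"
proof -
 have "(\<Sum>n\<in>S. f n) = (\<integral>\<^sup>+n. f n * indicator S n \<partial>count_space UNIV)"
  using assms by (simp add: nn_integral_count_space_finite flip: nn_integral_count_space_indicator)
 also have "\<dots> \<le> (\<integral>\<^sup>+n. f n \<partial>count_space UNIV)"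
  by (intro nn_integral_mono) (auto simp: indicator_def)
 finally show ?thesis .
qed

definition wgt :: "real \<Rightarrow> int \<times> int \<Rightarrow> real \<Rightarrow> real" where
 "wgt b n \<tau> = jbracket (\<bar>\<tau>\<bar> - jbracket (freq n)) powr b"

lemma wgt_measurable [measurable]: "wgt b n \<in> borel_measurable borel"
 unfolding wgt_def[abs_def] by measurable

lemma wgt_nonneg [simp]: "0 \<le> wgt b n \<tau>"
 by (simp add: wgt_def)

lemma jbracket_shift_le:
 fixes \<tau> :: real
 assumes m: "1 \<le> m"
 shows "jbracket (\<bar>\<tau>\<bar> - m) \<le> 2 * jbracket \<tau> * m"
proof (rule power2_le_imp_le)
 have m2: "1 \<le> m\<^sup>2" using m by (simp add: one_le_power)
 have "(\<bar>\<tau>\<bar> - m)\<^sup>2 \<le> 2 * \<tau>\<^sup>2 + 2 * m\<^sup>2"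
  using zero_le_power2[of "\<bar>\<tau>\<bar> + m"] by (simp add: power2_eq_square algebra_simps)
 moreover have "\<tau>\<^sup>2 * 1 \<le> \<tau>\<^sup>2 * m\<^sup>2" by (rule mult_left_mono[OF m2]) simp
 ultimately have "1 + (\<bar>\<tau>\<bar> - m)\<^sup>2 \<le> 4 * m\<^sup>2 + 4 * (\<tau>\<^sup>2 * m\<^sup>2)" using m2 zero_le_power2[of \<tau>] by linarith
 also have "\<dots> = 4 * (1 + \<tau>\<^sup>2) * m\<^sup>2" by (simp add: algebra_simps)
 finally have "1 + (\<bar>\<tau>\<bar> - m)\<^sup>2 \<le> 4 * (1 + \<tau>\<^sup>2) * m\<^sup>2" .
 then show "(jbracket (\<bar>\<tau>\<bar> - m))\<^sup>2 \<le> (2 * jbracket \<tau> * m)\<^sup>2"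
  by (simp add: jbracket_real_sq power_mult_distrib)
qed (use m in simp)

lemma st_fourier_measurable: "f \<in> schwartz \<Longrightarrow> (\<lambda>\<tau>. st_fourier f \<tau> n) \<in> borel_measurable borel"
 unfolding st_fourier_Fubini(1)
 by (intro tft_measurable[unfolded eta_contract_eq] borel_measurable_continuous_onI xcoeff_continuous)

lemma Xsb_sqnorm_schwartz_finite:
 assumes f: "f \<in> schwartz" and s: "s \<le> 1" and b: "0 \<le> b" "b \<le> 1"
 shows "Xsb_sqnorm s b (st_fourier f) < \<infinity>"
proof -
 obtain C where C: "C \<ge> 0" "\<And>\<tau> n. cmod (st_fourier f \<tau> n) \<le> C * jbracket \<tau> powr (- 2) / jbracket (freq n) ^ 4"
  using st_fourier_decay[OF f] by blast
 define I where "I = (\<integral>\<tau>. jbracket (\<tau> :: real) powr (- 2) \<partial>lborel)"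
 have I: "0 \<le> I" by (simp add: I_def)
 have pt: "(jbracket (freq n) powr s * jbracket (\<bar>\<tau>\<bar> - jbracket (freq n)) powr b * cmod (st_fourier f \<tau> n))\<^sup>2
   \<le> (4 * C\<^sup>2 / jbracket (freq n) ^ 4) * jbracket \<tau> powr (- 2)" for \<tau> n
 proof -
  define m where "m = jbracket (freq n)"
  define j where "j = jbracket \<tau>"
  have m: "1 \<le> m" "0 < m" and j: "1 \<le> j" "0 < j" by (simp_all add: m_def j_def jbracket_ge_one)
  have "m powr s \<le> m powr 1" using m s by (intro powr_mono) auto
  moreover have "jbracket (\<bar>\<tau>\<bar> - m) powr b \<le> jbracket (\<bar>\<tau>\<bar> - m) powr 1"
   using b jbracket_ge_one by (intro powr_mono) auto
  ultimately have "m powr s * jbracket (\<bar>\<tau>\<bar> - m) powr b * cmod (st_fourier f \<tau> n) \<le> m * (2 * j * m) * (C * j powr (- 2) / m ^ 4)"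
   using m j C jbracket_shift_le[OF m(1), of \<tau>] jbracket_ge_one[of "\<bar>\<tau>\<bar> - m"]
   by (intro mult_mono) (auto simp: m_def j_def)
  also have "\<dots> = 2 * C / (j * m\<^sup>2)"
   using m j by (simp add: powr_minus_divide power2_eq_square power4_eq_xxxx field_simps)
  finally have "m powr s * jbracket (\<bar>\<tau>\<bar> - m) powr b * cmod (st_fourier f \<tau> n) \<le> 2 * C / (j * m\<^sup>2)" .
  then have "(m powr s * jbracket (\<bar>\<tau>\<bar> - m) powr b * cmod (st_fourier f \<tau> n))\<^sup>2 \<le> (2 * C / (j * m\<^sup>2))\<^sup>2"
   by (intro power_mono) auto
  also have "\<dots> = (4 * C\<^sup>2 / m ^ 4) * j powr (- 2)"
   using m j by (simp add: powr_minus_divide power_mult_distrib power_divide field_simps flip: power_mult)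
  finally show ?thesis by (simp add: m_def j_def)
 qed
 have "Xsb_sqnorm s b (st_fourier f) \<le> (\<integral>\<^sup>+ n. ennreal (4 * C\<^sup>2 * I * (1 / jbracket (freq n) ^ 4)) \<partial>count_space UNIV)"
  unfolding Xsb_sqnorm_def
 proof (intro nn_integral_mono)
  fix n
  have "(\<integral>\<^sup>+ \<tau>. ennreal ((jbracket (freq n) powr s * jbracket (\<bar>\<tau>\<bar> - jbracket (freq n)) powr b * cmod (st_fourier f \<tau> n))\<^sup>2) \<partial>lborel)
    \<le> (\<integral>\<^sup>+ \<tau>. ennreal ((4 * C\<^sup>2 / jbracket (freq n) ^ 4) * jbracket (\<tau> :: real) powr (- 2)) \<partial>lborel)"
   by (intro nn_integral_mono ennreal_leI pt)
  also have "\<dots> = ennreal (\<integral>\<tau>. (4 * C\<^sup>2 / jbracket (freq n) ^ 4) * jbracket (\<tau> :: real) powr (- 2) \<partial>lborel)"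
   by (intro nn_integral_eq_integral integrable_mult_right jbracket_powr_integrable) auto
  finally show "(\<integral>\<^sup>+ \<tau>. ennreal ((jbracket (freq n) powr s * jbracket (\<bar>\<tau>\<bar> - jbracket (freq n)) powr b * cmod (st_fourier f \<tau> n))\<^sup>2) \<partial>lborel)
    \<le> ennreal (4 * C\<^sup>2 * I * (1 / jbracket (freq n) ^ 4))"
   by (simp add: I_def)
 qed
 also have "\<dots> \<le> ennreal (4 * C\<^sup>2 * I * 128)"
 proof (rule nn_integral_count_space_le)
  fix S :: "(int \<times> int) set" assume S: "finite S"
  have "(\<Sum>n\<in>S. ennreal (4 * C\<^sup>2 * I * (1 / jbracket (freq n) ^ 4))) = ennreal (4 * C\<^sup>2 * I * (\<Sum>n\<in>S. 1 / jbracket (freq n) ^ 4))"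
   using I by (subst sum_ennreal) (auto simp: sum_distrib_left)
  also have "\<dots> \<le> ennreal (4 * C\<^sup>2 * I * 128)"
   using I sum_jbracket_tail_le[OF S, of 0] by (intro ennreal_leI mult_left_mono) auto
  finally show "(\<Sum>n\<in>S. ennreal (4 * C\<^sup>2 * I * (1 / jbracket (freq n) ^ 4))) \<le> ennreal (4 * C\<^sup>2 * I * 128)" .
 qed
 finally show ?thesis by (auto intro: le_less_trans)
qed

lemma Xsb_sqnorm_add_le:
 assumes F: "\<And>n. (\<lambda>\<tau>. F \<tau> n) \<in> borel_measurable borel" and G: "\<And>n. (\<lambda>\<tau>. G \<tau> n) \<in> borel_measurable borel"
 shows "Xsb_sqnorm s b (\<lambda>\<tau> n. F \<tau> n + G \<tau> n) \<le> 2 * Xsb_sqnorm s b F + 2 * Xsb_sqnorm s b G"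
proof -
 define W where "W n \<tau> = jbracket (freq n) powr s * jbracket (\<bar>\<tau>\<bar> - jbracket (freq n)) powr b" for n \<tau>
 have [measurable]: "W n \<in> borel_measurable borel" for n unfolding W_def[abs_def] by measurable
 note [measurable] = F G
 have pt: "ennreal ((W n \<tau> * cmod (F \<tau> n + G \<tau> n))\<^sup>2) \<le> 2 * ennreal ((W n \<tau> * cmod (F \<tau> n))\<^sup>2) + 2 * ennreal ((W n \<tau> * cmod (G \<tau> n))\<^sup>2)" for n \<tau>
 proof -
  have "0 \<le> W n \<tau>" by (simp add: W_def)
  then have "(W n \<tau> * cmod (F \<tau> n + G \<tau> n))\<^sup>2 \<le> (W n \<tau> * cmod (F \<tau> n) + W n \<tau> * cmod (G \<tau> n))\<^sup>2"
   unfolding distrib_left[symmetric] by (intro power_mono mult_left_mono norm_triangle_ineq) auto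
  also have "\<dots> \<le> 2 * (W n \<tau> * cmod (F \<tau> n))\<^sup>2 + 2 * (W n \<tau> * cmod (G \<tau> n))\<^sup>2"
   using sum_squares_bound[of "W n \<tau> * cmod (F \<tau> n)" "W n \<tau> * cmod (G \<tau> n)"] by (simp add: power2_sum)
  finally have "ennreal ((W n \<tau> * cmod (F \<tau> n + G \<tau> n))\<^sup>2) \<le> ennreal (2 * (W n \<tau> * cmod (F \<tau> n))\<^sup>2 + 2 * (W n \<tau> * cmod (G \<tau> n))\<^sup>2)"
   by (rule ennreal_leI)
  then show ?thesis by (simp add: ennreal_mult)
 qed
 have "Xsb_sqnorm s b (\<lambda>\<tau> n. F \<tau> n + G \<tau> n) \<le>
   (\<integral>\<^sup>+ n. 2 * (\<integral>\<^sup>+ \<tau>. ennreal ((W n \<tau> * cmod (F \<tau> n))\<^sup>2) \<partial>lborel) + 2 * (\<integral>\<^sup>+ \<tau>. ennreal ((W n \<tau> * cmod (G \<tau> n))\<^sup>2) \<partial>lborel) \<partial>count_space UNIV)"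
  unfolding Xsb_sqnorm_def W_def[symmetric]
 proof (intro nn_integral_mono)
  fix n
  have "(\<integral>\<^sup>+ \<tau>. ennreal ((W n \<tau> * cmod (F \<tau> n + G \<tau> n))\<^sup>2) \<partial>lborel) \<le>
    (\<integral>\<^sup>+ \<tau>. 2 * ennreal ((W n \<tau> * cmod (F \<tau> n))\<^sup>2) + 2 * ennreal ((W n \<tau> * cmod (G \<tau> n))\<^sup>2) \<partial>lborel)"
   by (intro nn_integral_mono pt)
  also have "\<dots> = 2 * (\<integral>\<^sup>+ \<tau>. ennreal ((W n \<tau> * cmod (F \<tau> n))\<^sup>2) \<partial>lborel) + 2 * (\<integral>\<^sup>+ \<tau>. ennreal ((W n \<tau> * cmod (G \<tau> n))\<^sup>2) \<partial>lborel)"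
   by (simp add: nn_integral_add nn_integral_cmult)
  finally show "(\<integral>\<^sup>+ \<tau>. ennreal ((W n \<tau> * cmod (F \<tau> n + G \<tau> n))\<^sup>2) \<partial>lborel) \<le> \<dots>" .
 qed
 also have "\<dots> = 2 * Xsb_sqnorm s b F + 2 * Xsb_sqnorm s b G"
  unfolding Xsb_sqnorm_def W_def[symmetric] by (simp add: nn_integral_add nn_integral_cmult)
 finally show ?thesis .
qed

lemma Xsb_measurable:
 assumes F: "F \<in> Xsb s b"
 shows "(\<lambda>\<tau>. F \<tau> n) \<in> borel_measurable borel"
proof -
 have "(\<lambda>\<tau>. F \<tau> n) \<in> borel_measurable lborel" using F unfolding Xsb_def by blast
 then show ?thesis by simp
qed

text \<open>
 Membership is defined through closeness to Schwartz functions, whose norm is finite.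
\<close>

lemma Xsb_sqnorm_finite:
 assumes F: "F \<in> Xsb s b" and s: "s \<le> 1" and b: "0 \<le> b" "b \<le> 1"
 shows "Xsb_sqnorm s b F < \<infinity>"
proof -
 have "\<exists>f\<in>schwartz. Xsb_sqnorm s b (\<lambda>\<tau> n. F \<tau> n - st_fourier f \<tau> n) < ennreal 1"
  using F zero_less_one unfolding Xsb_def by blast
 then obtain f where f: "f \<in> schwartz" "Xsb_sqnorm s b (\<lambda>\<tau> n. F \<tau> n - st_fourier f \<tau> n) < ennreal 1" by blast
 have Fm: "(\<lambda>\<tau>. F \<tau> n) \<in> borel_measurable borel" for n by (rule Xsb_measurable[OF F])
 have "Xsb_sqnorm s b (\<lambda>\<tau> n. (F \<tau> n - st_fourier f \<tau> n) + st_fourier f \<tau> n) \<le>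
   2 * Xsb_sqnorm s b (\<lambda>\<tau> n. F \<tau> n - st_fourier f \<tau> n) + 2 * Xsb_sqnorm s b (st_fourier f)"
  by (rule Xsb_sqnorm_add_le) (intro borel_measurable_diff Fm st_fourier_measurable[OF f(1)])+
 also have "\<dots> < \<infinity>"
  using f(2) Xsb_sqnorm_schwartz_finite[OF f(1) s b] by (auto simp: ennreal_mult_less_top ennreal_add_less_top intro: less_trans)
 finally show ?thesis by simp
qed

text \<open>For \<open>b > 1/2\<close> the weight is square integrable, uniformly in the frequency.\<close>

lemma wgt_integral_le:
 assumes b: "1/2 < b"
 shows "(\<integral>\<^sup>+\<tau>. ennreal (wgt (- b) n \<tau> ^ 2) \<partial>lborel) \<le> ennreal (2 * (\<integral>\<tau>. jbracket (\<tau> :: real) powr (- (2 * b)) \<partial>lborel))"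
proof -
 define m where "m = jbracket (freq n)"
 let ?g = "\<lambda>\<tau> :: real. jbracket \<tau> powr (- (2 * b))"
 have gi: "integrable lborel ?g" using b by (intro jbracket_powr_integrable) simp
 have sq: "wgt (- b) n \<tau> ^ 2 = ?g (\<bar>\<tau>\<bar> - m)" for \<tau>
  by (simp add: wgt_def m_def powr_powr mult.commute flip: powr_numeral)
 have ev: "?g (- x) = ?g x" for x by (simp add: jbracket_def)
 have sh: "integrable lborel (\<lambda>\<tau>. ?g (\<tau> - m))" "(\<integral>\<tau>. ?g (\<tau> - m) \<partial>lborel) = (\<integral>\<tau>. ?g \<tau> \<partial>lborel)"
  "integrable lborel (\<lambda>\<tau>. ?g (- \<tau> - m))" "(\<integral>\<tau>. ?g (- \<tau> - m) \<partial>lborel) = (\<integral>\<tau>. ?g \<tau> \<partial>lborel)"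
  using lborel_integrable_real_affine[OF gi, of 1 "- m"] lborel_integral_real_affine[of 1 ?g "- m"]
   lborel_integrable_real_affine[OF gi, of "- 1" "- m"] lborel_integral_real_affine[of "- 1" ?g "- m"]
  by (simp_all add: algebra_simps)
 have "(\<integral>\<^sup>+\<tau>. ennreal (wgt (- b) n \<tau> ^ 2) \<partial>lborel) \<le> (\<integral>\<^sup>+\<tau>. ennreal (?g (\<tau> - m) + ?g (- \<tau> - m)) \<partial>lborel)"
 proof (intro nn_integral_mono ennreal_leI)
  fix \<tau> :: real
  have "0 \<le> ?g (\<tau> - m)" "0 \<le> ?g (- \<tau> - m)" by simp_all
  then show "wgt (- b) n \<tau> ^ 2 \<le> ?g (\<tau> - m) + ?g (- \<tau> - m)"
   unfolding sq by (cases "0 \<le> \<tau>") auto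
 qed
 also have "\<dots> = ennreal (\<integral>\<tau>. ?g (\<tau> - m) + ?g (- \<tau> - m) \<partial>lborel)"
  by (intro nn_integral_eq_integral Bochner_Integration.integrable_add sh) simp
 also have "(\<integral>\<tau>. ?g (\<tau> - m) + ?g (- \<tau> - m) \<partial>lborel) = 2 * (\<integral>\<tau>. ?g \<tau> \<partial>lborel)"
  by (simp add: Bochner_Integration.integral_add[OF sh(1,3)] sh(2,4))
 finally show ?thesis .
qed

text \<open>
 An element of \<open>X\<^sup>s\<^sup>,\<^sup>b\<close> with \<open>b > 1/2\<close> is continuous in time with values in \<open>H\<^sup>s\<close>; here its spatial Fourier
 coefficient at time \<open>t\<close>.
\<close>

definition time_slice :: "(real \<Rightarrow> int \<times> int \<Rightarrow> complex) \<Rightarrow> real \<Rightarrow> int \<times> int \<Rightarrow> complex" where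
 "time_slice F t n = (\<integral>\<tau>. F \<tau> n * cis (\<tau> * t) \<partial>lborel) / (2 * pi)"

text \<open>
 Cauchy--Schwarz in \<open>\<tau>\<close> against the weight, for each frequency.
\<close>

lemma time_slice_bound:
 assumes F: "F \<in> Xsb s b" and fin: "Xsb_sqnorm s b F < \<infinity>" and b: "1/2 < b"
 defines "K \<equiv> 2 * (\<integral>\<tau>. jbracket (\<tau> :: real) powr (- (2 * b)) \<partial>lborel)"
 shows "integrable lborel (\<lambda>\<tau>. F \<tau> n)" and "hbd s (time_slice F t) (sqrt K * Xsb_norm s b F)"
proof -
 note [measurable] = Xsb_measurable[OF F]
 define X where "X n = (\<integral>\<^sup>+ \<tau>. ennreal ((wgt b n \<tau> * cmod (F \<tau> n))\<^sup>2) \<partial>lborel)" for n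
 define J where "J n = jbracket (freq n)" for n
 have J: "0 < J n" for n by (simp add: J_def)
 have K: "0 \<le> K" by (simp add: K_def)
 have Xs: "Xsb_sqnorm s b F = (\<integral>\<^sup>+ n. ennreal ((J n powr s)\<^sup>2) * X n \<partial>count_space UNIV)"
 proof -
  have "(\<integral>\<^sup>+ \<tau>. ennreal ((jbracket (freq n) powr s * jbracket (\<bar>\<tau>\<bar> - jbracket (freq n)) powr b * cmod (F \<tau> n))\<^sup>2) \<partial>lborel)
    = ennreal ((J n powr s)\<^sup>2) * X n" for n
  proof -
   have "(\<integral>\<^sup>+ \<tau>. ennreal ((jbracket (freq n) powr s * jbracket (\<bar>\<tau>\<bar> - jbracket (freq n)) powr b * cmod (F \<tau> n))\<^sup>2) \<partial>lborel)
    = (\<integral>\<^sup>+ \<tau>. ennreal ((J n powr s)\<^sup>2) * ennreal ((wgt b n \<tau> * cmod (F \<tau> n))\<^sup>2) \<partial>lborel)"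
    by (intro nn_integral_cong) (simp add: J_def wgt_def power_mult_distrib mult.assoc flip: ennreal_mult)
   then show ?thesis by (simp add: X_def nn_integral_cmult)
  qed
  then show ?thesis by (simp add: Xsb_sqnorm_def)
 qed
 have sumX: "(\<Sum>n\<in>S. ennreal ((J n powr s)\<^sup>2) * X n) \<le> Xsb_sqnorm s b F" if "finite S" for S
  unfolding Xs by (rule sum_le_nn_integral_count_space[OF that])
 have Xfin: "X n < \<infinity>" for n
 proof -
  have "ennreal ((J n powr s)\<^sup>2) * X n < \<infinity>" using sumX[of "{n}"] fin by simp
  then show ?thesis using J[of n] by (auto simp: ennreal_mult_less_top)
 qed
 define x where "x n = enn2real (X n)" for n
 have x: "0 \<le> x n" "X n = ennreal (x n)" for n using Xfin[of n] by (simp_all add: x_def)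
 have CS: "(\<integral>\<^sup>+\<tau>. ennreal (cmod (F \<tau> n)) \<partial>lborel) \<le> ennreal (sqrt (K * x n))" for n
 proof -
  have w: "wgt (- b) n \<tau> * wgt b n \<tau> = 1" for \<tau> by (simp add: wgt_def flip: powr_add)
  have "(\<integral>\<^sup>+\<tau>. ennreal (cmod (F \<tau> n)) \<partial>lborel) = (\<integral>\<^sup>+\<tau>. ennreal (wgt (- b) n \<tau>) * ennreal (wgt b n \<tau> * cmod (F \<tau> n)) \<partial>lborel)"
   by (intro nn_integral_cong) (simp add: w mult.assoc[symmetric] flip: ennreal_mult)
  moreover have "(\<integral>\<^sup>+\<tau>. ennreal (wgt (- b) n \<tau>) * ennreal (wgt b n \<tau> * cmod (F \<tau> n)) \<partial>lborel)\<^sup>2 \<le>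
    (\<integral>\<^sup>+\<tau>. (ennreal (wgt (- b) n \<tau>))\<^sup>2 \<partial>lborel) * (\<integral>\<^sup>+\<tau>. (ennreal (wgt b n \<tau> * cmod (F \<tau> n)))\<^sup>2 \<partial>lborel)"
   by (rule Cauchy_Schwarz_nn_integral) measurable
  moreover have "\<dots> \<le> ennreal K * ennreal (x n)"
  proof (rule mult_mono)
   show "(\<integral>\<^sup>+\<tau>. (ennreal (wgt (- b) n \<tau>))\<^sup>2 \<partial>lborel) \<le> ennreal K"
    using wgt_integral_le[OF b, of n] by (simp add: K_def ennreal_power wgt_def)
   show "(\<integral>\<^sup>+\<tau>. (ennreal (wgt b n \<tau> * cmod (F \<tau> n)))\<^sup>2 \<partial>lborel) \<le> ennreal (x n)"
    using x(2)[of n] by (simp add: X_def ennreal_power wgt_def)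
  qed auto
  ultimately have le: "(\<integral>\<^sup>+\<tau>. ennreal (cmod (F \<tau> n)) \<partial>lborel)\<^sup>2 \<le> ennreal (K * x n)"
   using K x(1)[of n] by (simp add: ennreal_mult)
  show ?thesis
  proof (cases "(\<integral>\<^sup>+\<tau>. ennreal (cmod (F \<tau> n)) \<partial>lborel)")
   case (real r)
   then have "r\<^sup>2 \<le> K * x n" using le K x(1)[of n] by (simp add: ennreal_power)
   then show ?thesis unfolding real(2) by (intro ennreal_leI real_le_rsqrt)
  next
   case top
   then show ?thesis using le by (simp add: power2_eq_square ennreal_top_mult top_unique)
  qed
 qed
 show int: "integrable lborel (\<lambda>\<tau>. F \<tau> n)" for n
  by (rule integrableI_bounded) (use CS[of n] in \<open>auto intro: le_less_trans\<close>)
 show "hbd s (time_slice F t) (sqrt K * Xsb_norm s b F)"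
  unfolding hbd_def
 proof (intro allI impI)
  fix S :: "(int \<times> int) set" assume S: "finite S"
  have pt: "cmod (time_slice F t n) \<le> sqrt (K * x n)" for n
  proof -
   have "ennreal (cmod (\<integral>\<tau>. F \<tau> n * cis (\<tau> * t) \<partial>lborel)) \<le> (\<integral>\<^sup>+\<tau>. ennreal (cmod (F \<tau> n * cis (\<tau> * t))) \<partial>lborel)"
    by (rule integral_norm_bound_ennreal) (rule integrable_bounded_times[OF int, of _ 1]; simp)
   also have "\<dots> \<le> ennreal (sqrt (K * x n))" using CS[of n] by (simp add: norm_mult)
   finally have 1: "cmod (\<integral>\<tau>. F \<tau> n * cis (\<tau> * t) \<partial>lborel) \<le> sqrt (K * x n)"
    using K x(1)[of n] by simp
   have "cmod (time_slice F t n) = cmod (\<integral>\<tau>. F \<tau> n * cis (\<tau> * t) \<partial>lborel) / (2 * pi)"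
    by (simp add: time_slice_def norm_divide)
   also have "\<dots> \<le> cmod (\<integral>\<tau>. F \<tau> n * cis (\<tau> * t) \<partial>lborel) / 1"
    using pi_ge_two by (intro divide_left_mono) auto
   finally show ?thesis using 1 by simp
  qed
  have "(\<Sum>n\<in>S. (J n powr s)\<^sup>2 * x n) \<le> (Xsb_norm s b F)\<^sup>2"
  proof -
   have "ennreal (\<Sum>n\<in>S. (J n powr s)\<^sup>2 * x n) = (\<Sum>n\<in>S. ennreal ((J n powr s)\<^sup>2) * X n)"
    using x by (simp add: sum_ennreal[symmetric] ennreal_mult)
   also have "\<dots> \<le> Xsb_sqnorm s b F" by (rule sumX[OF S])
   also have "\<dots> = ennreal ((Xsb_norm s b F)\<^sup>2)" using fin by (simp add: Xsb_norm_def)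
   finally show ?thesis by simp
  qed
  then have "K * (\<Sum>n\<in>S. (J n powr s)\<^sup>2 * x n) \<le> K * (Xsb_norm s b F)\<^sup>2" by (intro mult_left_mono K)
  moreover have "(L2_set (\<lambda>n. J n powr s * cmod (time_slice F t n)) S)\<^sup>2 \<le> K * (\<Sum>n\<in>S. (J n powr s)\<^sup>2 * x n)"
  proof -
   have "(L2_set (\<lambda>n. J n powr s * cmod (time_slice F t n)) S)\<^sup>2 = (\<Sum>n\<in>S. (J n powr s * cmod (time_slice F t n))\<^sup>2)"
    by (simp add: L2_set_def sum_nonneg)
   also have "\<dots> \<le> (\<Sum>n\<in>S. K * ((J n powr s)\<^sup>2 * x n))"
   proof (rule sum_mono)
    fix n
    have "(cmod (time_slice F t n))\<^sup>2 \<le> (sqrt (K * x n))\<^sup>2" by (intro power_mono pt) simp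
    then have "(cmod (time_slice F t n))\<^sup>2 \<le> K * x n" using K x(1)[of n] by simp
    then show "(J n powr s * cmod (time_slice F t n))\<^sup>2 \<le> K * ((J n powr s)\<^sup>2 * x n)"
     by (simp add: power_mult_distrib mult.left_commute[of K] mult_left_mono)
   qed
   finally show ?thesis by (simp add: sum_distrib_left)
  qed
  ultimately have "(L2_set (\<lambda>n. J n powr s * cmod (time_slice F t n)) S)\<^sup>2 \<le> (sqrt K * Xsb_norm s b F)\<^sup>2"
   using K by (simp add: power_mult_distrib)
  then show "L2_set (\<lambda>n. jbracket (freq n) powr s * cmod (time_slice F t n)) S \<le> sqrt K * Xsb_norm s b F"
   unfolding J_def by (rule power2_le_imp_le) (simp add: K Xsb_norm_def)
 qed
qed

section \<open>Density of the test functions in time\<close>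

lemma bumps_sum:
 assumes "finite I" "\<And>i. i \<in> I \<Longrightarrow> f i \<in> bumps a b c"
 shows "(\<lambda>t. \<Sum>i\<in>I. z i * f i t) \<in> bumps a b c"
 using assms
proof (induction I rule: finite_induct)
 case empty
 show ?case using bumps.lin[OF bumps.mono[of 0 c 0 a 0 b] bumps.mono[of 0 c 0 a 0 b], of 0 0] by simp
next
 case (insert i I)
 then have "(\<lambda>t. z i * f i t + 1 * (\<Sum>i\<in>I. z i * f i t)) \<in> bumps a b c"
  by (intro bumps.lin) auto
 then show ?case using insert.hyps by simp
qed

lemma flatf_tendsto_one:
 assumes "a \<longlonglongrightarrow> 0" "c \<longlonglongrightarrow> 0" "0 < t"
 shows "(\<lambda>k. flatf (c k) 0 (t - a k)) \<longlonglongrightarrow> 1"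
proof -
 have "(\<lambda>k. exp (- c k / (t - a k))) \<longlonglongrightarrow> exp (- 0 / (t - 0))"
  using assms by (intro tendsto_intros) auto
 moreover have "\<forall>\<^sub>F k in sequentially. a k < t" using order_tendstoD(2)[OF assms(1,3)] .
 then have "\<forall>\<^sub>F k in sequentially. exp (- c k / (t - a k)) = flatf (c k) 0 (t - a k)"
  by eventually_elim (simp add: flatf_def)
 ultimately show ?thesis by (simp add: tendsto_cong)
qed

lemma flatf_zero_bounds: "0 < c \<Longrightarrow> 0 \<le> flatf c 0 t \<and> flatf c 0 t \<le> 1"
 by (simp add: flatf_def)

text \<open>Polynomial approximation, cut off to a compact subset of \<open>(0, T)\<close>.\<close>

lemma bumps_approx:
 fixes g :: "nat \<Rightarrow> real \<Rightarrow> complex"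
 assumes T: "0 < T" and g: "\<And>k. continuous_on UNIV (g k)" and R: "\<And>k t. cmod (g k t) \<le> R"
 shows "\<exists>\<psi>. (\<forall>k. \<exists>a b c. 0 < a \<and> b < T \<and> 0 < c \<and> \<psi> k \<in> bumps a b c) \<and> (\<forall>k t. cmod (\<psi> k t) \<le> R + 1) \<and>
   (\<forall>t. 0 < t \<and> t < T \<longrightarrow> (\<lambda>k. \<psi> k t - g k t) \<longlonglongrightarrow> 0)"
proof -
 have R0: "0 \<le> R" using R[of 0 0] norm_ge_zero order_trans by blast
 have "\<exists>p. polynomial_function p \<and> (\<forall>t\<in>{0..T}. cmod (g k t - p t) < inverse (real (Suc k)))" for k
  by (rule Stone_Weierstrass_polynomial_function) (auto intro: continuous_on_subset[OF g])
 then obtain p where p: "\<And>k. polynomial_function (p k)" "\<And>k t. t \<in> {0..T} \<Longrightarrow> cmod (g k t - p k t) < inverse (real (Suc k))"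
  by metis
 define c where "c k = inverse (real (Suc k))" for k
 define a where "a k = T / 2 * c k" for k
 have c: "c \<longlonglongrightarrow> 0" "0 < c k" "c k \<le> 1" for k
  unfolding c_def by (rule LIMSEQ_inverse_real_of_nat) (simp_all add: inverse_le_1_iff)
 have a: "a \<longlonglongrightarrow> 0" "0 < a k" for k
  unfolding a_def using tendsto_mult_right_zero[OF c(1), of "T / 2"] T c(2)[of k] by (auto simp: mult.commute)
 define E where "E k t = flatf (c k) 0 (t - a k) * flatf (c k) 0 ((T - a k) - t)" for k t
 have E01: "0 \<le> E k t" "E k t \<le> 1" for k t
  unfolding E_def using flatf_zero_bounds[OF c(2)] by (auto intro!: mult_le_one)
 have Es: "E k t = 0" if "t \<notin> {0..T}" for k t
  using that a(2)[of k] by (auto simp: E_def flatf_def)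
 have E1: "(\<lambda>k. E k t) \<longlonglongrightarrow> 1" if "0 < t" "t < T" for t
 proof -
  have "(\<lambda>k. flatf (c k) 0 (t - a k) * flatf (c k) 0 ((T - t) - a k)) \<longlonglongrightarrow> 1 * 1"
   using that by (intro tendsto_mult flatf_tendsto_one a c) auto
  then show ?thesis by (simp add: E_def algebra_simps)
 qed
 define \<psi> where "\<psi> k t = p k t * of_real (E k t)" for k t
 have mem: "\<psi> k \<in> bumps (a k) (T - a k) (c k)" for k
 proof -
  have "real_polynomial_function (\<lambda>t. Re (p k t))" "real_polynomial_function (\<lambda>t. Im (p k t))"
   using p(1)[of k] bounded_linear_Re bounded_linear_Im unfolding polynomial_function_def o_def by blast+
  then obtain r n r' n' where re: "(\<lambda>t. Re (p k t)) = (\<lambda>t. \<Sum>i\<le>n. r i * t ^ i)" and im: "(\<lambda>t. Im (p k t)) = (\<lambda>t. \<Sum>i\<le>n'. r' i * t ^ i)"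
   unfolding real_polynomial_function_iff_sum by blast
  have "\<psi> k t = 1 * (\<Sum>i\<le>n. of_real (r i) * of_real (t ^ i * flatf (c k) 0 (t - a k) * flatf (c k) 0 ((T - a k) - t)))
    + \<i> * (\<Sum>i\<le>n'. of_real (r' i) * of_real (t ^ i * flatf (c k) 0 (t - a k) * flatf (c k) 0 ((T - a k) - t)))" for t
  proof -
   have "p k t = of_real (\<Sum>i\<le>n. r i * t ^ i) + \<i> * of_real (\<Sum>i\<le>n'. r' i * t ^ i)"
    using fun_cong[OF re, of t] fun_cong[OF im, of t] by (simp only: complex_eq_iff) simp
   then show ?thesis unfolding \<psi>_def E_def
    by (simp only: of_real_sum of_real_mult distrib_right sum_distrib_right sum_distrib_left mult_1_left mult.assoc)
  qed
  then have "\<psi> k = (\<lambda>t. 1 * (\<Sum>i\<le>n. of_real (r i) * of_real (t ^ i * flatf (c k) 0 (t - a k) * flatf (c k) 0 ((T - a k) - t)))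
    + \<i> * (\<Sum>i\<le>n'. of_real (r' i) * of_real (t ^ i * flatf (c k) 0 (t - a k) * flatf (c k) 0 ((T - a k) - t))))" by (rule ext)
  also have "\<dots> \<in> bumps (a k) (T - a k) (c k)" by (intro bumps.lin bumps_sum bumps.mono) auto
  finally show ?thesis .
 qed
 have pR: "cmod (p k t) \<le> R + 1" if "t \<in> {0..T}" for k t
 proof -
  have "cmod (p k t) \<le> cmod (g k t) + cmod (g k t - p k t)" by (metis norm_triangle_sub norm_minus_commute)
  then show ?thesis using R[of k t] p(2)[OF that, of k] c(3)[of k] by (simp add: c_def)
 qed
 show ?thesis
 proof (intro exI[of _ \<psi>] conjI allI impI; (elim conjE)?)
  show "\<exists>a b c. 0 < a \<and> b < T \<and> 0 < c \<and> \<psi> k \<in> bumps a b c" for k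
   using mem[of k] a(2)[of k] c(2)[of k] by (intro exI[of _ "a k"] exI[of _ "T - a k"] exI[of _ "c k"]) auto
  show "cmod (\<psi> k t) \<le> R + 1" for k t
  proof (cases "t \<in> {0..T}")
   case True
   have "cmod (p k t) * E k t \<le> (R + 1) * 1" using pR[OF True] E01 R0 by (intro mult_mono) auto
   then show ?thesis using E01(1)[of k t] by (simp add: \<psi>_def norm_mult)
  qed (use R0 Es in \<open>simp add: \<psi>_def\<close>)
  fix t assume t: "0 < t" "t < T"
  have tT: "t \<in> {0..T}" using t by simp
  have "cmod (\<psi> k t - g k t) \<le> c k + R * (1 - E k t)" for k
  proof -
   have "\<psi> k t - g k t = (p k t - g k t) * of_real (E k t) + g k t * of_real (E k t - 1)"
    by (simp add: \<psi>_def algebra_simps)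
   also have "cmod \<dots> \<le> cmod (p k t - g k t) * E k t + cmod (g k t) * (1 - E k t)"
    using E01[of k t] by (intro order_trans[OF norm_triangle_ineq]) (simp only: norm_mult norm_of_real abs_of_nonneg abs_of_nonpos diff_le_0_iff_le minus_diff_eq order_refl)
   also have "\<dots> \<le> c k * 1 + R * (1 - E k t)"
    using E01[of k t] p(2)[OF tT, of k] R c(2)[of k]
    by (intro add_mono mult_mono mult_right_mono order_refl)
     (simp_all add: c_def norm_minus_commute order.strict_implies_order)
   finally show ?thesis by simp
  qed
  moreover have "(\<lambda>k. c k + R * (1 - E k t)) \<longlonglongrightarrow> 0 + R * (1 - 1)"
   by (intro tendsto_intros c E1 t)
  ultimately show "(\<lambda>k. \<psi> k t - g k t) \<longlonglongrightarrow> 0"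
   by (intro Lim_null_comparison[OF always_eventually, of "\<lambda>k. \<psi> k t - g k t" "\<lambda>k. c k + R * (1 - E k t)"]) simp_all
 qed
qed

lemma bumps_measurable: "0 < c \<Longrightarrow> f \<in> bumps a b c \<Longrightarrow> f \<in> borel_measurable borel"
 by (rule borel_measurable_continuous_onI) (rule bumps_continuous)

lemma bumps_integrable:
 assumes "0 < c" "f \<in> bumps a b c"
 shows "integrable lborel f"
proof -
 have "integrable lborel (\<lambda>t. indicator {a..b} t *\<^sub>R f t)"
  by (intro borel_integrable_compact bumps_continuous[OF assms]) auto
 moreover have "indicator {a..b} t *\<^sub>R f t = f t" for t
  using bumps_support[OF assms(2), of t] by (auto simp: indicator_def)
 ultimately show ?thesis by simp
qed

text \<open>
 An integrable function on \<open>(0, T)\<close> that integrates to zero against all test functions has vanishing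
 Fourier coefficients, so it vanishes.
\<close>

lemma AE_zero_of_bumps:
 fixes y :: "real \<Rightarrow> complex"
 assumes T: "0 < T" "T \<le> 1" and y: "integrable lborel y" and supp: "\<And>t. t \<notin> {0..T} \<Longrightarrow> y t = 0"
  and zero: "\<And>a b c f. 0 < a \<Longrightarrow> b < T \<Longrightarrow> 0 < c \<Longrightarrow> f \<in> bumps a b c \<Longrightarrow> (\<integral>t. f t * y t \<partial>lborel) = 0"
 shows "AE t in lborel. y t = 0"
proof -
 have [measurable]: "y \<in> borel_measurable borel" using y by (auto dest: borel_measurable_integrable)
 have coef: "(\<integral>t. y t * cis (k * t) \<partial>lborel) = 0" for k :: real
 proof -
  have "\<exists>\<psi>. (\<forall>j. \<exists>a b c. 0 < a \<and> b < T \<and> 0 < c \<and> \<psi> j \<in> bumps a b c) \<and> (\<forall>j t. cmod (\<psi> j t) \<le> 1 + 1) \<and>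
    (\<forall>t. 0 < t \<and> t < T \<longrightarrow> (\<lambda>j :: nat. \<psi> j t - cis (k * t)) \<longlonglongrightarrow> 0)"
  proof (rule bumps_approx[OF T(1)])
   show "continuous_on UNIV (\<lambda>t. cis (k * t))" unfolding cis_conv_exp by (intro continuous_intros)
  qed simp
  then obtain \<psi> where \<psi>: "\<forall>j. \<exists>a b c. 0 < a \<and> b < T \<and> 0 < c \<and> \<psi> j \<in> bumps a b c" "\<forall>j t. cmod (\<psi> j t) \<le> 1 + 1"
    "\<forall>t. 0 < t \<and> t < T \<longrightarrow> (\<lambda>j :: nat. \<psi> j t - cis (k * t)) \<longlonglongrightarrow> 0" by (elim exE conjE) (rule that)
  have \<psi>2: "cmod (\<psi> j t) \<le> 2" for j t using \<psi>(2) by simp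
  have [measurable]: "\<psi> j \<in> borel_measurable borel" for j using \<psi>(1)[rule_format, of j] bumps_measurable by blast
  have "(\<lambda>j. \<integral>t. \<psi> j t * y t \<partial>lborel) \<longlonglongrightarrow> (\<integral>t. y t * cis (k * t) \<partial>lborel)"
  proof (rule integral_dominated_convergence)
   show "integrable lborel (\<lambda>t. 2 * cmod (y t))" using y by simp
   show "AE t in lborel. norm (\<psi> j t * y t) \<le> 2 * cmod (y t)" for j
    using \<psi>2 by (intro AE_I2) (simp add: norm_mult mult_right_mono)
   have "AE t in lborel. t \<notin> {0, T}" by (rule AE_lborel_not_in_negligible) simp
   then show "AE t in lborel. (\<lambda>j. \<psi> j t * y t) \<longlonglongrightarrow> y t * cis (k * t)"
   proof eventually_elim
    case (elim t)
    show ?case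
    proof (cases "0 < t \<and> t < T")
     case True
     then have "(\<lambda>j. (\<psi> j t - cis (k * t)) * y t + cis (k * t) * y t) \<longlonglongrightarrow> 0 * y t + cis (k * t) * y t"
      by (intro tendsto_intros \<psi>(3)[rule_format]) auto
     then show ?thesis by (simp add: algebra_simps)
    next
     case False
     then have "t \<notin> {0..T}" using elim by auto
     then show ?thesis using supp by simp
    qed
   qed
  qed simp_all
  moreover have "(\<integral>t. \<psi> j t * y t \<partial>lborel) = 0" for j using \<psi>(1)[rule_format, of j] zero by blast
  ultimately show ?thesis by (simp add: LIMSEQ_const_iff)
 qed
 \<comment> \<open>The function \<open>y\<close> of one variable is seen as a function on the two-dimensional cell.\<close>
 define v where "v x = y (fst x)" for x :: "real \<times> real"
 have sub: "T < pi" using T pi_ge_two by linarith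
 have vi: "integrable (lborel \<Otimes>\<^sub>M lborel) (\<lambda>(s, r). y s * complex_of_real (indicator {- pi..pi} r))"
  by (rule integrable_lborel_mult_pair[OF y]) (intro integrable_of_real integrable_real_indicator; simp)
 have ind: "indicator cell x *\<^sub>R v x = y (fst x) * complex_of_real (indicator {- pi..pi} (snd x))" for x
  using supp[of "fst x"] sub by (cases "fst x \<in> {0..T}") (auto simp: cell_def v_def indicator_def mem_Times_iff)
 have v: "set_integrable lborel cell v"
  using vi unfolding set_integrable_def ind by (simp add: lborel_prod split_def)
 have "fcoeff v n = 0" for n
 proof -
  have i: "set_integrable lborel cell (\<lambda>x. v x * ech (- n) x)"
   using integrable_bounded_times[OF v[unfolded set_integrable_def], of "ech (- n)" 1] by (simp add: set_integrable_def)
  have "(LINT s:{- pi..pi}|lborel. v (s, r) * ech (- n) (s, r)) = 0" for r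
  proof -
   have "(LINT s:{- pi..pi}|lborel. v (s, r) * ech (- n) (s, r)) =
     (\<integral>s. cis (real_of_int (snd (- n)) * r) * (y s * cis (real_of_int (fst (- n)) * s)) \<partial>lborel)"
    unfolding set_lebesgue_integral_def
    by (intro Bochner_Integration.integral_cong refl)
     (use supp sub in \<open>auto simp: v_def ech_cis indicator_def\<close>)
   also have "\<dots> = 0" by (simp only: integral_mult_right_zero coef mult_zero_right)
   finally show ?thesis .
  qed
  then show ?thesis unfolding fcoeff_def LINT_cell_iterated(2)[OF i] by simp
 qed
 then have l: "l2 S (fcoeff v) \<le> 0" for S by (simp add: L2_set_def)
 have "(LINT x:cell|lborel. (cmod (v x))\<^sup>2) \<le> (0 / (2 * pi))\<^sup>2"
  by (rule cell_l2_of_fcoeff_l2(2)[OF v l])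
 then have le: "(\<integral>x. indicator cell x *\<^sub>R (cmod (v x))\<^sup>2 \<partial>lborel) \<le> 0" by (simp add: set_lebesgue_integral_def)
 have int: "integrable lborel (\<lambda>x. indicator cell x *\<^sub>R (cmod (v x))\<^sup>2)"
  using cell_l2_of_fcoeff_l2(1)[OF v l] by (simp add: set_integrable_def)
 have "(\<integral>x. indicator cell x *\<^sub>R (cmod (v x))\<^sup>2 \<partial>lborel) = 0"
  using le by (intro antisym Bochner_Integration.integral_nonneg) auto
 then have "AE x in lborel. indicator cell x *\<^sub>R (cmod (v x))\<^sup>2 = 0"
  by (subst (asm) integral_nonneg_eq_0_iff_AE[OF int]) auto
 then have "AE x in lborel \<Otimes>\<^sub>M lborel. indicator cell x *\<^sub>R (cmod (v x))\<^sup>2 = 0" unfolding lborel_prod .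
 from lborel_pair.AE_pair[OF this]
 show ?thesis
 proof eventually_elim
  case (elim t)
  show ?case
  proof (rule ccontr)
   assume yt: "y t \<noteq> 0"
   then have t: "t \<in> {- pi..pi}" using supp[of t] sub by (cases "t \<in> {0..T}") auto
   have "AE r in lborel. r \<notin> {- pi..pi}" using elim
    by eventually_elim (use yt t in \<open>auto simp: v_def cell_def indicator_def split: if_splits\<close>)
   then have "emeasure lborel {- pi..pi} = 0"
    by (subst (asm) AE_iff_measurable[OF _ refl]) (auto simp: atLeastAtMost_def atLeast_def atMost_def Int_def)
   then show False by simp
  qed
 qed
qed

section \<open>Identification of the spatial Fourier coefficients\<close>

lemma xcoeff_tensor:
 fixes \<psi> :: "real \<Rightarrow> complex"
 shows "xcoeff (tensor \<psi> k) t m = (if k = m then (2 * pi)\<^sup>2 * \<psi> t else 0)"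
proof -
 have "xcoeff (tensor \<psi> k) t m = \<psi> t * fcoeff (ech k) m"
  by (simp add: xcoeff_def fcoeff_def tensor_def mult.assoc)
 then show ?thesis by (simp add: fcoeff_ech)
qed

lemma st_fourier_tensor:
 assumes "0 < c" "\<psi> \<in> bumps a b c"
 shows "st_fourier (tensor \<psi> k) \<tau> m = (if k = m then (2 * pi)\<^sup>2 * tft \<psi> \<tau> else 0)"
proof -
 have "(\<lambda>t. xcoeff (tensor \<psi> k) t m) = (\<lambda>t. if k = m then (2 * pi)\<^sup>2 * \<psi> t else 0)"
  by (rule ext) (rule xcoeff_tensor)
 then show ?thesis
  unfolding st_fourier_Fubini(1)[OF tensor_bump_schwartz[OF assms]] by (simp add: tft_def mult.assoc)
qed

lemma slab_slices:
 assumes v: "set_integrable lborel (slab T) v"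
 shows "AE t in lborel. t \<in> {0..T} \<longrightarrow> set_integrable lborel cell (\<lambda>x. v (t, x))"
  and "integrable lborel (\<lambda>t. indicator {0..T} t *\<^sub>R fcoeff (\<lambda>x. v (t, x)) n)"
  and "(\<lambda>t. indicator {0..T} t *\<^sub>R fcoeff (\<lambda>x. v (t, x)) n) \<in> borel_measurable borel"
proof -
 have i: "integrable (lborel \<Otimes>\<^sub>M lborel) (\<lambda>p. indicator (slab T) p *\<^sub>R v p)"
  using v by (simp add: set_integrable_def lborel_prod)
 have ind: "indicator (slab T) (t, x) = (indicator {0..T} t * indicator cell x :: real)" for t x
  by (auto simp: slab_def indicator_def)
 from lborel_pair.AE_integrable_fst'[OF i]
 show "AE t in lborel. t \<in> {0..T} \<longrightarrow> set_integrable lborel cell (\<lambda>x. v (t, x))"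
 proof eventually_elim
  case (elim t)
  show ?case
  proof
   assume "t \<in> {0..T}"
   then show "set_integrable lborel cell (\<lambda>x. v (t, x))" using elim by (simp add: ind set_integrable_def)
  qed
 qed
 have e: "(\<lambda>p :: real \<times> real \<times> real. ech (- n) (snd p)) \<in> borel_measurable (lborel \<Otimes>\<^sub>M lborel)"
  using measurable_compose[OF measurable_snd measurable_ech] by simp
 have "integrable (lborel \<Otimes>\<^sub>M lborel) (\<lambda>p. (indicator (slab T) p *\<^sub>R v p) * ech (- n) (snd p))"
  by (rule integrable_bounded_times[OF i e, of 1]) simp
 from lborel_pair.integrable_fst'[OF this]
 show int: "integrable lborel (\<lambda>t. indicator {0..T} t *\<^sub>R fcoeff (\<lambda>x. v (t, x)) n)"
  by (simp add: ind fcoeff_def set_lebesgue_integral_def flip: scaleR_scaleR)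
 then show "(\<lambda>t. indicator {0..T} t *\<^sub>R fcoeff (\<lambda>x. v (t, x)) n) \<in> borel_measurable borel"
  by (auto dest: borel_measurable_integrable)
qed

lemma dist_of_iterated:
 assumes i: "set_integrable lborel (slab T) (\<lambda>p. v p * \<phi> p)"
 shows "dist_of T v \<phi> = (\<integral>t. indicator {0..T} t *\<^sub>R (LINT x:cell|lborel. v (t, x) * \<phi> (t, x)) \<partial>lborel)"
  and "integrable lborel (\<lambda>t. indicator {0..T} t *\<^sub>R (LINT x:cell|lborel. v (t, x) * \<phi> (t, x)))"
proof -
 have ind: "indicator (slab T) (t, x) = (indicator {0..T} t * indicator cell x :: real)" for t x
  by (auto simp: slab_def indicator_def)
 have i': "integrable (lborel \<Otimes>\<^sub>M lborel) (\<lambda>p. indicator (slab T) p *\<^sub>R (v p * \<phi> p))"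
  using i by (simp add: set_integrable_def lborel_prod)
 have inner: "(\<integral>x. indicator (slab T) (t, x) *\<^sub>R (v (t, x) * \<phi> (t, x)) \<partial>lborel) =
   indicator {0..T} t *\<^sub>R (LINT x:cell|lborel. v (t, x) * \<phi> (t, x))" for t
  by (simp add: ind set_lebesgue_integral_def flip: scaleR_scaleR)
 have "integrable (lborel \<Otimes>\<^sub>M lborel) (\<lambda>(t, x). indicator (slab T) (t, x) *\<^sub>R (v (t, x) * \<phi> (t, x)))"
  using i' by (simp add: split_def)
 from lborel_pair.integral_fst[OF this]
 show "dist_of T v \<phi> = (\<integral>t. indicator {0..T} t *\<^sub>R (LINT x:cell|lborel. v (t, x) * \<phi> (t, x)) \<partial>lborel)"
  unfolding inner dist_of_def set_lebesgue_integral_def by (simp add: lborel_prod split_def)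
 from lborel_pair.integrable_fst'[OF i']
 show "integrable lborel (\<lambda>t. indicator {0..T} t *\<^sub>R (LINT x:cell|lborel. v (t, x) * \<phi> (t, x)))"
  by (simp add: inner)
qed

text \<open>
 Testing the extension and \<open>v\<close> with bumps in time times one character shows that the two functions of
 time have the same integrals against all bumps in \<open>(0, T)\<close>.
\<close>

lemma fcoeff_eq_time_slice:
 assumes T: "0 < T" "T \<le> 1" and v: "set_integrable lborel (slab T) v"
  and F: "\<And>n. integrable lborel (\<lambda>\<tau>. F \<tau> n)"
  and eq: "\<And>\<phi>. \<phi> \<in> st_test T \<Longrightarrow> st_dist F \<phi> = dist_of T v \<phi>"
 shows "AE t in lborel. t \<in> {0..T} \<longrightarrow> fcoeff (\<lambda>x. v (t, x)) n = time_slice F t n"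
proof -
 have Fm: "(\<lambda>\<tau>. F \<tau> n) \<in> borel_measurable borel" using F[of n] by (auto dest: borel_measurable_integrable)
 have tsm: "(\<lambda>t. time_slice F t n) \<in> borel_measurable lborel"
  unfolding time_slice_def using Fm by measurable
 define B where "B = (\<integral>\<tau>. cmod (F \<tau> n) \<partial>lborel)"
 have tsB: "cmod (time_slice F t n) \<le> B" for t
 proof -
  have "cmod (\<integral>\<tau>. F \<tau> n * cis (\<tau> * t) \<partial>lborel) \<le> B"
   unfolding B_def by (rule integral_norm_bound_AE) (use F in \<open>auto simp: norm_mult\<close>)
  moreover have "cmod (time_slice F t n) \<le> cmod (\<integral>\<tau>. F \<tau> n * cis (\<tau> * t) \<partial>lborel) / 1"
   unfolding time_slice_def norm_divide using pi_ge_two by (intro divide_left_mono) auto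
  ultimately show ?thesis by simp
 qed
 let ?i = "indicator {0..T} :: real \<Rightarrow> real"
 have ii: "integrable lborel (\<lambda>t. complex_of_real (?i t))"
  by (intro integrable_of_real integrable_real_indicator) (simp_all add: emeasure_lborel_Icc_eq)
 have tsi: "integrable lborel (\<lambda>t. ?i t *\<^sub>R time_slice F t n)"
  using integrable_bounded_times[OF ii tsm tsB] by (simp add: scaleR_conv_of_real)
 define y where "y t = ?i t *\<^sub>R fcoeff (\<lambda>x. v (t, x)) n - ?i t *\<^sub>R time_slice F t n" for t
 have y: "integrable lborel y" unfolding y_def by (intro Bochner_Integration.integrable_diff slab_slices(2)[OF v] tsi)
 have "AE t in lborel. y t = 0"
 proof (rule AE_zero_of_bumps[OF T y])
  show "t \<notin> {0..T} \<Longrightarrow> y t = 0" for t by (simp add: y_def)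
  fix a b c :: real and \<psi> assume a: "0 < a" "b < T" and c: "0 < c" "\<psi> \<in> bumps a b c"
  define \<phi> where "\<phi> = tensor \<psi> (- n)"
  have \<phi>: "\<phi> \<in> st_test T" unfolding \<phi>_def by (rule tensor_bump_st_test[OF c a])
  have \<psi>i: "integrable lborel \<psi>" by (rule bumps_integrable[OF c])
  have \<psi>m: "\<psi> \<in> borel_measurable lborel" using bumps_measurable[OF c] by simp
  obtain D where D: "\<And>t. cmod (\<psi> t) \<le> D"
  proof -
   have "compact (\<psi> ` {a..b})" by (intro compact_continuous_image bumps_continuous[OF c]) simp
   then obtain D where D: "0 < D" "\<And>t. t \<in> {a..b} \<Longrightarrow> cmod (\<psi> t) \<le> D"
    using compact_imp_bounded bounded_pos by (metis imageI)
   have "cmod (\<psi> t) \<le> D" for t using D bumps_support[OF c(2), of t] by (cases "\<psi> t = 0") auto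
   then show ?thesis by (rule that)
  qed
  have supp: "?i t *\<^sub>R \<psi> t = \<psi> t" for t
   using bumps_support[OF c(2), of t] a by (cases "\<psi> t = 0") (auto simp: indicator_def)
  have "st_dist F \<phi> = (\<integral>t. \<psi> t * time_slice F t n \<partial>lborel)"
  proof -
   define h where "h m = (\<integral>\<tau>. F \<tau> m * st_fourier \<phi> (- \<tau>) (- m) \<partial>lborel)" for m
   have h0: "h m = 0" if "m \<noteq> n" for m
    using that by (simp add: h_def \<phi>_def st_fourier_tensor[OF c])
   have "(LINT m|count_space UNIV. h m) = (\<Sum>m | m \<in> UNIV \<and> h m \<noteq> 0. h m)"
    by (rule lebesgue_integral_count_space_finite_support) (rule finite_subset[of _ "{n}"], use h0 in auto)
   also have "\<dots> = (\<Sum>m\<in>{n}. h m)" by (intro sum.mono_neutral_left) (use h0 in auto)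
   also have "\<dots> = (\<integral>\<tau>. (2 * pi)\<^sup>2 * (F \<tau> n * tft \<psi> (- \<tau>)) \<partial>lborel)"
    by (simp add: h_def \<phi>_def st_fourier_tensor[OF c] mult_ac)
   also have "\<dots> = (2 * pi)\<^sup>2 * (\<integral>t. \<psi> t * (\<integral>\<tau>. F \<tau> n * cis (\<tau> * t) \<partial>lborel) \<partial>lborel)"
    unfolding integral_mult_right_zero tft_swap[OF F \<psi>i] ..
   also have "(\<integral>t. \<psi> t * (\<integral>\<tau>. F \<tau> n * cis (\<tau> * t) \<partial>lborel) \<partial>lborel) = (\<integral>t. (2 * pi) * (\<psi> t * time_slice F t n) \<partial>lborel)"
    by (simp add: time_slice_def)
   finally show ?thesis
    unfolding st_dist_def h_def[symmetric] integral_mult_right_zero by (simp add: power3_eq_cube power2_eq_square)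
  qed
  moreover have "dist_of T v \<phi> = (\<integral>t. \<psi> t * (?i t *\<^sub>R fcoeff (\<lambda>x. v (t, x)) n) \<partial>lborel)"
  proof -
   have bd: "cmod (\<phi> p) \<le> D" for p using D by (simp add: \<phi>_def tensor_def norm_mult)
   have "\<phi> \<in> borel_measurable borel"
    using \<phi> by (intro borel_measurable_continuous_onI schwartz_continuous st_test_schwartz)
   then have "set_integrable lborel (slab T) (\<lambda>p. v p * \<phi> p)"
    using integrable_bounded_times[OF v[unfolded set_integrable_def] _ bd] by (simp add: set_integrable_def)
   moreover have "(LINT x:cell|lborel. v (t, x) * \<phi> (t, x)) = \<psi> t * fcoeff (\<lambda>x. v (t, x)) n" for t
   proof -
    have "(LINT x:cell|lborel. v (t, x) * \<phi> (t, x)) = (LINT x:cell|lborel. \<psi> t * (v (t, x) * ech (- n) x))"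
     by (simp add: \<phi>_def tensor_def mult_ac)
    then show ?thesis by (simp add: fcoeff_def)
   qed
   ultimately show ?thesis by (simp add: dist_of_iterated)
  qed
  ultimately have eq': "(\<integral>t. \<psi> t * (?i t *\<^sub>R fcoeff (\<lambda>x. v (t, x)) n) \<partial>lborel) = (\<integral>t. \<psi> t * (?i t *\<^sub>R time_slice F t n) \<partial>lborel)"
   using eq[OF \<phi>] supp by (simp only: mult_scaleR_left[symmetric] mult_scaleR_right[symmetric]) (simp add: mult_scaleR_left[symmetric] supp)
  have "integrable lborel (\<lambda>t. \<psi> t * (?i t *\<^sub>R fcoeff (\<lambda>x. v (t, x)) n))" "integrable lborel (\<lambda>t. \<psi> t * (?i t *\<^sub>R time_slice F t n))"
   using integrable_bounded_times[OF slab_slices(2)[OF v, of n] \<psi>m D]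
    integrable_bounded_times[OF tsi \<psi>m D] by (simp_all add: mult.commute)
  then show "(\<integral>t. \<psi> t * y t \<partial>lborel) = 0"
   unfolding y_def right_diff_distrib by (subst Bochner_Integration.integral_diff) (use eq' in simp_all)
 qed
 then show ?thesis by eventually_elim (auto simp: y_def)
qed

section \<open>Square integrable curves of Fourier coefficients\<close>

lemma integrable_of_bounded_support:
 fixes y :: "real \<Rightarrow> complex"
 assumes ym: "y \<in> borel_measurable borel" and R: "AE t in lborel. cmod (y t) \<le> R"
  and supp: "\<And>t. t \<notin> {0..T} \<Longrightarrow> y t = 0"
 shows "integrable lborel y" and "integrable lborel (\<lambda>t. (cmod (y t))\<^sup>2)"
proof -
 have i: "integrable lborel (\<lambda>t. c * indicator {0..T} t :: real)" for c
  by (intro integrable_mult_right integrable_real_indicator) (simp_all add: emeasure_lborel_Icc_eq)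
 show "integrable lborel y"
 proof (rule Bochner_Integration.integrable_bound[OF i[of R]])
  show "AE t in lborel. norm (y t) \<le> norm (R * indicator {0..T} t)"
   using R by eventually_elim (use supp in \<open>auto simp: indicator_def\<close>)
 qed (use ym in simp)
 show "integrable lborel (\<lambda>t. (cmod (y t))\<^sup>2)"
 proof (rule Bochner_Integration.integrable_bound[OF i[of "R\<^sup>2"]])
  show "AE t in lborel. norm ((cmod (y t))\<^sup>2) \<le> norm (R\<^sup>2 * indicator {0..T} t)"
   using R by eventually_elim (use supp in \<open>auto simp: indicator_def intro: power_mono\<close>)
 qed (use ym in simp)
qed

text \<open>
 A measurable function is an almost everywhere limit of continuous ones. Clipping those to a ball keeps
 them uniformly bounded, so the bumps that approximate them converge dominatedly.
\<close>

lemma bumps_dense_L2: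
 fixes y :: "real \<Rightarrow> complex"
 assumes T: "0 < T" and ym: "y \<in> borel_measurable borel" and R: "AE t in lborel. cmod (y t) \<le> R" and R0: "0 \<le> R"
  and supp: "\<And>t. t \<notin> {0..T} \<Longrightarrow> y t = 0" and e: "0 < e"
 shows "\<exists>\<psi> a b c. 0 < a \<and> b < T \<and> 0 < c \<and> \<psi> \<in> bumps a b c \<and> (\<integral>t. (cmod (y t - \<psi> t))\<^sup>2 \<partial>lborel) < e"
proof -
 have "y measurable_on UNIV"
  using ym by (simp add: measurable_on_iff_borel_measurable lebesgue_on_UNIV_eq measurable_completion)
 then obtain N g where N: "negligible N" and g: "\<And>k. continuous_on UNIV (g k)"
  and gf: "\<And>x. x \<notin> N \<Longrightarrow> (\<lambda>k. g k x) \<longlonglongrightarrow> y x"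
  unfolding measurable_on_def by auto
 let ?c = "closest_point (cball 0 R :: complex set)"
 have ne: "cball 0 R \<noteq> ({} :: complex set)" using R0 by auto
 have cc: "continuous_on UNIV ?c" by (intro continuous_on_closest_point) (use ne in auto)
 have cR: "cmod (?c z) \<le> R" for z using closest_point_in_set[of "cball 0 R" z] ne by auto
 have "\<exists>\<psi>. (\<forall>k. \<exists>a b c. 0 < a \<and> b < T \<and> 0 < c \<and> \<psi> k \<in> bumps a b c) \<and> (\<forall>k t. cmod (\<psi> k t) \<le> R + 1) \<and>
   (\<forall>t. 0 < t \<and> t < T \<longrightarrow> (\<lambda>k. \<psi> k t - ?c (g k t)) \<longlonglongrightarrow> 0)"
  by (intro bumps_approx T cR continuous_on_compose2[OF cc] g) simp
 then obtain \<psi> where \<psi>: "\<forall>k. \<exists>a b c. 0 < a \<and> b < T \<and> 0 < c \<and> \<psi> k \<in> bumps a b c" "\<forall>k t. cmod (\<psi> k t) \<le> R + 1"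
   "\<forall>t. 0 < t \<and> t < T \<longrightarrow> (\<lambda>k. \<psi> k t - ?c (g k t)) \<longlonglongrightarrow> 0" by (elim exE conjE) (rule that)
 have \<psi>m [measurable]: "\<psi> k \<in> borel_measurable borel" for k using \<psi>(1)[rule_format, of k] bumps_measurable by blast
 note [measurable] = ym
 have \<psi>s: "\<psi> k t = 0" if "t \<notin> {0..T}" for k t
 proof (rule ccontr)
  assume n: "\<psi> k t \<noteq> 0"
  obtain a b c where "0 < a" "b < T" "\<psi> k \<in> bumps a b c" using \<psi>(1)[rule_format, of k] by blast
  then show False using bumps_support[of "\<psi> k" a b c t] n that by auto
 qed
 have "AE t in lborel. t \<notin> {0, T}" by (rule AE_lborel_not_in_negligible) simp
 with R AE_lborel_not_in_negligible[OF N]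
 have lim: "AE t in lborel. (\<lambda>k. y t - \<psi> k t) \<longlonglongrightarrow> 0"
 proof eventually_elim
  case (elim t)
  show ?case
  proof (cases "t \<in> {0..T}")
   case True
   then have t: "0 < t \<and> t < T" using elim by auto
   have "(\<lambda>k. ?c (g k t)) \<longlonglongrightarrow> ?c (y t)"
    using cc gf[OF elim(2)] by (rule continuous_on_tendsto_compose) auto
   moreover have "?c (y t) = y t" using elim(1) by (intro closest_point_self) simp
   ultimately have "(\<lambda>k. y t - (?c (g k t) + (\<psi> k t - ?c (g k t)))) \<longlonglongrightarrow> y t - (y t + 0)"
    using \<psi>(3)[rule_format, OF t] by (intro tendsto_intros) auto
   then show ?thesis by simp
  next
   case False
   then show ?thesis using supp \<psi>s by simp
  qed
 qed
 have "(\<lambda>k. \<integral>t. (cmod (y t - \<psi> k t))\<^sup>2 \<partial>lborel) \<longlonglongrightarrow> (\<integral>t. 0 \<partial>(lborel :: real measure))"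
 proof (rule integral_dominated_convergence)
  show "integrable lborel (\<lambda>t. (2 * R + 1)\<^sup>2 * indicator {0..T} t :: real)"
   by (intro integrable_mult_right integrable_real_indicator) (simp_all add: emeasure_lborel_Icc_eq)
  show "AE t in lborel. (\<lambda>k. (cmod (y t - \<psi> k t))\<^sup>2) \<longlonglongrightarrow> 0"
   using lim
  proof eventually_elim
   case (elim t)
   show ?case using tendsto_power[OF tendsto_norm_zero[OF elim], of 2] by simp
  qed
  show "AE t in lborel. norm ((cmod (y t - \<psi> k t))\<^sup>2) \<le> (2 * R + 1)\<^sup>2 * indicator {0..T} t" for k
   using R
  proof eventually_elim
   case (elim t)
   show ?case
   proof (cases "t \<in> {0..T}")
    case True
    have "cmod (y t - \<psi> k t) \<le> cmod (y t) + cmod (\<psi> k t)" by (rule norm_triangle_ineq4)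
    also have "\<dots> \<le> R + (R + 1)" using elim \<psi>(2) by (intro add_mono) auto
    finally have "cmod (y t - \<psi> k t) \<le> 2 * R + 1" by simp
    then show ?thesis using True by (simp add: power_mono)
   qed (use supp \<psi>s in simp)
  qed
 qed measurable
 then have "(\<lambda>k. \<integral>t. (cmod (y t - \<psi> k t))\<^sup>2 \<partial>lborel) \<longlonglongrightarrow> 0" by simp
 then have "\<forall>\<^sub>F k in sequentially. (\<integral>t. (cmod (y t - \<psi> k t))\<^sup>2 \<partial>lborel) < e" using e by (rule order_tendstoD)
 then obtain k where "(\<integral>t. (cmod (y t - \<psi> k t))\<^sup>2 \<partial>lborel) < e" by (auto simp: eventually_sequentially)
 then show ?thesis using \<psi>(1)[rule_format, of k] by blast
qed

text \<open>For \<open>b \<le> 0\<close> the modulation weight is at most one, so Plancherel in time bounds the norm.\<close>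

lemma Xsb_term_le:
 fixes y :: "real \<Rightarrow> complex"
 assumes y: "integrable lborel y" "integrable lborel (\<lambda>t. (cmod (y t))\<^sup>2)" and b: "b \<le> 0"
 shows "(\<integral>\<^sup>+ \<tau>. ennreal ((jbracket (freq n) powr s * jbracket (\<bar>\<tau>\<bar> - jbracket (freq n)) powr b * cmod (tft y \<tau>))\<^sup>2) \<partial>lborel)
  \<le> ennreal ((jbracket (freq n) powr s)\<^sup>2 * (2 * pi * (\<integral>t. (cmod (y t))\<^sup>2 \<partial>lborel)))"
proof -
 let ?J = "jbracket (freq n) powr s"
 have [measurable]: "tft y \<in> borel_measurable borel"
  using y(1) by (intro tft_measurable) (auto dest: borel_measurable_integrable)
 have "(\<integral>\<^sup>+ \<tau>. ennreal ((?J * jbracket (\<bar>\<tau>\<bar> - jbracket (freq n)) powr b * cmod (tft y \<tau>))\<^sup>2) \<partial>lborel)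
   \<le> (\<integral>\<^sup>+ \<tau>. ennreal (?J\<^sup>2) * ennreal ((cmod (tft y \<tau>))\<^sup>2) \<partial>lborel)"
 proof (rule nn_integral_mono)
  fix \<tau> :: real
  let ?w = "jbracket (\<bar>\<tau>\<bar> - jbracket (freq n)) powr b"
  have "?w \<le> jbracket (\<bar>\<tau>\<bar> - jbracket (freq n)) powr 0" using b jbracket_ge_one by (rule powr_mono)
  then have "?J * ?w * cmod (tft y \<tau>) \<le> ?J * 1 * cmod (tft y \<tau>)"
   by (intro mult_mono) auto
  then have "(?J * ?w * cmod (tft y \<tau>))\<^sup>2 \<le> (?J * cmod (tft y \<tau>))\<^sup>2" by (intro power_mono) auto
  then show "ennreal ((?J * ?w * cmod (tft y \<tau>))\<^sup>2) \<le> ennreal (?J\<^sup>2) * ennreal ((cmod (tft y \<tau>))\<^sup>2)"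
   by (simp add: power_mult_distrib flip: ennreal_mult)
 qed
 also have "\<dots> = ennreal (?J\<^sup>2) * (\<integral>\<^sup>+ \<tau>. ennreal ((cmod (tft y \<tau>))\<^sup>2) \<partial>lborel)" by (rule nn_integral_cmult) measurable
 also have "\<dots> \<le> ennreal (?J\<^sup>2) * ennreal (2 * pi * (\<integral>t. (cmod (y t))\<^sup>2 \<partial>lborel))"
  by (intro mult_left_mono tft_Plancherel_le y) simp
 also have "\<dots> = ennreal (?J\<^sup>2 * (2 * pi * (\<integral>t. (cmod (y t))\<^sup>2 \<partial>lborel)))"
  by (rule ennreal_mult[symmetric]) (auto intro!: mult_nonneg_nonneg Bochner_Integration.integral_nonneg)
 finally show ?thesis .
qed

lemma smooth_sum_tensor:
 assumes \<psi>: "\<And>m. \<exists>a b c. 0 < c \<and> \<psi> m \<in> bumps a b c" and S: "finite S"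
 shows "smooth (\<lambda>p. \<Sum>m\<in>S. z m * tensor (\<psi> m) m p)"
proof -
 have sm: "smooth (tensor (\<psi> m) m)" for m using \<psi>[of m] smooth_tensor_bump by blast
 show ?thesis using S
 proof (induction S rule: finite_induct)
  case empty
  show ?case using smooth_linear[OF sm[of 0] sm[of 0], of 0 0] by simp
 next
  case (insert m S)
  show ?case using smooth_linear[OF sm[of m] insert.IH, of "z m" 1] insert.hyps by simp
 qed
qed

text \<open>
 Schwartz functions with prescribed time dependence in finitely many frequencies.
\<close>

lemma trig_sum_bumps:
 fixes \<psi> :: "int \<times> int \<Rightarrow> real \<Rightarrow> complex"
 assumes \<psi>: "\<And>m. \<exists>a b c. 0 < a \<and> b < T \<and> 0 < c \<and> \<psi> m \<in> bumps a b c" and S: "finite S"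
 defines "f \<equiv> \<lambda>p. trig_sum S (\<lambda>m. \<psi> m (fst p) / (2 * pi)\<^sup>2) (snd p)"
 shows "f \<in> schwartz" and "st_fourier f \<tau> n = (if n \<in> S then tft (\<psi> n) \<tau> else 0)"
proof -
 have \<psi>': "\<exists>a b c. 0 < c \<and> \<psi> m \<in> bumps a b c" for m using \<psi>[of m] by blast
 have slice: "(\<lambda>x. f (t, x)) = trig_sum S (\<lambda>m. \<psi> m t / (2 * pi)\<^sup>2)" for t by (simp add: f_def)
 show f: "f \<in> schwartz"
 proof (rule schwartz_of_compact_support)
  have "f = (\<lambda>p. \<Sum>m\<in>S. (1 / (2 * pi)\<^sup>2) * tensor (\<psi> m) m p)"
   by (simp add: f_def trig_sum_def tensor_def)
  then show "smooth f" using smooth_sum_tensor[OF \<psi>' S, of "\<lambda>m. 1 / (2 * pi)\<^sup>2"] by simp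
  show "periodic (\<lambda>x. f (t, x))" for t
   unfolding slice using torus_test_trig_sum[OF S] by (simp add: torus_test_def)
  fix p assume fp: "f p \<noteq> 0"
  have "\<exists>m. \<psi> m (fst p) \<noteq> 0"
  proof (rule ccontr)
   assume "\<not> (\<exists>m. \<psi> m (fst p) \<noteq> 0)"
   then have z: "\<psi> m (fst p) = 0" for m by blast
   have "f p = 0" by (simp only: f_def trig_sum_def z) simp
   then show False using fp by simp
  qed
  then obtain m where "\<psi> m (fst p) \<noteq> 0" ..
  moreover obtain a b c where "0 < a" "b < T" "\<psi> m \<in> bumps a b c" using \<psi>[of m] by blast
  ultimately show "0 \<le> fst p \<and> fst p \<le> T" using bumps_support[of "\<psi> m" a b c "fst p"] by auto
 qed
 have "(\<lambda>t. xcoeff f t n) = (\<lambda>t. if n \<in> S then \<psi> n t else 0)"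
  by (rule ext) (simp add: xcoeff_def slice fcoeff_trig_sum[OF S])
 then show "st_fourier f \<tau> n = (if n \<in> S then tft (\<psi> n) \<tau> else 0)"
  unfolding st_fourier_Fubini(1)[OF f] by (simp add: tft_def)
qed

lemma hbd_pointwise: "hbd s c K \<Longrightarrow> cmod (c n) \<le> K * jbracket (freq n) powr (- s)"
proof -
 assume "hbd s c K"
 then have "L2_set (\<lambda>n. jbracket (freq n) powr s * cmod (c n)) {n} \<le> K" unfolding hbd_def by blast
 then have "jbracket (freq n) powr s * cmod (c n) \<le> K" by simp
 then show ?thesis using jbracket_pos[of "freq n"] by (simp add: powr_minus field_simps)
qed

text \<open>
 The space \<open>X\<^sup>s\<^sup>,\<^sup>b\<close> with \<open>b \<le> 0\<close> contains the curves in \<open>L\<^sup>2\<close> in time with values in \<open>H\<^sup>s\<close>, extended by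
 zero. This is where the power of \<open>T\<close> comes from: \<open>L\<^sup>\<infinity>\<close> curves on \<open>[0, T]\<close> have \<open>L\<^sup>2\<close> norm \<open>T\<^sup>1\<^sup>/\<^sup>2\<close>.
 For the membership, all but finitely many frequencies are dropped, and the others are replaced by
 bumps.
\<close>

lemma Xsb_of_curve:
 fixes y :: "int \<times> int \<Rightarrow> real \<Rightarrow> complex"
 assumes T: "0 < T" and ym: "\<And>m. y m \<in> borel_measurable borel" and supp: "\<And>m t. t \<notin> {0..T} \<Longrightarrow> y m t = 0"
  and hb: "AE t in lborel. hbd s (\<lambda>m. y m t) M" and M: "0 \<le> M" and b: "b \<le> 0"
 shows "Xsb_sqnorm s b (\<lambda>\<tau> m. tft (y m) \<tau>) \<le> ennreal (2 * pi * T * M\<^sup>2)"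
  and "(\<lambda>\<tau> m. tft (y m) \<tau>) \<in> Xsb s b"
proof -
 define J where "J m = jbracket (freq m) powr s" for m
 have J: "0 < J m" for m using jbracket_pos[of "freq m"] by (simp add: J_def)
 have yR: "AE t in lborel. cmod (y m t) \<le> M * jbracket (freq m) powr (- s)" for m
  using hb by eventually_elim (rule hbd_pointwise)
 note yi = integrable_of_bounded_support[OF ym yR supp]
 define a where "a m = (J m)\<^sup>2 * (2 * pi * (\<integral>t. (cmod (y m t))\<^sup>2 \<partial>lborel))" for m
 have a0: "0 \<le> a m" for m
  unfolding a_def by (intro mult_nonneg_nonneg Bochner_Integration.integral_nonneg) auto
 have suma: "sum a S \<le> 2 * pi * T * M\<^sup>2" if S: "finite S" for S
 proof -
  have "sum a S = 2 * pi * (\<Sum>m\<in>S. \<integral>t. (J m * cmod (y m t))\<^sup>2 \<partial>lborel)"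
   by (simp add: a_def sum_distrib_left power_mult_distrib mult_ac)
  also have "(\<Sum>m\<in>S. \<integral>t. (J m * cmod (y m t))\<^sup>2 \<partial>lborel) = (\<integral>t. (\<Sum>m\<in>S. (J m * cmod (y m t))\<^sup>2) \<partial>lborel)"
   by (rule Bochner_Integration.integral_sum[symmetric]) (use yi(2) in \<open>simp add: power_mult_distrib\<close>)
  also have "\<dots> \<le> (\<integral>t. M\<^sup>2 * indicator {0..T} t \<partial>lborel)"
  proof (rule integral_mono_AE)
   show "integrable lborel (\<lambda>t. \<Sum>m\<in>S. (J m * cmod (y m t))\<^sup>2)"
    by (intro Bochner_Integration.integrable_sum) (use yi(2) in \<open>simp add: power_mult_distrib\<close>)
   show "integrable lborel (\<lambda>t. M\<^sup>2 * indicator {0..T} t :: real)"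
    by (intro integrable_mult_right integrable_real_indicator) (simp_all add: emeasure_lborel_Icc_eq)
   show "AE t in lborel. (\<Sum>m\<in>S. (J m * cmod (y m t))\<^sup>2) \<le> M\<^sup>2 * indicator {0..T} t"
    using hb
   proof eventually_elim
    case (elim t)
    show ?case
    proof (cases "t \<in> {0..T}")
     case True
     have "L2_set (\<lambda>m. J m * cmod (y m t)) S \<le> M" using elim S unfolding hbd_def J_def by blast
     then have "(L2_set (\<lambda>m. J m * cmod (y m t)) S)\<^sup>2 \<le> M\<^sup>2" by (intro power_mono) auto
     then show ?thesis using True by (simp add: L2_set_def sum_nonneg)
    qed (use supp in simp)
   qed
  qed
  also have "\<dots> = M\<^sup>2 * T" using T by simp
  finally show ?thesis by (simp add: mult_ac)
 qed
 have term_le: "(\<integral>\<^sup>+ \<tau>. ennreal ((jbracket (freq m) powr s * jbracket (\<bar>\<tau>\<bar> - jbracket (freq m)) powr b * cmod (tft (y m) \<tau>))\<^sup>2) \<partial>lborel)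
   \<le> ennreal (a m)" for m
  unfolding a_def J_def by (rule Xsb_term_le[OF yi b])
 show "Xsb_sqnorm s b (\<lambda>\<tau> m. tft (y m) \<tau>) \<le> ennreal (2 * pi * T * M\<^sup>2)"
  unfolding Xsb_sqnorm_def
 proof (rule nn_integral_count_space_le)
  fix S :: "(int \<times> int) set" assume S: "finite S"
  have "(\<Sum>m\<in>S. \<integral>\<^sup>+ \<tau>. ennreal ((jbracket (freq m) powr s * jbracket (\<bar>\<tau>\<bar> - jbracket (freq m)) powr b * cmod (tft (y m) \<tau>))\<^sup>2) \<partial>lborel)
   \<le> (\<Sum>m\<in>S. ennreal (a m))" by (intro sum_mono term_le)
  also have "\<dots> = ennreal (sum a S)" by (rule sum_ennreal) (rule a0)
  also have "\<dots> \<le> ennreal (2 * pi * T * M\<^sup>2)" by (intro ennreal_leI suma S)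
  finally show "(\<Sum>m\<in>S. \<integral>\<^sup>+ \<tau>. ennreal ((jbracket (freq m) powr s * jbracket (\<bar>\<tau>\<bar> - jbracket (freq m)) powr b * cmod (tft (y m) \<tau>))\<^sup>2) \<partial>lborel)
   \<le> ennreal (2 * pi * T * M\<^sup>2)" .
 qed
 show "(\<lambda>\<tau> m. tft (y m) \<tau>) \<in> Xsb s b"
  unfolding Xsb_def mem_Collect_eq
 proof (intro conjI allI impI)
  show "(\<lambda>\<tau>. tft (y m) \<tau>) \<in> borel_measurable lborel" for m using tft_measurable[OF ym, of m] by simp
  fix e :: real assume e: "0 < e"
  have bdd: "bdd_above (sum a ` Collect finite)" using suma by (auto intro!: bdd_aboveI2)
  let ?A = "SUP S\<in>Collect finite. sum a S"
  have "?A - e / 4 < ?A" using e by simp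
  then obtain S where S: "finite S" "?A - e / 4 < sum a S"
   by (subst (asm) less_cSUP_iff[OF _ bdd]) auto
  have tail: "sum a S' \<le> e / 4" if "finite S'" "S' \<inter> S = {}" for S'
  proof -
   have "sum a (S' \<union> S) \<le> ?A" using that S by (intro cSUP_upper bdd) auto
   moreover have "sum a (S' \<union> S) = sum a S' + sum a S" using that S by (intro sum.union_disjoint) auto
   ultimately show ?thesis using S(2) by linarith
  qed
  define d where "d m = e / (4 * (real (card S) + 1) * (J m)\<^sup>2 * (2 * pi))" for m
  have d: "0 < d m" for m using e J[of m] unfolding d_def
   by (intro divide_pos_pos mult_pos_pos zero_less_power add_nonneg_pos) auto
  have "\<forall>m. \<exists>\<psi> a b c. 0 < a \<and> b < T \<and> 0 < c \<and> \<psi> \<in> bumps a b c \<and> (\<integral>t. (cmod (y m t - \<psi> t))\<^sup>2 \<partial>lborel) < d m"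
   by (intro allI bumps_dense_L2[OF T ym yR] supp d) (use M in auto)
  then obtain \<psi> where \<psi>: "\<forall>m. \<exists>a b c. 0 < a \<and> b < T \<and> 0 < c \<and> \<psi> m \<in> bumps a b c \<and> (\<integral>t. (cmod (y m t - \<psi> m t))\<^sup>2 \<partial>lborel) < d m"
   by (rule choice[THEN exE])
  have \<psi>b: "\<exists>a b c. 0 < a \<and> b < T \<and> 0 < c \<and> \<psi> m \<in> bumps a b c" for m using \<psi>[rule_format, of m] by blast
  have \<psi>d: "(\<integral>t. (cmod (y m t - \<psi> m t))\<^sup>2 \<partial>lborel) < d m" for m using \<psi>[rule_format, of m] by blast
  define f where "f p = trig_sum S (\<lambda>m. \<psi> m (fst p) / (2 * pi)\<^sup>2) (snd p)" for p
  note tb = trig_sum_bumps[where T = T and \<psi> = \<psi>, OF \<psi>b S(1)]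
  have f: "f \<in> schwartz" unfolding f_def[abs_def] by (rule tb(1))
  have ff: "st_fourier f \<tau> n = (if n \<in> S then tft (\<psi> n) \<tau> else 0)" for \<tau> n
   unfolding f_def[abs_def] by (rule tb(2))
  define a' where "a' m = (if m \<in> S then e / (4 * (real (card S) + 1)) else a m)" for m
  have a'0: "0 \<le> a' m" for m using a0 e by (simp add: a'_def)
  have term': "(\<integral>\<^sup>+ \<tau>. ennreal ((jbracket (freq m) powr s * jbracket (\<bar>\<tau>\<bar> - jbracket (freq m)) powr b * cmod (tft (y m) \<tau> - st_fourier f \<tau> m))\<^sup>2) \<partial>lborel)
   \<le> ennreal (a' m)" for m
  proof (cases "m \<in> S")
   case False
   then show ?thesis using term_le[of m] by (simp add: ff a'_def)
  next
   case True
   obtain a1 b1 c1 where c1: "0 < a1" "b1 < T" "0 < c1" "\<psi> m \<in> bumps a1 b1 c1" using \<psi>b[of m] by blast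
   have \<psi>i: "integrable lborel (\<psi> m)" by (rule bumps_integrable[OF c1(3,4)])
   have \<psi>m: "\<psi> m \<in> borel_measurable borel" by (rule bumps_measurable[OF c1(3,4)])
   have \<psi>s: "\<psi> m t = 0" if "t \<notin> {0..T}" for t
    using bumps_support[OF c1(4), of t] c1(1,2) that by (cases "\<psi> m t = 0") auto
   define q where "q t = y m t - \<psi> m t" for t
   obtain D where D: "\<And>t. t \<in> {0..T} \<Longrightarrow> cmod (\<psi> m t) \<le> D"
   proof -
    have "compact (\<psi> m ` {0..T})" by (intro compact_continuous_image bumps_continuous[OF c1(3,4)]) simp
    then obtain D where "\<forall>z\<in>\<psi> m ` {0..T}. cmod z \<le> D" using compact_imp_bounded bounded_iff by blast
    then show ?thesis by (intro that[of D]) blast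
   qed
   have qm: "q \<in> borel_measurable borel" unfolding q_def using ym[of m] \<psi>m by measurable
   have qs: "q t = 0" if "t \<notin> {0..T}" for t using that supp \<psi>s by (simp add: q_def)
   have D0: "0 \<le> D" using order_trans[OF norm_ge_zero D[of 0]] T by simp
   have qb: "AE t in lborel. cmod (q t) \<le> M * jbracket (freq m) powr (- s) + D"
    using yR[of m]
   proof eventually_elim
    case (elim t)
    show ?case
    proof (cases "t \<in> {0..T}")
     case True
     then show ?thesis unfolding q_def
      by (intro order_trans[OF norm_triangle_ineq4] add_mono elim D)
    next
     case False
     then show ?thesis using qs[OF False] M D0 by simp
    qed
   qed
   note q = integrable_of_bounded_support[OF qm qb qs]
   have lin: "tft q \<tau> = tft (y m) \<tau> - tft (\<psi> m) \<tau>" for \<tau>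
    unfolding tft_def q_def left_diff_distrib
    by (rule Bochner_Integration.integral_diff)
     (rule integrable_bounded_times[of _ _ _ 1, OF yi(1)] integrable_bounded_times[of _ _ _ 1, OF \<psi>i]; simp)+
   have "(J m)\<^sup>2 * (2 * pi * (\<integral>t. (cmod (q t))\<^sup>2 \<partial>lborel)) \<le> (J m)\<^sup>2 * (2 * pi * d m)"
    using \<psi>d[of m] by (intro mult_left_mono) (auto simp: q_def)
   also have "\<dots> = a' m" using True J[of m] by (simp add: d_def a'_def)
   finally have le: "ennreal ((J m)\<^sup>2 * (2 * pi * (\<integral>t. (cmod (q t))\<^sup>2 \<partial>lborel))) \<le> ennreal (a' m)" by (rule ennreal_leI)
   show ?thesis
    using order_trans[OF Xsb_term_le[OF q b, where n = m and s = s] le[unfolded J_def]] True by (simp add: ff lin)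
  qed
  have "Xsb_sqnorm s b (\<lambda>\<tau> m. tft (y m) \<tau> - st_fourier f \<tau> m) \<le> ennreal (e / 2)"
   unfolding Xsb_sqnorm_def
  proof (rule nn_integral_count_space_le)
   fix S' :: "(int \<times> int) set" assume S': "finite S'"
   have "sum a' S' = sum a' (S' \<inter> S) + sum a' (S' - S)"
    using S' by (simp add: sum.Int_Diff)
   also have "sum a' (S' - S) = sum a (S' - S)" by (intro sum.cong) (auto simp: a'_def)
   also have "\<dots> \<le> e / 4" using S' by (intro tail) auto
   also have "sum a' (S' \<inter> S) \<le> sum a' S" using S(1) a'0 by (intro sum_mono2) auto
   also have "sum a' S = real (card S) * (e / (4 * (real (card S) + 1)))" by (simp add: a'_def)
   also have "\<dots> \<le> e / 4" using e by (simp add: field_simps)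
   finally have le: "sum a' S' \<le> e / 2" by simp
   have "(\<Sum>m\<in>S'. \<integral>\<^sup>+ \<tau>. ennreal ((jbracket (freq m) powr s * jbracket (\<bar>\<tau>\<bar> - jbracket (freq m)) powr b * cmod (tft (y m) \<tau> - st_fourier f \<tau> m))\<^sup>2) \<partial>lborel)
    \<le> (\<Sum>m\<in>S'. ennreal (a' m))" by (intro sum_mono term')
   also have "\<dots> = ennreal (sum a' S')" by (rule sum_ennreal) (rule a'0)
   also have "\<dots> \<le> ennreal (e / 2)" by (rule ennreal_leI[OF le])
   finally show "(\<Sum>m\<in>S'. \<integral>\<^sup>+ \<tau>. ennreal ((jbracket (freq m) powr s * jbracket (\<bar>\<tau>\<bar> - jbracket (freq m)) powr b * cmod (tft (y m) \<tau> - st_fourier f \<tau> m))\<^sup>2) \<partial>lborel)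
    \<le> ennreal (e / 2)" .
  qed
  also have "\<dots> < ennreal e" using e by (simp add: ennreal_lessI)
  finally show "\<exists>f\<in>schwartz. Xsb_sqnorm s b (\<lambda>\<tau> n. tft (y n) \<tau> - st_fourier f \<tau> n) < ennreal e"
   using f by blast
 qed
qed

section \<open>The curve of the product\<close>

lemma jbracket_freq_uminus: "jbracket (freq (- n)) = jbracket (freq n)"
 by (simp add: freq_uminus jbracket_def)

lemma hbd_reflect:
 assumes c: "hbd s c K"
 shows "hbd s (\<lambda>n. c (- n)) K"
 unfolding hbd_def
proof (intro allI impI)
 fix S :: "(int \<times> int) set" assume S: "finite S"
 have inj: "inj_on uminus S" by (simp add: inj_on_def)
 have "L2_set (\<lambda>n. jbracket (freq n) powr s * cmod (c n)) (uminus ` S) \<le> K"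
  using c S unfolding hbd_def by blast
 then show "L2_set (\<lambda>n. jbracket (freq n) powr s * cmod (c (- n))) S \<le> K"
  unfolding L2_set_def sum.reindex[OF inj] o_def jbracket_freq_uminus .
qed

lemma hbd_cmult:
 assumes c: "hbd s c K"
 shows "hbd s (\<lambda>n. z * c n) (cmod z * K)"
 unfolding hbd_def
proof (intro allI impI)
 fix S :: "(int \<times> int) set" assume S: "finite S"
 have "L2_set (\<lambda>n. jbracket (freq n) powr s * cmod (z * c n)) S
   = cmod z * L2_set (\<lambda>n. jbracket (freq n) powr s * cmod (c n)) S"
  by (subst L2_set_right_distrib) (simp_all add: norm_mult mult_ac)
 also have "\<dots> \<le> cmod z * K" using c S unfolding hbd_def by (intro mult_left_mono) auto
 finally show "L2_set (\<lambda>n. jbracket (freq n) powr s * cmod (z * c n)) S \<le> cmod z * K" .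
qed

lemma hbd_of_decay:
 assumes c: "\<And>n. cmod (c n) \<le> K / jbracket (freq n) ^ 3" and s: "s \<le> 1"
 shows "hbd s c (K * 12)"
 unfolding hbd_def
proof (intro allI impI)
 fix S :: "(int \<times> int) set" assume S: "finite S"
 have K: "0 \<le> K" using order_trans[OF norm_ge_zero c[of 0]] by (simp add: jbracket_def)
 have le: "(jbracket (freq n) powr s * cmod (c n))\<^sup>2 \<le> K\<^sup>2 * (1 / jbracket (freq n) ^ 4)" for n
 proof -
  have J: "1 \<le> jbracket (freq n)" by (rule jbracket_ge_one)
  have "jbracket (freq n) powr s \<le> jbracket (freq n) powr 1" using s J by (rule powr_mono)
  then have "jbracket (freq n) powr s * cmod (c n) \<le> jbracket (freq n) * (K / jbracket (freq n) ^ 3)"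
   using c J by (intro mult_mono) auto
  also have "\<dots> = K / jbracket (freq n) ^ 2" using J by (simp add: field_simps power2_eq_square power3_eq_cube)
  finally have "(jbracket (freq n) powr s * cmod (c n))\<^sup>2 \<le> (K / jbracket (freq n) ^ 2)\<^sup>2" by (intro power_mono) auto
  then show ?thesis by (simp add: power_divide flip: power_mult)
 qed
 have "(\<Sum>n\<in>S. (jbracket (freq n) powr s * cmod (c n))\<^sup>2) \<le> (\<Sum>n\<in>S. K\<^sup>2 * (1 / jbracket (freq n) ^ 4))"
  by (intro sum_mono le)
 also have "\<dots> = K\<^sup>2 * (\<Sum>n\<in>S. 1 / jbracket (freq n) ^ 4)" by (simp only: sum_distrib_left)
 also have "\<dots> \<le> K\<^sup>2 * (128 * (1/4) ^ 0)" using sum_jbracket_tail_le[of S 0] S by (intro mult_left_mono) auto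
 also have "\<dots> \<le> (K * 12)\<^sup>2" by (simp add: power_mult_distrib)
 finally show "L2_set (\<lambda>n. jbracket (freq n) powr s * cmod (c n)) S \<le> K * 12"
  unfolding L2_set_def using K by (intro real_le_lsqrt sum_nonneg) auto
qed

lemma LINT_count_space_box:
 fixes c :: "int \<times> int \<Rightarrow> complex"
 assumes c: "\<And>n. cmod (c n) \<le> K / jbracket (freq n) ^ 4"
 shows "(\<lambda>N. \<Sum>n\<in>freq_box N. c n) \<longlonglongrightarrow> (LINT n|count_space UNIV. c n)"
proof -
 have K: "0 \<le> K" using order_trans[OF norm_ge_zero c[of 0]] by (simp add: jbracket_def)
 have "(\<integral>\<^sup>+n. ennreal (cmod (c n)) \<partial>count_space UNIV) \<le> ennreal (K * 128)"
 proof (rule nn_integral_count_space_le)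
  fix S :: "(int \<times> int) set" assume S: "finite S"
  have "(\<Sum>n\<in>S. cmod (c n)) \<le> (\<Sum>n\<in>S. K * (1 / jbracket (freq n) ^ 4))" using c by (intro sum_mono) simp
  also have "\<dots> = K * (\<Sum>n\<in>S. 1 / jbracket (freq n) ^ 4)" by (simp only: sum_distrib_left)
  also have "\<dots> \<le> K * (128 * (1/4) ^ 0)" using sum_jbracket_tail_le[of S 0] S K by (intro mult_left_mono) auto
  finally show "(\<Sum>n\<in>S. ennreal (cmod (c n))) \<le> ennreal (K * 128)" by (simp add: sum_ennreal ennreal_leI)
 qed
 then have int: "integrable (count_space UNIV) c" by (intro integrableI_bounded) (auto intro: le_less_trans)
 have "(\<lambda>N. LINT n|count_space UNIV. indicator (freq_box N) n *\<^sub>R c n) \<longlonglongrightarrow> (LINT n|count_space UNIV. c n)"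
 proof (rule integral_dominated_convergence[where w = "\<lambda>n. cmod (c n)"])
  show "AE n in count_space UNIV. (\<lambda>N. indicator (freq_box N) n *\<^sub>R c n) \<longlonglongrightarrow> c n"
  proof (rule AE_I2)
   fix n :: "int \<times> int"
   obtain N0 where N0: "{n} \<subseteq> freq_box N0" using finite_subset_box[of "{n}"] by auto
   show "(\<lambda>N. indicator (freq_box N) n *\<^sub>R c n) \<longlonglongrightarrow> c n"
   proof (rule tendsto_eventually, rule eventually_sequentiallyI[of N0])
    fix N assume "N0 \<le> N"
    then have "n \<in> freq_box N" using N0 freq_box_mono by blast
    then show "indicator (freq_box N) n *\<^sub>R c n = c n" by simp
   qed
  qed
  show "AE n in count_space UNIV. norm (indicator (freq_box N) n *\<^sub>R c n) \<le> cmod (c n)" for N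
   by (intro AE_I2) (simp add: indicator_def)
 qed (use int in simp_all)
 moreover have "(LINT n|count_space UNIV. indicator (freq_box N) n *\<^sub>R c n) = (\<Sum>n\<in>freq_box N. c n)" for N
 proof -
  let ?f = "\<lambda>n. indicator (freq_box N) n *\<^sub>R c n"
  have sub: "{n \<in> UNIV. ?f n \<noteq> 0} \<subseteq> freq_box N" by (auto simp: indicator_def)
  have "(LINT n|count_space UNIV. ?f n) = (\<Sum>n | n \<in> UNIV \<and> ?f n \<noteq> 0. ?f n)"
   by (rule lebesgue_integral_count_space_finite_support) (rule finite_subset[OF sub finite_freq_box])
  also have "\<dots> = (\<Sum>n\<in>freq_box N. ?f n)" by (intro sum.mono_neutral_left sub finite_freq_box) auto
  also have "\<dots> = (\<Sum>n\<in>freq_box N. c n)" by (intro sum.cong) auto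
  finally show ?thesis .
 qed
 ultimately show ?thesis by simp
qed

lemma sum_freq_box_uminus: "(\<Sum>n\<in>freq_box N. g (- n)) = (\<Sum>n\<in>freq_box N. g n)"
 by (rule sum.reindex_bij_witness[of _ uminus uminus]) (auto simp: freq_box_def)

lemma hbd_test_slice:
 assumes "\<phi> \<in> schwartz" and "s \<le> 1"
 shows "\<exists>K. \<forall>t. hbd s (ncoeff (\<lambda>x. \<phi> (t, x))) K"
proof -
 obtain K where K: "\<And>t n. cmod (xcoeff \<phi> t n) \<le> K * jbracket t powr (- 2) / jbracket (freq n) ^ 3" "0 \<le> K"
  using xcoeff_decay[OF assms(1)] by blast
 have "hbd s (ncoeff (\<lambda>x. \<phi> (t, x))) (K * 12)" for t
 proof (rule hbd_of_decay[OF _ assms(2)])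
  fix n
  have "jbracket t powr (- 2) \<le> jbracket t powr 0" by (intro powr_mono jbracket_ge_one) simp
  then have "K * jbracket t powr (- 2) \<le> K * 1" using K(2) by (intro mult_left_mono) auto
  then have "cmod (xcoeff \<phi> t n) \<le> K / jbracket (freq n) ^ 3"
   using K(1)[of t n] by (elim order_trans) (simp add: divide_right_mono)
  moreover have "cmod (ncoeff (\<lambda>x. \<phi> (t, x)) n) \<le> cmod (xcoeff \<phi> t n) / 1"
   unfolding ncoeff_def xcoeff_def norm_divide
   using power_mono[of 1 "2 * pi" 2] pi_ge_two by (intro divide_left_mono) (auto simp: norm_power)
  ultimately show "cmod (ncoeff (\<lambda>x. \<phi> (t, x)) n) \<le> K / jbracket (freq n) ^ 3" by simp
 qed
 then show ?thesis by blast
qed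

text \<open>
 The coefficients of the three factors as functions of time, with the fixed-time bounds that hold
 at almost every time.
\<close>

locale triple_curves =
 fixes \<alpha> \<epsilon> C :: real and e :: "nat \<Rightarrow> real" and A T Kv Kw :: real
  and \<beta> V W :: "real \<Rightarrow> int \<times> int \<Rightarrow> complex"
 assumes rate: "tri_rate \<alpha> \<epsilon> C e" and eps: "0 < \<epsilon>" "\<epsilon> < 3/4" and T: "0 < T" and nonneg: "0 \<le> A" "0 \<le> Kv" "0 \<le> Kw"
  and meas: "\<And>n. (\<lambda>t. \<beta> t n) \<in> borel_measurable borel" "\<And>n. (\<lambda>t. V t n) \<in> borel_measurable borel" "\<And>n. (\<lambda>t. W t n) \<in> borel_measurable borel"
  and supp: "\<And>t n. t \<notin> {0..T} \<Longrightarrow> V t n = 0"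
  and bds: "AE t in lborel. blockbdd A (\<beta> t) \<and> hbd (1/4 + \<epsilon>) (V t) Kv \<and> hbd (1/4 + \<epsilon>) (W t) Kw"
begin

definition curve :: "int \<times> int \<Rightarrow> real \<Rightarrow> complex" where
 "curve m t = (2 * pi)\<^sup>2 * prod_coeff (bessel_mult (\<alpha> + \<epsilon>) (\<beta> t)) (V t) (W t) (- m)"

definition pairing :: "(real \<times> real \<times> real \<Rightarrow> complex) \<Rightarrow> real \<Rightarrow> complex" where
 "pairing \<phi> t = (2 * pi)\<^sup>2 * Lam (bessel_mult (\<alpha> + \<epsilon>) (\<beta> t)) (V t) (W t) (ncoeff (\<lambda>x. \<phi> (t, x)))"

definition curve_bound :: real where
 "curve_bound = (2 * pi)\<^sup>2 * (C * (A * Kv * Kw))"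

lemma curve_bound_nonneg: "0 \<le> curve_bound"
 using rate nonneg by (simp add: curve_bound_def tri_rate_def)

lemma tri_measurable:
 assumes g: "\<And>l. (\<lambda>t. g t l) \<in> borel_measurable borel"
 shows "(\<lambda>t. tri (bessel_mult (\<alpha> + \<epsilon>) (\<beta> t)) S1 S2 S3 (V t) (W t) (g t)) \<in> borel_measurable borel"
 unfolding tri_def bessel_mult_def
 by (intro borel_measurable_sum borel_measurable_times borel_measurable_const meas g)

lemma curve_measurable: "curve m \<in> borel_measurable borel"
 unfolding curve_def[abs_def] prod_coeff_def
 by (intro borel_measurable_times borel_measurable_const borel_measurable_lim_metric tri_measurable)

lemma pairing_measurable: "\<phi> \<in> schwartz \<Longrightarrow> pairing \<phi> \<in> borel_measurable borel"
 unfolding pairing_def[abs_def] Lam_def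
proof (intro borel_measurable_times borel_measurable_const borel_measurable_lim_metric tri_measurable)
 fix l assume "\<phi> \<in> schwartz"
 then have "(\<lambda>t. xcoeff \<phi> t l / (2 * pi)\<^sup>2) \<in> borel_measurable borel"
  by (intro borel_measurable_divide borel_measurable_const borel_measurable_continuous_onI xcoeff_continuous)
 then show "(\<lambda>t. ncoeff (\<lambda>x. \<phi> (t, x)) l) \<in> borel_measurable borel" by (simp add: ncoeff_def xcoeff_def)
qed

lemma curve_supp: "t \<notin> {0..T} \<Longrightarrow> curve m t = 0" and pairing_supp: "t \<notin> {0..T} \<Longrightarrow> pairing \<phi> t = 0"
 by (simp_all add: curve_def pairing_def prod_coeff_def Lam_def tri_def supp)

text \<open>
 The reflection of the frequency is the one in the definition of \<open>curve\<close>: testing with frequency \<open>l\<close> sees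
 the coefficient of the product at \<open>-l\<close>.
\<close>

lemma curve_hbd: "AE t in lborel. hbd (- (3/4 - \<epsilon>)) (\<lambda>m. curve m t) curve_bound"
 using bds
proof eventually_elim
 case (elim t)
 then have "hbd (- (3/4 - \<epsilon>)) (prod_coeff (bessel_mult (\<alpha> + \<epsilon>) (\<beta> t)) (V t) (W t)) (C * (A * Kv * Kw))"
  by (intro hbd_prod_coeff[OF rate]) auto
 from hbd_cmult[OF hbd_reflect[OF this], of "of_real ((2 * pi)\<^sup>2)"]
 show ?case by (simp add: curve_def curve_bound_def norm_mult norm_power)
qed

text \<open>
 Parseval in time for each frequency, then summation over boxes of frequencies. The sums converge
 absolutely by the decay of the test function, and pointwise in time to the trilinear form.
\<close>

lemma st_dist_curve:
 assumes \<phi>: "\<phi> \<in> schwartz"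
 shows "st_dist (\<lambda>\<tau> m. tft (curve m) \<tau>) \<phi> = (\<integral>t. pairing \<phi> t \<partial>lborel)"
proof -
 obtain K where K: "\<And>t n. cmod (xcoeff \<phi> t n) \<le> K * jbracket t powr (- 2) / jbracket (freq n) ^ 5" and K0: "0 \<le> K"
  using xcoeff_decay[OF \<phi>] by blast
 have xb: "cmod (xcoeff \<phi> t n) \<le> K / jbracket (freq n) ^ 5" for t n
 proof -
  have "jbracket t powr (- 2) \<le> jbracket t powr 0" by (intro powr_mono jbracket_ge_one) simp
  then have "K * jbracket t powr (- 2) \<le> K * 1" using K0 by (intro mult_left_mono) auto
  then show ?thesis using K[of t n] by (elim order_trans) (simp add: divide_right_mono)
 qed
 have xb': "cmod (xcoeff \<phi> t n) \<le> K" for t n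
 proof -
  have "K / jbracket (freq n) ^ 5 \<le> K / 1" using K0 one_le_power[OF jbracket_ge_one] by (intro divide_left_mono) auto
  then show ?thesis using xb[of t n] by simp
 qed
 have xm: "(\<lambda>t. xcoeff \<phi> t n) \<in> borel_measurable lborel" for n
  using borel_measurable_continuous_onI[OF xcoeff_continuous[OF \<phi>]] by simp
 define M where "M = curve_bound"
 have M: "0 \<le> M" unfolding M_def by (rule curve_bound_nonneg)
 have cb: "AE t in lborel. cmod (curve m t) \<le> M * jbracket (freq m)" for m
  using curve_hbd
 proof eventually_elim
  case (elim t)
  have "jbracket (freq m) powr (3/4 - \<epsilon>) \<le> jbracket (freq m) powr 1"
   using eps by (intro powr_mono jbracket_ge_one) simp
  then have "M * jbracket (freq m) powr (3/4 - \<epsilon>) \<le> M * jbracket (freq m)" using M by (intro mult_left_mono) auto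
  then show ?case using hbd_pointwise[OF elim, of m] by (simp add: M_def)
 qed
 note ci = integrable_of_bounded_support(1)[OF curve_measurable cb curve_supp]
 have pb: "AE t in lborel. cmod (curve m t * xcoeff \<phi> t (- m)) \<le> M * K / jbracket (freq m) ^ 4 * indicator {0..T} t" for m
  using cb[of m]
 proof eventually_elim
  case (elim t)
  show ?case
  proof (cases "t \<in> {0..T}")
   case True
   have "cmod (curve m t * xcoeff \<phi> t (- m)) \<le> (M * jbracket (freq m)) * (K / jbracket (freq m) ^ 5)"
    unfolding norm_mult using elim xb[of t "- m"] M jbracket_pos[of "freq m"]
    by (intro mult_mono) (auto simp: jbracket_freq_uminus)
   also have "\<dots> = M * K / jbracket (freq m) ^ 4"
    using jbracket_pos[of "freq m"] by (simp add: field_simps eval_nat_numeral)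
   finally show ?thesis using True by simp
  qed (simp add: curve_supp)
 qed
 have pint: "integrable lborel (\<lambda>t. curve m t * xcoeff \<phi> t (- m))" for m
  by (rule integrable_bounded_times[OF ci xm xb'])
 have ind: "integrable lborel (\<lambda>t. c * indicator {0..T} t :: real)" for c
  by (intro integrable_mult_right integrable_real_indicator) (simp_all add: emeasure_lborel_Icc_eq)
 define I where "I m = (\<integral>t. curve m t * xcoeff \<phi> t (- m) \<partial>lborel)" for m
 have Ib: "cmod (I m) \<le> M * K * T / jbracket (freq m) ^ 4" for m
  using integral_norm_bound_AE[OF ind pb[of m]] T by (simp add: I_def)
 have inner: "(\<integral>\<tau>. tft (curve m) \<tau> * st_fourier \<phi> (- \<tau>) (- m) \<partial>lborel) = 2 * pi * I m" for m
  unfolding st_fourier_Fubini(1)[OF \<phi>] I_def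
 proof (rule tft_Parseval[OF ci st_fourier_Fubini(3)[OF \<phi>] xcoeff_continuous[OF \<phi>] xb'])
  obtain D where D: "\<And>\<tau> n. cmod (st_fourier \<phi> \<tau> n) \<le> D * jbracket \<tau> powr (- 2) / jbracket (freq n) ^ 0"
   using st_fourier_decay[OF \<phi>, of 0] by blast
  have "integrable lborel (\<lambda>\<tau>. st_fourier \<phi> \<tau> (- m))"
  proof (rule Bochner_Integration.integrable_bound)
   show "integrable lborel (\<lambda>\<tau> :: real. D * jbracket \<tau> powr (- 2))"
    by (intro integrable_mult_right jbracket_powr_integrable) simp
   show "AE \<tau> in lborel. norm (st_fourier \<phi> \<tau> (- m)) \<le> norm (D * jbracket \<tau> powr (- 2))"
    by (intro AE_I2 order_trans[OF D]) simp
  qed (use st_fourier_measurable[OF \<phi>] in simp)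
  then show "integrable lborel (tft (\<lambda>t. xcoeff \<phi> t (- m)))" by (simp add: st_fourier_Fubini(1)[OF \<phi>])
 qed
 have "(\<lambda>N. \<Sum>m\<in>freq_box N. I m) \<longlonglongrightarrow> (LINT m|count_space UNIV. I m)"
  by (rule LINT_count_space_box[OF Ib])
 moreover have "(\<lambda>N. \<Sum>m\<in>freq_box N. I m) \<longlonglongrightarrow> (\<integral>t. (2 * pi)\<^sup>2 * pairing \<phi> t \<partial>lborel)"
 proof -
  have "(\<lambda>N. \<integral>t. (\<Sum>m\<in>freq_box N. curve m t * xcoeff \<phi> t (- m)) \<partial>lborel) \<longlonglongrightarrow> (\<integral>t. (2 * pi)\<^sup>2 * pairing \<phi> t \<partial>lborel)"
  proof (rule integral_dominated_convergence[OF _ _ ind[of "M * K * 128"]])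
   show "(\<lambda>t. complex_of_real ((2 * pi)\<^sup>2) * pairing \<phi> t) \<in> borel_measurable lborel"
    using pairing_measurable[OF \<phi>] by simp
   show "(\<lambda>t. \<Sum>m\<in>freq_box N. curve m t * xcoeff \<phi> t (- m)) \<in> borel_measurable lborel" for N
    using pint by (intro borel_measurable_sum) (auto dest: borel_measurable_integrable)
   obtain Kg where Kg: "\<And>t. hbd (3/4 - \<epsilon>) (ncoeff (\<lambda>x. \<phi> (t, x))) Kg"
    using hbd_test_slice[OF \<phi>, of "3/4 - \<epsilon>"] eps by auto
   show "AE t in lborel. (\<lambda>N. \<Sum>m\<in>freq_box N. curve m t * xcoeff \<phi> t (- m)) \<longlonglongrightarrow> (2 * pi)\<^sup>2 * pairing \<phi> t"
    using bds
   proof eventually_elim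
    case (elim t)
    let ?P = "prod_coeff (bessel_mult (\<alpha> + \<epsilon>) (\<beta> t)) (V t) (W t)" and ?g = "ncoeff (\<lambda>x. \<phi> (t, x))"
    have "(\<Sum>m\<in>freq_box N. curve m t * xcoeff \<phi> t (- m)) = (2 * pi)\<^sup>2 * ((2 * pi)\<^sup>2 * (\<Sum>l\<in>freq_box N. ?g l * ?P l))" for N
    proof -
     have "curve m t * xcoeff \<phi> t (- m) = (2 * pi)\<^sup>2 * ((2 * pi)\<^sup>2 * (?g (- m) * ?P (- m)))" for m
      by (simp add: curve_def ncoeff_def xcoeff_def mult_ac)
     then have "(\<Sum>m\<in>freq_box N. curve m t * xcoeff \<phi> t (- m))
       = (2 * pi)\<^sup>2 * ((2 * pi)\<^sup>2 * (\<Sum>m\<in>freq_box N. ?g (- m) * ?P (- m)))"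
      by (simp only: sum_distrib_left)
     also have "(\<Sum>m\<in>freq_box N. ?g (- m) * ?P (- m)) = (\<Sum>l\<in>freq_box N. ?g l * ?P l)"
      by (rule sum_freq_box_uminus)
     finally show ?thesis .
    qed
    moreover have "(\<lambda>N. \<Sum>l\<in>freq_box N. ?g l * ?P l) \<longlonglongrightarrow> Lam (bessel_mult (\<alpha> + \<epsilon>) (\<beta> t)) (V t) (W t) ?g"
     using elim by (intro sum_prod_coeff_Lam[OF rate _ _ _ Kg]) auto
    ultimately show ?case unfolding pairing_def by (simp only:) (intro tendsto_intros)
   qed
   have all: "AE t in lborel. \<forall>m. cmod (curve m t * xcoeff \<phi> t (- m)) \<le> M * K / jbracket (freq m) ^ 4 * indicator {0..T} t"
    unfolding AE_all_countable using pb by (intro allI)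
   show "AE t in lborel. norm (\<Sum>m\<in>freq_box N. curve m t * xcoeff \<phi> t (- m)) \<le> M * K * 128 * indicator {0..T} t" for N
    using all
   proof eventually_elim
    case (elim t)
    have "norm (\<Sum>m\<in>freq_box N. curve m t * xcoeff \<phi> t (- m)) \<le> (\<Sum>m\<in>freq_box N. M * K * indicator {0..T} t * (1 / jbracket (freq m) ^ 4))"
    proof (rule sum_norm_le)
     fix m
     show "norm (curve m t * xcoeff \<phi> t (- m)) \<le> M * K * indicator {0..T} t * (1 / jbracket (freq m) ^ 4)"
      using elim[rule_format, of m] by simp
    qed
    also have "\<dots> = M * K * indicator {0..T} t * (\<Sum>m\<in>freq_box N. 1 / jbracket (freq m) ^ 4)" by (simp only: sum_distrib_left)
    also have "\<dots> \<le> M * K * indicator {0..T} t * (128 * (1/4) ^ 0)"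
     using sum_jbracket_tail_le[of "freq_box N" 0] M K0 by (intro mult_left_mono) auto
    finally show ?case by (simp add: mult_ac)
   qed
  qed
  then show ?thesis unfolding I_def using pint by (simp add: Bochner_Integration.integral_sum)
 qed
 ultimately have "(LINT m|count_space UNIV. I m) = (\<integral>t. (2 * pi)\<^sup>2 * pairing \<phi> t \<partial>lborel)" by (rule LIMSEQ_unique)
 then have eq: "(LINT m|count_space UNIV. I m) = (2 * pi)\<^sup>2 * (\<integral>t. pairing \<phi> t \<partial>lborel)" by simp
 have "st_dist (\<lambda>\<tau> m. tft (curve m) \<tau>) \<phi> = (2 * pi * (LINT m|count_space UNIV. I m)) / (2 * pi) ^ 3"
  unfolding st_dist_def inner by simp
 also have "\<dots> = (\<integral>t. pairing \<phi> t \<partial>lborel)"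
  unfolding eq by (simp add: power2_eq_square power3_eq_cube)
 finally show ?thesis .
qed

end

section \<open>The curve is the product\<close>

lemma cell_product_slices:
 assumes \<beta>: "\<And>n. cmod (\<beta> n) \<le> K\<beta> / jbracket (freq n) ^ 4"
  and v: "set_integrable lborel cell v" "hbd s (ncoeff v) Kv" and w: "set_integrable lborel cell w" "hbd s (ncoeff w) Kw"
  and s: "0 < s"
 shows "set_integrable lborel cell (\<lambda>x. fseries \<beta> x * v x * w x)"
  and "(LINT x:cell|lborel. cmod (fseries \<beta> x * v x * w x)) \<le> (K\<beta> * 129) * ((2 * pi * Kv) * (2 * pi * Kw))"
proof -
 have mv: "set_borel_measurable lborel cell v" "set_borel_measurable lborel cell w"
  using v(1) w(1) unfolding set_integrable_def set_borel_measurable_def by (auto dest: borel_measurable_integrable)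
 have mc: "set_borel_measurable lborel cell (\<lambda>x. complex_of_real (cmod (v x)))"
  "set_borel_measurable lborel cell (\<lambda>x. complex_of_real (cmod (w x)))"
  using mv[THEN set_borel_measurable_cmod, unfolded set_borel_measurable_def, THEN measurable_compose, OF borel_measurable_of_real]
  unfolding set_borel_measurable_def by (simp_all add: scaleR_conv_of_real)
 have nn: "0 \<le> 2 * pi * Kv" "0 \<le> 2 * pi * Kw" using hbd_nonneg[OF v(2)] hbd_nonneg[OF w(2)] by simp_all
 have fm: "fseries \<beta> \<in> borel_measurable borel" by (intro borel_measurable_continuous_onI continuous_fseries[OF \<beta>])
 note sq = cell_hbd_approx(1,2)[OF v s] cell_hbd_approx(1,2)[OF w s]
 have "set_integrable lborel cell (\<lambda>x. fseries \<beta> x * v x * w x * 1)"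
  by (rule LINT_cell_product4_le(1)[OF mv(1) sq(1,2) nn(1) mv(2) sq(3,4) nn(2) fm fseries_bounded(1)[OF \<beta>], where E = 1]) simp_all
 then show "set_integrable lborel cell (\<lambda>x. fseries \<beta> x * v x * w x)" by simp
 have "cmod (LINT x:cell|lborel. complex_of_real (cmod (fseries \<beta> x)) * complex_of_real (cmod (v x)) * complex_of_real (cmod (w x)) * 1)
   \<le> (K\<beta> * 129) * 1 * ((2 * pi * Kv) * (2 * pi * Kw))"
 proof (rule LINT_cell_product4_le(2)[OF mc(1) _ _ nn(1) mc(2) _ _ nn(2)])
  show "(\<lambda>x. complex_of_real (cmod (fseries \<beta> x))) \<in> borel_measurable borel" using fm by measurable
 qed (use sq fseries_bounded(1)[OF \<beta>] in simp_all)
 moreover have "(LINT x:cell|lborel. complex_of_real (cmod (fseries \<beta> x)) * complex_of_real (cmod (v x)) * complex_of_real (cmod (w x)) * 1)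
   = complex_of_real (LINT x:cell|lborel. cmod (fseries \<beta> x * v x * w x))"
  by (simp add: norm_mult flip: set_integral_complex_of_real)
 moreover have "0 \<le> (LINT x:cell|lborel. cmod (fseries \<beta> x * v x * w x))"
  unfolding set_lebesgue_integral_def by (intro Bochner_Integration.integral_nonneg) simp
 ultimately show "(LINT x:cell|lborel. cmod (fseries \<beta> x * v x * w x)) \<le> (K\<beta> * 129) * ((2 * pi * Kv) * (2 * pi * Kw))"
  by simp
qed

text \<open>
 Extension by zero of a curve that is given on \<open>[0, T]\<close>.
\<close>

definition cut :: "real \<Rightarrow> (real \<Rightarrow> int \<times> int \<Rightarrow> complex) \<Rightarrow> real \<Rightarrow> int \<times> int \<Rightarrow> complex" where
 "cut T c t n = indicator {0..T} t *\<^sub>R c t n"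

lemma cut_in: "t \<in> {0..T} \<Longrightarrow> cut T c t = c t"
 by (simp add: cut_def fun_eq_iff)

lemma cut_out: "t \<notin> {0..T} \<Longrightarrow> cut T c t = (\<lambda>n. 0)"
 by (simp add: cut_def fun_eq_iff)

lemma hbd_zero: "0 \<le> K \<Longrightarrow> hbd s (\<lambda>n. 0) K"
 by (simp add: hbd_def L2_set_def)

lemma blockbdd_zero: "0 \<le> A \<Longrightarrow> blockbdd A (\<lambda>n. 0)"
 by (simp add: blockbdd_def tri_def)

lemma blockbdd_le: "blockbdd A a \<Longrightarrow> A \<le> A' \<Longrightarrow> blockbdd A' a"
 unfolding blockbdd_def by (meson L2_set_nonneg mult_nonneg_nonneg mult_right_mono order_trans zero_le_numeral zero_le_power)

lemma dist_family_measurable: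
 assumes u: "dist_family T u"
 shows "(\<lambda>t. cut T (\<lambda>t. torus_coeff (u t)) t n) \<in> borel_measurable borel"
proof -
 have "ech (- n) \<in> torus_test" using ech_torus_test[of 1 "- n"] by simp
 then have "(\<lambda>t. u t (ech (- n))) \<in> borel_measurable (restrict_space lborel {0..T})" using u by (simp add: dist_family_def)
 then have "(\<lambda>t. indicator {0..T} t *\<^sub>R u t (ech (- n))) \<in> borel_measurable borel"
  by (subst (asm) borel_measurable_restrict_space_iff) auto
 then have "(\<lambda>t. indicator {0..T} t *\<^sub>R u t (ech (- n)) / (2 * pi)\<^sup>2) \<in> borel_measurable borel" by measurable
 then show ?thesis by (simp add: cut_def torus_coeff_eq scaleR_conv_of_real)
qed

text \<open>
 Only weak measurability of \<open>u\<close> is available, so the mollification is written as a limit of trigonometric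
 polynomials whose coefficients are measurable in time.
\<close>

lemma mollify_measurable:
 assumes u: "dist_family T u" and r: "r \<in> torus_test"
 shows "(\<lambda>p. indicator (slab T) p *\<^sub>R mollify r u p) \<in> borel_measurable (lborel \<Otimes>\<^sub>M lborel)"
proof (rule borel_measurable_LIMSEQ_metric)
 let ?c = "cut T (\<lambda>t. torus_coeff (u t))"
 let ?f = "\<lambda>N (p :: real \<times> real \<times> real). indicator cell (snd p) *\<^sub>R (\<Sum>n\<in>freq_box N. (fcoeff r n * ?c (fst p) n) * ech n (snd p))"
 show "?f N \<in> borel_measurable (lborel \<Otimes>\<^sub>M lborel)" for N
 proof (intro borel_measurable_scaleR borel_measurable_sum borel_measurable_times borel_measurable_const)
  have "(\<lambda>p. indicator cell (snd p) :: real) \<in> borel_measurable (lborel \<Otimes>\<^sub>M (lborel :: (real \<times> real) measure))"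
   by (rule measurable_compose[OF measurable_snd]) simp
  then show "(\<lambda>p :: real \<times> real \<times> real. indicator cell (snd p) :: real) \<in> borel_measurable (lborel \<Otimes>\<^sub>M lborel)" .
  show "(\<lambda>p :: real \<times> real \<times> real. ?c (fst p) n) \<in> borel_measurable (lborel \<Otimes>\<^sub>M lborel)" for n
   by (rule measurable_compose[OF measurable_fst]) (use dist_family_measurable[OF u] in simp)
  show "(\<lambda>p :: real \<times> real \<times> real. ech n (snd p)) \<in> borel_measurable (lborel \<Otimes>\<^sub>M lborel)" for n
   using measurable_compose[OF measurable_snd measurable_ech] by simp
 qed
 fix p :: "real \<times> real \<times> real"
 obtain t x where p: "p = (t, x)" by (cases p) blast
 show "(\<lambda>N. ?f N p) \<longlonglongrightarrow> indicator (slab T) p *\<^sub>R mollify r u p"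
 proof (cases "t \<in> {0..T}")
  case True
  then have "torus_distribution (u t)" using u by (simp add: dist_family_def)
  from mollify_tendsto[of u t r x, OF this r]
  have "(\<lambda>N. indicator cell x *\<^sub>R trig_sum (freq_box N) (\<lambda>n. fcoeff r n * torus_coeff (u t) n) x) \<longlonglongrightarrow> indicator cell x *\<^sub>R mollify r u (t, x)"
   by (intro tendsto_intros)
  moreover have "indicator (slab T) p = (indicator cell x :: real)" using True by (simp add: p slab_def indicator_def)
  ultimately show ?thesis by (simp add: p cut_in[OF True] trig_sum_def)
 next
  case False
  then have "indicator (slab T) p = (0 :: real)" by (auto simp: p slab_def indicator_def)
  then show ?thesis by (simp add: p cut_out[OF False])
 qed
qed

text \<open>
 Mollifying \<open>u\<close> multiplies its coefficients by those of the approximate identity. They tend to one,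
 and the fixed-time trilinear form is continuous along such a sequence with a bound uniform in time, so
 dominated convergence in time passes to the limit.
\<close>

lemma is_triple_product_curve:
 assumes tc: "triple_curves \<alpha> \<epsilon> C e A T Kv Kw (cut T (\<lambda>t. bessel_coeff (\<alpha> + \<epsilon>) (u t)))
   (cut T (\<lambda>t. ncoeff (\<lambda>x. v (t, x)))) (cut T (\<lambda>t. ncoeff (\<lambda>x. w (t, x))))"
  and se: "\<alpha> + \<epsilon> \<le> 1" and u: "dist_family T u"
  and v: "set_integrable lborel (slab T) v" and w: "set_integrable lborel (slab T) w"
 shows "is_triple_product T u v w (st_dist (\<lambda>\<tau> m. tft (triple_curves.curve \<alpha> \<epsilon> (cut T (\<lambda>t. bessel_coeff (\<alpha> + \<epsilon>) (u t)))
   (cut T (\<lambda>t. ncoeff (\<lambda>x. v (t, x)))) (cut T (\<lambda>t. ncoeff (\<lambda>x. w (t, x)))) m) \<tau>))"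
proof -
 interpret triple_curves \<alpha> \<epsilon> C e A T Kv Kw "cut T (\<lambda>t. bessel_coeff (\<alpha> + \<epsilon>) (u t))"
  "cut T (\<lambda>t. ncoeff (\<lambda>x. v (t, x)))" "cut T (\<lambda>t. ncoeff (\<lambda>x. w (t, x)))" by (rule tc)
 let ?s = "\<alpha> + \<epsilon>" and ?\<sigma> = "1/4 + \<epsilon>"
 let ?v = "\<lambda>t x. v (t, x)" and ?w = "\<lambda>t x. w (t, x)" and ?b = "\<lambda>t. bessel_coeff (\<alpha> + \<epsilon>) (u t)"
 have \<sigma>: "0 < ?\<sigma>" using eps by simp
 define good where "good t \<longleftrightarrow> blockbdd A (?b t) \<and> hbd ?\<sigma> (ncoeff (?v t)) Kv \<and> hbd ?\<sigma> (ncoeff (?w t)) Kw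
   \<and> set_integrable lborel cell (?v t) \<and> set_integrable lborel cell (?w t)" for t
 have AEg: "AE t in lborel. t \<in> {0..T} \<longrightarrow> good t"
  using bds slab_slices(1)[OF v] slab_slices(1)[OF w]
 proof eventually_elim
  case (elim t)
  show ?case
  proof
   assume t: "t \<in> {0..T}"
   show "good t" using elim t unfolding cut_in[OF t] good_def by blast
  qed
 qed
 have ind: "indicator (slab T) (t, x) = (indicator {0..T} t * indicator cell x :: real)" for t x
  by (auto simp: slab_def indicator_def)
 have indT: "integrable lborel (\<lambda>t. c * indicator {0..T} t :: real)" for c
  by (intro integrable_mult_right integrable_real_indicator) (simp_all add: emeasure_lborel_Icc_eq)
 show ?thesis
  unfolding is_triple_product_def
 proof (intro allI impI conjI ballI)
  fix \<rho> assume \<rho>: "approx_identity \<rho>"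
  have \<rho>t: "\<rho> k \<in> torus_test" for k using \<rho> by (simp add: approx_identity_def)
  define P where "P k p = mollify (\<rho> k) u p * v p * w p" for k p
  define bk where "bk k t n = fcoeff (\<rho> k) n * torus_coeff (u t) n" for k t n
  have moll: "mollify (\<rho> k) u (t, x) = fseries (bk k t) x" if "t \<in> {0..T}" for k t x
  proof -
   have "torus_distribution (u t)" using u that by (simp add: dist_family_def)
   then show ?thesis unfolding bk_def[abs_def] by (rule mollify_eq_fseries) (rule \<rho>t)
  qed
  have bk_decay: "\<exists>K. \<forall>t n. good t \<longrightarrow> cmod (bk k t n) \<le> K / jbracket (freq n) ^ 4" for k
  proof -
   obtain K where K: "0 \<le> K" "\<And>n. cmod (fcoeff (\<rho> k) n) \<le> K / jbracket (freq n) ^ 5"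
    using fcoeff_rapid_decay[OF \<rho>t] by metis
   have "cmod (bk k t n) \<le> K * A / jbracket (freq n) ^ 4" if g: "good t" for t n
   proof -
    have J: "1 \<le> jbracket (freq n)" by (rule jbracket_ge_one)
    have "cmod (torus_coeff (u t) n) = jbracket (freq n) powr ?s * cmod (?b t n)"
     unfolding torus_coeff_eq_bessel_mult[of "u t" ?s] bessel_mult_def norm_mult by simp
    also have "\<dots> \<le> jbracket (freq n) powr 1 * A"
     using g se J nonneg blockbdd_norm_le[of A "?b t" n] unfolding good_def by (intro mult_mono powr_mono) auto
    finally have "cmod (bk k t n) \<le> (K / jbracket (freq n) ^ 5) * (jbracket (freq n) * A)"
     unfolding bk_def norm_mult using K J nonneg by (intro mult_mono) auto
    also have "\<dots> = K * A / jbracket (freq n) ^ 4" using J by (simp add: field_simps eval_nat_numeral)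
    finally show ?thesis .
   qed
   then show ?thesis by blast
  qed
  have P: "set_integrable lborel (slab T) (P k)" for k
  proof -
   obtain K where K: "\<And>t n. good t \<Longrightarrow> cmod (bk k t n) \<le> K / jbracket (freq n) ^ 4" using bk_decay[of k] by blast
   define B where "B = (K * 129) * ((2 * pi * Kv) * (2 * pi * Kw))"
   let ?f = "\<lambda>p. indicator (slab T) p *\<^sub>R P k p"
   have slice: "?f (t, x) = indicator {0..T} t *\<^sub>R (indicator cell x *\<^sub>R (fseries (bk k t) x * v (t, x) * w (t, x)))" for t x
    by (cases "t \<in> {0..T}") (simp_all add: ind P_def moll)
   have f: "?f \<in> borel_measurable (lborel \<Otimes>\<^sub>M lborel)"
   proof -
    have "(\<lambda>p. indicator (slab T) p *\<^sub>R v p) \<in> borel_measurable (lborel \<Otimes>\<^sub>M lborel)"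
     "(\<lambda>p. indicator (slab T) p *\<^sub>R w p) \<in> borel_measurable (lborel \<Otimes>\<^sub>M lborel)"
     using v w unfolding set_integrable_def lborel_prod by (auto dest: borel_measurable_integrable)
    then have "(\<lambda>p. (indicator (slab T) p *\<^sub>R mollify (\<rho> k) u p) * (indicator (slab T) p *\<^sub>R v p) * (indicator (slab T) p *\<^sub>R w p))
      \<in> borel_measurable (lborel \<Otimes>\<^sub>M lborel)"
     by (intro borel_measurable_times mollify_measurable[OF u \<rho>t])
    moreover have "(\<lambda>p. (indicator (slab T) p *\<^sub>R mollify (\<rho> k) u p) * (indicator (slab T) p *\<^sub>R v p) * (indicator (slab T) p *\<^sub>R w p)) = ?f"
     by (rule ext) (simp add: P_def indicator_def)
    ultimately show ?thesis by simp
   qed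
   have "integrable (lborel \<Otimes>\<^sub>M lborel) ?f"
   proof (rule lborel_pair.Fubini_integrable[OF f])
    show "AE t in lborel. integrable lborel (\<lambda>x. ?f (t, x))"
     using AEg
    proof eventually_elim
     case (elim t)
     show ?case
     proof (cases "t \<in> {0..T}")
      case True
      then have g: "good t" using elim by blast
      have "set_integrable lborel cell (\<lambda>x. fseries (bk k t) x * v (t, x) * w (t, x))"
       using g K[OF g] \<sigma> unfolding good_def by (intro cell_product_slices(1)[where s = ?\<sigma>]) auto
      then show ?thesis using True unfolding slice by (simp add: set_integrable_def)
     qed (simp add: slice)
    qed
    show "integrable lborel (\<lambda>t. \<integral>x. norm (?f (t, x)) \<partial>lborel)"
    proof (rule Bochner_Integration.integrable_bound[OF indT[of B]])
     have "(\<lambda>(t, x). norm (?f (t, x))) \<in> borel_measurable (lborel \<Otimes>\<^sub>M lborel)"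
      using measurable_compose[OF f borel_measurable_norm] by (simp add: split_def)
     then show "(\<lambda>t. \<integral>x. norm (?f (t, x)) \<partial>lborel) \<in> borel_measurable lborel"
      by (rule lborel.borel_measurable_lebesgue_integral)
     show "AE t in lborel. norm (\<integral>x. norm (?f (t, x)) \<partial>lborel) \<le> norm (B * indicator {0..T} t)"
      using AEg
     proof eventually_elim
      case (elim t)
      show ?case
      proof (cases "t \<in> {0..T}")
       case True
       then have g: "good t" using elim by blast
       have "(LINT x:cell|lborel. cmod (fseries (bk k t) x * v (t, x) * w (t, x))) \<le> B"
        unfolding B_def using g K[OF g] \<sigma> unfolding good_def by (intro cell_product_slices(2)[where s = ?\<sigma>]) auto
       moreover have "(\<integral>x. norm (?f (t, x)) \<partial>lborel) = (LINT x:cell|lborel. cmod (fseries (bk k t) x * v (t, x) * w (t, x)))"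
        unfolding set_lebesgue_integral_def slice using True by simp
       moreover have "0 \<le> (\<integral>x. norm (?f (t, x)) \<partial>lborel)" by (intro Bochner_Integration.integral_nonneg) simp
       ultimately show ?thesis using True by simp
      qed (simp add: slice)
     qed
    qed
   qed
   then show ?thesis by (simp add: set_integrable_def lborel_prod)
  qed
  then show "set_integrable lborel (slab T) (\<lambda>p. mollify (\<rho> k) u p * v p * w p)" for k
   unfolding P_def by simp
  fix \<phi> assume \<phi>T: "\<phi> \<in> st_test T"
  have \<phi>: "\<phi> \<in> schwartz" by (rule st_test_schwartz[OF \<phi>T])
  have \<phi>m: "\<phi> \<in> borel_measurable borel" by (intro borel_measurable_continuous_onI schwartz_continuous \<phi>)
  obtain D where D: "cmod (\<phi> p) \<le> D" for p
  proof -
   obtain D where D: "0 \<le> D" "\<And>t x. cmod (\<phi> (t, x)) \<le> D * jbracket t powr (- 2)" using schwartz_bound[OF \<phi>] by metis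
   have "cmod (\<phi> p) \<le> D" for p
   proof -
    have "jbracket (fst p) powr (- 2) \<le> jbracket (fst p) powr 0" by (intro powr_mono jbracket_ge_one) simp
    then have "D * jbracket (fst p) powr (- 2) \<le> D * 1" using D(1) by (intro mult_left_mono) auto
    then show ?thesis using D(2)[of "fst p" "snd p"] by simp
   qed
   then show ?thesis by (rule that)
  qed
  have P\<phi>: "set_integrable lborel (slab T) (\<lambda>p. P k p * \<phi> p)" for k
   using integrable_bounded_times[OF P[of k, unfolded set_integrable_def] _ D] \<phi>m by (simp add: set_integrable_def)
  obtain L where L: "\<And>k. (LINT x:cell|lborel. cmod (\<rho> k x)) \<le> L" using \<rho> unfolding approx_identity_def by blast
  obtain Kg where Kg: "\<And>t. hbd (3/4 - \<epsilon>) (ncoeff (\<lambda>x. \<phi> (t, x))) Kg"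
   using hbd_test_slice[OF \<phi>, of "3/4 - \<epsilon>"] eps by auto
  have cont: "continuous_on cell (\<rho> k)" for k using \<rho>t[of k] unfolding torus_test_def by (auto intro: smooth_continuous)
  have \<rho>i: "set_integrable lborel cell (\<rho> k)" for k
   by (rule set_integrable_cell_continuous[OF cont])
  have one: "blockbdd (A * L) (\<lambda>n. fcoeff (\<rho> k) n * ?b t n)" if "good t" for k t
  proof (rule blockbdd_le)
   show "blockbdd (A * (LINT x:cell|lborel. cmod (\<rho> k x))) (\<lambda>n. fcoeff (\<rho> k) n * ?b t n)"
    using that by (intro blockbdd_mollify \<rho>i) (simp add: good_def)
   show "A * (LINT x:cell|lborel. cmod (\<rho> k x)) \<le> A * L" using L nonneg by (intro mult_left_mono) auto
  qed
  have bk_eq: "bk k t = bessel_mult ?s (\<lambda>n. fcoeff (\<rho> k) n * ?b t n)" for k t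
   by (rule ext) (simp add: bk_def torus_coeff_eq_bessel_mult[of "u t" ?s] bessel_mult_def mult_ac)
  define H where "H k t = indicator {0..T} t *\<^sub>R (LINT x:cell|lborel. P k (t, x) * \<phi> (t, x))" for k t
  have H: "H k t = (2 * pi)\<^sup>2 * Lam (bk k t) (ncoeff (?v t)) (ncoeff (?w t)) (ncoeff (\<lambda>x. \<phi> (t, x)))"
   if t: "t \<in> {0..T}" and g: "good t" for k t
  proof -
   obtain K where K: "\<And>t n. good t \<Longrightarrow> cmod (bk k t n) \<le> K / jbracket (freq n) ^ 4" using bk_decay[of k] by blast
   have \<phi>t: "(\<lambda>x. \<phi> (t, x)) \<in> torus_test" by (rule schwartz_slice[OF \<phi>])
   obtain Kc where Kc: "\<And>n. cmod (ncoeff (\<lambda>x. \<phi> (t, x)) n) \<le> Kc / jbracket (freq n) ^ 4"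
    using ncoeff_rapid_decay[OF \<phi>t, of 4] by blast
   have gs: "set_integrable lborel cell (?v t)" "hbd ?\<sigma> (ncoeff (?v t)) Kv" "set_integrable lborel cell (?w t)" "hbd ?\<sigma> (ncoeff (?w t)) Kw"
    using g unfolding good_def by blast+
   have "(LINT x:cell|lborel. P k (t, x) * \<phi> (t, x))
     = (LINT x:cell|lborel. fseries (bk k t) x * v (t, x) * w (t, x) * fseries (ncoeff (\<lambda>x. \<phi> (t, x))) x)"
    by (simp add: P_def moll[OF t] flip: torus_test_fseries[OF \<phi>t])
   also have "\<dots> = (2 * pi)\<^sup>2 * Lam (bk k t) (ncoeff (?v t)) (ncoeff (?w t)) (ncoeff (\<lambda>x. \<phi> (t, x)))"
    by (rule Lam_eq_integral(1)[OF K[OF g] Kc gs \<sigma>])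
   finally show ?thesis using t by (simp add: H_def)
  qed
  have "(\<lambda>k. \<integral>t. H k t \<partial>lborel) \<longlonglongrightarrow> (\<integral>t. pairing \<phi> t \<partial>lborel)"
  proof (rule integral_dominated_convergence[OF _ _ indT[of "(2 * pi)\<^sup>2 * (C * ((A * L) * Kv * Kw * Kg))"]])
   show "pairing \<phi> \<in> borel_measurable lborel" using pairing_measurable[OF \<phi>] by simp
   show "H k \<in> borel_measurable lborel" for k
    using dist_of_iterated(2)[OF P\<phi>[of k]] unfolding H_def[abs_def] by (rule borel_measurable_integrable)
   show "AE t in lborel. norm (H k t) \<le> (2 * pi)\<^sup>2 * (C * ((A * L) * Kv * Kw * Kg)) * indicator {0..T} t" for k
    using AEg
   proof eventually_elim
    case (elim t)
    show ?case
    proof (cases "t \<in> {0..T}")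
     case True
     then have g: "good t" using elim by blast
     then have gs: "hbd ?\<sigma> (ncoeff (?v t)) Kv" "hbd ?\<sigma> (ncoeff (?w t)) Kw" unfolding good_def by blast+
     have "cmod (Lam (bk k t) (ncoeff (?v t)) (ncoeff (?w t)) (ncoeff (\<lambda>x. \<phi> (t, x)))) \<le> C * ((A * L) * Kv * Kw * Kg)"
      unfolding bk_eq by (rule Lam_bound[OF rate one[OF g] gs Kg])
     then show ?thesis using True unfolding H[OF True g] norm_mult
      by (simp add: norm_power)
    qed (simp add: H_def)
   qed
   show "AE t in lborel. (\<lambda>k. H k t) \<longlonglongrightarrow> pairing \<phi> t"
    using AEg
   proof eventually_elim
    case (elim t)
    show ?case
    proof (cases "t \<in> {0..T}")
     case True
     then have g: "good t" using elim by blast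
     then have gs: "hbd ?\<sigma> (ncoeff (?v t)) Kv" "hbd ?\<sigma> (ncoeff (?w t)) Kw" "blockbdd A (?b t)" unfolding good_def by blast+
     have "L \<ge> 1"
     proof -
      have "1 = cmod (LINT x:cell|lborel. \<rho> 0 x)" using \<rho> by (simp add: approx_identity_def)
      also have "\<dots> \<le> (LINT x:cell|lborel. cmod (\<rho> 0 x))" by (rule set_integral_norm_bound[OF \<rho>i])
      finally show ?thesis using L[of 0] by simp
     qed
     then have "A * 1 \<le> A * L" using nonneg by (intro mult_left_mono) auto
     then have b1: "blockbdd (A * L) (?b t)" using blockbdd_le[OF gs(3)] by simp
     have lim: "(\<lambda>k. fcoeff (\<rho> k) n * ?b t n) \<longlonglongrightarrow> ?b t n" for n
      using tendsto_mult[OF approx_identity_fcoeff[OF \<rho>, of n] tendsto_const[of "?b t n"]] by simp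
     have "(\<lambda>k. Lam (bk k t) (ncoeff (?v t)) (ncoeff (?w t)) (ncoeff (\<lambda>x. \<phi> (t, x))))
       \<longlonglongrightarrow> Lam (bessel_mult ?s (?b t)) (ncoeff (?v t)) (ncoeff (?w t)) (ncoeff (\<lambda>x. \<phi> (t, x)))"
      unfolding bk_eq by (rule Lam_tendsto_first[OF rate one[OF g] b1 gs(1,2) Kg lim])
     then show ?thesis unfolding H[OF True g] pairing_def cut_in[OF True] by (intro tendsto_intros)
    next
     case False
     then show ?thesis by (simp add: H_def pairing_supp)
    qed
   qed
  qed
  moreover have "dist_of T (P k) \<phi> = (\<integral>t. H k t \<partial>lborel)" for k
   unfolding H_def by (rule dist_of_iterated(1)[OF P\<phi>])
  ultimately show "(\<lambda>k. dist_of T (\<lambda>p. mollify (\<rho> k) u p * v p * w p) \<phi>) \<longlonglongrightarrow> st_dist (\<lambda>\<tau> m. tft (curve m) \<tau>) \<phi>"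
   unfolding st_dist_curve[OF \<phi>] P_def[abs_def] by simp
 qed
qed

section \<open>The trilinear estimate\<close>

lemma hbd_le_coeff:
 assumes c: "hbd s c K" and le: "\<And>n. cmod (d n) \<le> cmod (c n)"
 shows "hbd s d K"
 unfolding hbd_def
proof (intro allI impI)
 fix S :: "(int \<times> int) set" assume S: "finite S"
 have "L2_set (\<lambda>n. jbracket (freq n) powr s * cmod (d n)) S \<le> L2_set (\<lambda>n. jbracket (freq n) powr s * cmod (c n)) S"
  by (rule L2_set_mono) (auto intro!: mult_left_mono le)
 also have "\<dots> \<le> K" using c S unfolding hbd_def by blast
 finally show "L2_set (\<lambda>n. jbracket (freq n) powr s * cmod (d n)) S \<le> K" .
qed

definition slice_const :: "real \<Rightarrow> real" where
 "slice_const b = 2 * (\<integral>\<tau>. jbracket (\<tau> :: real) powr (- (2 * b)) \<partial>lborel)"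

lemma slice_const_nonneg: "0 \<le> slice_const b"
 unfolding slice_const_def by (intro mult_nonneg_nonneg Bochner_Integration.integral_nonneg) auto

lemma slab_hbd:
 assumes T: "0 < T" "T \<le> 1" and v: "set_integrable lborel (slab T) v"
  and F: "F \<in> Xsb s b" "\<forall>\<phi>\<in>st_test T. st_dist F \<phi> = dist_of T v \<phi>" and s: "s \<le> 1" and b: "1/2 < b" "b \<le> 1"
 shows "AE t in lborel. t \<in> {0..T} \<longrightarrow> hbd s (ncoeff (\<lambda>x. v (t, x))) (sqrt (slice_const b) * Xsb_norm s b F)"
proof -
 have fin: "Xsb_sqnorm s b F < \<infinity>" by (rule Xsb_sqnorm_finite[OF F(1) s]) (use b in auto)
 have int: "integrable lborel (\<lambda>\<tau>. F \<tau> n)" for n by (rule time_slice_bound(1)[OF F(1) fin b(1)])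
 have h: "hbd s (time_slice F t) (sqrt (slice_const b) * Xsb_norm s b F)" for t
  unfolding slice_const_def by (rule time_slice_bound(2)[OF F(1) fin b(1)])
 have one: "AE t in lborel. t \<in> {0..T} \<longrightarrow> fcoeff (\<lambda>x. v (t, x)) n = time_slice F t n" for n
  by (rule fcoeff_eq_time_slice[OF T v int]) (use F(2) in blast)
 have "AE t in lborel. \<forall>n. t \<in> {0..T} \<longrightarrow> fcoeff (\<lambda>x. v (t, x)) n = time_slice F t n"
  unfolding AE_all_countable using one by (intro allI)
 then show ?thesis
 proof eventually_elim
  case (elim t)
  show ?case
  proof (intro impI hbd_le_coeff[OF h[of t]])
   fix n assume "t \<in> {0..T}"
   then have "fcoeff (\<lambda>x. v (t, x)) n = time_slice F t n" using elim by blast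
   moreover have "cmod (ncoeff (\<lambda>x. v (t, x)) n) \<le> cmod (fcoeff (\<lambda>x. v (t, x)) n) / 1"
    unfolding ncoeff_def norm_divide
    using power_mono[of 1 "2 * pi" 2] pi_ge_two by (intro divide_left_mono) (auto simp: norm_power)
   ultimately show "cmod (ncoeff (\<lambda>x. v (t, x)) n) \<le> cmod (time_slice F t n)" by simp
  qed
 qed
qed

lemma cut_ncoeff_measurable:
 assumes v: "set_integrable lborel (slab T) v"
 shows "(\<lambda>t. cut T (\<lambda>t. ncoeff (\<lambda>x. v (t, x))) t n) \<in> borel_measurable borel"
proof -
 have "(\<lambda>t. indicator {0..T} t *\<^sub>R fcoeff (\<lambda>x. v (t, x)) n / (2 * pi)\<^sup>2) \<in> borel_measurable borel"
  by (intro borel_measurable_divide borel_measurable_const slab_slices(3) v)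
 then show ?thesis by (simp add: cut_def ncoeff_def scaleR_conv_of_real)
qed

text \<open>
 The factor \<open>2\<close> in front of \<open>U\<close> is the constant of \<open>blockbdd_bessel_coeff\<close>. The embedding of \<open>X\<^sup>\<sigma>\<^sup>,\<^sup>b\<close> is applied to
 extensions of \<open>v\<close> and \<open>w\<close>, which need not attain the restricted norms.
\<close>

lemma triple_curves_of_norms:
 fixes \<alpha> \<epsilon> b T U :: real
 defines "s \<equiv> \<alpha> + \<epsilon>" and "\<sigma> \<equiv> 1/4 + \<epsilon>"
 assumes rate: "tri_rate \<alpha> \<epsilon> C e" and eps: "0 < \<epsilon>" "\<epsilon> < 3/4" and T: "0 < T" "T \<le> 1"
  and u: "dist_family T u" "LinfW_norm (- s) T u \<le> ennreal U" "0 \<le> U" and b: "1/2 < b" "b \<le> 1"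
  and v: "set_integrable lborel (slab T) v" "F \<in> Xsb \<sigma> b" "\<forall>\<phi>\<in>st_test T. st_dist F \<phi> = dist_of T v \<phi>"
  and w: "set_integrable lborel (slab T) w" "G \<in> Xsb \<sigma> b" "\<forall>\<phi>\<in>st_test T. st_dist G \<phi> = dist_of T w \<phi>"
 shows "triple_curves \<alpha> \<epsilon> C e (2 * U) T
  (sqrt (slice_const b) * Xsb_norm \<sigma> b F) (sqrt (slice_const b) * Xsb_norm \<sigma> b G)
  (cut T (\<lambda>t. bessel_coeff s (u t))) (cut T (\<lambda>t. ncoeff (\<lambda>x. v (t, x)))) (cut T (\<lambda>t. ncoeff (\<lambda>x. w (t, x))))"
proof
 let ?Kv = "sqrt (slice_const b) * Xsb_norm \<sigma> b F" and ?Kw = "sqrt (slice_const b) * Xsb_norm \<sigma> b G"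
 have nn: "0 \<le> ?Kv" "0 \<le> ?Kw" using slice_const_nonneg by (simp_all add: Xsb_norm_def)
 show "0 \<le> ?Kv" by (rule nn(1))
 show "0 \<le> ?Kw" by (rule nn(2))
 show "tri_rate \<alpha> \<epsilon> C e" by (rule rate)
 show "0 < \<epsilon>" by (rule eps(1))
 show "\<epsilon> < 3/4" by (rule eps(2))
 show "0 < T" by (rule T(1))
 show "0 \<le> 2 * U" using u(3) by simp
 show "(\<lambda>t. cut T (\<lambda>t. bessel_coeff s (u t)) t n) \<in> borel_measurable borel" for n
 proof -
  have "(\<lambda>t. of_real (jbracket (freq n) powr (- s)) * cut T (\<lambda>t. torus_coeff (u t)) t n) \<in> borel_measurable borel"
   by (intro borel_measurable_times borel_measurable_const dist_family_measurable u)
  then show ?thesis by (simp only: cut_def bessel_coeff_def mult_scaleR_right)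
 qed
 show "(\<lambda>t. cut T (\<lambda>t. ncoeff (\<lambda>x. v (t, x))) t n) \<in> borel_measurable borel" for n
  by (rule cut_ncoeff_measurable[OF v(1)])
 show "(\<lambda>t. cut T (\<lambda>t. ncoeff (\<lambda>x. w (t, x))) t n) \<in> borel_measurable borel" for n
  by (rule cut_ncoeff_measurable[OF w(1)])
 show "cut T (\<lambda>t. ncoeff (\<lambda>x. v (t, x))) t n = 0" if "t \<notin> {0..T}" for t n by (simp add: cut_out[OF that])
 have \<sigma>: "\<sigma> \<le> 1" using eps by (simp add: \<sigma>_def)
 have "AE t in restrict_space lborel {0..T}. Winf_norm (- s) (u t) \<le> LinfW_norm (- s) T u"
  unfolding LinfW_norm_def by (rule esssup_AE)
 then have "AE t in lborel. t \<in> {0..T} \<longrightarrow> Winf_norm (- s) (u t) \<le> LinfW_norm (- s) T u"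
  by (subst (asm) AE_restrict_space_iff) auto
 with slab_hbd[OF T v \<sigma> b] slab_hbd[OF T w \<sigma> b]
 show "AE t in lborel. blockbdd (2 * U) (cut T (\<lambda>t. bessel_coeff s (u t)) t)
   \<and> hbd (1/4 + \<epsilon>) (cut T (\<lambda>t. ncoeff (\<lambda>x. v (t, x))) t) ?Kv \<and> hbd (1/4 + \<epsilon>) (cut T (\<lambda>t. ncoeff (\<lambda>x. w (t, x))) t) ?Kw"
 proof eventually_elim
  case (elim t)
  show ?case
  proof (cases "t \<in> {0..T}")
   case True
   have "Winf_norm (- s) (u t) \<le> ennreal U" using elim True u(2) order_trans by blast
   then have "blockbdd (2 * U) (bessel_coeff s (u t))" using u(3) by (rule blockbdd_bessel_coeff)
   then show ?thesis using elim True unfolding cut_in[OF True] \<sigma>_def by blast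
  next
   case False
   then show ?thesis unfolding cut_out[OF False] using u(3) nn by (auto intro: blockbdd_zero hbd_zero)
  qed
 qed
qed

lemma XT_norm_approx:
 assumes fin: "XT_norm s b T z < \<infinity>" and e: "0 < e"
 shows "\<exists>F\<in>Xsb s b. (\<forall>\<phi>\<in>st_test T. st_dist F \<phi> = z \<phi>) \<and> Xsb_norm s b F \<le> enn2real (XT_norm s b T z) + e"
proof -
 let ?a = "enn2real (XT_norm s b T z)"
 have "XT_norm s b T z = ennreal ?a" using fin by simp
 also have "\<dots> < ennreal (?a + e)" using e by (simp add: ennreal_lessI add_nonneg_pos)
 finally obtain F where F: "F \<in> Xsb s b" "\<forall>\<phi>\<in>st_test T. st_dist F \<phi> = z \<phi>" "ennreal (Xsb_norm s b F) < ennreal (?a + e)"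
  unfolding XT_norm_def[of s b T z] INF_less_iff by blast
 have "0 \<le> Xsb_norm s b F" by (simp add: Xsb_norm_def)
 then have "Xsb_norm s b F \<le> ?a + e" using F(3) by (subst (asm) ennreal_less_iff) auto
 then show ?thesis using F by blast
qed

theorem proposition5p4:
  fixes \<epsilon> :: real
  assumes "0 < \<epsilon>"
  shows "\<exists>\<eta>>0. \<forall>\<alpha> \<delta> :: real.
    0 < \<alpha> \<and> \<alpha> < 1/4 \<and> \<epsilon> < min (1/12) (1/4 - \<alpha>) \<and> 0 < \<delta> \<and> \<delta> < 2/3 * \<epsilon> \<longrightarrow>
    (\<exists>C>0. \<forall>T u v w.
       0 < T \<and> T \<le> 1 \<and>
       dist_family T u \<and> LinfW_norm (-\<alpha> - \<epsilon>) T u < \<infinity> \<and>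
       set_integrable lborel (slab T) v \<and> XT_norm (1/4 + \<epsilon>) (1/2 + \<delta>) T (dist_of T v) < \<infinity> \<and>
       set_integrable lborel (slab T) w \<and> XT_norm (1/4 + \<epsilon>) (1/2 + \<delta>) T (dist_of T w) < \<infinity>
       \<longrightarrow> (\<exists>z. is_triple_product T u v w z \<and>
             XT_norm (-3/4 + \<epsilon>) (-1/2 + \<delta>) T z
               \<le> ennreal (C * T powr \<eta>) * LinfW_norm (-\<alpha> - \<epsilon>) T u
                  * XT_norm (1/4 + \<epsilon>) (1/2 + \<delta>) T (dist_of T v)
                  * XT_norm (1/4 + \<epsilon>) (1/2 + \<delta>) T (dist_of T w)))"
proof (rule exI[of _ "1/2"], (intro conjI allI impI; (elim conjE)?))
 fix \<alpha> \<delta> :: real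
 assume a: "0 < \<alpha>" "\<alpha> < 1/4" "\<epsilon> < min (1/12) (1/4 - \<alpha>)" "0 < \<delta>" "\<delta> < 2/3 * \<epsilon>"
 define b where "b = 1/2 + \<delta>"
 define s where "s = \<alpha> + \<epsilon>"
 define \<sigma> where "\<sigma> = 1/4 + \<epsilon>"
 have b: "1/2 < b" "b \<le> 1" using a by (simp_all add: b_def)
 have s: "s \<le> 1" using a by (simp add: s_def)
 have eps: "\<epsilon> < 1/4 - \<alpha>" "\<epsilon> < 3/4" using a by auto
 obtain C0 e where rate: "tri_rate \<alpha> \<epsilon> C0 e" using ex_tri_rate[OF a(1) assms eps(1)] by blast
 \<comment> \<open>The \<open>+ 1\<close> makes the constant positive.\<close>
 define C where "C = sqrt (2 * pi) * (2 * pi)\<^sup>2 * C0 * 2 * slice_const b + 1"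
 have C0: "0 < C0" using rate by (simp add: tri_rate_def)
 have C: "0 < C" unfolding C_def using C0 slice_const_nonneg[of b] by (intro add_nonneg_pos mult_nonneg_nonneg) auto
 show "\<exists>C>0. \<forall>T u v w.
    0 < T \<and> T \<le> 1 \<and>
    dist_family T u \<and> LinfW_norm (-\<alpha> - \<epsilon>) T u < \<infinity> \<and>
    set_integrable lborel (slab T) v \<and> XT_norm (1/4 + \<epsilon>) (1/2 + \<delta>) T (dist_of T v) < \<infinity> \<and>
    set_integrable lborel (slab T) w \<and> XT_norm (1/4 + \<epsilon>) (1/2 + \<delta>) T (dist_of T w) < \<infinity>
    \<longrightarrow> (\<exists>z. is_triple_product T u v w z \<and>
       XT_norm (-3/4 + \<epsilon>) (-1/2 + \<delta>) T z
        \<le> ennreal (C * T powr (1/2)) * LinfW_norm (-\<alpha> - \<epsilon>) T u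
         * XT_norm (1/4 + \<epsilon>) (1/2 + \<delta>) T (dist_of T v)
         * XT_norm (1/4 + \<epsilon>) (1/2 + \<delta>) T (dist_of T w))"
 proof (intro exI[of _ C] conjI C allI impI; (elim conjE)?)
  fix T :: real and u :: "real \<Rightarrow> (real \<times> real \<Rightarrow> complex) \<Rightarrow> complex" and v w :: "real \<times> real \<times> real \<Rightarrow> complex"
  assume T: "0 < T" "T \<le> 1" and u: "dist_family T u" "LinfW_norm (-\<alpha> - \<epsilon>) T u < \<infinity>"
   and v: "set_integrable lborel (slab T) v" "XT_norm (1/4 + \<epsilon>) (1/2 + \<delta>) T (dist_of T v) < \<infinity>"
   and w: "set_integrable lborel (slab T) w" "XT_norm (1/4 + \<epsilon>) (1/2 + \<delta>) T (dist_of T w) < \<infinity>"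
  have ms: "- \<alpha> - \<epsilon> = - s" by (simp add: s_def)
  define U where "U = enn2real (LinfW_norm (- s) T u)"
  define p where "p = enn2real (XT_norm \<sigma> b T (dist_of T v))"
  define q where "q = enn2real (XT_norm \<sigma> b T (dist_of T w))"
  have nn: "0 \<le> U" "0 \<le> p" "0 \<le> q" by (simp_all add: U_def p_def q_def)
  have U: "LinfW_norm (- s) T u = ennreal U" using u(2) by (simp add: U_def ms)
  have p: "XT_norm \<sigma> b T (dist_of T v) = ennreal p" using v(2) by (simp add: p_def \<sigma>_def b_def)
  have q: "XT_norm \<sigma> b T (dist_of T w) = ennreal q" using w(2) by (simp add: q_def \<sigma>_def b_def)
  \<comment> \<open>The candidate depends on \<open>u\<close>, \<open>v\<close>, \<open>w\<close> only, not on the extensions that bound it.\<close>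
  let ?y = "triple_curves.curve \<alpha> \<epsilon> (cut T (\<lambda>t. bessel_coeff s (u t)))
   (cut T (\<lambda>t. ncoeff (\<lambda>x. v (t, x)))) (cut T (\<lambda>t. ncoeff (\<lambda>x. w (t, x))))"
  let ?F = "\<lambda>\<tau> m. tft (?y m) \<tau>"
  let ?z = "st_dist ?F"
  \<comment> \<open>The restricted norms are infima, approached up to \<open>r\<close> by extensions.\<close>
  have main: "is_triple_product T u v w ?z \<and>
    XT_norm (-3/4 + \<epsilon>) (-1/2 + \<delta>) T ?z \<le> ennreal (C * sqrt T * U * (p + r) * (q + r))" if r: "0 < r" for r
  proof -
   obtain F where F: "F \<in> Xsb \<sigma> b" "\<forall>\<phi>\<in>st_test T. st_dist F \<phi> = dist_of T v \<phi>" "Xsb_norm \<sigma> b F \<le> p + r"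
    using XT_norm_approx[OF v(2) r] unfolding p_def \<sigma>_def b_def by blast
   obtain G where G: "G \<in> Xsb \<sigma> b" "\<forall>\<phi>\<in>st_test T. st_dist G \<phi> = dist_of T w \<phi>" "Xsb_norm \<sigma> b G \<le> q + r"
    using XT_norm_approx[OF w(2) r] unfolding q_def \<sigma>_def b_def by blast
   have UU: "LinfW_norm (- (\<alpha> + \<epsilon>)) T u \<le> ennreal U" using U by (simp add: s_def)
   note tc = triple_curves_of_norms[OF rate assms eps(2) T u(1) UU nn(1) b v(1) F(1,2)[unfolded \<sigma>_def] w(1) G(1,2)[unfolded \<sigma>_def]]
   interpret triple_curves \<alpha> \<epsilon> C0 e "2 * U" T
    "sqrt (slice_const b) * Xsb_norm \<sigma> b F" "sqrt (slice_const b) * Xsb_norm \<sigma> b G"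
    "cut T (\<lambda>t. bessel_coeff s (u t))" "cut T (\<lambda>t. ncoeff (\<lambda>x. v (t, x)))" "cut T (\<lambda>t. ncoeff (\<lambda>x. w (t, x)))"
    using tc unfolding s_def \<sigma>_def .
   have "- (3/4 - \<epsilon>) = -3/4 + \<epsilon>" by simp
   note hb = curve_hbd[unfolded this]
   have b': "-1/2 + \<delta> \<le> 0" using a by simp
   note X = Xsb_of_curve[OF T(1) curve_measurable curve_supp hb curve_bound_nonneg b']
   let ?M = curve_bound
   have "0 \<le> 2 * pi * T * ?M\<^sup>2" using T by simp
   then have "enn2real (Xsb_sqnorm (-3/4 + \<epsilon>) (-1/2 + \<delta>) ?F) \<le> 2 * pi * T * ?M\<^sup>2"
    by (rule enn2real_leI) (rule X(1))
   then have "Xsb_norm (-3/4 + \<epsilon>) (-1/2 + \<delta>) ?F \<le> sqrt (2 * pi * T * ?M\<^sup>2)"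
    by (simp only: Xsb_norm_def[of "-3/4 + \<epsilon>" "-1/2 + \<delta>" ?F] real_sqrt_le_iff)
   also have "\<dots> = sqrt (2 * pi) * sqrt T * ?M"
    using curve_bound_nonneg by (simp add: real_sqrt_mult)
   also have "\<dots> = (C - 1) * sqrt T * U * Xsb_norm \<sigma> b F * Xsb_norm \<sigma> b G"
   proof -
    have "sqrt (slice_const b) * sqrt (slice_const b) = slice_const b" using slice_const_nonneg by simp
    moreover have "?M = (2 * pi)\<^sup>2 * C0 * 2 * (sqrt (slice_const b) * sqrt (slice_const b)) * (U * Xsb_norm \<sigma> b F * Xsb_norm \<sigma> b G)"
     unfolding curve_bound_def by (simp only: mult_ac)
    ultimately have M: "?M = (2 * pi)\<^sup>2 * C0 * 2 * slice_const b * (U * Xsb_norm \<sigma> b F * Xsb_norm \<sigma> b G)" by (simp only:)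
    have "C - 1 = sqrt (2 * pi) * (2 * pi)\<^sup>2 * C0 * 2 * slice_const b" by (simp add: C_def)
    then show ?thesis unfolding M by (simp only: mult_ac)
   qed
   also have "\<dots> \<le> C * sqrt T * U * (p + r) * (q + r)"
    using F(3) G(3) nn r C T(1) by (intro mult_mono mult_nonneg_nonneg) (auto simp: Xsb_norm_def)
   finally have le: "Xsb_norm (-3/4 + \<epsilon>) (-1/2 + \<delta>) ?F \<le> C * sqrt T * U * (p + r) * (q + r)" .
   have "XT_norm (-3/4 + \<epsilon>) (-1/2 + \<delta>) T ?z \<le> ennreal (Xsb_norm (-3/4 + \<epsilon>) (-1/2 + \<delta>) ?F)"
    unfolding XT_norm_def by (rule INF_lower) (use X(2) in simp)
   also have "\<dots> \<le> ennreal (C * sqrt T * U * (p + r) * (q + r))" by (rule ennreal_leI[OF le])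
   finally show ?thesis
    using is_triple_product_curve[OF tc s[unfolded s_def] u(1) v(1) w(1)] unfolding s_def by blast
  qed
  have lim: "XT_norm (-3/4 + \<epsilon>) (-1/2 + \<delta>) T ?z \<le> ennreal (C * sqrt T * U * p * q)"
  proof (rule LIMSEQ_le_const)
   let ?r = "\<lambda>n. inverse (real (Suc n))"
   have "(\<lambda>n. C * sqrt T * U * (p + ?r n) * (q + ?r n)) \<longlonglongrightarrow> C * sqrt T * U * (p + 0) * (q + 0)"
    by (intro tendsto_intros LIMSEQ_inverse_real_of_nat)
   then show "(\<lambda>n. ennreal (C * sqrt T * U * (p + ?r n) * (q + ?r n))) \<longlonglongrightarrow> ennreal (C * sqrt T * U * p * q)"
    by (intro tendsto_ennrealI) simp
   show "\<exists>N. \<forall>n\<ge>N. XT_norm (-3/4 + \<epsilon>) (-1/2 + \<delta>) T ?z \<le> ennreal (C * sqrt T * U * (p + ?r n) * (q + ?r n))"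
    using main by simp
  qed
  have "ennreal (C * sqrt T * U * p * q) = ennreal (C * T powr (1/2)) * LinfW_norm (-\<alpha> - \<epsilon>) T u
    * XT_norm (1/4 + \<epsilon>) (1/2 + \<delta>) T (dist_of T v) * XT_norm (1/4 + \<epsilon>) (1/2 + \<delta>) T (dist_of T w)"
   using nn C T unfolding ms U p[unfolded \<sigma>_def b_def] q[unfolded \<sigma>_def b_def] by (simp add: powr_half_sqrt ennreal_mult)
  then show "\<exists>z. is_triple_product T u v w z \<and>
    XT_norm (-3/4 + \<epsilon>) (-1/2 + \<delta>) T z
     \<le> ennreal (C * T powr (1/2)) * LinfW_norm (-\<alpha> - \<epsilon>) T u
       * XT_norm (1/4 + \<epsilon>) (1/2 + \<delta>) T (dist_of T v)
       * XT_norm (1/4 + \<epsilon>) (1/2 + \<delta>) T (dist_of T w)"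
   using main[of 1] lim by (intro exI[of _ ?z]) simp
 qed
qed simp

end
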